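(* Let $D$ be a finite subset of $\mathbb{C}$, $\tilde{p}$ and $\tilde{q}$ tangential base points in $\mathbb{C}$, $\gamma$ a path from $\tilde{p}$ to $\tilde{q}$ in $\mathbb{C}\setminus D$, and $(X;\mathbf{k})=(V,E,\mathrm{rt},C;\mathbf{k})$ a $\gamma$-harvestable $D$-colored rooted tree with index $\mathbf{k}$. Then we have \[I_{\gamma}(X;\mathbf{k})=I_{\gamma}(\tilde{p};w_{(X;\mathbf{k})};\tilde{q}).\]
   Context: A tangential base point is a pair $(p,v)$ of $p\in\mathbb{C}$ and a nonzero tangent vector $v$; a path from $\tilde{p}=(p,v)$ to $\tilde{q}=(q,w)$ on $M\subseteq\mathbb{C}$ is a piecewise smooth $\gamma\colon[0,1]\to\mathbb{C}$ with $\gamma(0)=p$, $\gamma(1)=q$, $\lim_{t\searrow0}(\gamma(t)-p)/t=v$, $\lim_{t\nearrow1}(\gamma(t)-q)/(t-1)=-w$ and $\gamma((0,1))\subseteq M$. Let $\mathfrak{H}_{D}=\mathbb{Q}\langle e_{z}\mid z\in D\cup\{0\}\rangle$ with shuffle product $\mathbin{\sqcup\!\sqcup}$ defined by $1\mathbin{\sqcup\!\sqcup} w=w\mathbin{\sqcup\!\sqcup}1=w$, $we_{z}\mathbin{\sqcup\!\sqcup}w'e_{z'}=(we_{z}\mathbin{\sqcup\!\sqcup}w')e_{z'}+(w\mathbin{\sqcup\!\sqcup}w'e_{z'})e_{z}$. The regularized iterated integral $I_{\gamma}(\tilde{p};-;\tilde{q})$ is the $\mathbb{Q}$-linear map with $1\mapsto1$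 sending $e_{a_{1}}\cdots e_{a_{k}}$ to the constant term $c_{0,0}$ of the asymptotic expansion $\sum_{i,j}c_{i,j}(\log z)^{i}z^{j}$ ($z\to+0$) of $\int_{z<t_{1}<\cdots<t_{k}<1-z}\prod_{i}\frac{d\gamma(t_{i})}{\gamma(t_{i})-a_{i}}$. A $D$-colored rooted tree $X=(V,E,\mathrm{rt},C)$ is a finite tree $(V,E)$ with root $\mathrm{rt}\in V$ and colour map $C\colon V\to D\cup\{0\}$; an index is $\mathbf{k}\colon E\to\mathbb{Z}_{\ge0}$; $p_{v}$ is the parent (neighbour nearest to the root), $\mathbf{k}_{v}=\mathbf{k}(\{v,p_{v}\})$, $\mathbf{k}_{\mathrm{rt}}=1$. $X$ is $\gamma$-admissible if every vertex coloured $\gamma(0)$ has degree $>1$ and $C(\mathrm{rt})\notin\{\gamma(0),\gamma(1)\}$. With $\Delta(X;\mathbf{k})=\{(t_{v})\in[0,1]^{V}\mid t_{v}<t_{p_{v}}\text{ if }\mathbf{k}_{v}>0,\ t_{v}=t_{p_{v}}\text{ if }\mathbf{k}_{v}=0\}$, set $I_{\gamma}(X;\mathbf{k})=\int_{\Delta(X;\mathbf{k})}\prod_{v}F_{v,\mathbf{k}_{v}}(\gamma(\mathbf{t}))$, where $F_{v,k}=\frac{1}{(k-1)!}(\log t_{p_{v}}-\log t_{v})^{k-1}\frac{dt_{v}}{t_{v}-C(v)}$ for $k>0$ and $F_{v,0}=\frac{t_{v}}{t_{v}-C(v)}$. The pair $(X;\mathbf{k})$ is $\gamma$-harvestable if: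 $X$ is $\gamma$-admissible; $\deg(\mathrm{rt})=1$; $\deg(v)\le2$ whenever $C(v)\neq0$ and $\deg(v)\neq2$ whenever $C(v)=0$; and $\mathbf{k}_{v}=0$ implies $C(v)=0$ and $C(p_{v})\neq0$. The word $w_{(X;\mathbf{k})}\in\mathfrak{H}_{D}$ is defined recursively. If $X$ has no vertex of degree $>2$, it is a path $v_{1},\ldots,v_{r+1}=\mathrm{rt}$ with $C(v_{i})=z_{i}$ and $\mathbf{k}(\{v_{i},v_{i+1}\})=k_{i}>0$, and $w_{(X;\mathbf{k})}=e_{z_{1}}e_{0}^{k_{1}-1}\cdots e_{z_{r}}e_{0}^{k_{r}-1}e_{z_{r+1}}$. Otherwise let $v'$ be the vertex of degree $>2$ nearest to $\mathrm{rt}$ (then $C(v')=0$), $u_{0}$ the neighbour of $v'$ towards $\mathrm{rt}$, $L$ the path from $u_{0}$ to $\mathrm{rt}$ (a linear pair with the restricted colours and indices), and $v_{1},\ldots,v_{m}$ the other neighbours of $v'$. For each $i$, let $X_{i}$ be the subtree consisting of $v_{i}$ and all vertices whose path to $\mathrm{rt}$ passes through $v_{i}$, together with a new root $w_{i}$ joined to $v_{i}$ by an edge of index $\mathbf{k}(\{v_{i},v'\})$ and coloured by any element not in $\{0,\gamma(0),\gamma(1)\}$ (this pair is $\gamma$-harvestable with fewer branched vertices). Then \[w_{(X;\mathbf{k})}=(\tilde{w}_{X_{1}}\mathbin{\sqcup\!\sqcup}\cdots\mathbin{\sqcup\!\sqcup}\tilde{w}_{X_{m}})\,e_{0}^{\mathbf{k}(\{v',u_{0}\})}\,w_{L},\]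 where $\tilde{w}$ is the image under the $\mathbb{Q}$-linear map $1\mapsto0$, $w'e_{z}\mapsto w'$ (removing the last letter); this is independent of the chosen root colours.
   Formalization: Added, since forms, logs or the word can be undefined: if γ((0,1)) contains 0, no vertex is coloured 0 and all indices are 1 (t/t cases follow by translating γ and nonzero colours); every degree-1 vertex has positive index, else the word contains e_0 e_0^{-1}. *)

theory Defs
  imports "HOL-Analysis.Analysis" "HOL-Library.Poly_Mapping" "HOL-Library.Landau_Symbols"
begin

section \<open>Tangential base points and paths\<close>

type_synonym tangential_point = "complex \<times> complex"

definition tangential_base_point :: "tangential_point \<Rightarrow> bool" where
  "tangential_base_point P \<longleftrightarrow> snd P \<noteq> 0"

text \<open>Smooth on a closed interval means infinitely differentiable, with one-sided derivatives
  at the end points; \<open>d n\<close> is the \<open>n\<close>-th derivative.\<close>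

definition smooth_on_Icc :: "(real \<Rightarrow> complex) \<Rightarrow> real \<Rightarrow> real \<Rightarrow> bool" where
  "smooth_on_Icc g a b \<longleftrightarrow>
     (\<exists>d :: nat \<Rightarrow> real \<Rightarrow> complex.
        (\<forall>t\<in>{a..b}. d 0 t = g t) \<and>
        (\<forall>n. \<forall>t\<in>{a..b}. (d n has_vector_derivative d (Suc n) t) (at t within {a..b})))"

definition piecewise_smooth :: "(real \<Rightarrow> complex) \<Rightarrow> bool" where
  "piecewise_smooth g \<longleftrightarrow>
     (\<exists>S. finite S \<and> {0, 1} \<subseteq> S \<and> S \<subseteq> {0..1} \<and>
        (\<forall>a\<in>S. \<forall>b\<in>S. a < b \<and> {a<..<b} \<inter> S = {} \<longrightarrow> smooth_on_Icc g a b))"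

definition tangential_path ::
    "tangential_point \<Rightarrow> tangential_point \<Rightarrow> complex set \<Rightarrow> (real \<Rightarrow> complex) \<Rightarrow> bool" where
  "tangential_path P Q M \<gamma> \<longleftrightarrow>
     piecewise_smooth \<gamma> \<and> \<gamma> 0 = fst P \<and> \<gamma> 1 = fst Q \<and>
     ((\<lambda>t. (\<gamma> t - fst P) / of_real t) \<longlongrightarrow> snd P) (at_right 0) \<and>
     ((\<lambda>t. (\<gamma> t - fst Q) / of_real (t - 1)) \<longlongrightarrow> - snd Q) (at_left 1) \<and>
     \<gamma> ` {0<..<1} \<subseteq> M"


section \<open>Noncommutative polynomials and the shuffle product\<close>

text \<open>\<open>Word [a\<^sub>1, \<dots>, a\<^sub>k]\<close> stands for \<open>e\<^bsub>a\<^sub>1\<^esub> \<cdots> e\<^bsub>a\<^sub>k\<^esub>\<close>.  Words form the free monoid,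
  written additively so that the convolution product of \<^theory>\<open>HOL-Library.Poly_Mapping\<close> on
  \<open>ncpoly\<close> is the concatenation product.  This ring has one letter for every
  complex number and contains every \<open>\<HH>\<^sub>D\<close>.\<close>

datatype 'a fword = Word (letters: "'a list")

instantiation fword :: (type) monoid_add
begin

definition "0 = Word []"

definition "u + v = Word (letters u @ letters v)"

instance
  by standard (simp_all add: zero_fword_def plus_fword_def)

end

type_synonym ncpoly = "complex fword \<Rightarrow>\<^sub>0 rat"

definition wmono :: "complex list \<Rightarrow> ncpoly" where
  "wmono u = Poly_Mapping.single (Word u) 1"

abbreviation letter :: "complex \<Rightarrow> ncpoly" where
  "letter z \<equiv> wmono [z]"

definition scale :: "rat \<Rightarrow> ncpoly \<Rightarrow> ncpoly" where
  "scale c x = Poly_Mapping.single 0 c * x"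

function shuffle_words :: "complex list \<Rightarrow> complex list \<Rightarrow> ncpoly" where
  "shuffle_words u v =
     (if u = [] then wmono v
      else if v = [] then wmono u
      else shuffle_words u (butlast v) * letter (last v) + shuffle_words (butlast u) v * letter (last u))"
  by pat_completeness auto
termination
  by (relation "Wellfounded.measure (\<lambda>(u, v). length u + length v)") auto

declare shuffle_words.simps [simp del]

definition shuffle :: "ncpoly \<Rightarrow> ncpoly \<Rightarrow> ncpoly" (infixr "\<squnion>" 68) where
  "x \<squnion> y = (\<Sum>u\<in>Poly_Mapping.keys x. \<Sum>v\<in>Poly_Mapping.keys y.
      scale (Poly_Mapping.lookup x u * Poly_Mapping.lookup y v)
        (shuffle_words (letters u) (letters v)))"

definition remove_last :: "ncpoly \<Rightarrow> ncpoly" where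
  "remove_last x = (\<Sum>u\<in>Poly_Mapping.keys x.
      if letters u = [] then 0 else scale (Poly_Mapping.lookup x u) (wmono (butlast (letters u))))"


section \<open>Regularized iterated integrals\<close>

definition cut_simplex :: "nat \<Rightarrow> real \<Rightarrow> (nat \<Rightarrow> real) set" where
  "cut_simplex k z = {t \<in> {..<k} \<rightarrow>\<^sub>E UNIV.
     (\<forall>i<k. z < t i \<and> t i < 1 - z) \<and> (\<forall>i j. i < j \<and> j < k \<longrightarrow> t i < t j)}"

definition cut_iterated_integral :: "(real \<Rightarrow> complex) \<Rightarrow> complex list \<Rightarrow> real \<Rightarrow> complex" where
  "cut_iterated_integral \<gamma> as z =
     (LINT t:cut_simplex (length as) z|Pi\<^sub>M {..<length as} (\<lambda>_. lborel).
        (\<Prod>i<length as. vector_derivative \<gamma> (at (t i)) / (\<gamma> (t i) - as ! i)))"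

text \<open>\<open>f z\<close> has the asymptotic expansion \<open>\<Sum>\<^bsub>i,j\<^esub> c\<^bsub>i,j\<^esub> (log z)\<^sup>i z\<^sup>j\<close> as \<open>z \<rightarrow> +0\<close>; for every
  \<open>j\<close> only finitely many powers of the logarithm occur.\<close>

definition has_log_expansion :: "(real \<Rightarrow> complex) \<Rightarrow> (nat \<Rightarrow> nat \<Rightarrow> complex) \<Rightarrow> bool" where
  "has_log_expansion f c \<longleftrightarrow>
     (\<forall>j. finite {i. c i j \<noteq> 0}) \<and>
     (\<forall>N. (\<lambda>z. f z - (\<Sum>j\<le>N. \<Sum>i | c i j \<noteq> 0. c i j * of_real (ln z ^ i * z ^ j)))
        \<in> o[at_right 0](\<lambda>z. of_real (z ^ N)))"

definition constant_term :: "(real \<Rightarrow> complex) \<Rightarrow> complex" where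
  "constant_term f = (THE a. \<exists>c. has_log_expansion f c \<and> a = c 0 0)"

definition reg_iterated_integral :: "(real \<Rightarrow> complex) \<Rightarrow> ncpoly \<Rightarrow> complex" where
  "reg_iterated_integral \<gamma> x = (\<Sum>u\<in>Poly_Mapping.keys x.
      of_rat (Poly_Mapping.lookup x u) * constant_term (cut_iterated_integral \<gamma> (letters u)))"


section \<open>Colored rooted trees\<close>

record 'v crtree =
  verts :: "'v set"
  edges :: "'v set set"
  rt :: 'v
  color :: "'v \<Rightarrow> complex"

definition walk :: "'v crtree \<Rightarrow> 'v \<Rightarrow> 'v list \<Rightarrow> 'v \<Rightarrow> bool" where
  "walk X u xs v \<longleftrightarrow> xs \<noteq> [] \<and> hd xs = u \<and> last xs = v \<and> set xs \<subseteq> verts X \<and>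
     successively (\<lambda>x y. {x, y} \<in> edges X) xs"

definition simple_walk :: "'v crtree \<Rightarrow> 'v \<Rightarrow> 'v list \<Rightarrow> 'v \<Rightarrow> bool" where
  "simple_walk X u xs v \<longleftrightarrow> walk X u xs v \<and> distinct xs"

definition is_tree :: "'v crtree \<Rightarrow> bool" where
  "is_tree X \<longleftrightarrow>
     finite (verts X) \<and> rt X \<in> verts X \<and>
     (\<forall>d\<in>edges X. d \<subseteq> verts X \<and> card d = 2) \<and>
     (\<forall>u\<in>verts X. \<forall>v\<in>verts X. \<exists>xs. walk X u xs v) \<and>
     \<not> (\<exists>u v xs. simple_walk X u xs v \<and> length xs \<ge> 3 \<and> {v, u} \<in> edges X)"

definition colored_rooted_tree :: "complex set \<Rightarrow> 'v crtree \<Rightarrow> bool" where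
  "colored_rooted_tree D X \<longleftrightarrow> is_tree X \<and> color X ` verts X \<subseteq> insert 0 D"

definition neighbors :: "'v crtree \<Rightarrow> 'v \<Rightarrow> 'v set" where
  "neighbors X v = {u \<in> verts X. {u, v} \<in> edges X}"

definition vdegree :: "'v crtree \<Rightarrow> 'v \<Rightarrow> nat" where
  "vdegree X v = card (neighbors X v)"

definition root_dist :: "'v crtree \<Rightarrow> 'v \<Rightarrow> nat" where
  "root_dist X v = (LEAST n. \<exists>xs. walk X v xs (rt X) \<and> length xs = Suc n)"

text \<open>The value at the root is irrelevant.\<close>

definition parent :: "'v crtree \<Rightarrow> 'v \<Rightarrow> 'v" where
  "parent X v = (ARG_MIN (root_dist X) u. u \<in> neighbors X v)"

definition vindex :: "'v crtree \<Rightarrow> ('v set \<Rightarrow> nat) \<Rightarrow> 'v \<Rightarrow> nat" where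
  "vindex X k v = (if v = rt X then 1 else k {v, parent X v})"

definition admissible :: "(real \<Rightarrow> complex) \<Rightarrow> 'v crtree \<Rightarrow> bool" where
  "admissible \<gamma> X \<longleftrightarrow>
     (\<forall>v\<in>verts X. color X v = \<gamma> 0 \<longrightarrow> vdegree X v > 1) \<and> color X (rt X) \<notin> {\<gamma> 0, \<gamma> 1}"

definition harvestable :: "(real \<Rightarrow> complex) \<Rightarrow> 'v crtree \<Rightarrow> ('v set \<Rightarrow> nat) \<Rightarrow> bool" where
  "harvestable \<gamma> X k \<longleftrightarrow>
     admissible \<gamma> X \<and>
     vdegree X (rt X) = 1 \<and>
     (\<forall>v\<in>verts X. color X v \<noteq> 0 \<longrightarrow> vdegree X v \<le> 2) \<and>
     (\<forall>v\<in>verts X. color X v = 0 \<longrightarrow> vdegree X v \<noteq> 2) \<and>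
     (\<forall>v\<in>verts X. vindex X k v = 0 \<longrightarrow> color X v = 0 \<and> color X (parent X v) \<noteq> 0)"


section \<open>The integral of a colored rooted tree\<close>

definition tree_domain :: "'v crtree \<Rightarrow> ('v set \<Rightarrow> nat) \<Rightarrow> ('v \<Rightarrow> real) set" where
  "tree_domain X k = {t \<in> verts X \<rightarrow>\<^sub>E {0..1}. \<forall>v\<in>verts X - {rt X}.
     (if vindex X k v > 0 then t v < t (parent X v) else t v = t (parent X v))}"

text \<open>A continuous branch of the logarithm along the open path; it is only used in differences,
  which do not depend on the branch.\<close>

definition path_log :: "(real \<Rightarrow> complex) \<Rightarrow> real \<Rightarrow> complex" where
  "path_log \<gamma> = (SOME l. continuous_on {0<..<1} l \<and> (\<forall>t\<in>{0<..<1}. exp (l t) = \<gamma> t))"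

text \<open>The pullback along \<open>\<gamma>\<close> of the form at \<open>v\<close>, as the coefficient of \<open>dt\<^sub>v\<close> if the index
  is positive.  For the root the exponent of the logarithmic factor is \<open>0\<close>.\<close>

definition tree_factor ::
    "(real \<Rightarrow> complex) \<Rightarrow> 'v crtree \<Rightarrow> ('v set \<Rightarrow> nat) \<Rightarrow> ('v \<Rightarrow> real) \<Rightarrow> 'v \<Rightarrow> complex" where
  "tree_factor \<gamma> X k t v =
     (if vindex X k v > 0
      then (path_log \<gamma> (t (parent X v)) - path_log \<gamma> (t v)) ^ (vindex X k v - 1)
             / fact (vindex X k v - 1)
             * (vector_derivative \<gamma> (at (t v)) / (\<gamma> (t v) - color X v))
      else \<gamma> (t v) / (\<gamma> (t v) - color X v))"

text \<open>The coordinates with index \<open>0\<close> are determined by the others, so that the domain is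
  parametrized by its projection to the coordinates with positive index.\<close>

definition free_verts :: "'v crtree \<Rightarrow> ('v set \<Rightarrow> nat) \<Rightarrow> 'v set" where
  "free_verts X k = {v \<in> verts X. vindex X k v > 0}"

definition proj_free :: "'v crtree \<Rightarrow> ('v set \<Rightarrow> nat) \<Rightarrow> ('v \<Rightarrow> real) \<Rightarrow> 'v \<Rightarrow> real" where
  "proj_free X k t = restrict t (free_verts X k)"

definition tree_integral :: "(real \<Rightarrow> complex) \<Rightarrow> 'v crtree \<Rightarrow> ('v set \<Rightarrow> nat) \<Rightarrow> complex" where
  "tree_integral \<gamma> X k =
     (LINT s:proj_free X k ` tree_domain X k|Pi\<^sub>M (free_verts X k) (\<lambda>_. lborel).
        (\<Prod>v\<in>verts X. tree_factor \<gamma> X k (the_inv_into (tree_domain X k) (proj_free X k) s) v))"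


section \<open>The word of a harvestable pair\<close>

fun linear_word :: "('v \<Rightarrow> complex) \<Rightarrow> ('v set \<Rightarrow> nat) \<Rightarrow> 'v list \<Rightarrow> ncpoly" where
  "linear_word C k [] = 1"
| "linear_word C k [v] = letter (C v)"
| "linear_word C k (v # u # vs) = letter (C v) * letter 0 ^ (k {v, u} - 1) * linear_word C k (u # vs)"

text \<open>The vertices of a tree without branching, listed along the tree and ending at the root.\<close>

definition linear_order :: "'v crtree \<Rightarrow> 'v list" where
  "linear_order X = (THE xs. set xs = verts X \<and> simple_walk X (hd xs) xs (rt X))"

definition root_path :: "'v crtree \<Rightarrow> 'v \<Rightarrow> 'v list" where
  "root_path X u = (THE xs. simple_walk X u xs (rt X))"

definition has_branch :: "'v crtree \<Rightarrow> bool" where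
  "has_branch X \<longleftrightarrow> (\<exists>v\<in>verts X. vdegree X v > 2)"

definition first_branch :: "'v crtree \<Rightarrow> 'v" where
  "first_branch X = (ARG_MIN (root_dist X) v. v \<in> verts X \<and> vdegree X v > 2)"

definition through :: "'v crtree \<Rightarrow> 'v \<Rightarrow> 'v set" where
  "through X v = {u \<in> verts X. \<exists>xs. simple_walk X u xs (rt X) \<and> v \<in> set xs}"

text \<open>The subtree at a child \<open>v\<close> of \<open>v'\<close>, with a new root of color \<open>c\<close> attached to \<open>v\<close>.  Since
  \<open>v'\<close> itself is not a vertex of that subtree, it serves as the new root; in this way the
  index of the new edge is that of \<open>{v, v'}\<close>.\<close>

definition planted_subtree :: "'v crtree \<Rightarrow> 'v \<Rightarrow> complex \<Rightarrow> 'v \<Rightarrow> 'v crtree" where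
  "planted_subtree X v' c v =
     \<lparr>verts = insert v' (through X v),
      edges = insert {v, v'} {d \<in> edges X. d \<subseteq> through X v},
      rt = v',
      color = (color X)(v' := c)\<rparr>"

definition other_neighbors :: "'v crtree \<Rightarrow> 'v \<Rightarrow> 'v list" where
  "other_neighbors X v = (SOME vs. distinct vs \<and> set vs = neighbors X v - {parent X v})"

lemma set_other_neighbors:
  assumes "is_tree X"
  shows "set (other_neighbors X v) = neighbors X v - {parent X v}"
proof -
  have "finite (neighbors X v - {parent X v})"
    using assms by (auto simp: is_tree_def neighbors_def)
  then have "\<exists>vs. distinct vs \<and> set vs = neighbors X v - {parent X v}"
    using finite_distinct_list by metis
  then show ?thesis
    unfolding other_neighbors_def by (rule someI2_ex) auto
qed

lemma root_dist_root:
  assumes "is_tree X"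
  shows "root_dist X (rt X) = 0"
  using assms unfolding root_dist_def
  by (intro Least_eq_0 exI[of _ "[rt X]"]) (auto simp: walk_def is_tree_def)

lemma root_dist_eq_0:
  assumes "is_tree X" "u \<in> verts X" "root_dist X u = 0"
  shows "u = rt X"
proof -
  obtain xs where xs: "walk X u xs (rt X)"
    using assms unfolding is_tree_def by metis
  then have "length xs = Suc (length xs - 1)"
    by (cases xs) (auto simp: walk_def)
  with xs have "\<exists>n xs. walk X u xs (rt X) \<and> length xs = Suc n"
    by blast
  then have "\<exists>xs. walk X u xs (rt X) \<and> length xs = Suc (root_dist X u)"
    unfolding root_dist_def by (rule LeastI_ex)
  then show ?thesis
    using assms(3) by (auto simp: walk_def length_Suc_conv)
qed

lemma root_notin_other_neighbors:
  assumes "is_tree X"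
  shows "rt X \<notin> neighbors X v - {parent X v}"
proof
  assume *: "rt X \<in> neighbors X v - {parent X v}"
  have "parent X v \<in> neighbors X v \<and> root_dist X (parent X v) \<le> root_dist X (rt X)"
    using * arg_min_nat_lemma[of "\<lambda>u. u \<in> neighbors X v" "rt X" "root_dist X"]
    unfolding parent_def by blast
  then have "parent X v = rt X"
    using root_dist_eq_0[OF assms, of "parent X v"] root_dist_root[OF assms]
    by (auto simp: neighbors_def)
  with * show False by simp
qed

lemma first_branch_props:
  assumes "has_branch X"
  shows "first_branch X \<in> verts X" "vdegree X (first_branch X) > 2"
  using assms arg_min_natI[of "\<lambda>v. v \<in> verts X \<and> vdegree X v > 2" _ "root_dist X"]
  unfolding has_branch_def first_branch_def by auto

lemma card_planted_subtree_less:
  assumes "is_tree X" "vdegree X (rt X) = 1" "has_branch X"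
    and v: "v \<in> set (other_neighbors X (first_branch X))"
  shows "card (verts (planted_subtree X (first_branch X) c v)) < card (verts X)"
proof (rule psubset_card_mono)
  show "finite (verts X)"
    using assms(1) by (simp add: is_tree_def)
  have "first_branch X \<noteq> rt X"
    using assms(2) first_branch_props(2)[OF assms(3)] by auto
  moreover have "rt X \<notin> through X v"
  proof
    assume "rt X \<in> through X v"
    then obtain xs where xs: "simple_walk X (rt X) xs (rt X)" "v \<in> set xs"
      by (auto simp: through_def)
    then have "xs = [rt X]"
      by (cases xs) (auto simp: simple_walk_def walk_def split: if_splits dest: last_in_set)
    with xs have "v = rt X" by simp
    then show False
      using v root_notin_other_neighbors[OF assms(1)] set_other_neighbors[OF assms(1)] by metis
  qed
  moreover have "rt X \<in> verts X"
    using assms(1) by (simp add: is_tree_def)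
  moreover have "insert (first_branch X) (through X v) \<subseteq> verts X"
    using first_branch_props(1)[OF assms(3)] by (auto simp: through_def)
  ultimately show "verts (planted_subtree X (first_branch X) c v) \<subset> verts X"
    unfolding planted_subtree_def by (simp add: psubset_eq) (metis insertE)
qed

text \<open>\<open>P = {\<gamma>(0), \<gamma>(1)}\<close>.  The auxiliary root color \<open>c\<close> only affects the last letter, which is
  removed, so that any choice may be made.  The first two conjuncts of the guard hold for all
  harvestable pairs and for the pairs in the recursion; they ensure termination.\<close>

function tree_word :: "complex set \<Rightarrow> 'v crtree \<Rightarrow> ('v set \<Rightarrow> nat) \<Rightarrow> ncpoly" where
  "tree_word P X k =
     (if is_tree X \<and> vdegree X (rt X) = 1 \<and> has_branch X then
        (let v' = first_branch X;
             u\<^sub>0 = parent X v';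
             c = (SOME c. c \<notin> insert 0 P)
         in foldr (\<squnion>)
              (map (\<lambda>v. remove_last (tree_word P (planted_subtree X v' c v) k))
                 (other_neighbors X v')) 1
            * letter 0 ^ k {v', u\<^sub>0} * linear_word (color X) k (root_path X u\<^sub>0))
      else linear_word (color X) k (linear_order X))"
  by pat_completeness auto
termination
  by (relation "Wellfounded.measure (\<lambda>(P, X, k). card (verts X))") (auto intro: card_planted_subtree_less)

declare tree_word.simps [simp del]

end

theory Submission
  imports Defs "HOL-Computational_Algebra.Fundamental_Theorem_Algebra"
begin

text \<open>Write \<open>f\<^sub>a dt\<close> for the pullback of \<open>dz/(z - a)\<close> along \<open>\<gamma>\<close>.  Integrating out the variables of
  the tree from the leaves to the root expresses the tree integral by functions \<open>T\<^sub>v(t)\<close>, one for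
  every nonroot vertex \<open>v\<close>: for positive index, \<open>T\<^sub>v(t)\<close> is the integral of
  \<open>(L(t) - L(s))\<^bsup>k-1\<^esup>/(k-1)! f\<^bsub>C(v)\<^esub>(s) \<Prod>\<^sub>c T\<^sub>c(s)\<close> over \<open>0 < s < t\<close>, where \<open>c\<close> runs over the
  children and \<open>L = log \<gamma>\<close>; a vertex of index \<open>0\<close> only multiplies the functions of its children.
  Products of iterated integrals are iterated integrals of shuffles, and the kernel
  \<open>(L(t) - L(s))\<^bsup>k-1\<^esup>/(k-1)!\<close> is a \<open>(k-1)\<close>-fold iterated integral of \<open>f\<^sub>0\<close>.  So \<open>T\<^sub>v\<close> is the
  iterated integral of a linear combination of words that follows the recursion of the word of the tree.

  Absolute convergence comes from the bound \<open>O((t/(1 - t))\<^bsup>b\<^esup>)\<close> with small \<open>b > 0\<close>: the function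
  \<open>(t/(1 - t))\<^bsup>b\<^esup>\<close> is an eigenfunction of integration against \<open>dt/(t(1 - t))\<close>, products add the
  exponents, and the words that occur neither start with \<open>\<gamma>(0)\<close> nor end with \<open>\<gamma>(1)\<close>.  For such words the
  regularized integral is the convergent one, once the cut-off integral is known to have an
  asymptotic expansion; this follows by cutting the path at \<open>1/2\<close>, because primitives of functions
  with a logarithmic expansion have a logarithmic expansion.\<close>

section \<open>Integration over rooted trees\<close>

text \<open>One exchange of integrals, \<open>rooted_tree_Fubini\<close>, is used twice: for the
  given tree with its vertices of index 0 contracted, and for a single word, whose simplex is the
  domain of a tree without branching. The second use shows by dominated convergence that the cut-off
  integrals tend to the improper iterated integral. Convergence at 0 and at 1 has different sources.
  At 0 it comes from the leaves: their colour is not the starting point, and the exponent gained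
  there survives all further integrations. At 1 nothing is gained before the root, whose form is
  bounded; so the exponents are scaled such that they add up to 1/2 there, which is below the
  critical value 1. A logarithmic kernel must not consume this exponent, and it does not, because a
  power of a logarithm is bounded by an arbitrarily small power. Convergence alone does not
  determine the regularized value: \<open>constant_term\<close> is a definite description, so an
  expansion has to exist. Both ends of the cut path move with \<open>z\<close>, so that it is not a
  primitive in \<open>z\<close> directly; splitting the path makes it a sum of products of functions
  that each depend on one end.\<close>

interpretation lborel_product: product_sigma_finite "\<lambda>_. lborel :: real measure"
  by standard

text \<open>The variables are released one at a time along a growing set \<open>A\<close> of
  vertices that contains the parents of its members. Branches that are not yet released enter
  through their inner integrals \<open>T\<close>. The majorants \<open>B\<close> satisfy the same
  recursion as an inequality; Tonelli for \<open>B\<close> gives the finiteness that Fubini for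
  \<open>T\<close> needs.\<close>

lemma rooted_tree_Fubini:
  fixes V :: "'v set" and K :: "'v \<Rightarrow> real \<Rightarrow> real \<Rightarrow> complex" and T :: "'v \<Rightarrow> real \<Rightarrow> complex"
    and B :: "'v \<Rightarrow> real \<Rightarrow> ennreal" and W :: "real \<Rightarrow> complex" and rank :: "'v \<Rightarrow> nat"
    and r :: 'v and par :: "'v \<Rightarrow> 'v"
  defines "ch \<equiv> \<lambda>v. {c \<in> V - {r}. par c = v}"
  assumes fin: "finite V" and r: "r \<in> V"
    and par: "\<And>v. v \<in> V - {r} \<Longrightarrow> par v \<in> V \<and> rank (par v) < rank v"
    and K: "\<And>v. v \<in> V - {r} \<Longrightarrow> (\<lambda>z. K v (fst z) (snd z)) \<in> borel_measurable (borel \<Otimes>\<^sub>M borel)"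
    and W[measurable]: "W \<in> borel_measurable borel"
    and T: "\<And>v t. v \<in> V - {r} \<Longrightarrow> T v t = (LINT s|lborel. K v t s * (\<Prod>c\<in>ch v. T c s))"
    and Bm: "\<And>v. v \<in> V - {r} \<Longrightarrow> B v \<in> borel_measurable borel"
    and B: "\<And>v t. v \<in> V - {r} \<Longrightarrow> (\<integral>\<^sup>+ s. ennreal (norm (K v t s)) * (\<Prod>c\<in>ch v. B c s) \<partial>lborel) \<le> B v t"
    and WB: "(\<integral>\<^sup>+ s. ennreal (norm (W s)) * (\<Prod>c\<in>ch r. B c s) \<partial>lborel) < \<infinity>"
  shows "integrable (Pi\<^sub>M V (\<lambda>_. lborel)) (\<lambda>x. W (x r) * (\<Prod>v\<in>V - {r}. K v (x (par v)) (x v)))"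
    and "(LINT x|Pi\<^sub>M V (\<lambda>_. lborel). W (x r) * (\<Prod>v\<in>V - {r}. K v (x (par v)) (x v)))
       = (LINT s|lborel. W s * (\<Prod>c\<in>ch r. T c s))"
proof -
  have ch: "ch v \<subseteq> V - {r}" "finite (ch v)" for v
    using fin by (auto simp: ch_def)
  define N where "N = Max (rank ` V)"
  have N: "rank v \<le> N" if "v \<in> V" for v
    unfolding N_def using fin that by auto
  \<comment> \<open>Induction from the leaves to the root, as \<open>N - rank\<close> decreases from
    a vertex to its children. \<open>B v t\<close> may be infinite.\<close>
  have TB: "T v \<in> borel_measurable borel \<and> (\<forall>t. ennreal (norm (T v t)) \<le> B v t)" if "v \<in> V - {r}" for v
    using that
  proof (induction "N - rank v" arbitrary: v rule: less_induct)
    case less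
    have IH: "T c \<in> borel_measurable borel" "ennreal (norm (T c t)) \<le> B c t" if "c \<in> ch v" for c t
    proof -
      have c: "c \<in> V - {r}" "par c = v" using that by (auto simp: ch_def)
      then have "rank v < rank c" "rank c \<le> N" using par N by auto
      then have "N - rank c < N - rank v" by linarith
      then show "T c \<in> borel_measurable borel" "ennreal (norm (T c t)) \<le> B c t" using less(1)[of c] c by auto
    qed
    have [measurable]: "(\<lambda>z. K v (fst z) (snd z)) \<in> borel_measurable (borel \<Otimes>\<^sub>M borel)"
      using K less.prems by auto
    have [measurable]: "(\<lambda>s. \<Prod>c\<in>ch v. T c s) \<in> borel_measurable borel"
      using IH by (intro borel_measurable_prod) auto
    have "(\<lambda>t. LINT s|lborel. K v (fst (t, s)) (snd (t, s)) * (\<Prod>c\<in>ch v. T c s)) \<in> borel_measurable borel"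
      by measurable
    moreover have "T v = (\<lambda>t. LINT s|lborel. K v (fst (t, s)) (snd (t, s)) * (\<Prod>c\<in>ch v. T c s))"
      by (rule ext) (simp add: T[OF less.prems])
    ultimately have 1: "T v \<in> borel_measurable borel"
      by simp
    have "ennreal (norm (T v t)) \<le> B v t" for t
    proof -
      have "ennreal (norm (T v t)) \<le> (\<integral>\<^sup>+ s. ennreal (norm (K v t s * (\<Prod>c\<in>ch v. T c s))) \<partial>lborel)"
        unfolding T[OF less.prems] by (cases "integrable lborel (\<lambda>s. K v t s * (\<Prod>c\<in>ch v. T c s))")
           (auto intro: integral_norm_bound_ennreal simp: not_integrable_integral_eq)
      also have "\<dots> \<le> (\<integral>\<^sup>+ s. ennreal (norm (K v t s)) * (\<Prod>c\<in>ch v. B c s) \<partial>lborel)"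
      proof (rule nn_integral_mono)
        fix s
        have "ennreal (norm (K v t s * (\<Prod>c\<in>ch v. T c s))) = ennreal (norm (K v t s)) * (\<Prod>c\<in>ch v. ennreal (norm (T c s)))"
          by (simp add: norm_mult ennreal_mult prod_norm [symmetric] prod_ennreal prod_nonneg)
        also have "\<dots> \<le> ennreal (norm (K v t s)) * (\<Prod>c\<in>ch v. B c s)"
          by (intro mult_left_mono prod_mono_ennreal) (auto simp: IH)
        finally show "ennreal (norm (K v t s * (\<Prod>c\<in>ch v. T c s))) \<le> \<dots>" .
      qed
      finally show ?thesis using B[OF less.prems] order_trans by blast
    qed
    with 1 show ?case by blast
  qed
  have Tm: "T v \<in> borel_measurable borel" if "v \<in> V - {r}" for v using TB that by blast
  \<comment> \<open>\<open>fr A\<close> is the frontier of \<open>A\<close>: the vertices outside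
    \<open>A\<close> with parent in \<open>A\<close>. \<open>F A\<close> is the integrand over
    \<open>A\<close> with every frontier branch replaced by its \<open>T\<close>, and
    \<open>G A\<close> is its majorant. \<open>F {r}\<close> is the right-hand side of the claim and
    \<open>F V\<close> the full integrand.\<close>
  define fr where "fr = (\<lambda>A. {c \<in> V - A. par c \<in> A})"
  define F where "F = (\<lambda>A x. W (x r) * (\<Prod>v\<in>A - {r}. K v (x (par v)) (x v)) * (\<Prod>c\<in>fr A. T c (x (par c))))"
  define G where "G = (\<lambda>A x. ennreal (norm (W (x r))) * (\<Prod>v\<in>A - {r}. ennreal (norm (K v (x (par v)) (x v)))) * (\<Prod>c\<in>fr A. B c (x (par c))))"
  define cl where "cl = (\<lambda>A. r \<in> A \<and> A \<subseteq> V \<and> (\<forall>v\<in>A - {r}. par v \<in> A))"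
  have frsub: "fr A \<subseteq> V - {r}" "finite (fr A)" "fr A \<inter> A = {}" if "cl A" for A
    using that fin by (auto simp: fr_def cl_def)
  have comp[measurable]: "(\<lambda>x. x v) \<in> borel_measurable (Pi\<^sub>M A (\<lambda>_. lborel :: real measure))" if "v \<in> A" for v and A :: "'v set"
    using measurable_component_singleton[OF that, of "\<lambda>_. lborel :: real measure"] by simp
  have Km: "(\<lambda>x. K v (x (par v)) (x v)) \<in> borel_measurable (Pi\<^sub>M A (\<lambda>_. lborel))" if "v \<in> A - {r}" "cl A" for v A
  proof -
    have [measurable]: "(\<lambda>z. K v (fst z) (snd z)) \<in> borel_measurable (borel \<Otimes>\<^sub>M borel)"
      using that K by (auto simp: cl_def)
    have [simp]: "par v \<in> A" "v \<in> A" using that by (auto simp: cl_def)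
    have [measurable]: "(\<lambda>x. (x (par v), x v)) \<in> measurable (Pi\<^sub>M A (\<lambda>_. lborel)) (borel \<Otimes>\<^sub>M borel)"
      by (intro measurable_Pair comp) auto
    have "(\<lambda>x. K v (fst (x (par v), x v)) (snd (x (par v), x v))) \<in> borel_measurable (Pi\<^sub>M A (\<lambda>_. lborel))"
      by measurable
    then show ?thesis by simp
  qed
  have Wm: "(\<lambda>x. W (x r)) \<in> borel_measurable (Pi\<^sub>M A (\<lambda>_. lborel))" if "cl A" for A
    using that by (intro measurable_compose[OF comp W]) (auto simp: cl_def)
  have Fm: "F A \<in> borel_measurable (Pi\<^sub>M A (\<lambda>_. lborel))" if "cl A" for A
  proof -
    have "(\<lambda>x. T c (x (par c))) \<in> borel_measurable (Pi\<^sub>M A (\<lambda>_. lborel))" if "c \<in> fr A" for c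
      using that frsub[OF \<open>cl A\<close>] Tm by (intro measurable_compose[OF comp]) (auto simp: fr_def)
    then show ?thesis unfolding F_def
      by (intro borel_measurable_times borel_measurable_prod Km Wm that) auto
  qed
  have Gm: "G A \<in> borel_measurable (Pi\<^sub>M A (\<lambda>_. lborel))" if "cl A" for A
  proof -
    have "(\<lambda>x. B c (x (par c))) \<in> borel_measurable (Pi\<^sub>M A (\<lambda>_. lborel))" if "c \<in> fr A" for c
      using that frsub[OF \<open>cl A\<close>] Bm by (intro measurable_compose[OF comp]) (auto simp: fr_def)
    moreover have "(\<lambda>x. ennreal (norm (h x))) \<in> borel_measurable M"
      if "h \<in> borel_measurable M" for h :: "('v \<Rightarrow> real) \<Rightarrow> complex" and M
      using that by measurable
    ultimately show ?thesis unfolding G_def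
      by (intro borel_measurable_times_ennreal borel_measurable_prod_ennreal) (use Km Wm that in auto)
  qed
  \<comment> \<open>When \<open>l\<close> is added, it leaves the frontier and its children enter;
    no other factor involves the new variable \<open>y\<close>.\<close>
  have step: "cl (insert l A) \<and> (\<forall>x y. F (insert l A) (x(l := y)) =
        W (x r) * (\<Prod>v\<in>A - {r}. K v (x (par v)) (x v)) * (\<Prod>c\<in>fr A - {l}. T c (x (par c))) *
          (K l (x (par l)) y * (\<Prod>c\<in>ch l. T c y)))
     \<and> (\<forall>x y. G (insert l A) (x(l := y)) =
        ennreal (norm (W (x r))) * (\<Prod>v\<in>A - {r}. ennreal (norm (K v (x (par v)) (x v)))) * (\<Prod>c\<in>fr A - {l}. B c (x (par c))) *
          (ennreal (norm (K l (x (par l)) y)) * (\<Prod>c\<in>ch l. B c y)))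
     \<and> l \<in> fr A"
    if A: "cl A" and l: "l \<in> V - A" "par l \<in> A" for A l
  proof -
    have lr: "l \<noteq> r" using that by (auto simp: cl_def)
    have finA: "finite A" using A fin finite_subset by (auto simp: cl_def)
    have frl: "fr (insert l A) = (fr A - {l}) \<union> ch l" "(fr A - {l}) \<inter> ch l = {}"
      using A l unfolding fr_def cl_def ch_def using par by fastforce+
    have pl: "par l \<noteq> l" using l by auto
    have e1: "(\<Prod>v\<in>insert l A - {r}. h v ((x(l := y)) (par v)) ((x(l := y)) v))
        = h l (x (par l)) y * (\<Prod>v\<in>A - {r}. h v (x (par v)) (x v))"
      for h :: "'v \<Rightarrow> real \<Rightarrow> real \<Rightarrow> 'c::comm_monoid_mult" and x y
    proof -
      have "insert l A - {r} = insert l (A - {r})" using lr by auto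
      moreover have "l \<notin> A - {r}" "finite (A - {r})" using l finA by auto
      moreover have "(\<Prod>v\<in>A - {r}. h v ((x(l := y)) (par v)) ((x(l := y)) v)) = (\<Prod>v\<in>A - {r}. h v (x (par v)) (x v))"
        using A l by (intro prod.cong) (auto simp: cl_def)
      ultimately show ?thesis using pl by simp
    qed
    have e2: "(\<Prod>c\<in>fr (insert l A). h c ((x(l := y)) (par c)))
        = (\<Prod>c\<in>fr A - {l}. h c (x (par c))) * (\<Prod>c\<in>ch l. h c y)"
      for h :: "'v \<Rightarrow> real \<Rightarrow> 'c::comm_monoid_mult" and x y
    proof -
      have "(\<Prod>c\<in>fr A - {l}. h c ((x(l := y)) (par c))) = (\<Prod>c\<in>fr A - {l}. h c (x (par c)))"
        using l by (intro prod.cong) (auto simp: fr_def)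
      moreover have "(\<Prod>c\<in>ch l. h c ((x(l := y)) (par c))) = (\<Prod>c\<in>ch l. h c y)"
        by (intro prod.cong) (auto simp: ch_def)
      ultimately show ?thesis unfolding frl(1)
        by (subst prod.union_disjoint) (use frsub[OF A] ch frl(2) in auto)
    qed
    have e3: "(x(l := y)) r = x r" for x :: "'v \<Rightarrow> real" and y using lr by auto
    have "cl (insert l A)" using A l by (auto simp: cl_def)
    moreover have "l \<in> fr A" using l by (auto simp: fr_def)
    ultimately show ?thesis
      unfolding F_def G_def e2 e3 e1[of K] e1[of "\<lambda>v a b. ennreal (norm (K v a b))"]
      by (simp add: mult_ac)
  qed
  \<comment> \<open>Integrating out \<open>l\<close> turns its kernel and the bounds of its children
    into at most \<open>B l\<close>. Hence the integral of \<open>G\<close> does not increase with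
    \<open>A\<close> and stays below its finite value at \<open>{r}\<close>.\<close>
  have stepG: "(\<integral>\<^sup>+ x. G (insert l A) x \<partial>Pi\<^sub>M (insert l A) (\<lambda>_. lborel)) \<le> (\<integral>\<^sup>+ x. G A x \<partial>Pi\<^sub>M A (\<lambda>_. lborel))"
    if A: "cl A" and l: "l \<in> V - A" "par l \<in> A" for A l
  proof -
    note st = step[OF that]
    have finA: "finite A" using A fin finite_subset by (auto simp: cl_def)
    have lV: "l \<in> V - {r}" using that by (auto simp: cl_def)
    have [measurable]: "(\<lambda>z. K l (fst z) (snd z)) \<in> borel_measurable (borel \<Otimes>\<^sub>M borel)"
      using lV K by auto
    have [measurable]: "(\<lambda>s. \<Prod>c\<in>ch l. B c s) \<in> borel_measurable borel"
      using Bm ch by (intro borel_measurable_prod_ennreal) auto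
    have Kl: "(\<lambda>s. K l t s) \<in> borel_measurable borel" for t
      using measurable_compose[OF measurable_Pair1' \<open>(\<lambda>z. K l (fst z) (snd z)) \<in> borel_measurable (borel \<Otimes>\<^sub>M borel)\<close>, of t] by simp
    have "(\<integral>\<^sup>+ x. G (insert l A) x \<partial>Pi\<^sub>M (insert l A) (\<lambda>_. lborel))
        = (\<integral>\<^sup>+ x. (\<integral>\<^sup>+ y. G (insert l A) (x(l := y)) \<partial>lborel) \<partial>Pi\<^sub>M A (\<lambda>_. lborel))"
      using finA l Gm st by (intro lborel_product.product_nn_integral_insert) auto
    also have "\<dots> \<le> (\<integral>\<^sup>+ x. G A x \<partial>Pi\<^sub>M A (\<lambda>_. lborel))"
    proof (rule nn_integral_mono)
      fix x :: "'v \<Rightarrow> real"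
      let ?c = "ennreal (norm (W (x r))) * (\<Prod>v\<in>A - {r}. ennreal (norm (K v (x (par v)) (x v)))) * (\<Prod>c\<in>fr A - {l}. B c (x (par c)))"
      have [measurable]: "(\<lambda>s. K l (x (par l)) s) \<in> borel_measurable borel" by (rule Kl)
      have "(\<integral>\<^sup>+ y. G (insert l A) (x(l := y)) \<partial>lborel)
         = ?c * (\<integral>\<^sup>+ y. ennreal (norm (K l (x (par l)) y)) * (\<Prod>c\<in>ch l. B c y) \<partial>lborel)"
        using st by (simp add: nn_integral_cmult)
      also have "\<dots> \<le> ?c * B l (x (par l))"
        by (intro mult_left_mono B[OF lV]) auto
      also have "\<dots> = G A x"
        unfolding G_def using st frsub[OF A] by (subst prod.remove[of "fr A" l]) (auto simp: mult_ac)
      finally show "(\<integral>\<^sup>+ y. G (insert l A) (x(l := y)) \<partial>lborel) \<le> G A x" .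
    qed
    finally show ?thesis .
  qed
  have FG: "ennreal (norm (F A x)) \<le> G A x" if "cl A" for A x
    unfolding F_def G_def using frsub[OF that] TB
    by (simp add: norm_mult ennreal_mult prod_nonneg prod_norm[symmetric] prod_ennreal[symmetric])
       (intro mult_left_mono prod_mono_ennreal, auto)
  have frr: "fr {r} = ch r" using par by (auto simp: fr_def ch_def)
  have clr: "cl {r}" using r by (auto simp: cl_def)
  have G0: "(\<integral>\<^sup>+ x. G {r} x \<partial>Pi\<^sub>M {r} (\<lambda>_. lborel)) < \<infinity>"
  proof -
    have "(\<integral>\<^sup>+ x. G {r} x \<partial>Pi\<^sub>M {r} (\<lambda>_. lborel)) = (\<integral>\<^sup>+ x. (\<lambda>s. ennreal (norm (W s)) * (\<Prod>c\<in>ch r. B c s)) (x r) \<partial>Pi\<^sub>M {r} (\<lambda>_. lborel))"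
      unfolding G_def frr by (intro nn_integral_cong) (auto simp: ch_def intro!: arg_cong2[where f="(*)"] prod.cong)
    also have "\<dots> = (\<integral>\<^sup>+ s. ennreal (norm (W s)) * (\<Prod>c\<in>ch r. B c s) \<partial>lborel)"
      using Bm ch by (intro lborel_product.product_nn_integral_singleton) (auto intro!: borel_measurable_times_ennreal borel_measurable_prod_ennreal)
    finally show ?thesis using WB by simp
  qed
  have F0: "(LINT x|Pi\<^sub>M {r} (\<lambda>_. lborel). F {r} x) = (LINT s|lborel. W s * (\<Prod>c\<in>ch r. T c s))"
  proof -
    have "(LINT x|Pi\<^sub>M {r} (\<lambda>_. lborel). F {r} x) = (LINT x|Pi\<^sub>M {r} (\<lambda>_. lborel). (\<lambda>s. W s * (\<Prod>c\<in>ch r. T c s)) (x r))"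
      unfolding F_def frr by (intro Bochner_Integration.integral_cong) (auto simp: ch_def intro!: prod.cong)
    also have "\<dots> = (LINT s|lborel. W s * (\<Prod>c\<in>ch r. T c s))"
      using Tm ch by (intro lborel_product.product_integral_singleton) (auto intro!: borel_measurable_times borel_measurable_prod)
    finally show ?thesis .
  qed
  have stepF: "(LINT x|Pi\<^sub>M (insert l A) (\<lambda>_. lborel). F (insert l A) x) = (LINT x|Pi\<^sub>M A (\<lambda>_. lborel). F A x)"
    if A: "cl A" and l: "l \<in> V - A" "par l \<in> A"
      and int: "(\<integral>\<^sup>+ x. G (insert l A) x \<partial>Pi\<^sub>M (insert l A) (\<lambda>_. lborel)) < \<infinity>" for A l
  proof -
    note st = step[OF that(1-3)]
    have finA: "finite A" using A fin finite_subset by (auto simp: cl_def)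
    have lV: "l \<in> V - {r}" using that by (auto simp: cl_def)
    have "integrable (Pi\<^sub>M (insert l A) (\<lambda>_. lborel)) (F (insert l A))"
    proof (rule integrableI_bounded)
      show "F (insert l A) \<in> borel_measurable (Pi\<^sub>M (insert l A) (\<lambda>_. lborel))" using Fm st by auto
      have "(\<integral>\<^sup>+ x. ennreal (norm (F (insert l A) x)) \<partial>Pi\<^sub>M (insert l A) (\<lambda>_. lborel))
          \<le> (\<integral>\<^sup>+ x. G (insert l A) x \<partial>Pi\<^sub>M (insert l A) (\<lambda>_. lborel))"
        using FG st by (intro nn_integral_mono) auto
      then show "(\<integral>\<^sup>+ x. ennreal (norm (F (insert l A) x)) \<partial>Pi\<^sub>M (insert l A) (\<lambda>_. lborel)) < \<infinity>"
        using int by (rule le_less_trans)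
    qed
    then have "(LINT x|Pi\<^sub>M (insert l A) (\<lambda>_. lborel). F (insert l A) x)
        = (LINT x|Pi\<^sub>M A (\<lambda>_. lborel). (LINT y|lborel. F (insert l A) (x(l := y))))"
      using finA l by (intro lborel_product.product_integral_insert) auto
    also have "\<dots> = (LINT x|Pi\<^sub>M A (\<lambda>_. lborel). F A x)"
    proof (rule Bochner_Integration.integral_cong[OF refl])
      fix x :: "'v \<Rightarrow> real"
      let ?c = "W (x r) * (\<Prod>v\<in>A - {r}. K v (x (par v)) (x v)) * (\<Prod>c\<in>fr A - {l}. T c (x (par c)))"
      have "(LINT y|lborel. F (insert l A) (x(l := y))) = ?c * T l (x (par l))"
        unfolding T[OF lV] using st by simp
      also have "\<dots> = F A x"
        unfolding F_def using st frsub[OF A] by (subst prod.remove[of "fr A" l]) (auto simp: mult_ac)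
      finally show "(LINT y|lborel. F (insert l A) (x(l := y))) = F A x" .
    qed
    finally show ?thesis .
  qed
  \<comment> \<open>The next vertex is one of least rank outside \<open>A\<close>; its parent has
    smaller rank and so lies in \<open>A\<close>.\<close>
  have grow: "(\<integral>\<^sup>+ x. G A x \<partial>Pi\<^sub>M A (\<lambda>_. lborel)) < \<infinity> \<Longrightarrow>
     (\<integral>\<^sup>+ x. G V x \<partial>Pi\<^sub>M V (\<lambda>_. lborel)) < \<infinity> \<and> (LINT x|Pi\<^sub>M V (\<lambda>_. lborel). F V x) = (LINT x|Pi\<^sub>M A (\<lambda>_. lborel). F A x)"
    if "cl A" for A
    using that
  proof (induction "card (V - A)" arbitrary: A rule: less_induct)
    case less
    show ?case
    proof (cases "A = V")
      case False
      then have ne: "V - A \<noteq> {}" using less.prems by (auto simp: cl_def)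
      define l where "l = arg_min rank (\<lambda>v. v \<in> V - A)"
      have l: "l \<in> V - A" and min: "\<And>u. u \<in> V - A \<Longrightarrow> rank l \<le> rank u"
        using ne arg_min_nat_lemma[of "\<lambda>v. v \<in> V - A" _ rank] unfolding l_def by blast+
      have pl: "par l \<in> A"
      proof (rule ccontr)
        assume "par l \<notin> A"
        moreover have "l \<in> V - {r}" using l less.prems by (auto simp: cl_def)
        ultimately have "rank l \<le> rank (par l)" "rank (par l) < rank l" using par min by auto
        then show False by simp
      qed
      have fin': "(\<integral>\<^sup>+ x. G (insert l A) x \<partial>Pi\<^sub>M (insert l A) (\<lambda>_. lborel)) < \<infinity>"
        using stepG[OF less.prems(2) l pl] less.prems(1) by (rule le_less_trans)
      have "card (V - insert l A) < card (V - A)"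
        using l fin by (intro psubset_card_mono) auto
      from less.hyps[OF this fin'] stepF[OF less.prems(2) l pl fin'] step[OF less.prems(2) l pl]
      show ?thesis by auto
    qed (use less.prems in auto)
  qed
  have clV: "cl V" using r par by (auto simp: cl_def)
  have frV: "fr V = {}" by (auto simp: fr_def)
  have FV: "F V = (\<lambda>x. W (x r) * (\<Prod>v\<in>V - {r}. K v (x (par v)) (x v)))"
    by (simp add: F_def frV)
  show "integrable (Pi\<^sub>M V (\<lambda>_. lborel)) (\<lambda>x. W (x r) * (\<Prod>v\<in>V - {r}. K v (x (par v)) (x v)))"
    unfolding FV[symmetric]
  proof (rule integrableI_bounded)
    show "F V \<in> borel_measurable (Pi\<^sub>M V (\<lambda>_. lborel))" by (rule Fm[OF clV])
    have "(\<integral>\<^sup>+ x. ennreal (norm (F V x)) \<partial>Pi\<^sub>M V (\<lambda>_. lborel)) \<le> (\<integral>\<^sup>+ x. G V x \<partial>Pi\<^sub>M V (\<lambda>_. lborel))"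
      using FG clV by (intro nn_integral_mono) auto
    then show "(\<integral>\<^sup>+ x. ennreal (norm (F V x)) \<partial>Pi\<^sub>M V (\<lambda>_. lborel)) < \<infinity>"
      using grow[OF clr G0] le_less_trans by blast
  qed
  show "(LINT x|Pi\<^sub>M V (\<lambda>_. lborel). W (x r) * (\<Prod>v\<in>V - {r}. K v (x (par v)) (x v)))
       = (LINT s|lborel. W s * (\<Prod>c\<in>ch r. T c s))"
    unfolding FV[symmetric] using grow[OF clr G0] F0 by simp
qed

section \<open>Linear functionals on noncommutative polynomials\<close>

text \<open>Cancellation can make the support of \<open>x + y\<close> smaller than the union of the
  supports. All three sums are extended to that union, where the extra terms are
  \<open>h u 0 = 0\<close>.\<close>

lemma sum_keys_add:
  fixes h :: "'a \<Rightarrow> 'b::comm_monoid_add \<Rightarrow> 'c::comm_monoid_add"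
  assumes h0: "\<And>u. h u 0 = 0" and hadd: "\<And>u a b. h u (a + b) = h u a + h u b"
  shows "(\<Sum>u\<in>Poly_Mapping.keys (x + y). h u (Poly_Mapping.lookup (x + y) u))
    = (\<Sum>u\<in>Poly_Mapping.keys x. h u (Poly_Mapping.lookup x u)) + (\<Sum>u\<in>Poly_Mapping.keys y. h u (Poly_Mapping.lookup y u))"
proof -
  let ?U = "Poly_Mapping.keys x \<union> Poly_Mapping.keys y"
  have ext: "(\<Sum>u\<in>Poly_Mapping.keys z. h u (Poly_Mapping.lookup z u)) = (\<Sum>u\<in>?U. h u (Poly_Mapping.lookup z u))"
    if "Poly_Mapping.keys z \<subseteq> ?U" for z
    using that by (intro sum.mono_neutral_left) (auto simp: h0 in_keys_iff)
  have "(\<Sum>u\<in>Poly_Mapping.keys (x + y). h u (Poly_Mapping.lookup (x + y) u))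
      = (\<Sum>u\<in>?U. h u (Poly_Mapping.lookup (x + y) u))"
    by (rule ext) (rule Poly_Mapping.keys_add)
  also have "\<dots> = (\<Sum>u\<in>?U. h u (Poly_Mapping.lookup x u)) + (\<Sum>u\<in>?U. h u (Poly_Mapping.lookup y u))"
    by (simp add: lookup_add hadd sum.distrib)
  also have "\<dots> = (\<Sum>u\<in>Poly_Mapping.keys x. h u (Poly_Mapping.lookup x u)) + (\<Sum>u\<in>Poly_Mapping.keys y. h u (Poly_Mapping.lookup y u))"
    by (simp add: ext)
  finally show ?thesis .
qed

lemma sum_keys_sum:
  fixes h :: "'a \<Rightarrow> 'b::comm_monoid_add \<Rightarrow> 'c::comm_monoid_add"
  assumes "\<And>u. h u 0 = 0" and "\<And>u a b. h u (a + b) = h u a + h u b"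
  shows "(\<Sum>u\<in>Poly_Mapping.keys (\<Sum>i\<in>I. f i). h u (Poly_Mapping.lookup (\<Sum>i\<in>I. f i) u))
    = (\<Sum>i\<in>I. \<Sum>u\<in>Poly_Mapping.keys (f i). h u (Poly_Mapping.lookup (f i) u))"
  by (induction I rule: infinite_finite_induct) (auto simp: sum_keys_add[of h, OF assms])

lemma sum_keys_single:
  fixes h :: "'a \<Rightarrow> 'b::comm_monoid_add \<Rightarrow> 'c::comm_monoid_add"
  assumes "\<And>u. h u 0 = 0"
  shows "(\<Sum>u\<in>Poly_Mapping.keys (Poly_Mapping.single v c). h u (Poly_Mapping.lookup (Poly_Mapping.single v c) u)) = h v c"
  using assms by (cases "c = 0") auto

lemma poly_mapping_sum_single:
  "x = (\<Sum>u\<in>Poly_Mapping.keys x. Poly_Mapping.single u (Poly_Mapping.lookup x u))"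
  by (rule poly_mapping_eqI) (simp add: lookup_sum lookup_single when_def in_keys_iff sum.delta)

text \<open>Linear extension from words to polynomials. Both \<open>reg_iterated_integral\<close>
  and the functions \<open>J\<close> below are of this form.\<close>

definition lin :: "(complex list \<Rightarrow> complex) \<Rightarrow> ncpoly \<Rightarrow> complex" where
  "lin g x = (\<Sum>u\<in>Poly_Mapping.keys x. of_rat (Poly_Mapping.lookup x u) * g (letters u))"

lemma lin_single: "lin g (Poly_Mapping.single v c) = of_rat c * g (letters v)"
  unfolding lin_def by (rule sum_keys_single) simp

lemma lin_add: "lin g (x + y) = lin g x + lin g y"
  unfolding lin_def by (rule sum_keys_add) (auto simp: of_rat_add algebra_simps)

lemma lin_sum: "lin g (\<Sum>i\<in>I. f i) = (\<Sum>i\<in>I. lin g (f i))"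
  unfolding lin_def by (rule sum_keys_sum) (auto simp: of_rat_add algebra_simps)

lemma lin_wmono: "lin g (wmono u) = g u"
  by (simp add: wmono_def lin_single)

lemma letters_zero: "letters 0 = []"
  by (simp add: zero_fword_def)

lemma lin_one: "lin g 1 = g []"
  using lin_single[of g 0 1] by (simp add: letters_zero)

lemma scale_single: "scale c (Poly_Mapping.single u d) = Poly_Mapping.single u (c * d)"
  by (simp add: scale_def mult_single)

lemma scale_wmono: "scale c (wmono u) = Poly_Mapping.single (Word u) c"
  by (simp add: wmono_def scale_single)

lemma lin_scale: "lin g (scale c x) = of_rat c * lin g x"
proof -
  have "scale c x = (\<Sum>u\<in>Poly_Mapping.keys x. Poly_Mapping.single u (c * Poly_Mapping.lookup x u))"
    by (subst poly_mapping_sum_single[of x]) (simp add: scale_def sum_distrib_left mult_single)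
  then show ?thesis
    by (simp add: lin_sum lin_single) (simp add: lin_def of_rat_mult sum_distrib_left mult.assoc)
qed

lemma lin_cong: "(\<And>u. u \<in> letters ` Poly_Mapping.keys x \<Longrightarrow> g u = h u) \<Longrightarrow> lin g x = lin h x"
  unfolding lin_def by (intro sum.cong) auto

lemma times_letter: "x * letter a =
    (\<Sum>u\<in>Poly_Mapping.keys x. Poly_Mapping.single (Word (letters u @ [a])) (Poly_Mapping.lookup x u))"
  by (subst poly_mapping_sum_single[of x]) (simp add: wmono_def sum_distrib_right mult_single plus_fword_def)

lemma lin_times_letter: "lin g (x * letter a) = lin (\<lambda>u. g (u @ [a])) x"
  by (simp add: times_letter lin_sum lin_single) (simp add: lin_def)

lemma remove_last_times_letter: "remove_last (x * letter a) = x"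
proof -
  define h :: "complex fword \<Rightarrow> rat \<Rightarrow> ncpoly"
    where "h = (\<lambda>u c. if letters u = [] then 0 else scale c (wmono (butlast (letters u))))"
  have h: "h u 0 = 0" "h u (a + b) = h u a + h u b" for u a b
    by (auto simp: h_def scale_wmono single_add)
  have "remove_last (x * letter a) =
      (\<Sum>u\<in>Poly_Mapping.keys (x * letter a). h u (Poly_Mapping.lookup (x * letter a) u))"
    by (simp add: remove_last_def h_def)
  also have "\<dots> = (\<Sum>u\<in>Poly_Mapping.keys x. h (Word (letters u @ [a])) (Poly_Mapping.lookup x u))"
    unfolding times_letter by (simp only: sum_keys_sum[of h, OF h] sum_keys_single[of h, OF h(1)])
  also have "\<dots> = (\<Sum>u\<in>Poly_Mapping.keys x. Poly_Mapping.single u (Poly_Mapping.lookup x u))"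
    by (simp add: h_def scale_wmono)
  finally show ?thesis by (simp only: poly_mapping_sum_single[symmetric])
qed

lemma shuffle_words_Nil: "shuffle_words u [] = wmono u" "shuffle_words [] v = wmono v"
  by (subst shuffle_words.simps; simp)+

lemma shuffle_words_snoc: "shuffle_words (u @ [a]) (v @ [b]) =
    shuffle_words (u @ [a]) v * letter b + shuffle_words u (v @ [b]) * letter a"
  by (subst shuffle_words.simps) simp

lemma shuffle_one: "x \<squnion> 1 = x"
  using poly_mapping_sum_single[of x, symmetric]
  by (simp add: shuffle_def letters_zero shuffle_words_Nil scale_wmono)

text \<open>Multiplicativity is demanded only on the words that occur, since iterated integrals are
  shown to be multiplicative only for words that converge at the start.\<close>

lemma lin_shuffle:
  assumes "\<And>u v. u \<in> letters ` Poly_Mapping.keys x \<Longrightarrow> v \<in> letters ` Poly_Mapping.keys y \<Longrightarrow>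
      lin g (shuffle_words u v) = g u * g v"
  shows "lin g (x \<squnion> y) = lin g x * lin g y"
proof -
  have "lin g (x \<squnion> y) = (\<Sum>u\<in>Poly_Mapping.keys x. \<Sum>v\<in>Poly_Mapping.keys y.
      (of_rat (Poly_Mapping.lookup x u) * g (letters u)) * (of_rat (Poly_Mapping.lookup y v) * g (letters v)))"
    unfolding shuffle_def lin_sum lin_scale using assms
    by (intro sum.cong refl) (auto simp: of_rat_mult)
  then show ?thesis by (simp add: lin_def sum_product)
qed

section \<open>Supports, and words that converge at the start of the path\<close>

abbreviation supp :: "ncpoly \<Rightarrow> complex list set" where
  "supp x \<equiv> letters ` Poly_Mapping.keys x"

lemma supp_single: "supp (Poly_Mapping.single u c) \<subseteq> {letters u}"
  by (cases "c = 0") auto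

lemma supp_add: "supp (x + y) \<subseteq> supp x \<union> supp y"
  using Poly_Mapping.keys_add[of x y] by blast

lemma supp_sum: "supp (\<Sum>i\<in>I. f i) \<subseteq> (\<Union>i\<in>I. supp (f i))"
  using Poly_Mapping.keys_sum[of f I] by blast

lemma supp_wmono: "supp (wmono u) = {u}"
  by (simp add: wmono_def)

lemma supp_scale: "supp (scale c x) \<subseteq> supp x"
proof -
  have "scale c x = (\<Sum>u\<in>Poly_Mapping.keys x. Poly_Mapping.single u (c * Poly_Mapping.lookup x u))"
    by (subst poly_mapping_sum_single[of x]) (simp add: scale_def sum_distrib_left mult_single)
  also have "supp \<dots> \<subseteq> (\<Union>u\<in>Poly_Mapping.keys x. supp (Poly_Mapping.single u (c * Poly_Mapping.lookup x u)))"
    by (rule supp_sum)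
  also have "\<dots> \<subseteq> (\<Union>u\<in>Poly_Mapping.keys x. {letters u})"
    by (intro UN_mono supp_single subset_refl)
  finally show ?thesis by auto
qed

lemma supp_times_letter: "supp (x * letter a) \<subseteq> (\<lambda>u. u @ [a]) ` supp x"
proof -
  have "supp (x * letter a) \<subseteq> (\<Union>u\<in>Poly_Mapping.keys x.
      supp (Poly_Mapping.single (Word (letters u @ [a])) (Poly_Mapping.lookup x u)))"
    unfolding times_letter by (rule supp_sum)
  also have "\<dots> \<subseteq> (\<Union>u\<in>Poly_Mapping.keys x. {letters (Word (letters u @ [a]))})"
    by (intro UN_mono supp_single subset_refl)
  finally show ?thesis by auto
qed

lemma supp_shuffle: "supp (x \<squnion> y) \<subseteq> (\<Union>u\<in>supp x. \<Union>v\<in>supp y. supp (shuffle_words u v))"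
proof -
  have "supp (x \<squnion> y) \<subseteq> (\<Union>u\<in>Poly_Mapping.keys x. supp (\<Sum>v\<in>Poly_Mapping.keys y.
      scale (Poly_Mapping.lookup x u * Poly_Mapping.lookup y v) (shuffle_words (letters u) (letters v))))"
    unfolding shuffle_def by (rule supp_sum)
  also have "\<dots> \<subseteq> (\<Union>u\<in>Poly_Mapping.keys x. \<Union>v\<in>Poly_Mapping.keys y.
      supp (scale (Poly_Mapping.lookup x u * Poly_Mapping.lookup y v) (shuffle_words (letters u) (letters v))))"
    by (intro UN_mono supp_sum subset_refl)
  also have "\<dots> \<subseteq> (\<Union>u\<in>Poly_Mapping.keys x. \<Union>v\<in>Poly_Mapping.keys y. supp (shuffle_words (letters u) (letters v)))"
    by (intro UN_mono supp_scale subset_refl)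
  finally show ?thesis by auto
qed

text \<open>The iterated integrals of these words converge at the start of a path that begins at \<open>p\<close>.\<close>

definition start_words :: "complex set \<Rightarrow> complex \<Rightarrow> complex list set" where
  "start_words A p = {u. set u \<subseteq> A \<and> (u \<noteq> [] \<longrightarrow> hd u \<noteq> p)}"

lemma start_words_Nil: "[] \<in> start_words A p"
  by (simp add: start_words_def)

lemma start_words_snoc:
  "u @ [a] \<in> start_words A p \<longleftrightarrow> u \<in> start_words A p \<and> a \<in> A \<and> (u = [] \<longrightarrow> a \<noteq> p)"
  by (cases u) (auto simp: start_words_def)

text \<open>The first letter of a shuffle is the first letter of one of the two words. The length is
  carried along because it shows that a shuffle with a nonempty word does not contain the empty
  word.\<close>

lemma supp_shuffle_words:
  assumes "u \<in> start_words A p" "v \<in> start_words A p"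
  shows "supp (shuffle_words u v) \<subseteq> {w \<in> start_words A p. length w = length u + length v}"
  using assms
proof (induction "length u + length v" arbitrary: u v rule: less_induct)
  case less
  show ?case
  proof (cases u rule: rev_cases)
    case Nil
    then show ?thesis using less.prems by (simp add: shuffle_words_Nil supp_wmono)
  next
    case u: (snoc u' a)
    show ?thesis
    proof (cases v rule: rev_cases)
      case Nil
      then show ?thesis using less.prems by (simp add: shuffle_words_Nil supp_wmono)
    next
      case v: (snoc v' b)
      have ab: "a \<in> A" "b \<in> A" "u' \<in> start_words A p" "v' \<in> start_words A p"
        using less.prems u v by (auto simp: start_words_snoc)
      have 1: "supp (shuffle_words u v') \<subseteq> {w \<in> start_words A p. length w = length u + length v'}"
        using less.hyps[of u v'] less.prems ab v by auto
      have 2: "supp (shuffle_words u' v) \<subseteq> {w \<in> start_words A p. length w = length u' + length v}"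
        using less.hyps[of u' v] less.prems ab u by auto
      have "supp (shuffle_words u v) \<subseteq> supp (shuffle_words u v' * letter b) \<union> supp (shuffle_words u' v * letter a)"
        unfolding u v shuffle_words_snoc by (rule supp_add)
      also have "\<dots> \<subseteq> (\<lambda>w. w @ [b]) ` supp (shuffle_words u v') \<union> (\<lambda>w. w @ [a]) ` supp (shuffle_words u' v)"
        by (intro Un_mono supp_times_letter)
      also have "\<dots> \<subseteq> {w \<in> start_words A p. length w = length u + length v}"
        using 1 2 ab u v by (force simp: start_words_snoc)
      finally show ?thesis .
    qed
  qed
qed

lemma supp_shuffle_start_words:
  assumes "supp x \<subseteq> start_words A p" "supp y \<subseteq> start_words A p"
  shows "supp (x \<squnion> y) \<subseteq> start_words A p"
proof
  fix w assume "w \<in> supp (x \<squnion> y)"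
  then obtain u v where "u \<in> supp x" "v \<in> supp y" "w \<in> supp (shuffle_words u v)"
    using supp_shuffle[of x y] by blast
  then show "w \<in> start_words A p"
    using supp_shuffle_words[of u A p v] assms by blast
qed

section \<open>Logarithmic asymptotic expansions\<close>

lemma eventually_at_right_0: "0 < d \<Longrightarrow> \<forall>\<^sub>F z in at_right (0::real). 0 < z \<and> z < d"
  by (auto simp: eventually_at_right_field intro!: exI[of _ d])

text \<open>With \<open>z = exp (- y)\<close> this is the decay of
  \<open>y ^ k / exp y\<close>.\<close>

lemma tendsto_ln_power_mult:
  "((\<lambda>z::real. ln z ^ k * z) \<longlongrightarrow> 0) (at_right 0)"
proof -
  have "filterlim (\<lambda>z::real. - ln z) at_top (at_right 0)"
    using ln_at_0 by (simp add: filterlim_uminus_at_top)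
  from filterlim_compose[OF tendsto_power_div_exp_0[of k] this]
  have "((\<lambda>z::real. (-1) ^ k * ((- ln z) ^ k / exp (- ln z))) \<longlongrightarrow> (-1) ^ k * 0) (at_right 0)"
    by (intro tendsto_intros)
  then have "((\<lambda>z::real. (-1) ^ k * ((- ln z) ^ k / exp (- ln z))) \<longlongrightarrow> 0) (at_right 0)"
    by simp
  then show ?thesis
  proof (rule Lim_transform_eventually)
    show "\<forall>\<^sub>F z::real in at_right 0. (-1) ^ k * ((- ln z) ^ k / exp (- ln z)) = ln z ^ k * z"
      by (intro eventually_mono[OF eventually_at_right_0[OF zero_less_one]])
         (auto simp: exp_minus divide_inverse power_mult_distrib[symmetric] simp flip: mult.assoc)
  qed
qed

lemma tendsto_poly_ln_mult:
  "((\<lambda>z. poly p (of_real (ln z) :: complex) * of_real z) \<longlongrightarrow> 0) (at_right 0)"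
proof -
  have "((\<lambda>z. \<Sum>i\<le>degree p. coeff p i * of_real (ln z ^ i * z) :: complex) \<longlongrightarrow> (\<Sum>i\<le>degree p. coeff p i * of_real 0)) (at_right 0)"
    by (intro tendsto_intros tendsto_ln_power_mult)
  then show ?thesis
    by (simp add: poly_altdef sum_distrib_right mult.assoc)
qed

text \<open>One spare power of \<open>z\<close> absorbs every polynomial in
  \<open>ln z\<close>.\<close>

lemma poly_ln_bigo:
  assumes "n < m"
  shows "(\<lambda>z. poly p (of_real (ln z)) * of_real z ^ m) \<in> O[at_right 0](\<lambda>z. of_real z ^ n :: complex)"
proof (rule bigoI[where c=1])
  have "\<forall>\<^sub>F z in at_right 0. norm (poly p (of_real (ln z) :: complex) * of_real z) < 1"
    using order_tendstoD(2)[OF tendsto_norm_zero[OF tendsto_poly_ln_mult], of 1 p] by simp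
  then show "\<forall>\<^sub>F z in at_right 0. norm (poly p (of_real (ln z)) * of_real z ^ m :: complex) \<le> 1 * norm (of_real z ^ n :: complex)"
    using eventually_at_right_0[OF zero_less_one]
  proof eventually_elim
    case (elim z)
    have "norm (poly p (of_real (ln z)) * of_real z ^ m :: complex) = norm (poly p (of_real (ln z) :: complex) * of_real z) * z ^ (m - 1)"
      using assms elim by (cases m) (auto simp: norm_mult norm_power)
    also have "\<dots> \<le> 1 * z ^ n"
      using elim assms by (intro mult_mono power_decreasing) auto
    finally show ?case using elim by (simp add: norm_power)
  qed
qed

lemma bigo_ev_cong: "f \<in> O[F](h) \<Longrightarrow> \<forall>\<^sub>F z in F. f z = g z \<Longrightarrow> g \<in> O[F](h)"
  using landau_o.big.in_cong by blast

definition log_partial :: "(nat \<Rightarrow> complex poly) \<Rightarrow> nat \<Rightarrow> real \<Rightarrow> complex" where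
  "log_partial P N z = (\<Sum>j\<le>N. poly (P j) (of_real (ln z)) * of_real z ^ j)"

text \<open>A variant of \<open>has_log_expansion\<close> that is easier to calculate with: the
  coefficient of a power of \<open>z\<close> is a polynomial in \<open>ln z\<close>, and the
  remainders are bounded by O instead of o. Nothing is lost, since the remainder of order
  \<open>N + 1\<close> controls the one of order \<open>N\<close>.\<close>

definition log_exp :: "(real \<Rightarrow> complex) \<Rightarrow> (nat \<Rightarrow> complex poly) \<Rightarrow> bool" where
  "log_exp f P \<longleftrightarrow> (\<forall>N. (\<lambda>z. f z - log_partial P N z) \<in> O[at_right 0](\<lambda>z. of_real z ^ N))"

lemma power_bigo:
  assumes "n \<le> m"
  shows "(\<lambda>z. of_real z ^ m :: complex) \<in> O[at_right 0](\<lambda>z. of_real z ^ n :: complex)"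
proof (rule bigoI[where c=1])
  show "\<forall>\<^sub>F z in at_right 0. norm (of_real z ^ m :: complex) \<le> 1 * norm (of_real z ^ n :: complex)"
    using eventually_at_right_0[OF zero_less_one] assms
    by (auto elim!: eventually_mono simp: norm_power intro!: power_decreasing)
qed

text \<open>All orders are required, so an estimate may lose one power of \<open>z\<close>.\<close>

lemma log_expI:
  assumes "\<And>N. (\<lambda>z. f z - log_partial P (Suc N) z) \<in> O[at_right 0](\<lambda>z. of_real z ^ N)"
  shows "log_exp f P"
  unfolding log_exp_def
proof
  fix N
  have "(\<lambda>z. (f z - log_partial P (Suc N) z) + poly (P (Suc N)) (of_real (ln z)) * of_real z ^ Suc N) \<in> O[at_right 0](\<lambda>z. of_real z ^ N)"
    by (intro sum_in_bigo(1) assms poly_ln_bigo) auto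
  then show "(\<lambda>z. f z - log_partial P N z) \<in> O[at_right 0](\<lambda>z. of_real z ^ N)"
    by (simp add: log_partial_def)
qed

lemma log_exp_smallo:
  assumes "log_exp f P"
  shows "(\<lambda>z. f z - log_partial P N z) \<in> o[at_right 0](\<lambda>z. of_real z ^ N)"
proof -
  have s: "(\<lambda>z. of_real z ^ (N + 1) :: complex) \<in> o[at_right 0](\<lambda>z. of_real z ^ N :: complex)"
  proof (rule smalloI_tendsto)
    have "((\<lambda>z. of_real z :: complex) \<longlongrightarrow> of_real 0) (at_right 0)"
      by (intro tendsto_intros)
    then have "((\<lambda>z. of_real z :: complex) \<longlongrightarrow> 0) (at_right 0)"
      by simp
    then show "((\<lambda>z. of_real z ^ (N + 1) / of_real z ^ N :: complex) \<longlongrightarrow> 0) (at_right 0)"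
      by (rule Lim_transform_eventually)
         (intro eventually_mono[OF eventually_at_right_0[OF zero_less_one]], auto)
  qed (intro eventually_mono[OF eventually_at_right_0[OF zero_less_one]], auto)
  have "(\<lambda>z. poly (P (Suc N)) (of_real (ln z)) * of_real z ^ Suc N) \<in> o[at_right 0](\<lambda>z. of_real z ^ N)"
  proof (rule smalloI_tendsto)
    show "((\<lambda>z. poly (P (Suc N)) (of_real (ln z)) * of_real z ^ Suc N / of_real z ^ N) \<longlongrightarrow> 0) (at_right 0)"
      by (rule Lim_transform_eventually[OF tendsto_poly_ln_mult[of "P (Suc N)"] eventually_mono[OF eventually_at_right_0[OF zero_less_one]]]) auto
  qed (intro eventually_mono[OF eventually_at_right_0[OF zero_less_one]], auto)
  moreover have "(\<lambda>z. f z - log_partial P (N + 1) z) \<in> o[at_right 0](\<lambda>z. of_real z ^ N)"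
    using assms unfolding log_exp_def by (blast intro: landau_o.big_small_trans s)
  ultimately have "(\<lambda>z. (f z - log_partial P (N + 1) z) + poly (P (Suc N)) (of_real (ln z)) * of_real z ^ Suc N) \<in> o[at_right 0](\<lambda>z. of_real z ^ N)"
    by (intro sum_in_smallo(1))
  then show ?thesis by (simp add: log_partial_def)
qed

lemma log_exp_cong:
  assumes "log_exp f P" "\<forall>\<^sub>F z in at_right 0. f z = g z"
  shows "log_exp g P"
  unfolding log_exp_def
proof
  fix N
  have "(\<lambda>z. f z - log_partial P N z) \<in> O[at_right 0](\<lambda>z. of_real z ^ N) \<longleftrightarrow>
        (\<lambda>z. g z - log_partial P N z) \<in> O[at_right 0](\<lambda>z. of_real z ^ N)"
    by (rule landau_o.big.in_cong) (use assms(2) in \<open>auto elim: eventually_mono\<close>)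
  with assms(1) show "(\<lambda>z. g z - log_partial P N z) \<in> O[at_right 0](\<lambda>z. of_real z ^ N)"
    by (simp add: log_exp_def)
qed

lemma log_exp_const: "log_exp (\<lambda>_. c) (\<lambda>j. if j = 0 then [:c:] else 0)"
  unfolding log_exp_def log_partial_def
  by (auto simp: sum.delta if_distrib[of "\<lambda>p. poly p _ * _"] cong: if_cong)

lemma log_exp_add:
  assumes "log_exp f P" "log_exp g Q"
  shows "log_exp (\<lambda>z. f z + g z) (\<lambda>j. P j + Q j)"
  unfolding log_exp_def
proof
  fix N
  have "(\<lambda>z. (f z - log_partial P N z) + (g z - log_partial Q N z)) \<in> O[at_right 0](\<lambda>z. of_real z ^ N)"
    using assms unfolding log_exp_def by (intro sum_in_bigo(1)) auto
  then show "(\<lambda>z. f z + g z - log_partial (\<lambda>j. P j + Q j) N z) \<in> O[at_right 0](\<lambda>z. of_real z ^ N)"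
    by (simp add: log_partial_def sum.distrib algebra_simps)
qed

text \<open>A crude bound for the logarithms of the leading term; it costs one power of
  \<open>z\<close>, which the estimates of products can afford.\<close>

lemma log_exp_bigo:
  assumes "log_exp f P"
  shows "f \<in> O[at_right 0](\<lambda>z. inverse (of_real z))"
proof -
  have one: "(\<lambda>_. 1 :: complex) \<in> O[at_right 0](\<lambda>z. inverse (of_real z))"
    using eventually_at_right_0[OF zero_less_one]
    by (intro bigoI[where c=1]) (auto elim!: eventually_mono simp: norm_inverse one_le_inverse)
  have "(\<lambda>z. poly (P 0) (of_real (ln z)) * of_real z ^ 1 * inverse (of_real z)) \<in> O[at_right 0](\<lambda>z. of_real z ^ 0 * inverse (of_real z) :: complex)"
    by (intro landau_o.big.mult poly_ln_bigo) auto
  then have "(\<lambda>z. poly (P 0) (of_real (ln z)) * of_real z ^ 1 * inverse (of_real z)) \<in> O[at_right 0](\<lambda>z. inverse (of_real z) :: complex)"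
    by simp
  then have "(\<lambda>z. poly (P 0) (of_real (ln z))) \<in> O[at_right 0](\<lambda>z. inverse (of_real z) :: complex)"
    by (rule bigo_ev_cong) (intro eventually_mono[OF eventually_at_right_0[OF zero_less_one]], auto)
  moreover have "(\<lambda>z. f z - log_partial P 0 z) \<in> O[at_right 0](\<lambda>z. inverse (of_real z))"
  proof -
    have "(\<lambda>z. f z - log_partial P 0 z) \<in> O[at_right 0](\<lambda>z. of_real z ^ 0)"
      using assms unfolding log_exp_def by blast
    then show ?thesis using one landau_o.big_trans by fastforce
  qed
  ultimately have "(\<lambda>z. (f z - log_partial P 0 z) + poly (P 0) (of_real (ln z))) \<in> O[at_right 0](\<lambda>z. inverse (of_real z))"
    by (intro sum_in_bigo(1))
  then show ?thesis by (simp add: log_partial_def)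
qed

lemma log_partial_bigo: "log_partial P N \<in> O[at_right 0](\<lambda>z. inverse (of_real z))"
proof -
  have "log_exp (log_partial P N) (\<lambda>j. if j \<le> N then P j else 0)"
    unfolding log_exp_def
  proof
    fix M
    have "(\<lambda>z. \<Sum>j\<in>{M<..N}. poly (P j) (of_real (ln z)) * of_real z ^ j) \<in> O[at_right 0](\<lambda>z. of_real z ^ M :: complex)"
      by (intro big_sum_in_bigo poly_ln_bigo) auto
    moreover have "log_partial P N z - log_partial (\<lambda>j. if j \<le> N then P j else 0) M z
        = (\<Sum>j\<in>{M<..N}. poly (P j) (of_real (ln z)) * of_real z ^ j)" for z
    proof -
      have "log_partial (\<lambda>j. if j \<le> N then P j else 0) M z = (\<Sum>j\<in>{..N} \<inter> {..M}. poly (P j) (of_real (ln z)) * of_real z ^ j)"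
        unfolding log_partial_def by (intro sum.mono_neutral_cong_right) auto
      moreover have "log_partial P N z = (\<Sum>j\<in>{..N} \<inter> {..M}. poly (P j) (of_real (ln z)) * of_real z ^ j)
          + (\<Sum>j\<in>{M<..N}. poly (P j) (of_real (ln z)) * of_real z ^ j)"
        unfolding log_partial_def by (subst sum.union_disjoint[symmetric]) (auto intro: sum.cong)
      ultimately show ?thesis by simp
    qed
    ultimately show "(\<lambda>z. log_partial P N z - log_partial (\<lambda>j. if j \<le> N then P j else 0) M z) \<in> O[at_right 0](\<lambda>z. of_real z ^ M)"
      by simp
  qed
  then show ?thesis by (rule log_exp_bigo)
qed

text \<open>The terms of the product of the partial sums that are missing from the Cauchy product
  have \<open>i + j > N\<close>.\<close>

lemma log_partial_mult:
  "(\<lambda>z. log_partial P (Suc N) z * log_partial Q (Suc N) z - log_partial (\<lambda>n. \<Sum>i\<le>n. P i * Q (n - i)) N z)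
     \<in> O[at_right 0](\<lambda>z. of_real z ^ N)"
proof -
  let ?I = "{..Suc N} \<times> {..Suc N}" and ?D = "{(i, j). i + j \<le> N}"
  let ?h = "\<lambda>z (i, j). poly (P i * Q j) (of_real (ln z)) * of_real z ^ (i + j) :: complex"
  have 1: "log_partial P (Suc N) z * log_partial Q (Suc N) z = sum (?h z) ?I" for z
    unfolding log_partial_def sum_product sum.cartesian_product
    by (intro sum.cong refl) (auto simp: power_add)
  have 2: "log_partial (\<lambda>n. \<Sum>i\<le>n. P i * Q (n - i)) N z = sum (?h z) ?D" for z
  proof -
    have "log_partial (\<lambda>n. \<Sum>i\<le>n. P i * Q (n - i)) N z = (\<Sum>n\<le>N. \<Sum>i\<le>n. ?h z (i, n - i))"
      unfolding log_partial_def by (intro sum.cong refl) (auto simp: poly_sum sum_distrib_right)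
    also have "\<dots> = sum (?h z) ?D"
      using sum.triangle_reindex_eq[of "\<lambda>i j. ?h z (i, j)" N] by simp
    finally show ?thesis .
  qed
  have "sum (?h z) ?I - sum (?h z) ?D = sum (?h z) (?I - ?D)" for z
    by (subst sum.subset_diff[of ?D ?I]) auto
  moreover have "(\<lambda>z. sum (?h z) (?I - ?D)) \<in> O[at_right 0](\<lambda>z. of_real z ^ N)"
  proof (rule big_sum_in_bigo)
    fix x assume "x \<in> ?I - ?D"
    then show "(\<lambda>z. ?h z x) \<in> O[at_right 0](\<lambda>z. of_real z ^ N)"
      using poly_ln_bigo[of N "fst x + snd x" "P (fst x) * Q (snd x)"] by (cases x) auto
  qed
  ultimately show ?thesis by (simp add: 1 2)
qed

lemma log_exp_mult:
  assumes f: "log_exp f P" and g: "log_exp g Q"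
  shows "log_exp (\<lambda>z. f z * g z) (\<lambda>n. \<Sum>i\<le>n. P i * Q (n - i))"
  unfolding log_exp_def
proof
  fix N
  have inv: "(\<lambda>z. of_real z ^ Suc N * inverse (of_real z) :: complex) \<in> O[at_right 0](\<lambda>z. of_real z ^ N)"
    using eventually_at_right_0[OF zero_less_one]
    by (intro bigoI[where c=1]) (auto elim!: eventually_mono simp: norm_mult norm_power norm_inverse)
  have "(\<lambda>z. (f z - log_partial P (Suc N) z) * g z) \<in> O[at_right 0](\<lambda>z. of_real z ^ Suc N * inverse (of_real z))"
    using f log_exp_bigo[OF g] unfolding log_exp_def by (intro landau_o.big.mult) blast+
  then have 1: "(\<lambda>z. (f z - log_partial P (Suc N) z) * g z) \<in> O[at_right 0](\<lambda>z. of_real z ^ N)"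
    using inv by (rule landau_o.big_trans)
  have "(\<lambda>z. (g z - log_partial Q (Suc N) z) * log_partial P (Suc N) z) \<in> O[at_right 0](\<lambda>z. of_real z ^ Suc N * inverse (of_real z))"
    using g log_partial_bigo unfolding log_exp_def by (intro landau_o.big.mult) blast+
  then have 2: "(\<lambda>z. (g z - log_partial Q (Suc N) z) * log_partial P (Suc N) z) \<in> O[at_right 0](\<lambda>z. of_real z ^ N)"
    using inv by (rule landau_o.big_trans)
  \<comment> \<open>With \<open>A\<close>, \<open>B\<close> for the partial sums of
    \<open>f\<close>, \<open>g\<close> this is \<open>f g - A B = (f - A) g + (g - B) A\<close>,
    followed by the comparison of \<open>A B\<close> with the Cauchy product.\<close>
  have "(\<lambda>z. (f z - log_partial P (Suc N) z) * g z + (g z - log_partial Q (Suc N) z) * log_partial P (Suc N) z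
     + (log_partial P (Suc N) z * log_partial Q (Suc N) z - log_partial (\<lambda>n. \<Sum>i\<le>n. P i * Q (n - i)) N z))
     \<in> O[at_right 0](\<lambda>z. of_real z ^ N)"
    by (intro sum_in_bigo(1) 1 2 log_partial_mult)
  then show "(\<lambda>z. f z * g z - log_partial (\<lambda>n. \<Sum>i\<le>n. P i * Q (n - i)) N z) \<in> O[at_right 0](\<lambda>z. of_real z ^ N)"
    by (simp add: algebra_simps)
qed

section \<open>The constant term of a convergent function\<close>

lemma log_exp_imp_has_log_expansion:
  assumes "log_exp f P"
  shows "has_log_expansion f (\<lambda>i j. coeff (P j) i)"
  unfolding has_log_expansion_def
proof (intro conjI allI)
  fix j
  show "finite {i. coeff (P j) i \<noteq> 0}"
    by (rule finite_subset[of _ "{..degree (P j)}"]) (auto simp: le_degree)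
next
  fix N
  have "(\<Sum>i | coeff (P j) i \<noteq> 0. coeff (P j) i * of_real (ln z ^ i * z ^ j)) = poly (P j) (of_real (ln z)) * of_real z ^ j"
    for j z
  proof -
    have "(\<Sum>i | coeff (P j) i \<noteq> 0. coeff (P j) i * of_real (ln z ^ i * z ^ j))
        = (\<Sum>i\<le>degree (P j). coeff (P j) i * of_real (ln z ^ i * z ^ j))"
      by (rule sum.mono_neutral_left) (auto simp: le_degree)
    then show ?thesis by (simp add: poly_altdef sum_distrib_right mult.assoc)
  qed
  then have "(\<Sum>j\<le>N. \<Sum>i | coeff (P j) i \<noteq> 0. coeff (P j) i * of_real (ln z ^ i * z ^ j)) = log_partial P N z" for z
    by (simp add: log_partial_def)
  then show "(\<lambda>z. f z - (\<Sum>j\<le>N. \<Sum>i | coeff (P j) i \<noteq> 0. coeff (P j) i * of_real (ln z ^ i * z ^ j)))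
      \<in> o[at_right 0](\<lambda>z. of_real (z ^ N))"
    using log_exp_smallo[OF assms, of N] by simp
qed

text \<open>A nonconstant polynomial in \<open>ln z\<close> is unbounded as \<open>z \<rightarrow> +0\<close>.\<close>

lemma has_log_expansion_tendsto:
  assumes "has_log_expansion f c" "(f \<longlongrightarrow> l) (at_right 0)"
  shows "c 0 0 = l"
proof -
  define I where "I = {i. c i 0 \<noteq> 0}"
  define q where "q = (\<Sum>i\<in>I. monom (c i 0) i)"
  have I: "finite I" using assms(1) by (simp add: has_log_expansion_def I_def)
  have q0: "coeff q 0 = c 0 0"
    using I by (simp add: q_def coeff_sum I_def if_distrib[of "\<lambda>x. _ = x"] sum.delta)
  have "(\<lambda>z. f z - (\<Sum>j\<le>0. \<Sum>i | c i j \<noteq> 0. c i j * of_real (ln z ^ i * z ^ j))) \<in> o[at_right 0](\<lambda>z. of_real (z ^ 0))"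
    using assms(1) unfolding has_log_expansion_def by blast
  then have "(\<lambda>z. f z - poly q (of_real (ln z))) \<in> o[at_right 0](\<lambda>z. 1)"
    by (simp add: q_def poly_sum poly_monom I_def)
  then have "((\<lambda>z. f z - poly q (of_real (ln z))) \<longlongrightarrow> 0) (at_right 0)"
    using smalloD_tendsto by fastforce
  from tendsto_diff[OF assms(2) this]
  have lim: "((\<lambda>z. poly q (of_real (ln z))) \<longlongrightarrow> l) (at_right 0)" by simp
  obtain a p where q: "q = pCons a p" by (cases q)
  have "p = 0"
  proof (rule ccontr)
    assume "p \<noteq> 0"
    from poly_infinity[OF this, of "norm l + 1" a]
    obtain r where r: "\<And>z. r \<le> norm z \<Longrightarrow> norm l + 1 \<le> norm (poly q z)" using q by blast
    have "\<forall>\<^sub>F z in at_right 0. norm (poly q (of_real (ln z))) < norm l + 1"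
      by (rule order_tendstoD(2)[OF tendsto_norm[OF lim]]) simp
    moreover have "\<forall>\<^sub>F z in at_right 0. ln z \<le> - r" 
      using ln_at_0 by (simp add: filterlim_at_bot)
    ultimately have "\<forall>\<^sub>F z in at_right (0::real). False"
    proof eventually_elim
      case (elim z)
      then have "r \<le> norm (of_real (ln z) :: complex)" by simp
      from r[OF this] elim show False by simp
    qed
    then show False by simp
  qed
  then have "((\<lambda>z::real. a) \<longlongrightarrow> l) (at_right 0)" using lim q by simp
  then have "a = l" using tendsto_const_iff trivial_limit_at_right_real by blast
  then show ?thesis using q0 q by simp
qed

text \<open>The expansion supplies existence for the definite description; the limit supplies
  uniqueness, because it equals the coefficient \<open>c 0 0\<close> of every expansion.\<close>

lemma constant_term_eq_limit:
  assumes "log_exp f P" "(f \<longlongrightarrow> l) (at_right 0)"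
  shows "constant_term f = l"
  unfolding constant_term_def
proof (rule the_equality)
  show "\<exists>c. has_log_expansion f c \<and> l = c 0 0"
    using log_exp_imp_has_log_expansion[OF assms(1)] has_log_expansion_tendsto[OF _ assms(2)] by blast
qed (use has_log_expansion_tendsto[OF _ assms(2)] in blast)

lemma log_exp_sum:
  "(\<And>i. i \<in> I \<Longrightarrow> \<exists>P. log_exp (f i) P) \<Longrightarrow> \<exists>P. log_exp (\<lambda>z. \<Sum>i\<in>I. f i z) P"
proof (induction I rule: infinite_finite_induct)
  case (insert i I)
  then obtain P Q where "log_exp (f i) P" "log_exp (\<lambda>z. \<Sum>i\<in>I. f i z) Q" by blast
  from log_exp_add[OF this] insert show ?case by auto
qed (use log_exp_const[of 0] in auto)

text \<open>Coefficients without logarithms form an ordinary power series; it is inverted formally.\<close>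

lemma log_exp_inverse:
  assumes f: "log_exp f (\<lambda>j. [:a j:])" and a0: "a 0 \<noteq> 0"
  shows "\<exists>b. log_exp (\<lambda>z. inverse (f z)) (\<lambda>j. [:b j:])"
proof -
  \<comment> \<open>The coefficients of the inverse formal power series; \<open>conv\<close> says
    that the Cauchy product with \<open>a\<close> is 1.\<close>
  define b where "b = fps_nth (inverse (Abs_fps a))"
  have conv: "(\<Sum>i\<le>n. b (n - i) * a i) = (if n = 0 then 1 else 0)" for n
  proof -
    have "Abs_fps a * inverse (Abs_fps a) = 1"
      using a0 by (intro inverse_mult_eq_1') simp
    then have "fps_nth (Abs_fps a * inverse (Abs_fps a)) n = fps_nth 1 n" by simp
    then show ?thesis by (simp add: fps_mult_nth b_def atMost_atLeast0 mult.commute)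
  qed
  have f0: "(f \<longlongrightarrow> a 0) (at_right 0)"
  proof -
    have "(\<lambda>z. f z - log_partial (\<lambda>j. [:a j:]) 0 z) \<in> o[at_right 0](\<lambda>z. of_real z ^ 0)"
      by (rule log_exp_smallo[OF f])
    then have "((\<lambda>z. f z - a 0) \<longlongrightarrow> 0) (at_right 0)"
      using smalloD_tendsto by (fastforce simp: log_partial_def)
    then show ?thesis by (simp add: LIM_zero_iff)
  qed
  have inv: "(\<lambda>z. inverse (f z)) \<in> O[at_right 0](\<lambda>_. 1)"
    by (rule bigoI_tendsto[where c="inverse (a 0)"]) (use a0 f0 in \<open>auto intro!: tendsto_intros\<close>)
  have nz: "\<forall>\<^sub>F z in at_right 0. f z \<noteq> 0"
    using f0 a0 by (rule tendsto_imp_eventually_ne)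
  have "log_exp (\<lambda>z. inverse (f z)) (\<lambda>j. [:b j:])"
    unfolding log_exp_def
  proof
    fix N
    let ?B = "log_partial (\<lambda>j. [:b j:]) (Suc N)"
    have "(\<lambda>z. (f z - log_partial (\<lambda>j. [:a j:]) (Suc N) z) * ?B z) \<in> O[at_right 0](\<lambda>z. of_real z ^ Suc N * inverse (of_real z))"
      using f log_partial_bigo unfolding log_exp_def by (intro landau_o.big.mult) blast+
    moreover have "(\<lambda>z. of_real z ^ Suc N * inverse (of_real z) :: complex) \<in> O[at_right 0](\<lambda>z. of_real z ^ N)"
      using eventually_at_right_0[OF zero_less_one]
      by (intro bigoI[where c=1]) (auto elim!: eventually_mono simp: norm_mult norm_power norm_inverse)
    ultimately have 1: "(\<lambda>z. (f z - log_partial (\<lambda>j. [:a j:]) (Suc N) z) * ?B z) \<in> O[at_right 0](\<lambda>z. of_real z ^ N)"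
      by (rule landau_o.big_trans)
    have "(\<lambda>z. log_partial (\<lambda>j. [:a j:]) (Suc N) z * ?B z - log_partial (\<lambda>n. \<Sum>i\<le>n. [:a i:] * [:b (n - i):]) N z)
       \<in> O[at_right 0](\<lambda>z. of_real z ^ N)"
      by (rule log_partial_mult)
    moreover have "log_partial (\<lambda>n. \<Sum>i\<le>n. [:a i:] * [:b (n - i):]) N z = 1" for z
      by (simp add: log_partial_def poly_sum conv if_distrib[of "\<lambda>c. c * _"] sum.delta cong: if_cong)
    ultimately have 2: "(\<lambda>z. log_partial (\<lambda>j. [:a j:]) (Suc N) z * ?B z - 1) \<in> O[at_right 0](\<lambda>z. of_real z ^ N)"
      by simp
    \<comment> \<open>With \<open>A\<close> for the partial sum of \<open>f\<close>, the bracket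
      \<open>(f - A) B + (A B - 1)\<close> equals \<open>f B - 1\<close>; dividing by
      \<open>f\<close> and changing the sign gives \<open>inverse f - B\<close>.\<close>
    have "(\<lambda>z. - (((f z - log_partial (\<lambda>j. [:a j:]) (Suc N) z) * ?B z + (log_partial (\<lambda>j. [:a j:]) (Suc N) z * ?B z - 1)) * inverse (f z)))
        \<in> O[at_right 0](\<lambda>z. of_real z ^ N * 1)"
      unfolding landau_o.big.uminus_in_iff by (intro landau_o.big.mult sum_in_bigo(1) 1 2 inv)
    then have "(\<lambda>z. - (((f z - log_partial (\<lambda>j. [:a j:]) (Suc N) z) * ?B z + (log_partial (\<lambda>j. [:a j:]) (Suc N) z * ?B z - 1)) * inverse (f z)))
        \<in> O[at_right 0](\<lambda>z. of_real z ^ N)"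
      by simp
    then have 3: "(\<lambda>z. inverse (f z) - ?B z) \<in> O[at_right 0](\<lambda>z. of_real z ^ N)"
      by (rule bigo_ev_cong) (use nz in \<open>auto elim!: eventually_mono simp: field_simps\<close>)
    have "(\<lambda>z. (inverse (f z) - ?B z) + poly [:b (Suc N):] (of_real (ln z)) * of_real z ^ Suc N) \<in> O[at_right 0](\<lambda>z. of_real z ^ N)"
      by (intro sum_in_bigo(1) 3 poly_ln_bigo) auto
    then show "(\<lambda>z. inverse (f z) - log_partial (\<lambda>j. [:b j:]) N z) \<in> O[at_right 0](\<lambda>z. of_real z ^ N)"
      by (simp add: log_partial_def)
  qed
  then show ?thesis by blast
qed

text \<open>\<open>r' + j r = p\<close> expresses that \<open>r (ln z) z^j\<close> is a primitive of
  \<open>p (ln z) z^(j - 1)\<close>. For \<open>j = 0\<close> it is formal integration, which raises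
  the power of the logarithm; for \<open>j > 0\<close> it is solved by induction on the degree,
  since \<open>pderiv\<close> lowers it.\<close>

lemma pderiv_plus_smult_surj:
  "\<exists>r. pderiv r + smult (of_nat j) r = (p :: complex poly)"
proof (cases "j = 0")
  case True
  have "pderiv (\<Sum>i\<le>degree p. monom (coeff p i / of_nat (Suc i)) (Suc i)) = (\<Sum>i\<le>degree p. monom (coeff p i) i)"
    by (simp add: higher_pderiv_sum[where n=1, simplified] pderiv_monom del: of_nat_Suc)
  also have "\<dots> = p" by (rule poly_as_sum_of_monoms)
  finally show ?thesis using True by auto
next
  case False
  have "\<exists>r. pderiv r + smult (of_nat j) r = p" if "degree p \<le> n" for n and p :: "complex poly"
    using that
  proof (induction n arbitrary: p)
    case 0
    then obtain a where "p = [:a:]" by (metis degree_eq_zeroE le_zero_eq)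
    then show ?case using False by (intro exI[of _ "[:a / of_nat j:]"]) (simp add: pderiv_pCons)
  next
    case (Suc n)
    have "degree (- smult (1 / of_nat j) (pderiv p)) \<le> n" using Suc.prems by (auto simp: degree_pderiv)
    from Suc.IH[OF this] obtain r where r: "pderiv r + smult (of_nat j) r = - smult (1 / of_nat j) (pderiv p)" by blast
    have "pderiv (r + smult (1 / of_nat j) p) + smult (of_nat j) (r + smult (1 / of_nat j) p) = p"
      using r False by (simp add: pderiv_add pderiv_smult smult_add_right add_ac) (simp flip: add.assoc)
    then show ?case by blast
  qed
  then show ?thesis by blast
qed

lemma has_vector_derivative_log_term:
  assumes "0 < z"
  shows "((\<lambda>z. poly r (of_real (ln z)) * of_real z ^ j :: complex) has_vector_derivative
     poly (pderiv r + smult (of_nat j) r) (of_real (ln z)) * of_real z ^ j / of_real z) (at z)"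
proof -
  have 1: "((\<lambda>z. of_real (ln z) :: complex) has_vector_derivative of_real (1 / z)) (at z)"
    using assms by (intro has_vector_derivative_of_real) (auto simp: has_real_derivative_iff_has_vector_derivative[symmetric] intro!: derivative_eq_intros)
  have 2: "((\<lambda>z. poly r (of_real (ln z)) :: complex) has_vector_derivative of_real (1 / z) * poly (pderiv r) (of_real (ln z))) (at z)"
    using field_vector_diff_chain_at[OF 1 poly_DERIV] by (simp add: o_def)
  have 3: "((\<lambda>z. of_real z ^ j :: complex) has_vector_derivative of_nat j * of_real z ^ j / of_real z) (at z)"
  proof -
    have "((\<lambda>z. of_real (z ^ j) :: complex) has_vector_derivative of_real (of_nat j * z ^ (j - 1))) (at z)"
      by (intro has_vector_derivative_of_real) (auto simp: has_real_derivative_iff_has_vector_derivative[symmetric] intro!: derivative_eq_intros)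
    then show ?thesis using assms by (cases j) auto
  qed
  show ?thesis
    using has_vector_derivative_mult[OF 2 3] assms by (simp add: field_simps)
qed

text \<open>Subtracting the termwise primitive \<open>R\<close> leaves a function whose derivative
  is small near 0, so that it has a limit \<open>k\<close> there. This constant of integration is
  the only datum not determined by \<open>Q\<close>, and it is added to the coefficient of
  \<open>z^0\<close>.\<close>

lemma log_exp_primitive:
  assumes g: "log_exp g Q" and d: "0 < d"
    and H: "\<And>z. 0 < z \<Longrightarrow> z < d \<Longrightarrow> (H has_vector_derivative g z / of_real z) (at z)"
  shows "\<exists>P. log_exp H P"
proof -
  obtain R where R: "\<And>j. pderiv (R j) + smult (of_nat j) (R j) = Q j"
    using choice[of "\<lambda>j r. pderiv r + smult (of_nat j) r = Q j"] pderiv_plus_smult_surj by blast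
  define U where "U = (\<lambda>N z. H z - log_partial R N z)"
  have dU: "(U N has_vector_derivative (g z - log_partial Q N z) / of_real z) (at z)" if "0 < z" "z < d" for N z
  proof -
    have "(log_partial R N has_vector_derivative (\<Sum>j\<le>N. poly (Q j) (of_real (ln z)) * of_real z ^ j / of_real z)) (at z)"
      unfolding log_partial_def
      by (intro has_vector_derivative_sum, subst R[symmetric], rule has_vector_derivative_log_term[OF that(1)])
    from has_vector_derivative_diff[OF H[OF that] this] show ?thesis
      unfolding U_def log_partial_def by (simp add: diff_divide_distrib sum_divide_distrib)
  qed
  have U: "\<exists>k. (U (Suc N) \<longlongrightarrow> k) (at_right 0) \<and> (\<lambda>z. U (Suc N) z - k) \<in> O[at_right 0](\<lambda>z. of_real z ^ Suc N)" for N
  proof -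
    have "(\<lambda>z. g z - log_partial Q (Suc N) z) \<in> O[at_right 0](\<lambda>z. of_real z ^ Suc N)"
      using g unfolding log_exp_def by blast
    then obtain C where C: "C > 0" "\<forall>\<^sub>F z in at_right 0. norm (g z - log_partial Q (Suc N) z) \<le> C * norm (of_real z ^ Suc N :: complex)"
      by (elim landau_o.bigE)
    obtain e where e: "e > 0" "e \<le> d" "e \<le> 1" "\<And>z. 0 < z \<Longrightarrow> z < e \<Longrightarrow> norm (g z - log_partial Q (Suc N) z) \<le> C * z ^ Suc N"
    proof -
      from C(2) obtain e where "e > 0" "\<And>z. 0 < z \<Longrightarrow> z < e \<Longrightarrow> norm (g z - log_partial Q (Suc N) z) \<le> C * norm (of_real z ^ Suc N :: complex)"
        by (auto simp: eventually_at_right_field)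
      with d show ?thesis by (intro that[of "min (min e d) 1"]) (auto simp: norm_power norm_mult)
    qed
    have bd: "norm (U (Suc N) b - U (Suc N) y) \<le> C * b ^ N * norm (b - y)" if "0 < y" "y \<le> b" "b < e" for y b
    proof -
      have "norm (U (Suc N) b - U (Suc N) y) \<le> (C * b ^ N) * norm (b - y)"
      proof (rule differentiable_bound[of "{y..b}" "U (Suc N)" "\<lambda>z h. h *\<^sub>R ((g z - log_partial Q (Suc N) z) / of_real z)"])
        fix z assume z: "z \<in> {y..b}"
        show "(U (Suc N) has_derivative (\<lambda>h. h *\<^sub>R ((g z - log_partial Q (Suc N) z) / of_real z))) (at z within {y..b})"
          using dU[of z "Suc N"] z that e unfolding has_vector_derivative_def by (auto intro: has_derivative_at_withinI)
        have "norm ((g z - log_partial Q (Suc N) z) / of_real z) \<le> C * z ^ Suc N / z"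
          using e(4)[of z] z that by (auto simp: norm_divide field_simps)
        also have "\<dots> \<le> C * b ^ N"
          using z that C(1) by (auto intro!: mult_left_mono power_mono)
        finally show "onorm (\<lambda>h. h *\<^sub>R ((g z - log_partial Q (Suc N) z) / of_real z)) \<le> C * b ^ N"
          by (intro onorm_le) (simp add: mult.commute mult_left_mono)
      qed (use that in auto)
      then show ?thesis .
    qed
    \<comment> \<open>As \<open>e \<le> 1\<close>, the factor \<open>b ^ N\<close> in
      \<open>bd\<close> is at most 1. Lipschitz continuity on the punctured interval gives uniform
      continuity and thereby the limit at 0.\<close>
    have "C-lipschitz_on {0<..<e} (U (Suc N))"
    proof (rule lipschitz_onI)
      fix x y assume xy: "x \<in> {0<..<e}" "y \<in> {0<..<e}"
      have *: "norm (U (Suc N) b - U (Suc N) y) \<le> C * norm (b - y)" if "0 < y" "y \<le> b" "b < e" for y b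
        using bd[OF that] that e C(1)
        by (smt (verit) mult_left_le mult_right_mono norm_ge_zero power_le_one)
      show "dist (U (Suc N) x) (U (Suc N) y) \<le> C * dist x y"
        using *[of x y] *[of y x] xy by (cases "x \<le> y") (auto simp: dist_norm norm_minus_commute)
    qed (use C in simp)
    then have uc: "uniformly_continuous_on {0<..<e} (U (Suc N))"
      by (rule lipschitz_on_uniformly_continuous)
    have "0 \<in> closure {0<..<e}" using e by simp
    then obtain k where "(U (Suc N) \<longlongrightarrow> k) (at 0 within {0<..<e})"
      using uniformly_continuous_on_extension_at_closure[OF uc] by blast
    then have k: "(U (Suc N) \<longlongrightarrow> k) (at_right 0)"
      using e at_within_nhd[of 0 "{..<e}" "{0<..<e}" "{0<..}"] by fastforce
    have "norm (U (Suc N) b - k) \<le> C * norm (of_real b ^ Suc N :: complex)" if "0 < b" "b < e" for b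
    proof (rule tendsto_upperbound[OF tendsto_norm[OF tendsto_diff[OF tendsto_const k]]])
      show "\<forall>\<^sub>F y in at_right 0. norm (U (Suc N) b - U (Suc N) y) \<le> C * norm (of_real b ^ Suc N :: complex)"
        using eventually_at_right_0[OF that(1)]
      proof eventually_elim
        case (elim y)
        have "norm (U (Suc N) b - U (Suc N) y) \<le> C * b ^ N * norm (b - y)" using elim that by (intro bd) auto
        also have "\<dots> \<le> C * b ^ N * b" using elim C(1) by (intro mult_left_mono) auto
        finally show ?case using that by (simp add: norm_mult norm_power mult_ac)
      qed
    qed simp
    then have "(\<lambda>z. U (Suc N) z - k) \<in> O[at_right 0](\<lambda>z. of_real z ^ Suc N)"
      using e(1) by (intro bigoI[where c=C]) (auto simp: eventually_at_right_field intro!: exI[of _ e])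
    with k show ?thesis by blast
  qed
  obtain k where k: "(U (Suc 0) \<longlongrightarrow> k) (at_right 0)" using U by blast
  \<comment> \<open>\<open>U (Suc N)\<close> and \<open>U (Suc 0)\<close> differ by terms with
    powers of \<open>z\<close> of at least 2, which vanish at 0; hence the limit \<open>k\<close>
    does not depend on \<open>N\<close>.\<close>
  have Uk: "(\<lambda>z. U (Suc N) z - k) \<in> O[at_right 0](\<lambda>z. of_real z ^ Suc N)" for N
  proof -
    obtain k' where k': "(U (Suc N) \<longlongrightarrow> k') (at_right 0)" "(\<lambda>z. U (Suc N) z - k') \<in> O[at_right 0](\<lambda>z. of_real z ^ Suc N)"
      using U by blast
    have "((\<lambda>z. U (Suc 0) z - (\<Sum>j\<in>{1<..Suc N}. poly (R j) (of_real (ln z)) * of_real z ^ j)) \<longlongrightarrow> k - (\<Sum>j\<in>{1<..Suc N}. 0)) (at_right 0)"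
    proof (intro tendsto_diff k tendsto_sum)
      fix j assume "j \<in> {1<..Suc N}"
      then have "(\<lambda>z. poly (R j) (of_real (ln z)) * of_real z ^ j) \<in> O[at_right 0](\<lambda>z. of_real z ^ 1 :: complex)"
        by (intro poly_ln_bigo) auto
      moreover have "((\<lambda>z. of_real z ^ 1 :: complex) \<longlongrightarrow> of_real 0 ^ 1) (at_right 0)"
        by (intro tendsto_intros)
      then have "(\<lambda>z. of_real z ^ 1 :: complex) \<in> o[at_right 0](\<lambda>z. 1 :: complex)"
        by (intro smalloI_tendsto) auto
      ultimately have "(\<lambda>z. poly (R j) (of_real (ln z)) * of_real z ^ j) \<in> o[at_right 0](\<lambda>z. 1 :: complex)"
        by (rule landau_o.big_small_trans)
      then show "((\<lambda>z. poly (R j) (of_real (ln z)) * of_real z ^ j) \<longlongrightarrow> 0) (at_right 0)"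
        using smalloD_tendsto by fastforce
    qed
    moreover have "U (Suc 0) z - (\<Sum>j\<in>{1<..Suc N}. poly (R j) (of_real (ln z)) * of_real z ^ j) = U (Suc N) z" for z
    proof -
      have "{..Suc N} = {..Suc 0} \<union> {1<..Suc N}" by auto
      then have "log_partial R (Suc N) z = log_partial R (Suc 0) z + (\<Sum>j\<in>{1<..Suc N}. poly (R j) (of_real (ln z)) * of_real z ^ j)"
        unfolding log_partial_def by (simp only:) (rule sum.union_disjoint; auto)
      then show ?thesis by (simp add: U_def)
    qed
    ultimately have "(U (Suc N) \<longlongrightarrow> k) (at_right 0)" by simp
    then have "k = k'" using k'(1) tendsto_unique trivial_limit_at_right_real by blast
    then show ?thesis using k'(2) by simp
  qed
  have "log_exp H (\<lambda>j. if j = 0 then R 0 + [:k:] else R j)"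
  proof (rule log_expI)
    fix N
    have "log_partial (\<lambda>j. if j = 0 then R 0 + [:k:] else R j) (Suc N) z = log_partial R (Suc N) z + k" for z
    proof -
      have "poly (if j = 0 then R 0 + [:k:] else R j) (of_real (ln z)) * of_real z ^ j
          = poly (R j) (of_real (ln z)) * of_real z ^ j + (if j = 0 then k else 0)" for j
        by simp
      then show ?thesis unfolding log_partial_def by (simp only: sum.distrib sum.delta finite_atMost) simp
    qed
    then have "H z - log_partial (\<lambda>j. if j = 0 then R 0 + [:k:] else R j) (Suc N) z = U (Suc N) z - k" for z
      by (simp add: U_def)
    then show "(\<lambda>z. H z - log_partial (\<lambda>j. if j = 0 then R 0 + [:k:] else R j) (Suc N) z) \<in> O[at_right 0](\<lambda>z. of_real z ^ N)"
      using landau_o.big_trans[OF Uk power_bigo[of N "Suc N"]] by simp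
  qed
  then show ?thesis by blast
qed

section \<open>Integration against the form dt/(t(1 - t))\<close>

definition odds :: "real \<Rightarrow> real" where "odds t = t / (1 - t)"
text \<open>The model form with a simple pole at both ends. It is the derivative of
  \<open>ln (odds t)\<close> and dominates every form of a path with nonzero tangent
  vectors.\<close>

definition lam :: "real \<Rightarrow> real" where "lam t = 1 / (t * (1 - t))"

lemma odds_pos: "0 < t \<Longrightarrow> t < 1 \<Longrightarrow> 0 < odds t"
  by (simp add: odds_def)

lemma lam_pos: "0 < t \<Longrightarrow> t < 1 \<Longrightarrow> 0 < lam t"
  by (simp add: lam_def)

lemma lam_measurable[measurable]: "lam \<in> borel_measurable borel"
  unfolding lam_def by measurable

lemma odds_measurable[measurable]: "odds \<in> borel_measurable borel"
  unfolding odds_def by measurable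

lemma has_derivative_odds_powr:
  assumes "0 < t" "t < 1"
  shows "((\<lambda>t. odds t powr b) has_real_derivative b * (lam t * odds t powr b)) (at t)"
proof -
  have "(odds has_real_derivative 1 / (1 - t)^2) (at t)"
    unfolding odds_def using assms by (auto intro!: derivative_eq_intros simp: field_simps power2_eq_square)
  from DERIV_fun_powr[OF this odds_pos[OF assms], of b]
  have "((\<lambda>t. odds t powr b) has_real_derivative b * odds t powr (b - 1) * (1 / (1 - t)^2)) (at t)"
    by simp
  moreover have "b * odds t powr (b - 1) * (1 / (1 - t)^2) = b * (lam t * odds t powr b)"
  proof -
    have "odds t powr (b - 1) = odds t powr b * ((1 - t) / t)"
      using assms by (subst powr_diff) (simp add: odds_def)
    moreover have "(1 - t) / t * (1 / (1 - t)^2) = lam t"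
      using assms by (simp add: lam_def power2_eq_square)
    ultimately show ?thesis by (simp only: mult_ac)
  qed
  ultimately show ?thesis by simp
qed

lemma odds_powr_continuous:
  assumes "0 < b" "t < 1"
  shows "continuous_on {0..t} (\<lambda>s. odds s powr b)"
proof -
  have "continuous_on {0..t} odds"
    unfolding odds_def using assms by (intro continuous_intros) auto
  then show ?thesis
    using assms by (intro continuous_on_powr' continuous_on_const) (simp_all add: odds_def)
qed

lemma has_integral_lam_odds_powr:
  assumes "0 < b" "0 < t" "t < 1"
  shows "((\<lambda>s. lam s * odds s powr b) has_integral odds t powr b / b) {0..t}"
proof -
  have "((\<lambda>s. b * (lam s * odds s powr b)) has_integral odds t powr b - odds 0 powr b) {0..t}"
    using assms
    by (intro fundamental_theorem_of_calculus_interior_strong[OF finite.emptyI] odds_powr_continuous)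
       (auto simp: has_real_derivative_iff_has_vector_derivative[symmetric] intro!: has_derivative_odds_powr)
  from has_integral_mult_right[OF this, of "1 / b"] show ?thesis
    using assms by (simp add: odds_def)
qed

lemma nn_integral_lam_odds_powr:
  assumes "0 < b" "0 < t" "t < 1"
  shows "(\<integral>\<^sup>+ s. ennreal (indicator {0<..<t} s * (lam s * odds s powr b)) \<partial>lborel) = ennreal (odds t powr b / b)"
proof (rule nn_integral_has_integral_lborel)
  have "((\<lambda>s. lam s * odds s powr b) has_integral odds t powr b / b) {0<..<t}"
    using has_integral_lam_odds_powr[OF assms] by (simp add: has_integral_Icc_iff_Ioo)
  then show "((\<lambda>s. indicator {0<..<t} s * (lam s * odds s powr b)) has_integral odds t powr b / b) UNIV"
    by (subst (asm) has_integral_restrict_UNIV[symmetric])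
       (auto elim!: has_integral_eq[rotated] simp: indicator_def)
qed (use assms in \<open>auto simp: indicator_def lam_def\<close>)

text \<open>Source of the positive exponent: a form without pole at 0 is bounded by a multiple of
  \<open>1 / (1 - t)\<close>, hence by \<open>lam\<close> times a positive power of
  \<open>odds\<close>.\<close>

lemma le_odds_powr:
  assumes "0 < t" "t < 1" "0 < b" "b \<le> 1"
  shows "1 / (1 - t) \<le> lam t * odds t powr b"
proof -
  have "t powr 1 \<le> t powr b" using assms by (intro powr_mono') auto
  also have "\<dots> \<le> odds t powr b"
    unfolding odds_def using assms by (intro powr_mono2) (auto simp: field_simps)
  finally have "t \<le> odds t powr b" using assms by simp
  then have "lam t * t \<le> lam t * odds t powr b" using assms lam_pos by (intro mult_left_mono) (auto intro: less_imp_le)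
  then show ?thesis using assms by (simp add: lam_def)
qed

lemma zero_derivative_imp_const:
  fixes F :: "real \<Rightarrow> complex"
  assumes "finite S" "continuous_on {a<..<b} F"
    and "\<And>t. t \<in> {a<..<b} - S \<Longrightarrow> (F has_vector_derivative 0) (at t)"
    and "x \<in> {a<..<b}" "y \<in> {a<..<b}"
  shows "F x = F y"
proof -
  have *: "F x = F y" if "x \<le> y" "x \<in> {a<..<b}" "y \<in> {a<..<b}" for x y
  proof -
    have "((\<lambda>_. 0) has_integral F y - F x) {x..y}"
      using that assms(3)
      by (intro fundamental_theorem_of_calculus_interior_strong[OF assms(1)] continuous_on_subset[OF assms(2)]) auto
    then have "F y - F x = 0" by (rule has_integral_unique) simp
    then show ?thesis by simp
  qed
  show ?thesis
  proof (cases "x \<le> y")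
    case True
    then show ?thesis using * assms(4,5) by blast
  next
    case False
    then have "F y = F x" using assms(4,5) by (intro *) auto
    then show ?thesis by simp
  qed
qed

text \<open>The value at 0 is prescribed only as a limit, because the functions that are compared
  need not be continuous at 0 itself.\<close>

lemma primitive_unique:
  fixes F G :: "real \<Rightarrow> complex"
  assumes "finite S" "continuous_on {0<..<1} F" "continuous_on {0<..<1} G"
    and "\<And>t. t \<in> {0<..<1} - S \<Longrightarrow> (F has_vector_derivative h t) (at t)"
    and "\<And>t. t \<in> {0<..<1} - S \<Longrightarrow> (G has_vector_derivative h t) (at t)"
    and "(F \<longlongrightarrow> 0) (at_right 0)" "(G \<longlongrightarrow> 0) (at_right 0)" and x: "x \<in> {0<..<1}"
  shows "F x = G x"
proof -
  have c: "F y - G y = F x - G x" if "y \<in> {0<..<1}" for y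
  proof (rule zero_derivative_imp_const[OF assms(1)])
    show "continuous_on {0<..<1} (\<lambda>t. F t - G t)" by (intro continuous_intros assms(2,3))
    show "((\<lambda>t. F t - G t) has_vector_derivative 0) (at t)" if "t \<in> {0<..<1} - S" for t
      using has_vector_derivative_diff[OF assms(4,5)[OF that]] by simp
  qed (use that x in auto)
  have "((\<lambda>y. F y - G y) \<longlongrightarrow> 0 - 0) (at_right 0)"
    by (intro tendsto_intros assms)
  moreover have "\<forall>\<^sub>F y in at_right 0. F y - G y = F x - G x"
    using eventually_at_right_0[of 1] by (auto elim!: eventually_mono intro: c)
  ultimately have "((\<lambda>y::real. F x - G x) \<longlongrightarrow> 0 - 0) (at_right 0)"
    by (rule Lim_transform_eventually)
  then have "F x - G x = 0 - 0" using tendsto_const_iff trivial_limit_at_right_real by blast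
  then show ?thesis by simp
qed

text \<open>Covers \<open>z = 0\<close>, where \<open>g\<close> may be singular and is merely
  integrable, as well as a cut at \<open>z > 0\<close>. Differentiability is claimed off the break
  points \<open>S\<close> only.\<close>

lemma primitive_from:
  fixes g :: "real \<Rightarrow> complex"
  assumes int: "\<And>t. z < t \<Longrightarrow> t < 1 \<Longrightarrow> integrable lborel (\<lambda>s. indicator {z<..<t} s *\<^sub>R g s)"
    and cont: "continuous_on ({0<..<1} - S) g" and S: "finite S" and z: "0 \<le> z" "z < 1"
  defines "G \<equiv> \<lambda>t. LINT s|lborel. indicator {z<..<t} s *\<^sub>R g s"
  shows "continuous_on {z..<1} G" and "G z = 0"
    and "\<And>t. t \<in> {z<..<1} - S \<Longrightarrow> (G has_vector_derivative g t) (at t)"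
    and "\<And>t. z < t \<Longrightarrow> t < 1 \<Longrightarrow> g integrable_on {z..t} \<and> G t = integral {z..t} g"
proof -
  show Gint: "g integrable_on {z..t} \<and> G t = integral {z..t} g" if "z < t" "t < 1" for t
  proof -
    have si: "set_integrable lborel {z<..<t} g" using int[OF that] by (simp add: set_integrable_def)
    have "G t = set_lebesgue_integral lborel {z<..<t} g" by (simp add: G_def set_lebesgue_integral_def)
    with set_borel_integral_eq_integral[OF si] have "g integrable_on {z<..<t}" "G t = integral {z<..<t} g" by auto
    then show ?thesis by (simp add: integrable_on_Icc_iff_Ioo integral_open_interval_real)
  qed
  show G0: "G z = 0" by (simp add: G_def)
  then have Gint': "G t = integral {z..t} g" if "z \<le> t" "t < 1" for t
    using Gint[of t] that by (cases "t = z") auto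
  have cG: "continuous_on {z..t} G" if "z < t" "t < 1" for t
  proof -
    have "continuous_on {z..t} (\<lambda>x. integral {z..x} g)"
      using Gint that by (intro indefinite_integral_continuous_1) auto
    then show ?thesis using Gint' that by (subst continuous_on_cong[OF refl, of _ _ "\<lambda>x. integral {z..x} g"]) auto
  qed
  show "continuous_on {z..<1} G"
    unfolding continuous_on_eq_continuous_within
  proof
    fix t assume t: "t \<in> {z..<1}"
    then obtain t' where t': "t < t'" "t' < 1" using dense by auto
    then have "continuous (at t within {z..t'}) G"
      using cG[of t'] t by (auto simp: continuous_on_eq_continuous_within)
    moreover have "at t within {z..t'} = at t within {z..<1}"
      using t t' by (intro at_within_nhd[of t "{..<t'}"]) auto
    ultimately show "continuous (at t within {z..<1}) G" by (simp add: continuous_within)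
  qed
  fix t assume t: "t \<in> {z<..<1} - S"
  obtain t' where t': "t < t'" "t' < 1" using t dense by auto
  have "open ({0<..<1} - S)" using S by (intro open_Diff finite_imp_closed) auto
  then have gc: "isCont g t"
    using cont t z continuous_on_eq_continuous_at by fastforce
  have "((\<lambda>u. integral {z..u} g) has_vector_derivative g t) (at t within {z..t'})"
    using integral_has_vector_derivative_continuous_at[of g z t' t "{}"] t t' Gint[of t'] gc
    by (auto intro: continuous_at_imp_continuous_at_within)
  then have "((\<lambda>u. integral {z..u} g) has_vector_derivative g t) (at t)"
    using t t' by (simp add: at_within_Icc_at)
  then show "(G has_vector_derivative g t) (at t)"
    by (rule has_vector_derivative_transform_within_open[where S="{z<..<1}"]) (use t Gint' in auto)
qed

lemma odds_integrable:
  fixes g :: "real \<Rightarrow> complex"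
  assumes [measurable]: "g \<in> borel_measurable borel" and b: "0 < b"
    and bd: "\<And>s. 0 < s \<Longrightarrow> s < t \<Longrightarrow> norm (g s) \<le> C * (lam s * odds s powr b)" and t: "0 < t" "t < 1"
  shows "integrable lborel (\<lambda>s. indicator {0<..<t} s *\<^sub>R g s)"
    and "norm (LINT s|lborel. indicator {0<..<t} s *\<^sub>R g s) \<le> C * (odds t powr b / b)"
proof -
  \<comment> \<open>The sign of \<open>C\<close> follows from the bound at one interior
    point.\<close>
  have C: "0 \<le> C"
  proof -
    have "0 \<le> norm (g (t/2))" by simp
    also have "\<dots> \<le> C * (lam (t/2) * odds (t/2) powr b)" using bd[of "t/2"] t by auto
    finally show ?thesis using lam_pos[of "t/2"] odds_pos[of "t/2"] t by (auto simp: zero_le_mult_iff mult_le_0_iff)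
  qed
  have "(\<integral>\<^sup>+ s. ennreal (norm (indicator {0<..<t} s *\<^sub>R g s)) \<partial>lborel)
      \<le> (\<integral>\<^sup>+ s. ennreal C * ennreal (indicator {0<..<t} s * (lam s * odds s powr b)) \<partial>lborel)"
  proof (rule nn_integral_mono)
    fix s
    show "ennreal (norm (indicator {0<..<t} s *\<^sub>R g s)) \<le> ennreal C * ennreal (indicator {0<..<t} s * (lam s * odds s powr b))"
    proof (cases "s \<in> {0<..<t}")
      case True
      then have "ennreal (norm (g s)) \<le> ennreal (C * (lam s * odds s powr b))"
        using bd by (intro ennreal_leI) auto
      then show ?thesis using True C by (simp add: ennreal_mult')
    qed simp
  qed
  also have "\<dots> = ennreal (C * (odds t powr b / b))"
  proof -
    have "(\<integral>\<^sup>+ s. ennreal C * ennreal (indicator {0<..<t} s * (lam s * odds s powr b)) \<partial>lborel)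
       = ennreal C * (\<integral>\<^sup>+ s. ennreal (indicator {0<..<t} s * (lam s * odds s powr b)) \<partial>lborel)"
      by (rule nn_integral_cmult) measurable
    then show ?thesis using C by (simp only: nn_integral_lam_odds_powr[OF b t] ennreal_mult')
  qed
  finally have le: "(\<integral>\<^sup>+ s. ennreal (norm (indicator {0<..<t} s *\<^sub>R g s)) \<partial>lborel) \<le> ennreal (C * (odds t powr b / b))" .
  then show int: "integrable lborel (\<lambda>s. indicator {0<..<t} s *\<^sub>R g s)"
    by (intro integrableI_bounded) (auto simp: le_less_trans)
  have "ennreal (norm (LINT s|lborel. indicator {0<..<t} s *\<^sub>R g s)) \<le> ennreal (C * (odds t powr b / b))"
    using integral_norm_bound_ennreal[OF int] le by (rule order_trans)
  then show "norm (LINT s|lborel. indicator {0<..<t} s *\<^sub>R g s) \<le> C * (odds t powr b / b)"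
    using C b by (subst (asm) ennreal_le_iff) auto
qed

lemma tendsto_odds_powr: "0 < b \<Longrightarrow> ((\<lambda>s. odds s powr b) \<longlongrightarrow> 0) (at_right 0)"
proof -
  assume b: "0 < b"
  have "continuous_on {0..1/2} (\<lambda>s. odds s powr b)" by (rule odds_powr_continuous) (use b in auto)
  then have "((\<lambda>s. odds s powr b) \<longlongrightarrow> odds 0 powr b) (at 0 within {0..1/2})"
    by (auto simp: continuous_on_def)
  then have "((\<lambda>s. odds s powr b) \<longlongrightarrow> odds 0 powr b) (at_right 0)"
    by (simp add: at_within_Icc_at_right)
  then show ?thesis by (simp add: odds_def)
qed

section \<open>Iterated integrals and shuffles\<close>

text \<open>An iterated integral grows at its last letter, the outermost variable, whereas
  \<open>primrec\<close> removes the first. So the recursion runs on the reversed word, and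
  \<open>iter\<close> undoes the reversal.\<close>

primrec riter :: "('a \<Rightarrow> real \<Rightarrow> complex) \<Rightarrow> real \<Rightarrow> 'a list \<Rightarrow> real \<Rightarrow> complex" where
  "riter f z [] t = 1"
| "riter f z (a # u) t = (LINT s|lborel. indicator {z<..<t} s *\<^sub>R (f a s * riter f z u s))"

definition iter :: "('a \<Rightarrow> real \<Rightarrow> complex) \<Rightarrow> real \<Rightarrow> 'a list \<Rightarrow> real \<Rightarrow> complex" where
  "iter f z u = riter f z (rev u)"

lemma iter_Nil: "iter f z [] t = 1"
  by (simp add: iter_def)

lemma iter_snoc: "iter f z (u @ [a]) t = (LINT s|lborel. indicator {z<..<t} s *\<^sub>R (f a s * iter f z u s))"
  by (simp add: iter_def)

text \<open>What is used about the pullbacks \<open>f a\<close>: \<open>S\<close> contains the break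
  points, \<open>A\<close> the letters that the open path avoids, and \<open>p\<close> is its
  starting point. The last assumption says that only the letter \<open>p\<close> produces a pole at
  0.\<close>

locale path_forms =
  fixes S :: "real set" and A :: "complex set" and p :: complex and f :: "complex \<Rightarrow> real \<Rightarrow> complex"
  assumes finite_S: "finite S"
    and f_measurable[measurable]: "\<And>a. a \<in> A \<Longrightarrow> f a \<in> borel_measurable borel"
    and f_cont: "\<And>a. a \<in> A \<Longrightarrow> continuous_on ({0<..<1} - S) (f a)"
    and f_bound: "\<And>a. a \<in> A \<Longrightarrow> \<exists>C\<ge>0. \<forall>t. 0 < t \<longrightarrow> t < 1 \<longrightarrow> norm (f a t) \<le> C * lam t"
    and f_bound_start: "\<And>a. a \<in> A \<Longrightarrow> a \<noteq> p \<Longrightarrow> \<exists>C\<ge>0. \<forall>t. 0 < t \<longrightarrow> t < 1 \<longrightarrow> norm (f a t) \<le> C * (1 / (1 - t))"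
begin

abbreviation G :: "complex list set" where "G \<equiv> start_words A p"

lemma iter_measurable: "set u \<subseteq> A \<Longrightarrow> iter f z u \<in> borel_measurable borel"
proof (induction u rule: rev_induct)
  case Nil
  then show ?case by (simp add: iter_Nil[abs_def])
next
  case (snoc a u)
  then have [measurable]: "f a \<in> borel_measurable borel" "iter f z u \<in> borel_measurable borel" by auto
  have "(\<lambda>t. LINT s|lborel. (if z < s \<and> s < t then f a s * iter f z u s else 0)) \<in> borel_measurable borel"
    by measurable
  also have "(\<lambda>t. LINT s|lborel. (if z < s \<and> s < t then f a s * iter f z u s else 0)) = iter f z (u @ [a])"
    unfolding iter_snoc fun_eq_iff by (intro allI Bochner_Integration.integral_cong) (auto simp: indicator_def)
  finally show ?case .
qed

lemma start_words_set: "u \<in> G \<Longrightarrow> set u \<subseteq> A"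
  by (simp add: start_words_def)

text \<open>The exponent 1/2 comes from \<open>le_odds_powr\<close> at the first letter, where any
  exponent in (0, 1] would be possible. It is preserved by every further integration, which
  multiplies the constant by \<open>1 / (1/2) = 2\<close>.\<close>

lemma form_iter_bound:
  "u @ [a] \<in> G \<Longrightarrow> \<exists>C\<ge>0. \<forall>s. 0 < s \<longrightarrow> s < 1 \<longrightarrow> norm (f a s * iter f 0 u s) \<le> C * (lam s * odds s powr (1/2))"
proof (induction u arbitrary: a rule: rev_induct)
  case Nil
  then have "a \<in> A" "a \<noteq> p" by (auto simp: start_words_def)
  then obtain C where C: "C \<ge> 0" "\<And>t. 0 < t \<Longrightarrow> t < 1 \<Longrightarrow> norm (f a t) \<le> C * (1 / (1 - t))"
    using f_bound_start by blast
  show ?case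
  proof (intro exI[of _ C] conjI allI impI C(1))
    fix s :: real assume s: "0 < s" "s < 1"
    have "norm (f a s) \<le> C * (1 / (1 - s))" using C s by blast
    also have "\<dots> \<le> C * (lam s * odds s powr (1/2))" using s C(1) by (intro mult_left_mono le_odds_powr) auto
    finally show "norm (f a s * iter f 0 [] s) \<le> C * (lam s * odds s powr (1/2))" by (simp add: iter_Nil)
  qed
next
  case (snoc b v)
  have vb: "v @ [b] \<in> G" and a: "a \<in> A" using snoc.prems start_words_snoc by blast+
  obtain C where C: "C \<ge> 0" "\<And>s. 0 < s \<Longrightarrow> s < 1 \<Longrightarrow> norm (f b s * iter f 0 v s) \<le> C * (lam s * odds s powr (1/2))"
    using snoc.IH[OF vb] by blast
  obtain C' where C': "C' \<ge> 0" "\<And>t. 0 < t \<Longrightarrow> t < 1 \<Longrightarrow> norm (f a t) \<le> C' * lam t"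
    using f_bound a by blast
  have [measurable]: "f b \<in> borel_measurable borel" "iter f 0 v \<in> borel_measurable borel"
    using start_words_set[OF vb] by (auto intro: iter_measurable)
  show ?case
  proof (intro exI[of _ "C' * C * 2"] conjI allI impI)
    fix s :: real assume s: "0 < s" "s < 1"
    have "norm (iter f 0 (v @ [b]) s) \<le> C * (odds s powr (1/2) / (1/2))"
      unfolding iter_snoc by (rule odds_integrable(2)) (use C s in auto)
    then have "norm (f a s * iter f 0 (v @ [b]) s) \<le> (C' * lam s) * (C * (odds s powr (1/2) / (1/2)))"
      unfolding norm_mult using C' s lam_pos[OF s] by (intro mult_mono) auto
    then show "norm (f a s * iter f 0 (v @ [b]) s) \<le> C' * C * 2 * (lam s * odds s powr (1/2))"
      by (simp add: mult_ac)
  qed (use C C' in auto)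
qed

text \<open>Continuity of the shorter integral is a hypothesis here, so that
  \<open>iter_cont\<close> can be proved from it by induction; \<open>iter_props\<close> then
  removes it.\<close>

lemma iter_step:
  assumes ua: "u @ [a] \<in> G" and cu: "continuous_on {0<..<1} (iter f 0 u)"
  shows "continuous_on {0<..<1} (iter f 0 (u @ [a]))"
    and "\<And>t. t \<in> {0<..<1} - S \<Longrightarrow> (iter f 0 (u @ [a]) has_vector_derivative f a t * iter f 0 u t) (at t)"
    and "\<exists>C\<ge>0. \<forall>s. 0 < s \<longrightarrow> s < 1 \<longrightarrow> norm (iter f 0 (u @ [a]) s) \<le> C * odds s powr (1/2)"
    and "\<And>t. 0 < t \<Longrightarrow> t < 1 \<Longrightarrow> integrable lborel (\<lambda>s. indicator {0<..<t} s *\<^sub>R (f a s * iter f 0 u s))"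
proof -
  have a: "a \<in> A" using ua by (simp add: start_words_snoc)
  have [measurable]: "f a \<in> borel_measurable borel" "iter f 0 u \<in> borel_measurable borel"
    using start_words_set[OF ua] by (auto intro: iter_measurable)
  obtain C where C: "C \<ge> 0" "\<And>s. 0 < s \<Longrightarrow> s < 1 \<Longrightarrow> norm (f a s * iter f 0 u s) \<le> C * (lam s * odds s powr (1/2))"
    using form_iter_bound[OF ua] by blast
  show int: "integrable lborel (\<lambda>s. indicator {0<..<t} s *\<^sub>R (f a s * iter f 0 u s))" if "0 < t" "t < 1" for t
    by (rule odds_integrable(1)[of _ "1/2" _ C]) (use C that in auto)
  have c: "continuous_on ({0<..<1} - S) (\<lambda>s. f a s * iter f 0 u s)"
    by (intro continuous_on_mult f_cont a continuous_on_subset[OF cu]) auto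
  have e: "iter f 0 (u @ [a]) = (\<lambda>t. LINT s|lborel. indicator {0<..<t} s *\<^sub>R (f a s * iter f 0 u s))"
    by (rule ext) (rule iter_snoc)
  note prim = primitive_from[OF int c finite_S order_refl zero_less_one, folded e]
  show "continuous_on {0<..<1} (iter f 0 (u @ [a]))"
    by (rule continuous_on_subset[OF prim(1)]) auto
  show "(iter f 0 (u @ [a]) has_vector_derivative f a t * iter f 0 u t) (at t)" if "t \<in> {0<..<1} - S" for t
    by (rule prim(3)) (use that in auto)
  show "\<exists>C\<ge>0. \<forall>s. 0 < s \<longrightarrow> s < 1 \<longrightarrow> norm (iter f 0 (u @ [a]) s) \<le> C * odds s powr (1/2)"
  proof (intro exI[of _ "C * 2"] conjI allI impI)
    fix s :: real assume s: "0 < s" "s < 1"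
    have "norm (iter f 0 (u @ [a]) s) \<le> C * (odds s powr (1/2) / (1/2))"
      unfolding iter_snoc by (rule odds_integrable(2)) (use C s in auto)
    then show "norm (iter f 0 (u @ [a]) s) \<le> C * 2 * odds s powr (1/2)" by simp
  qed (use C in auto)
qed

lemma iter_cont: "u \<in> G \<Longrightarrow> continuous_on {0<..<1} (iter f 0 u)"
proof (induction u rule: rev_induct)
  case Nil
  then show ?case by (simp add: iter_Nil[abs_def])
next
  case (snoc a u)
  then show ?case using iter_step(1) start_words_snoc by blast
qed

lemma iter_props:
  assumes "u @ [a] \<in> G"
  shows "\<And>t. t \<in> {0<..<1} - S \<Longrightarrow> (iter f 0 (u @ [a]) has_vector_derivative f a t * iter f 0 u t) (at t)"
    and "\<exists>C\<ge>0. \<forall>s. 0 < s \<longrightarrow> s < 1 \<longrightarrow> norm (iter f 0 (u @ [a]) s) \<le> C * odds s powr (1/2)"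
    and "\<And>t. 0 < t \<Longrightarrow> t < 1 \<Longrightarrow> integrable lborel (\<lambda>s. indicator {0<..<t} s *\<^sub>R (f a s * iter f 0 u s))"
  using iter_step[OF assms iter_cont] assms start_words_snoc by blast+

definition J :: "ncpoly \<Rightarrow> real \<Rightarrow> complex" where
  "J x t = lin (\<lambda>u. iter f 0 u t) x"

lemma J_sum: "J x t = (\<Sum>u\<in>Poly_Mapping.keys x. of_rat (Poly_Mapping.lookup x u) * iter f 0 (letters u) t)"
  by (simp add: J_def lin_def)

lemma J_add: "J (x + y) t = J x t + J y t"
  by (simp add: J_def lin_add)

lemma J_one: "J 1 t = 1"
  by (simp add: J_def lin_one iter_Nil)

lemma J_cont: "supp x \<subseteq> G \<Longrightarrow> continuous_on {0<..<1} (J x)"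
  unfolding J_sum[abs_def] by (intro continuous_intros iter_cont) auto

lemma J_measurable: "supp x \<subseteq> G \<Longrightarrow> J x \<in> borel_measurable borel"
  unfolding J_sum[abs_def]
  by (intro borel_measurable_sum borel_measurable_times borel_measurable_const iter_measurable start_words_set) auto

lemma norm_lin_bound:
  fixes h :: "complex list \<Rightarrow> real \<Rightarrow> complex" and m :: "real \<Rightarrow> real"
  assumes "\<And>u. u \<in> supp x \<Longrightarrow> \<exists>C\<ge>0. \<forall>s. 0 < s \<longrightarrow> s < 1 \<longrightarrow> norm (h u s) \<le> C * m s"
  shows "\<exists>C\<ge>0. \<forall>s. 0 < s \<longrightarrow> s < 1 \<longrightarrow> norm (\<Sum>u\<in>Poly_Mapping.keys x. of_rat (Poly_Mapping.lookup x u) * h (letters u) s) \<le> C * m s"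
proof -
  have "\<forall>u\<in>Poly_Mapping.keys x. \<exists>C\<ge>0. \<forall>s. 0 < s \<longrightarrow> s < 1 \<longrightarrow> norm (h (letters u) s) \<le> C * m s"
    using assms by blast
  from bchoice[OF this] obtain C where
    C: "\<And>u. u \<in> Poly_Mapping.keys x \<Longrightarrow> C u \<ge> 0"
       "\<And>u s. u \<in> Poly_Mapping.keys x \<Longrightarrow> 0 < s \<Longrightarrow> s < 1 \<Longrightarrow> norm (h (letters u) s) \<le> C u * m s" by blast
  let ?C = "\<Sum>u\<in>Poly_Mapping.keys x. norm (of_rat (Poly_Mapping.lookup x u) :: complex) * C u"
  show ?thesis
  proof (intro exI[of _ ?C] conjI allI impI)
    show "0 \<le> ?C" using C by (intro sum_nonneg) auto
    fix s :: real assume s: "0 < s" "s < 1"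
    have "norm (\<Sum>u\<in>Poly_Mapping.keys x. of_rat (Poly_Mapping.lookup x u) * h (letters u) s)
        \<le> (\<Sum>u\<in>Poly_Mapping.keys x. norm (of_rat (Poly_Mapping.lookup x u) :: complex) * (C u * m s))"
      by (rule sum_norm_le) (use C s in \<open>auto simp: norm_mult intro!: mult_left_mono\<close>)
    then show "norm (\<Sum>u\<in>Poly_Mapping.keys x. of_rat (Poly_Mapping.lookup x u) * h (letters u) s) \<le> ?C * m s"
      by (simp add: sum_distrib_right mult.assoc)
  qed
qed

lemma J_bound:
  assumes "supp x \<subseteq> G - {[]}"
  shows "\<exists>C\<ge>0. \<forall>s. 0 < s \<longrightarrow> s < 1 \<longrightarrow> norm (J x s) \<le> C * odds s powr (1/2)"
  unfolding J_sum
proof (rule norm_lin_bound)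
  fix u assume "u \<in> supp x"
  then have u: "u \<in> G" "u \<noteq> []" using assms by auto
  then obtain v a where "u = v @ [a]" using rev_exhaust by blast
  then show "\<exists>C\<ge>0. \<forall>s. 0 < s \<longrightarrow> s < 1 \<longrightarrow> norm (iter f 0 u s) \<le> C * odds s powr (1/2)"
    using iter_props(2) u by blast
qed

lemma J_tendsto_0:
  assumes "supp x \<subseteq> G - {[]}"
  shows "(J x \<longlongrightarrow> 0) (at_right 0)"
proof -
  obtain C where C: "\<And>s. 0 < s \<Longrightarrow> s < 1 \<Longrightarrow> norm (J x s) \<le> C * odds s powr (1/2)"
    using J_bound[OF assms] by blast
  have "((\<lambda>s. C * odds s powr (1/2)) \<longlongrightarrow> C * 0) (at_right 0)"
    by (intro tendsto_intros tendsto_odds_powr) auto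
  then have "((\<lambda>s. C * odds s powr (1/2)) \<longlongrightarrow> 0) (at_right 0)" by simp
  then show ?thesis
    by (rule Lim_null_comparison[rotated]) (use C in \<open>auto intro: eventually_mono[OF eventually_at_right_0[OF zero_less_one]]\<close>)
qed

text \<open>The letter \<open>a\<close> may be appended to all words of \<open>x\<close>. The empty
  word is the critical one: it requires that \<open>a\<close> is not the starting point.\<close>

definition ok :: "ncpoly \<Rightarrow> complex \<Rightarrow> bool" where
  "ok x a \<longleftrightarrow> (\<forall>u\<in>supp x. u @ [a] \<in> G)"

lemma ok_supp: "ok x a \<Longrightarrow> supp x \<subseteq> G"
  using start_words_snoc by (auto simp: ok_def)

lemma ok_supp_letter: "ok x a \<Longrightarrow> supp (x * letter a) \<subseteq> G - {[]}"
  using supp_times_letter[of x a] by (auto simp: ok_def)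

lemma ok_nonempty: "supp x \<subseteq> G - {[]} \<Longrightarrow> a \<in> A \<Longrightarrow> ok x a"
  by (force simp: ok_def start_words_snoc)

lemma form_J_bound:
  assumes "ok x a"
  shows "\<exists>C\<ge>0. \<forall>s. 0 < s \<longrightarrow> s < 1 \<longrightarrow> norm (f a s * J x s) \<le> C * (lam s * odds s powr (1/2))"
proof -
  have "f a s * J x s = (\<Sum>u\<in>Poly_Mapping.keys x. of_rat (Poly_Mapping.lookup x u) * (f a s * iter f 0 (letters u) s))" for s
    by (simp add: J_sum sum_distrib_left mult_ac)
  moreover have "\<exists>C\<ge>0. \<forall>s. 0 < s \<longrightarrow> s < 1 \<longrightarrow>
      norm (\<Sum>u\<in>Poly_Mapping.keys x. of_rat (Poly_Mapping.lookup x u) * (f a s * iter f 0 (letters u) s))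
        \<le> C * (lam s * odds s powr (1/2))"
    using assms unfolding ok_def by (intro norm_lin_bound[where h = "\<lambda>u s. f a s * iter f 0 u s"] form_iter_bound) auto
  ultimately show ?thesis by simp
qed

lemma J_letter:
  assumes "ok x a" "0 < t" "t < 1"
  shows "J (x * letter a) t = (LINT s|lborel. indicator {0<..<t} s *\<^sub>R (f a s * J x s))"
proof -
  have int: "integrable lborel (\<lambda>s. of_rat (Poly_Mapping.lookup x u) * (indicator {0<..<t} s *\<^sub>R (f a s * iter f 0 (letters u) s)))"
    if "u \<in> Poly_Mapping.keys x" for u
    by (intro integrable_mult_right impI iter_props(3) assms(2,3)) (use that assms(1) in \<open>auto simp: ok_def\<close>)
  have "J (x * letter a) t = (\<Sum>u\<in>Poly_Mapping.keys x. of_rat (Poly_Mapping.lookup x u) *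
      (LINT s|lborel. indicator {0<..<t} s *\<^sub>R (f a s * iter f 0 (letters u) s)))"
    by (simp add: J_def lin_times_letter) (simp add: lin_def iter_snoc)
  also have "\<dots> = (\<Sum>u\<in>Poly_Mapping.keys x. LINT s|lborel. of_rat (Poly_Mapping.lookup x u) * 
      (indicator {0<..<t} s *\<^sub>R (f a s * iter f 0 (letters u) s)))"
    by (simp only: integral_mult_right_zero)
  also have "\<dots> = (LINT s|lborel. (\<Sum>u\<in>Poly_Mapping.keys x. of_rat (Poly_Mapping.lookup x u) *
      (indicator {0<..<t} s *\<^sub>R (f a s * iter f 0 (letters u) s))))"
    using int by (subst Bochner_Integration.integral_sum) auto
  also have "\<dots> = (LINT s|lborel. indicator {0<..<t} s *\<^sub>R (f a s * J x s))"
    by (intro Bochner_Integration.integral_cong) (auto simp: J_sum sum_distrib_left scaleR_conv_of_real mult_ac)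
  finally show ?thesis .
qed

lemma J_letter_deriv:
  assumes "ok x a" "t \<in> {0<..<1} - S"
  shows "(J (x * letter a) has_vector_derivative f a t * J x t) (at t)"
proof -
  have e: "J (x * letter a) = (\<lambda>t. \<Sum>u\<in>Poly_Mapping.keys x. of_rat (Poly_Mapping.lookup x u) * iter f 0 (letters u @ [a]) t)"
    by (rule ext, simp add: J_def lin_times_letter) (simp add: lin_def)
  have "(J (x * letter a) has_vector_derivative
      (\<Sum>u\<in>Poly_Mapping.keys x. of_rat (Poly_Mapping.lookup x u) * (f a t * iter f 0 (letters u) t))) (at t)"
    unfolding e
    by (intro has_vector_derivative_sum has_vector_derivative_mult_right iter_props(1) assms(2))
       (use assms(1) in \<open>auto simp: ok_def\<close>)
  then show ?thesis by (simp add: J_sum sum_distrib_left mult_ac)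
qed

text \<open>Both sides vanish at 0 and have the same derivative: the shuffle recursion on last
  letters is the Leibniz rule for the product. The words on the right are shorter, so the induction
  hypothesis identifies their integrals.\<close>

lemma J_shuffle_words:
  "u \<in> G \<Longrightarrow> v \<in> G \<Longrightarrow> 0 < t \<Longrightarrow> t < 1 \<Longrightarrow> J (shuffle_words u v) t = iter f 0 u t * iter f 0 v t"
proof (induction "length u + length v" arbitrary: u v t rule: less_induct)
  case less
  show ?case
  proof (cases "u = [] \<or> v = []")
    case True
    then show ?thesis by (auto simp: shuffle_words_Nil J_def lin_wmono iter_Nil)
  next
    case False
    then obtain u' a v' b where u: "u = u' @ [a]" and v: "v = v' @ [b]" using rev_exhaust by metis
    have uG: "u' @ [a] \<in> G" "v' @ [b] \<in> G" using less.prems u v by auto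
    then have G': "u' \<in> G" "v' \<in> G" "a \<in> A" "b \<in> A" by (auto simp: start_words_snoc)
    have ok1: "ok (shuffle_words u v') b" and ok2: "ok (shuffle_words u' v) a"
      using supp_shuffle_words[of u A p v'] supp_shuffle_words[of u' A p v] G' less.prems u v
      by (auto intro!: ok_nonempty)
    have IH1: "J (shuffle_words u v') s = iter f 0 u s * iter f 0 v' s" if "s \<in> {0<..<1}" for s
      using less.hyps[of u v'] less.prems G' v that by auto
    have IH2: "J (shuffle_words u' v) s = iter f 0 u' s * iter f 0 v s" if "s \<in> {0<..<1}" for s
      using less.hyps[of u' v] less.prems G' u that by auto
    have split: "J (shuffle_words u v) = (\<lambda>s. J (shuffle_words u v' * letter b) s + J (shuffle_words u' v * letter a) s)"
      unfolding u v shuffle_words_snoc J_add[symmetric] ..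
    have tend: "(iter f 0 (w @ [c]) \<longlongrightarrow> 0) (at_right 0)" if "w @ [c] \<in> G" for w c
      using J_tendsto_0[of "wmono (w @ [c])"] that by (simp add: supp_wmono J_def[abs_def] lin_wmono)
    show ?thesis
    proof (rule primitive_unique[OF finite_S, where h = "\<lambda>s. f b s * (iter f 0 u s * iter f 0 v' s) + f a s * (iter f 0 u' s * iter f 0 v s)"])
      show "continuous_on {0<..<1} (J (shuffle_words u v))"
        unfolding split using ok1 ok2 ok_supp_letter by (intro continuous_on_add J_cont) blast+
      show "continuous_on {0<..<1} (\<lambda>t. iter f 0 u t * iter f 0 v t)"
        using less.prems by (intro continuous_on_mult iter_cont) auto
      show "(J (shuffle_words u v) has_vector_derivative f b s * (iter f 0 u s * iter f 0 v' s) + f a s * (iter f 0 u' s * iter f 0 v s)) (at s)"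
        if "s \<in> {0<..<1} - S" for s
        using has_vector_derivative_add[OF J_letter_deriv[OF ok1 that] J_letter_deriv[OF ok2 that]] IH1[of s] IH2[of s] that
        unfolding split by simp
      show "((\<lambda>t. iter f 0 u t * iter f 0 v t) has_vector_derivative f b s * (iter f 0 u s * iter f 0 v' s) + f a s * (iter f 0 u' s * iter f 0 v s)) (at s)"
        if "s \<in> {0<..<1} - S" for s
        using has_vector_derivative_mult[OF iter_props(1)[OF uG(1) that] iter_props(1)[OF uG(2) that]]
        unfolding u v by (simp add: mult_ac)
      have "((\<lambda>s. J (shuffle_words u v' * letter b) s + J (shuffle_words u' v * letter a) s) \<longlongrightarrow> 0 + 0) (at_right 0)"
        using ok1 ok2 ok_supp_letter by (intro tendsto_add J_tendsto_0) blast+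
      then show "(J (shuffle_words u v) \<longlongrightarrow> 0) (at_right 0)" unfolding split by simp
      have "((\<lambda>t. iter f 0 u t * iter f 0 v t) \<longlongrightarrow> 0 * 0) (at_right 0)"
        unfolding u v by (intro tendsto_mult tend uG)
      then show "((\<lambda>t. iter f 0 u t * iter f 0 v t) \<longlongrightarrow> 0) (at_right 0)" by simp
    qed (use less.prems in auto)
  qed
qed

lemma J_shuffle:
  assumes "supp x \<subseteq> G" "supp y \<subseteq> G" "0 < t" "t < 1"
  shows "J (x \<squnion> y) t = J x t * J y t"
  unfolding J_def using assms
  by (intro lin_shuffle J_shuffle_words[unfolded J_def]) auto

lemma J_foldr_shuffle:
  assumes "\<And>x. x \<in> set xs \<Longrightarrow> supp x \<subseteq> G" "0 < t" "t < 1"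
  shows "supp (foldr (\<squnion>) xs 1) \<subseteq> G" "J (foldr (\<squnion>) xs 1) t = prod_list (map (\<lambda>x. J x t) xs)"
proof -
  have "supp (foldr (\<squnion>) xs 1) \<subseteq> G \<and> J (foldr (\<squnion>) xs 1) t = prod_list (map (\<lambda>x. J x t) xs)"
    using assms(1)
  proof (induction xs)
    case (Cons x xs)
    then show ?case
      using J_shuffle[of x "foldr (\<squnion>) xs 1" t] supp_shuffle_start_words[of x A p "foldr (\<squnion>) xs 1"] assms by auto
  qed (simp add: J_one letters_zero start_words_Nil)
  then show "supp (foldr (\<squnion>) xs 1) \<subseteq> G" "J (foldr (\<squnion>) xs 1) t = prod_list (map (\<lambda>x. J x t) xs)" by auto
qed

end

section \<open>Kernel bounds and absolute convergence over a tree\<close>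

lemma power_over_fact_le_exp: "0 \<le> y \<Longrightarrow> y ^ m / fact m \<le> exp (y::real)"
proof -
  assume y: "0 \<le> y"
  have "(\<Sum>n\<in>{m}. y ^ n /\<^sub>R fact n) \<le> suminf (\<lambda>n. y ^ n /\<^sub>R fact n)"
    using y by (intro sum_le_suminf summable_exp_generic) auto
  then show ?thesis by (simp add: exp_def divide_inverse_commute)
qed

lemma odds_mono: "0 < s \<Longrightarrow> s \<le> t \<Longrightarrow> t < 1 \<Longrightarrow> odds s \<le> odds t"
  unfolding odds_def by (intro frac_le) auto

text \<open>Write \<open>d\<close> for the difference of the logarithms of \<open>odds\<close>. Then
  \<open>(C d)^m / m! = (C/b)^m (b d)^m / m!\<close>, and the last quotient is at most
  \<open>exp (b d)\<close>, which is the power \<open>b\<close> of the ratio. So logarithmic kernels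
  cost an arbitrarily small exponent.\<close>

lemma log_power_bound:
  fixes L :: "real \<Rightarrow> complex"
  assumes L: "\<And>s t. 0 < s \<Longrightarrow> s \<le> t \<Longrightarrow> t < 1 \<Longrightarrow> norm (L t - L s) \<le> C * (ln (odds t) - ln (odds s))"
    and C: "0 \<le> C" and b: "0 < b"
  shows "\<exists>c\<ge>0. \<forall>s t. 0 < s \<longrightarrow> s < t \<longrightarrow> t < 1 \<longrightarrow> norm ((L t - L s) ^ m / fact m) \<le> c * (odds t / odds s) powr b"
proof (intro exI[of _ "(C / b) ^ m"] conjI allI impI)
  fix s t :: real assume st: "0 < s" "s < t" "t < 1"
  let ?d = "ln (odds t) - ln (odds s)"
  have o: "0 < odds s" "0 < odds t" "odds s \<le> odds t" using st odds_pos odds_mono by auto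
  then have d: "0 \<le> ?d" by simp
  have "norm ((L t - L s) ^ m / fact m) \<le> (C * ?d) ^ m / fact m"
    using L[of s t] st by (auto simp: norm_divide norm_power intro!: divide_right_mono power_mono)
  also have "\<dots> = (C / b) ^ m * ((b * ?d) ^ m / fact m)"
    using b by (simp add: power_mult_distrib[symmetric])
  also have "\<dots> \<le> (C / b) ^ m * exp (b * ?d)"
    using b C d by (intro mult_left_mono power_over_fact_le_exp) auto
  also have "exp (b * ?d) = (odds t / odds s) powr b"
    using o by (simp add: powr_def ln_div)
  finally show "norm ((L t - L s) ^ m / fact m) \<le> (C / b) ^ m * (odds t / odds s) powr b" .
qed (use C b in auto)

text \<open>The singularity at 1 is \<open>(1 - s) powr (-1/2)\<close>, with primitive
  \<open>- 2 * (1 - s) powr (1/2)\<close>. This is why the exponents at the root are normalized to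
  1/2.\<close>

lemma nn_integral_odds_half: "(\<integral>\<^sup>+ s. ennreal (indicator {0<..<1} s * odds s powr (1/2)) \<partial>lborel) < \<infinity>"
proof -
  have "((\<lambda>s. (1 - s) powr (-1/2)) has_integral (- 2 * (1 - 1) powr (1/2)) - (- 2 * (1 - 0) powr (1/2))) {0..1::real}"
  proof (rule fundamental_theorem_of_calculus_interior_strong[OF finite.emptyI])
    show "continuous_on {0..1::real} (\<lambda>s. - 2 * (1 - s) powr (1/2))"
      by (intro continuous_intros continuous_on_powr') auto
    fix x :: real assume "x \<in> {0<..<1} - {}"
    then have "((\<lambda>s. - 2 * (1 - s) powr (1/2)) has_real_derivative (1 - x) powr (-1/2)) (at x)"
      by (auto intro!: derivative_eq_intros simp: powr_diff powr_minus field_simps)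
    then show "((\<lambda>s. - 2 * (1 - s) powr (1/2)) has_vector_derivative (1 - x) powr (-1/2)) (at x)"
      by (simp add: has_real_derivative_iff_has_vector_derivative)
  qed simp
  then have "((\<lambda>s. (1 - s) powr (-1/2)) has_integral 2) {0<..<1::real}"
    by (simp add: has_integral_Icc_iff_Ioo)
  then have I: "((\<lambda>s. indicator {0<..<1} s * (1 - s) powr (-1/2)) has_integral 2) (UNIV :: real set)"
    by (subst (asm) has_integral_restrict_UNIV[symmetric])
       (auto elim!: has_integral_eq[rotated] simp: indicator_def)
  have "(\<integral>\<^sup>+ s. ennreal (indicator {0<..<1} s * odds s powr (1/2)) \<partial>lborel)
     \<le> (\<integral>\<^sup>+ s. ennreal (indicator {0<..<1} s * (1 - s) powr (-1/2)) \<partial>lborel)"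
  proof (intro nn_integral_mono ennreal_leI)
    fix s :: real
    have "odds s powr (1/2) \<le> (1 - s) powr (-1/2)" if "0 < s" "s < 1"
    proof -
      have "odds s powr (1/2) \<le> (1 / (1 - s)) powr (1/2)"
        unfolding odds_def using that by (intro powr_mono2 divide_right_mono) auto
      also have "\<dots> = (1 - s) powr (-1/2)"
        using that by (simp add: powr_divide powr_minus field_simps)
      finally show ?thesis .
    qed
    then show "indicator {0<..<1} s * odds s powr (1/2) \<le> indicator {0<..<1} s * (1 - s) powr (-1/2)"
      by (auto simp: indicator_def)
  qed
  also have "\<dots> = ennreal 2"
    by (rule nn_integral_has_integral_lborel[OF _ _ I]) (auto simp: indicator_def)
  finally show ?thesis by (simp add: le_less_trans)
qed

lemma AE_not_01: "AE s in lborel. s \<noteq> (0::real) \<and> s \<noteq> 1"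
  using AE_lborel_singleton[of "0::real"] AE_lborel_singleton[of "1::real"] by eventually_elim auto

text \<open>Every vertex \<open>v\<close> gets an exponent \<open>b v > 0\<close>, additive over children, such that its inner
  integral is at most a multiple of \<open>odds t powr b v\<close>; at the root the exponents add up to \<open>1/2\<close>.\<close>

lemma tree_integral_by_recursion:
  fixes V :: "'v set" and K :: "'v \<Rightarrow> real \<Rightarrow> real \<Rightarrow> complex" and T :: "'v \<Rightarrow> real \<Rightarrow> complex"
    and W :: "real \<Rightarrow> complex" and rank :: "'v \<Rightarrow> nat" and r :: 'v and par :: "'v \<Rightarrow> 'v"
  defines "ch \<equiv> \<lambda>v. {c \<in> V - {r}. par c = v}"
  assumes fin: "finite V" and r: "r \<in> V"
    and par: "\<And>v. v \<in> V - {r} \<Longrightarrow> par v \<in> V \<and> rank (par v) < rank v"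
    and K: "\<And>v. v \<in> V - {r} \<Longrightarrow> (\<lambda>z. K v (fst z) (snd z)) \<in> borel_measurable (borel \<Otimes>\<^sub>M borel)"
    and W[measurable]: "W \<in> borel_measurable borel"
    and T: "\<And>v t. v \<in> V - {r} \<Longrightarrow> T v t = (LINT s|lborel. K v t s * (\<Prod>c\<in>ch v. T c s))"
    and Kb: "\<And>v b. v \<in> V - {r} \<Longrightarrow> 0 < b \<Longrightarrow> \<exists>c\<ge>0. \<forall>t s. 0 < t \<longrightarrow> t < 1 \<longrightarrow> s \<noteq> 0 \<longrightarrow>
        norm (K v t s) \<le> c * (indicator {0<..<t} s * ((odds t / odds s) powr b * lam s))"
    and Kl: "\<And>v b. v \<in> V - {r} \<Longrightarrow> ch v = {} \<Longrightarrow> 0 < b \<Longrightarrow> \<exists>c\<ge>0. \<forall>t s. 0 < t \<longrightarrow> t < 1 \<longrightarrow> s \<noteq> 0 \<longrightarrow>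
        norm (K v t s) \<le> c * (indicator {0<..<t} s * ((odds t / odds s) powr b * (1 / (1 - s))))"
    and Wb: "\<exists>c\<ge>0. \<forall>s. s \<noteq> 0 \<longrightarrow> s \<noteq> 1 \<longrightarrow> norm (W s) \<le> c * indicator {0<..<1} s"
    and chr: "ch r \<noteq> {}"
  shows "integrable (Pi\<^sub>M V (\<lambda>_. lborel)) (\<lambda>x. W (x r) * (\<Prod>v\<in>V - {r}. K v (x (par v)) (x v)))"
    and "(LINT x|Pi\<^sub>M V (\<lambda>_. lborel). W (x r) * (\<Prod>v\<in>V - {r}. K v (x (par v)) (x v)))
       = (LINT s|lborel. W s * (\<Prod>c\<in>ch r. T c s))"
proof -
  have ch: "ch v \<subseteq> V - {r}" "finite (ch v)" for v
    using fin by (auto simp: ch_def)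
  define N where "N = Max (rank ` V)"
  have N: "rank v \<le> N" if "v \<in> V" for v
    unfolding N_def using fin that by auto
  define R where "R = {(c, v). c \<in> ch v}"
  have wfR: "wf R"
  proof (rule wf_subset[OF wf_measure[of "\<lambda>v. N - rank v"]])
    show "R \<subseteq> Wellfounded.measure (\<lambda>v. N - rank v)"
    proof
      fix z assume "z \<in> R"
      then obtain c v where z: "z = (c, v)" "c \<in> V - {r}" "par c = v" by (auto simp: R_def ch_def)
      then have "rank v < rank c" "rank c \<le> N" using par N by auto
      then show "z \<in> Wellfounded.measure (\<lambda>v. N - rank v)" using z by auto
    qed
  qed
  \<comment> \<open>\<open>n v\<close> counts the leaves below \<open>v\<close>, which is positive
    and additive. The exponents are \<open>b v = n v / (2 n r)\<close>, so those of the children of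
    the root add up to 1/2.\<close>
  have "\<exists>n. \<forall>v. n v = (if ch v = {} then 1 else (\<Sum>c\<in>ch v. n c) :: real)"
  proof (rule dependent_wf_choice[OF wfR, of "\<lambda>n v m. m = (if ch v = {} then 1 else (\<Sum>c\<in>ch v. n c) :: real)"])
    fix n n' :: "'v \<Rightarrow> real" and v m assume "\<And>z. (z, v) \<in> R \<Longrightarrow> n z = n' z"
    then have "(\<Sum>c\<in>ch v. n c) = (\<Sum>c\<in>ch v. n' c)" by (intro sum.cong) (auto simp: R_def)
    then show "(m = (if ch v = {} then 1 else (\<Sum>c\<in>ch v. n c))) = (m = (if ch v = {} then 1 else (\<Sum>c\<in>ch v. n' c)))" by simp
  qed blast
  then obtain n :: "'v \<Rightarrow> real" where n: "\<And>v. n v = (if ch v = {} then 1 else (\<Sum>c\<in>ch v. n c))" by blast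
  have n1: "1 \<le> n v" for v
    using wfR
  proof (induction v rule: wf_induct_rule)
    case (less v)
    show ?case
    proof (cases "ch v = {}")
      case False
      then obtain c where c: "c \<in> ch v" by blast
      have "1 \<le> n c" using less c by (auto simp: R_def)
      also have "n c \<le> (\<Sum>c\<in>ch v. n c)"
        using less c ch(2) by (intro member_le_sum) (auto simp: R_def intro: order_trans[OF zero_le_one])
      finally show ?thesis using n[of v] False by simp
    qed (simp add: n[of v])
  qed
  define b where "b = (\<lambda>v. n v / (2 * n r))"
  have nr: "n r = (\<Sum>c\<in>ch r. n c)" using n[of r] chr by simp
  have b0: "0 < b v" for v using n1[of v] n1[of r] by (simp add: b_def)
  have b_leaf: "b v \<le> 1" if "ch v = {}" for v using n[of v] n1[of r] that by (simp add: b_def)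
  have b_node: "b v = (\<Sum>c\<in>ch v. b c)" if "ch v \<noteq> {}" for v
    using n[of v] that by (simp add: b_def sum_divide_distrib)
  have b_root: "(\<Sum>c\<in>ch r. b c) = 1/2" using nr n1[of r] by (simp add: b_def sum_divide_distrib[symmetric])
  \<comment> \<open>The kernel is bounded with exponent \<open>b v / 2\<close>. From the power
    \<open>b v\<close> of \<open>odds s\<close> this leaves \<open>b v / 2\<close>, which remains
    positive and reproduces itself under integration; together with the factor
    \<open>odds t powr (b v / 2)\<close> of the kernel the full exponent \<open>b v\<close> is
    restored.\<close>
  have step: "\<exists>c\<ge>0. v \<in> V - {r} \<longrightarrow> (\<forall>t. 0 < t \<longrightarrow> t < 1 \<longrightarrow>
      (\<integral>\<^sup>+ s. ennreal (norm (K v t s)) * ennreal (D * (\<Prod>c\<in>ch v. odds s powr b c)) \<partial>lborel) \<le> ennreal (c * odds t powr b v))"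
    if D: "D \<ge> 0" for v D
  proof (cases "v \<in> V - {r}")
    case True
    have "\<exists>c\<ge>0. \<forall>t s. 0 < t \<longrightarrow> t < 1 \<longrightarrow> s \<noteq> 0 \<longrightarrow>
        norm (K v t s) * (\<Prod>c\<in>ch v. odds s powr b c) \<le> c * (indicator {0<..<t} s * (odds t powr (b v / 2) * (lam s * odds s powr (b v / 2))))"
    proof (cases "ch v = {}")
      case leaf: True
      obtain c where c: "c \<ge> 0" "\<And>t s. 0 < t \<Longrightarrow> t < 1 \<Longrightarrow> s \<noteq> 0 \<Longrightarrow>
        norm (K v t s) \<le> c * (indicator {0<..<t} s * ((odds t / odds s) powr (b v / 2) * (1 / (1 - s))))"
        using Kl[OF True leaf, of "b v / 2"] b0[of v] by auto
      show ?thesis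
      proof (intro exI[of _ c] conjI c(1) allI impI)
        fix t s :: real assume ts: "0 < t" "t < 1" "s \<noteq> 0"
        have "norm (K v t s) \<le> c * (indicator {0<..<t} s * ((odds t / odds s) powr (b v / 2) * (1 / (1 - s))))"
          by (rule c(2)[OF ts])
        also have "\<dots> \<le> c * (indicator {0<..<t} s * (odds t powr (b v / 2) * (lam s * odds s powr (b v / 2))))"
        proof (cases "s \<in> {0<..<t}")
          case s: True
          have o: "0 < odds s" "0 < odds t" using s ts odds_pos by auto
          have "(odds t / odds s) powr (b v / 2) * (1 / (1 - s)) \<le> (odds t / odds s) powr (b v / 2) * (lam s * odds s powr b v)"
            using s ts b0[of v] b_leaf[OF leaf] by (intro mult_left_mono le_odds_powr) auto
          also have "\<dots> = odds t powr (b v / 2) * (lam s * (odds s powr (b v) / odds s powr (b v / 2)))"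
            using o by (simp add: powr_divide mult_ac)
          also have "odds s powr (b v) / odds s powr (b v / 2) = odds s powr (b v / 2)"
            by (simp flip: powr_diff)
          finally show ?thesis using c(1) s by (intro mult_left_mono) auto
        qed simp
        finally show "norm (K v t s) * (\<Prod>c\<in>ch v. odds s powr b c) \<le> c * (indicator {0<..<t} s * (odds t powr (b v / 2) * (lam s * odds s powr (b v / 2))))"
          using leaf by simp
      qed
    next
      case node: False
      obtain c where c: "c \<ge> 0" "\<And>t s. 0 < t \<Longrightarrow> t < 1 \<Longrightarrow> s \<noteq> 0 \<Longrightarrow>
        norm (K v t s) \<le> c * (indicator {0<..<t} s * ((odds t / odds s) powr (b v / 2) * lam s))"
        using Kb[OF True, of "b v / 2"] b0[of v] by auto
      show ?thesis
      proof (intro exI[of _ c] conjI c(1) allI impI)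
        fix t s :: real assume ts: "0 < t" "t < 1" "s \<noteq> 0"
        have "norm (K v t s) * (\<Prod>c\<in>ch v. odds s powr b c) \<le> c * (indicator {0<..<t} s * ((odds t / odds s) powr (b v / 2) * lam s)) * (\<Prod>c\<in>ch v. odds s powr b c)"
          using c(2)[OF ts] by (intro mult_right_mono prod_nonneg) auto
        also have "\<dots> = c * (indicator {0<..<t} s * (odds t powr (b v / 2) * (lam s * odds s powr (b v / 2))))"
        proof (cases "s \<in> {0<..<t}")
          case s: True
          have o: "0 < odds s" "0 < odds t" using s ts odds_pos by auto
          have "(\<Prod>c\<in>ch v. odds s powr b c) = odds s powr b v"
            using o ch(2) by (simp add: b_node[OF node] powr_sum)
          moreover have "odds s powr (b v) / odds s powr (b v / 2) = odds s powr (b v / 2)"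
            by (simp flip: powr_diff)
          ultimately show ?thesis using o by (simp add: powr_divide field_simps)
        qed simp
        finally show "norm (K v t s) * (\<Prod>c\<in>ch v. odds s powr b c) \<le> c * (indicator {0<..<t} s * (odds t powr (b v / 2) * (lam s * odds s powr (b v / 2))))" .
      qed
    qed
    then obtain c where c: "c \<ge> 0" "\<And>t s. 0 < t \<Longrightarrow> t < 1 \<Longrightarrow> s \<noteq> 0 \<Longrightarrow>
        norm (K v t s) * (\<Prod>c\<in>ch v. odds s powr b c) \<le> c * (indicator {0<..<t} s * (odds t powr (b v / 2) * (lam s * odds s powr (b v / 2))))"
      by blast
    show ?thesis
    proof (intro exI[of _ "D * c * 2 / b v"] conjI allI impI)
      show "0 \<le> D * c * 2 / b v" using D c(1) b0[of v] by auto
      fix t :: real assume t: "0 < t" "t < 1"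
      have "(\<integral>\<^sup>+ s. ennreal (norm (K v t s)) * ennreal (D * (\<Prod>c\<in>ch v. odds s powr b c)) \<partial>lborel)
          \<le> (\<integral>\<^sup>+ s. ennreal (D * c * odds t powr (b v / 2)) * ennreal (indicator {0<..<t} s * (lam s * odds s powr (b v / 2))) \<partial>lborel)"
      proof (rule nn_integral_mono_AE)
        show "AE s in lborel. ennreal (norm (K v t s)) * ennreal (D * (\<Prod>c\<in>ch v. odds s powr b c))
          \<le> ennreal (D * c * odds t powr (b v / 2)) * ennreal (indicator {0<..<t} s * (lam s * odds s powr (b v / 2)))"
          using AE_not_01
        proof eventually_elim
          case (elim s)
          have "norm (K v t s) * (D * (\<Prod>c\<in>ch v. odds s powr b c)) = D * (norm (K v t s) * (\<Prod>c\<in>ch v. odds s powr b c))"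
            by (simp add: mult_ac)
          also have "\<dots> \<le> D * (c * (indicator {0<..<t} s * (odds t powr (b v / 2) * (lam s * odds s powr (b v / 2)))))"
            using c(2)[of t s] t elim D by (intro mult_left_mono) auto
          also have "\<dots> = (D * c * odds t powr (b v / 2)) * (indicator {0<..<t} s * (lam s * odds s powr (b v / 2)))"
            by (simp add: mult_ac)
          finally have "ennreal (norm (K v t s) * (D * (\<Prod>c\<in>ch v. odds s powr b c))) \<le> ennreal ((D * c * odds t powr (b v / 2)) * (indicator {0<..<t} s * (lam s * odds s powr (b v / 2))))"
            by (rule ennreal_leI)
          then show ?case
            using D c(1) by (subst (asm) ennreal_mult', simp, subst (asm) ennreal_mult') auto
        qed
      qed
      also have "\<dots> = ennreal (D * c * odds t powr (b v / 2)) * ennreal (odds t powr (b v / 2) / (b v / 2))"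
        using b0[of v] t by (subst nn_integral_cmult) (auto simp: nn_integral_lam_odds_powr)
      also have "\<dots> = ennreal ((D * c * odds t powr (b v / 2)) * (odds t powr (b v / 2) / (b v / 2)))"
        using D c(1) by (intro ennreal_mult'[symmetric]) auto
      also have "(D * c * odds t powr (b v / 2)) * (odds t powr (b v / 2) / (b v / 2)) = D * c * 2 / b v * (odds t powr (b v / 2) * odds t powr (b v / 2))"
        by (simp add: field_simps)
      also have "odds t powr (b v / 2) * odds t powr (b v / 2) = odds t powr b v"
        by (simp flip: powr_add)
      finally show "(\<integral>\<^sup>+ s. ennreal (norm (K v t s)) * ennreal (D * (\<Prod>c\<in>ch v. odds s powr b c)) \<partial>lborel)
         \<le> ennreal (D * c * 2 / b v * odds t powr b v)" .
    qed
  qed (auto intro: exI[of _ 0])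
  \<comment> \<open>The constants \<open>C v\<close> are chosen by recursion from the leaves. The
    absolute value makes the choice possible for arbitrary \<open>C\<close>; it disappears once
    \<open>C\<close> is known to be nonnegative.\<close>
  let ?P = "\<lambda>(C :: 'v \<Rightarrow> real) v c. c \<ge> 0 \<and> (v \<in> V - {r} \<longrightarrow> (\<forall>t. 0 < t \<longrightarrow> t < 1 \<longrightarrow>
      (\<integral>\<^sup>+ s. ennreal (norm (K v t s)) * ennreal (abs (\<Prod>c\<in>ch v. C c) * (\<Prod>c\<in>ch v. odds s powr b c)) \<partial>lborel) \<le> ennreal (c * odds t powr b v)))"
  have "\<exists>C. \<forall>v. ?P C v (C v)"
  proof (rule dependent_wf_choice[OF wfR, of ?P])
    fix C C' :: "'v \<Rightarrow> real" and v c assume "\<And>z. (z, v) \<in> R \<Longrightarrow> C z = C' z"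
    then have "(\<Prod>c\<in>ch v. C c) = (\<Prod>c\<in>ch v. C' c)" by (intro prod.cong) (auto simp: R_def)
    then show "?P C v c = ?P C' v c" by simp
  next
    fix v and C :: "'v \<Rightarrow> real"
    show "\<exists>c. ?P C v c" using step[of "abs (\<Prod>c\<in>ch v. C c)" v] by auto
  qed
  then obtain C where C0: "\<And>v. C v \<ge> 0" and C: "\<And>v t. v \<in> V - {r} \<Longrightarrow> 0 < t \<Longrightarrow> t < 1 \<Longrightarrow>
      (\<integral>\<^sup>+ s. ennreal (norm (K v t s)) * ennreal (abs (\<Prod>c\<in>ch v. C c) * (\<Prod>c\<in>ch v. odds s powr b c)) \<partial>lborel) \<le> ennreal (C v * odds t powr b v)"
    by blast
  \<comment> \<open>The Fubini lemma wants a bound for all real \<open>t\<close>; the value infinity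
    makes it trivial outside (0, 1). For \<open>t\<close> in (0, 1) these infinite values do no
    harm, since by \<open>Kzero\<close> the kernel vanishes unless \<open>s\<close> lies in (0, t),
    up to the null set \<open>s = 0\<close>.\<close>
  define B where "B = (\<lambda>v t. if 0 < t \<and> t < 1 then ennreal (C v * odds t powr b v) else \<infinity>)"
  have Bm: "B v \<in> borel_measurable borel" for v
    unfolding B_def by measurable
  have prodB: "(\<Prod>c\<in>ch v. B c s) = ennreal (abs (\<Prod>c\<in>ch v. C c) * (\<Prod>c\<in>ch v. odds s powr b c))" if "0 < s" "s < 1" for v s
    using that C0 by (simp add: B_def prod_ennreal prod.distrib prod_nonneg abs_of_nonneg)
  have Kzero: "K v t s = 0" if kz: "v \<in> V - {r}" "0 < t" "t < 1" "s \<noteq> 0" "s \<notin> {0<..<t}" for v t s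
  proof -
    obtain c where "norm (K v t s) \<le> c * (indicator {0<..<t} s * ((odds t / odds s) powr 1 * lam s))"
      using Kb[OF kz(1), of 1] kz(2-4) by (metis zero_less_one)
    also have "\<dots> = 0" unfolding indicator_def using kz(5) by (simp only: if_False of_bool_def mult_zero_left mult_zero_right)
    finally show ?thesis by simp
  qed
  have B: "(\<integral>\<^sup>+ s. ennreal (norm (K v t s)) * (\<Prod>c\<in>ch v. B c s) \<partial>lborel) \<le> B v t" if v: "v \<in> V - {r}" for v t
  proof (cases "0 < t \<and> t < 1")
    case True
    have "(\<integral>\<^sup>+ s. ennreal (norm (K v t s)) * (\<Prod>c\<in>ch v. B c s) \<partial>lborel)
       = (\<integral>\<^sup>+ s. ennreal (norm (K v t s)) * ennreal (abs (\<Prod>c\<in>ch v. C c) * (\<Prod>c\<in>ch v. odds s powr b c)) \<partial>lborel)"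
    proof (rule nn_integral_cong_AE)
      show "AE s in lborel. ennreal (norm (K v t s)) * (\<Prod>c\<in>ch v. B c s) = ennreal (norm (K v t s)) * ennreal (abs (\<Prod>c\<in>ch v. C c) * (\<Prod>c\<in>ch v. odds s powr b c))"
        using AE_not_01
      proof eventually_elim
        case (elim s)
        then show ?case using prodB[of s v] Kzero[OF v, of t s] True by (cases "s \<in> {0<..<t}") auto
      qed
    qed
    also have "\<dots> \<le> B v t" using C[OF v] True by (simp add: B_def)
    finally show ?thesis .
  next
    case False
    then have "B v t = \<infinity>" by (simp add: B_def)
    then show ?thesis by simp
  qed
  have WB: "(\<integral>\<^sup>+ s. ennreal (norm (W s)) * (\<Prod>c\<in>ch r. B c s) \<partial>lborel) < \<infinity>"
  proof -
    obtain c where c: "c \<ge> 0" "\<And>s. s \<noteq> 0 \<Longrightarrow> s \<noteq> 1 \<Longrightarrow> norm (W s) \<le> c * indicator {0<..<1} s" using Wb by blast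
    let ?D = "abs (\<Prod>c\<in>ch r. C c)"
    have "(\<integral>\<^sup>+ s. ennreal (norm (W s)) * (\<Prod>c\<in>ch r. B c s) \<partial>lborel)
      \<le> (\<integral>\<^sup>+ s. ennreal (c * ?D) * ennreal (indicator {0<..<1} s * odds s powr (1/2)) \<partial>lborel)"
    proof (rule nn_integral_mono_AE)
      show "AE s in lborel. ennreal (norm (W s)) * (\<Prod>c\<in>ch r. B c s) \<le> ennreal (c * ?D) * ennreal (indicator {0<..<1} s * odds s powr (1/2))"
        using AE_not_01
      proof eventually_elim
        case (elim s)
        show ?case
        proof (cases "s \<in> {0<..<1}")
          case True
          then have "odds s > 0" using odds_pos by auto
          then have "(\<Prod>c\<in>ch r. odds s powr b c) = odds s powr (1/2)"
            using ch(2) by (simp add: b_root powr_sum[symmetric])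
          then have "ennreal (norm (W s)) * (\<Prod>c\<in>ch r. B c s) = ennreal (norm (W s) * (?D * odds s powr (1/2)))"
            using True prodB[of s r] by (simp add: ennreal_mult')
          also have "\<dots> \<le> ennreal (c * (?D * odds s powr (1/2)))"
            using c(2)[of s] elim True by (intro ennreal_leI mult_right_mono) auto
          finally show ?thesis using True c(1) by (simp add: ennreal_mult' mult.assoc)
        next
          case False
          then have "norm (W s) \<le> 0" using c(2)[of s] elim by (metis indicator_simps(2) mult_zero_right)
          then show ?thesis by simp
        qed
      qed
    qed
    also have "\<dots> = ennreal (c * ?D) * (\<integral>\<^sup>+ s. ennreal (indicator {0<..<1} s * odds s powr (1/2)) \<partial>lborel)"
      by (rule nn_integral_cmult) measurable
    also have "\<dots> < \<infinity>" using nn_integral_odds_half by (simp add: ennreal_mult_less_top)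
    finally show ?thesis .
  qed
  note F = rooted_tree_Fubini[where V=V and r=r and par=par and rank=rank and K=K and W=W and T=T and B=B,
      OF fin r par K W T[unfolded ch_def] Bm B[unfolded ch_def] WB[unfolded ch_def]]
  show "integrable (Pi\<^sub>M V (\<lambda>_. lborel)) (\<lambda>x. W (x r) * (\<Prod>v\<in>V - {r}. K v (x (par v)) (x v)))"
    and "(LINT x|Pi\<^sub>M V (\<lambda>_. lborel). W (x r) * (\<Prod>v\<in>V - {r}. K v (x (par v)) (x v)))
       = (LINT s|lborel. W s * (\<Prod>c\<in>ch r. T c s))"
    using F unfolding ch_def by blast+
qed

section \<open>Logarithmic kernels and composition of paths\<close>

context path_forms
begin

text \<open>Repeated integration of \<open>f\<^sub>0 dt = dL\<close>.  With \<open>h\<^sub>j\<close> the \<open>j\<close>-fold integral, the function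
  \<open>s \<mapsto> \<Sum>\<^sub>j (L t - L s)\<^sup>j / j! h\<^bsub>m - j\<^esub> s\<close> has a telescoping derivative.\<close>

lemma J_letter_power:
  assumes ok: "ok x a" and a: "a \<in> A" and c: "c \<in> A"
    and L: "continuous_on {0<..<1} L" "\<And>s. s \<in> {0<..<1} - S \<Longrightarrow> (L has_vector_derivative f c s) (at s)"
    and Lb: "\<And>s t. 0 < s \<Longrightarrow> s \<le> t \<Longrightarrow> t < 1 \<Longrightarrow> norm (L t - L s) \<le> C * (ln (odds t) - ln (odds s))"
    and C: "0 \<le> C" and t: "0 < t" "t < 1"
  shows "J (x * letter a * letter c ^ m) t =
     (LINT s|lborel. indicator {0<..<t} s *\<^sub>R ((L t - L s) ^ m / fact m * (f a s * J x s)))"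
proof -
  define h where "h = (\<lambda>j. J (x * letter a * letter c ^ j))"
  have s0: "supp (x * letter a * letter c ^ j) \<subseteq> G - {[]}" for j
  proof (induction j)
    case 0
    show ?case using ok_supp_letter[OF ok] by simp
  next
    case (Suc j)
    show ?case using ok_supp_letter[OF ok_nonempty[OF Suc c]] by (simp only: power_Suc2 mult.assoc)
  qed
  have hc: "continuous_on {0<..<1} (h j)" for j
    unfolding h_def using s0 by (intro J_cont) blast
  have h0: "(h 0 has_vector_derivative f a s * J x s) (at s)" if "s \<in> {0<..<1} - S" for s
    using J_letter_deriv[OF ok that] by (simp add: h_def)
  have hS: "(h (Suc j) has_vector_derivative f c s * h j s) (at s)" if "s \<in> {0<..<1} - S" for s j
    using J_letter_deriv[OF ok_nonempty[OF s0 c] that, of j] by (simp only: h_def power_Suc2 mult.assoc)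
  define \<Phi> where "\<Phi> = (\<lambda>s. \<Sum>j\<le>m. (L t - L s) ^ j / fact j * h (m - j) s)"
  \<comment> \<open>\<open>- D s j\<close> is the part of the derivative of the \<open>j\<close>-th
    summand that comes from the kernel. The part that comes from \<open>h\<close> is
    \<open>D s (Suc j)\<close>, except for \<open>j = m\<close>, where it is the integrand that is
    wanted.\<close>
  define D where "D = (\<lambda>s j. (if j = 0 then 0 else f c s * ((L t - L s) ^ (j - 1) / fact (j - 1) * h (m - j) s)))"
  have d\<Phi>: "(\<Phi> has_vector_derivative (L t - L s) ^ m / fact m * (f a s * J x s)) (at s)" if s: "s \<in> {0<..<t} - S" for s
  proof -
    have s1: "s \<in> {0<..<1} - S" using s t by auto
    have dterm: "((\<lambda>s. (L t - L s) ^ j / fact j * h (m - j) s) has_vector_derivative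
        (if j = m then (L t - L s) ^ m / fact m * (f a s * J x s) else D s (Suc j)) - D s j) (at s)" if j: "j \<le> m" for j
    proof -
      have d1: "((\<lambda>s. L t - L s) has_vector_derivative - f c s) (at s)"
        using has_vector_derivative_diff[OF has_vector_derivative_const[of "L t"] L(2)[OF s1]]
        by (simp only: diff_0)
      have "((\<lambda>z. z ^ j / fact j) has_field_derivative of_nat j * (L t - L s) ^ (j - 1) / fact j) (at (L t - L s))"
        using DERIV_cdivide[OF DERIV_power[OF DERIV_ident[of "at (L t - L s)"], of j], of "fact j"] by simp
      moreover have "of_nat j * (L t - L s) ^ (j - 1) / fact j = (if j = 0 then 0 else (L t - L s) ^ (j - 1) / fact (j - 1))"
        by (cases j) (simp_all add: field_simps del: of_nat_Suc)
      ultimately have "((\<lambda>z. z ^ j / fact j) has_field_derivative (if j = 0 then 0 else (L t - L s) ^ (j - 1) / fact (j - 1))) (at (L t - L s))"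
        by simp
      from field_vector_diff_chain_at[OF d1 this]
      have d2: "((\<lambda>s. (L t - L s) ^ j / fact j) has_vector_derivative - f c s * (if j = 0 then 0 else (L t - L s) ^ (j - 1) / fact (j - 1))) (at s)"
        by (simp add: o_def)
      have d3: "(h (m - j) has_vector_derivative (if j = m then f a s * J x s else f c s * h (m - Suc j) s)) (at s)"
      proof (cases "j = m")
        case False
        then have "m - j = Suc (m - Suc j)" using j by simp
        then show ?thesis using hS[OF s1, of "m - Suc j"] False by simp
      qed (use h0[OF s1] in simp)
      show ?thesis
        using has_vector_derivative_mult[OF d2 d3]
        by (rule has_vector_derivative_eq_rhs) (auto simp: D_def algebra_simps)
    qed
    have "(\<Phi> has_vector_derivative (\<Sum>j\<le>m. (if j = m then (L t - L s) ^ m / fact m * (f a s * J x s) else D s (Suc j)) - D s j)) (at s)"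
      unfolding \<Phi>_def by (intro has_vector_derivative_sum dterm) simp
    moreover have "(\<Sum>j\<le>m. (if j = m then z else D s (Suc j)) - D s j) = z" for z
    proof -
      have "(\<Sum>j\<le>m. (if j = m then z else D s (Suc j)) - D s j) = (z - D s m) + (\<Sum>j<m. D s (Suc j) - D s j)"
        by (subst lessThan_Suc_atMost[symmetric]) (simp add: add.commute)
      also have "(\<Sum>j<m. D s (Suc j) - D s j) = D s m - D s 0"
        by (rule sum_lessThan_telescope)
      finally show ?thesis by (simp add: D_def)
    qed
    ultimately show ?thesis by simp
  qed
  \<comment> \<open>The extension of \<open>\<Phi>\<close> by its limit 0, to which the fundamental
    theorem applies on the closed interval. At \<open>s = t\<close> all powers of
    \<open>L t - L s\<close> vanish except the one with exponent 0, so
    \<open>\<Psi> t = h m t\<close>.\<close>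
  define \<Psi> where "\<Psi> = (\<lambda>s. if s = 0 then 0 else \<Phi> s)"
  have \<Phi>0: "(\<Phi> \<longlongrightarrow> 0) (at_right 0)"
  proof -
    have "((\<lambda>s. (L t - L s) ^ j / fact j * h (m - j) s) \<longlongrightarrow> 0) (at_right 0)" for j
    proof -
      \<comment> \<open>The kernel is given the exponent 1/4, below the 1/2 of \<open>h\<close>, so
        that a positive power of \<open>odds s\<close> is left to force the limit 0.\<close>
      obtain k where k: "\<And>s t. 0 < s \<Longrightarrow> s < t \<Longrightarrow> t < 1 \<Longrightarrow> norm ((L t - L s) ^ j / fact j) \<le> k * (odds t / odds s) powr (1/4)"
        using log_power_bound[of L C "1/4" j] Lb C by (metis zero_less_divide_1_iff zero_less_numeral)
      obtain B where B: "\<And>s. 0 < s \<Longrightarrow> s < 1 \<Longrightarrow> norm (h (m - j) s) \<le> B * odds s powr (1/2)"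
        using J_bound[OF s0[of "m - j"]] by (auto simp: h_def)
      have "((\<lambda>s. k * B * odds t powr (1/4) * odds s powr (1/4)) \<longlongrightarrow> k * B * odds t powr (1/4) * 0) (at_right 0)"
        by (intro tendsto_intros tendsto_odds_powr) auto
      then have "((\<lambda>s. k * B * odds t powr (1/4) * odds s powr (1/4)) \<longlongrightarrow> 0) (at_right 0)" by simp
      then show ?thesis
      proof (rule Lim_null_comparison[rotated])
        show "\<forall>\<^sub>F s in at_right 0. norm ((L t - L s) ^ j / fact j * h (m - j) s) \<le> k * B * odds t powr (1/4) * odds s powr (1/4)"
          using eventually_at_right_0[OF t(1)]
        proof eventually_elim
          case (elim s)
          have o: "0 < odds s" "0 < odds t" using elim t odds_pos by auto
          have "0 \<le> norm ((L t - L s) ^ j / fact j)" by simp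
          also have "\<dots> \<le> k * (odds t / odds s) powr (1/4)" using k elim t by auto
          finally have k0: "0 \<le> k * (odds t / odds s) powr (1/4)" .
          have "norm ((L t - L s) ^ j / fact j * h (m - j) s) \<le> (k * (odds t / odds s) powr (1/4)) * (B * odds s powr (1/2))"
            unfolding norm_mult using k[of s t] B[of s] elim t k0 by (intro mult_mono) auto
          also have "\<dots> = k * B * odds t powr (1/4) * (odds s powr (1/2) / odds s powr (1/4))"
            using o by (simp add: powr_divide)
          also have "odds s powr (1/2) / odds s powr (1/4) = odds s powr (1/4)"
            by (simp flip: powr_diff)
          finally show ?case .
        qed
      qed
    qed
    then have "(\<Phi> \<longlongrightarrow> (\<Sum>j\<le>m. 0)) (at_right 0)" unfolding \<Phi>_def by (intro tendsto_sum) auto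
    then show ?thesis by simp
  qed
  have c\<Psi>: "continuous_on {0..t} \<Psi>"
    unfolding continuous_on_eq_continuous_within
  proof
    fix s assume s: "s \<in> {0..t}"
    show "continuous (at s within {0..t}) \<Psi>"
    proof (cases "s = 0")
      case True
      have "(\<Psi> \<longlongrightarrow> 0) (at_right 0)"
        using \<Phi>0 by (rule Lim_transform_eventually) (auto simp: \<Psi>_def eventually_at_filter)
      then show ?thesis using True t by (simp add: continuous_within at_within_Icc_at_right \<Psi>_def)
    next
      case False
      have "continuous_on {0<..<1} \<Phi>"
        unfolding \<Phi>_def by (intro continuous_intros L(1) hc) auto
      then have "isCont \<Phi> s" using s False t by (auto simp: continuous_on_eq_continuous_at)
      moreover have "\<forall>\<^sub>F x in nhds s. \<Phi> x = \<Psi> x"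
        by (rule eventually_mono[OF eventually_nhds_in_open[of "{0<..}" s]]) (use s False in \<open>auto simp: \<Psi>_def\<close>)
      ultimately have "isCont \<Psi> s" using isCont_cong by blast
      then show ?thesis by (rule continuous_at_imp_continuous_at_within)
    qed
  qed
  let ?g = "\<lambda>s. (L t - L s) ^ m / fact m * (f a s * J x s)"
  have "(?g has_integral \<Psi> t - \<Psi> 0) {0..t}"
  proof (rule fundamental_theorem_of_calculus_interior_strong[OF finite_S _ _ c\<Psi>])
    fix s assume s: "s \<in> {0<..<t} - S"
    show "(\<Psi> has_vector_derivative ?g s) (at s)"
      by (rule has_vector_derivative_transform_within_open[OF d\<Phi>[OF s], of "{0<..}"]) (use s in \<open>auto simp: \<Psi>_def\<close>)
  qed (use t in simp)
  moreover have "\<Psi> t = h m t"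
  proof -
    have "\<Phi> t = (\<Sum>j\<le>m. if j = 0 then h m t else 0)"
      unfolding \<Phi>_def by (intro sum.cong) (auto simp: power_0_left)
    then show ?thesis using t by (simp add: \<Psi>_def)
  qed
  ultimately have HK: "(?g has_integral h m t) {0<..<t}"
    by (simp add: \<Psi>_def has_integral_Icc_iff_Ioo)
  have "set_integrable lborel {0<..<t} ?g"
  proof -
    obtain k where k: "k \<ge> 0" "\<And>s t. 0 < s \<Longrightarrow> s < t \<Longrightarrow> t < 1 \<Longrightarrow> norm ((L t - L s) ^ m / fact m) \<le> k * (odds t / odds s) powr (1/4)"
      using log_power_bound[of L C "1/4" m] Lb C by (metis zero_less_divide_1_iff zero_less_numeral)
    obtain B where B: "B \<ge> 0" "\<And>s. 0 < s \<Longrightarrow> s < 1 \<Longrightarrow> norm (f a s * J x s) \<le> B * (lam s * odds s powr (1/2))"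
      using form_J_bound[OF ok] by blast
    \<comment> \<open>\<open>L\<close> is controlled only on (0, 1); cutting it off there makes the
      integrand Borel measurable without changing it on (0, t).\<close>
    define g' where "g' = (\<lambda>s. (L t - indicator {0<..<1} s *\<^sub>R L s) ^ m / fact m * (f a s * J x s))"
    have [measurable]: "(\<lambda>s. indicator {0<..<1} s *\<^sub>R L s) \<in> borel_measurable borel"
      by (intro borel_measurable_continuous_on_indicator L(1)) auto
    have [measurable]: "J x \<in> borel_measurable borel" by (rule J_measurable[OF ok_supp[OF ok]])
    have "integrable lborel (\<lambda>s. indicator {0<..<t} s *\<^sub>R g' s)"
    proof (rule odds_integrable(1)[of _ "1/4" _ "k * B * odds t powr (1/4)"])
      show "g' \<in> borel_measurable borel" unfolding g'_def using a by measurable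
      fix s assume s: "0 < s" "s < t"
      have o: "0 < odds s" "0 < odds t" using s t odds_pos by auto
      have "norm (g' s) = norm ((L t - L s) ^ m / fact m) * norm (f a s * J x s)"
        using s t by (simp add: g'_def norm_mult norm_divide)
      also have "\<dots> \<le> (k * (odds t / odds s) powr (1/4)) * (B * (lam s * odds s powr (1/2)))"
        using k B(2)[of s] s t by (intro mult_mono) auto
      also have "\<dots> = k * B * odds t powr (1/4) * (lam s * (odds s powr (1/2) / odds s powr (1/4)))"
        using o by (simp add: powr_divide)
      also have "odds s powr (1/2) / odds s powr (1/4) = odds s powr (1/4)"
        by (simp flip: powr_diff)
      finally show "norm (g' s) \<le> k * B * odds t powr (1/4) * (lam s * odds s powr (1/4))" .
    qed (use t in auto)
    also have "(\<lambda>s. indicator {0<..<t} s *\<^sub>R g' s) = (\<lambda>s. indicator {0<..<t} s *\<^sub>R ?g s)"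
      using t by (auto simp: g'_def indicator_def fun_eq_iff)
    finally show ?thesis by (simp add: set_integrable_def)
  qed
  from set_borel_integral_eq_integral(2)[OF this]
  have "(LINT s|lborel. indicator {0<..<t} s *\<^sub>R ?g s) = h m t"
    by (simp only: set_lebesgue_integral_def integral_unique[OF HK])
  then show ?thesis by (simp add: h_def)
qed

end

section \<open>Iterated integrals from an interior base point and composition of paths\<close>

definition anti :: "(real \<Rightarrow> complex) \<Rightarrow> real \<Rightarrow> complex" where
  "anti g t = (if 1/2 \<le> t then integral {1/2..t} g else - integral {t..1/2} g)"

text \<open>The base point 1/2 is interior, so integrability on compact subintervals suffices and no
  condition arises at either end. This is what makes divergent words accessible.\<close>

lemma anti_props:
  assumes int: "\<And>x y. 0 < x \<Longrightarrow> y < 1 \<Longrightarrow> g integrable_on {x..y}"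
    and cont: "continuous_on ({0<..<1} - S) g" and S: "finite S"
  shows "continuous_on {0<..<1} (anti g)" and "anti g (1/2) = 0"
    and "\<And>t. t \<in> {0<..<1} - S \<Longrightarrow> (anti g has_vector_derivative g t) (at t)"
proof -
  show "anti g (1/2) = 0" by (simp add: anti_def)
  have e: "anti g t = integral {x..t} g - integral {x..1/2} g" if "0 < x" "x \<le> t" "x \<le> 1/2" "t < 1" for x t
  proof (cases "1/2 \<le> t")
    case True
    have "integral {x..1/2} g + integral {1/2..t} g = integral {x..t} g"
      using that True by (intro Henstock_Kurzweil_Integration.integral_combine int) auto
    then show ?thesis using True by (simp add: anti_def algebra_simps)
  next
    case False
    have "integral {x..t} g + integral {t..1/2} g = integral {x..1/2} g"
      using that False by (intro Henstock_Kurzweil_Integration.integral_combine int) auto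
    then show ?thesis using False by (simp add: anti_def algebra_simps)
  qed
  have loc: "\<exists>x y. 0 < x \<and> x < t \<and> x \<le> 1/2 \<and> t < y \<and> y < 1" if "t \<in> {0<..<1}" for t :: real
    using that by (intro exI[of _ "t / 2"] exI[of _ "(t + 1) / 2"]) auto
  show "continuous_on {0<..<1} (anti g)"
  proof (rule continuous_at_imp_continuous_on, rule ballI)
    fix t :: real assume "t \<in> {0<..<1}"
    then obtain x y where xy: "0 < x" "x < t" "x \<le> 1/2" "t < y" "y < 1" using loc by blast
    have "continuous_on {x..y} (\<lambda>t. integral {x..t} g - integral {x..1/2} g)"
      by (intro continuous_intros indefinite_integral_continuous_1 int xy)
    then have "continuous_on {x..y} (anti g)"
      by (rule continuous_on_eq) (use xy in \<open>auto intro!: e[symmetric]\<close>)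
    then have "continuous_on {x<..<y} (anti g)" by (rule continuous_on_subset) auto
    then show "isCont (anti g) t" using xy by (auto simp: continuous_on_eq_continuous_at)
  qed
  fix t assume t: "t \<in> {0<..<1} - S"
  then obtain x y where xy: "0 < x" "x < t" "x \<le> 1/2" "t < y" "y < 1" using loc by blast
  have "open ({0<..<1} - S)" using S by (intro open_Diff finite_imp_closed) auto
  then have gc: "isCont g t"
    using cont t continuous_on_eq_continuous_at by fastforce
  have "((\<lambda>u. integral {x..u} g) has_vector_derivative g t) (at t within {x..y})"
    using integral_has_vector_derivative_continuous_at[of g x y t "{}"] xy int[of x y] gc
    by (auto intro: continuous_at_imp_continuous_at_within)
  then have "((\<lambda>u. integral {x..u} g) has_vector_derivative g t) (at t)"
    using xy by (simp add: at_within_Icc_at)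
  then have "((\<lambda>u. integral {x..u} g - integral {x..1/2} g) has_vector_derivative g t - 0) (at t)"
    by (intro has_vector_derivative_diff has_vector_derivative_const)
  then have "((\<lambda>u. integral {x..u} g - integral {x..1/2} g) has_vector_derivative g t) (at t)" by simp
  then show "(anti g has_vector_derivative g t) (at t)"
    by (rule has_vector_derivative_transform_within_open[where S="{x<..<y}"]) (use xy in \<open>auto intro!: e[symmetric]\<close>)
qed

text \<open>The oriented iterated integral from \<open>z\<close> to 1/2, as a function of its lower
  limit: it grows at the first letter, and the minus sign reverses the direction of
  \<open>anti\<close>.\<close>

primrec left_iter :: "('a \<Rightarrow> real \<Rightarrow> complex) \<Rightarrow> 'a list \<Rightarrow> real \<Rightarrow> complex" where
  "left_iter f [] z = 1"
| "left_iter f (a # u) z = - anti (\<lambda>s. f a s * left_iter f u s) z"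

text \<open>The oriented iterated integral from 1/2 to \<open>z\<close>; it grows at the last
  letter, so the word is reversed as for \<open>riter\<close>.\<close>

primrec rright_iter :: "('a \<Rightarrow> real \<Rightarrow> complex) \<Rightarrow> 'a list \<Rightarrow> real \<Rightarrow> complex" where
  "rright_iter f [] z = 1"
| "rright_iter f (a # u) z = anti (\<lambda>s. f a s * rright_iter f u s) z"

definition right_iter :: "('a \<Rightarrow> real \<Rightarrow> complex) \<Rightarrow> 'a list \<Rightarrow> real \<Rightarrow> complex" where
  "right_iter f u = rright_iter f (rev u)"

declare left_iter.simps(2)[simp del]

lemma left_iter_Cons: "left_iter f (a # u) = (\<lambda>z. - anti (\<lambda>s. f a s * left_iter f u s) z)"
  by (rule ext) (rule left_iter.simps(2))

lemma right_iter_Nil: "right_iter f [] z = 1"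
  by (simp add: right_iter_def)

lemma right_iter_snoc: "right_iter f (u @ [a]) z = anti (\<lambda>s. f a s * right_iter f u s) z"
  by (simp add: right_iter_def)

context path_forms
begin

lemma form_times_integrable:
  assumes a: "a \<in> A" and h: "continuous_on {x..y} h" and xy: "0 < x" "y < 1"
  shows "integrable lborel (\<lambda>s. indicator {x..y} s *\<^sub>R (f a s * h s))"
    and "(\<lambda>s. f a s * h s) integrable_on {x..y}"
proof -
  obtain C where C: "C \<ge> 0" "\<And>t. 0 < t \<Longrightarrow> t < 1 \<Longrightarrow> norm (f a t) \<le> C * lam t" using f_bound[OF a] by blast
  have "bounded (h ` {x..y})" by (intro compact_imp_bounded compact_continuous_image h) auto
  then obtain B where B: "\<And>s. s \<in> {x..y} \<Longrightarrow> norm (h s) \<le> B" unfolding bounded_iff by blast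
  have [measurable]: "(\<lambda>s. indicator {x..y} s *\<^sub>R h s) \<in> borel_measurable borel"
    by (intro borel_measurable_continuous_on_indicator h) auto
  have "integrable lborel (\<lambda>s. indicator {x..y} s *\<^sub>R (f a s * (indicator {x..y} s *\<^sub>R h s)))"
  proof (rule integrableI_bounded_set_indicator[where B = "C * (1 / (x * (1 - y))) * B"])
    show "(\<lambda>s. f a s * (indicator {x..y} s *\<^sub>R h s)) \<in> borel_measurable lborel" using a by measurable
    show "emeasure lborel {x..y} < \<infinity>" by (simp add: emeasure_lborel_Icc_eq)
    show "AE s in lborel. s \<in> {x..y} \<longrightarrow> norm (f a s * (indicator {x..y} s *\<^sub>R h s)) \<le> C * (1 / (x * (1 - y))) * B"
    proof (intro AE_I2 impI)
      fix s assume s: "s \<in> {x..y}"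
      have "lam s \<le> 1 / (x * (1 - y))"
        unfolding lam_def using s xy by (intro divide_left_mono mult_mono) auto
      then have "norm (f a s) \<le> C * (1 / (x * (1 - y)))"
        using C(2)[of s] C(1) s xy by (smt (verit) atLeastAtMost_iff mult_left_mono)
      then have "norm (f a s) * norm (h s) \<le> C * (1 / (x * (1 - y))) * B"
        using B[OF s] by (intro mult_mono) (auto intro: order_trans[OF norm_ge_zero])
      then show "norm (f a s * (indicator {x..y} s *\<^sub>R h s)) \<le> C * (1 / (x * (1 - y))) * B"
        using s by (simp add: norm_mult)
    qed
  qed auto
  also have "(\<lambda>s. indicator {x..y} s *\<^sub>R (f a s * (indicator {x..y} s *\<^sub>R h s))) = (\<lambda>s. indicator {x..y} s *\<^sub>R (f a s * h s))"
    by (auto simp: indicator_def fun_eq_iff)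
  finally show *: "integrable lborel (\<lambda>s. indicator {x..y} s *\<^sub>R (f a s * h s))" .
  then show "(\<lambda>s. f a s * h s) integrable_on {x..y}"
    by (intro set_borel_integral_eq_integral(1)) (simp add: set_integrable_def)
qed

lemma anti_form:
  assumes a: "a \<in> A" and h: "continuous_on {0<..<1} h"
  shows "continuous_on {0<..<1} (anti (\<lambda>s. f a s * h s))"
    and "\<And>t. t \<in> {0<..<1} - S \<Longrightarrow> (anti (\<lambda>s. f a s * h s) has_vector_derivative f a t * h t) (at t)"
proof -
  have i: "(\<lambda>s. f a s * h s) integrable_on {x..y}" if "0 < x" "y < 1" for x y
    by (intro form_times_integrable a that continuous_on_subset[OF h]) (use that in auto)
  have c: "continuous_on ({0<..<1} - S) (\<lambda>s. f a s * h s)"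
    by (intro continuous_on_mult f_cont a continuous_on_subset[OF h]) auto
  note P = anti_props[OF i c finite_S]
  show "continuous_on {0<..<1} (anti (\<lambda>s. f a s * h s))" by (rule P(1))
  show "\<And>t. t \<in> {0<..<1} - S \<Longrightarrow> (anti (\<lambda>s. f a s * h s) has_vector_derivative f a t * h t) (at t)" by (rule P(3))
qed

lemma left_iter_cont: "set u \<subseteq> A \<Longrightarrow> continuous_on {0<..<1} (left_iter f u)"
proof (induction u)
  case Nil
  then show ?case by (simp add: continuous_on_const cong: continuous_on_cong)
next
  case (Cons a u)
  then show ?case unfolding left_iter_Cons by (intro continuous_on_minus anti_form) auto
qed

lemma left_iter_deriv:
  assumes "set (a # u) \<subseteq> A" "t \<in> {0<..<1} - S"
  shows "(left_iter f (a # u) has_vector_derivative - (f a t * left_iter f u t)) (at t)"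
  using has_vector_derivative_minus[OF anti_form(2)[OF _ left_iter_cont assms(2)]] assms(1) unfolding left_iter_Cons by simp

lemma right_iter_cont: "set u \<subseteq> A \<Longrightarrow> continuous_on {0<..<1} (right_iter f u)"
proof (induction u rule: rev_induct)
  case Nil
  then show ?case by (simp add: right_iter_Nil[abs_def])
next
  case (snoc a u)
  have "right_iter f (u @ [a]) = anti (\<lambda>s. f a s * right_iter f u s)" by (rule ext) (rule right_iter_snoc)
  then show ?case using anti_form(1) snoc by simp
qed

lemma right_iter_deriv:
  assumes "set (u @ [a]) \<subseteq> A" "t \<in> {0<..<1} - S"
  shows "(right_iter f (u @ [a]) has_vector_derivative f a t * right_iter f u t) (at t)"
proof -
  have "right_iter f (u @ [a]) = anti (\<lambda>s. f a s * right_iter f u s)" by (rule ext) (rule right_iter_snoc)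
  then show ?thesis using anti_form(2)[OF _ right_iter_cont assms(2)] assms(1) by simp
qed

text \<open>Composition of paths at \<open>1/2\<close>; for \<open>z = t\<close> the sum is the expansion of a trivial path.\<close>

definition chen :: "complex list \<Rightarrow> real \<Rightarrow> real \<Rightarrow> complex" where
  "chen w z t = (\<Sum>i\<le>length w. left_iter f (take i w) z * right_iter f (drop i w) t)"

lemma set_take_drop: "set w \<subseteq> A \<Longrightarrow> set (take i w) \<subseteq> A" "set w \<subseteq> A \<Longrightarrow> set (drop i w) \<subseteq> A"
  using set_take_subset[of i w] set_drop_subset[of i w] by auto

lemma chen_cont: "set w \<subseteq> A \<Longrightarrow> continuous_on {0<..<1} (chen w z)"
  unfolding chen_def[abs_def] by (intro continuous_intros right_iter_cont set_take_drop)

lemma right_iter_sum_deriv: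
  assumes "set (w @ [b]) \<subseteq> A" "t \<in> {0<..<1} - S"
  shows "(right_iter f (drop i (w @ [b])) has_vector_derivative
     (if i \<le> length w then f b t * right_iter f (drop i w) t else 0)) (at t)"
proof (cases "i \<le> length w")
  case True
  then show ?thesis using right_iter_deriv[of "drop i w" b t] set_take_drop[of w i] assms by simp
next
  case False
  then show ?thesis by (simp add: right_iter_Nil[abs_def])
qed

lemma chen_deriv:
  assumes "set (w @ [b]) \<subseteq> A" "t \<in> {0<..<1} - S"
  shows "(chen (w @ [b]) z has_vector_derivative f b t * chen w z t) (at t)"
proof -
  have "(chen (w @ [b]) z has_vector_derivative
     (\<Sum>i\<le>length (w @ [b]). left_iter f (take i (w @ [b])) z * (if i \<le> length w then f b t * right_iter f (drop i w) t else 0))) (at t)"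
    unfolding chen_def[abs_def]
    by (intro has_vector_derivative_sum has_vector_derivative_mult_right right_iter_sum_deriv assms)
  moreover have "(\<Sum>i\<le>length (w @ [b]). left_iter f (take i (w @ [b])) z * (if i \<le> length w then f b t * right_iter f (drop i w) t else 0))
     = f b t * chen w z t"
    by (simp add: chen_def sum_distrib_left mult_ac cong: sum.cong_simp)
  ultimately show ?thesis by simp
qed

lemma chen_diagonal_cont: "set w \<subseteq> A \<Longrightarrow> continuous_on {0<..<1} (\<lambda>z. chen w z z)"
  unfolding chen_def by (intro continuous_intros right_iter_cont left_iter_cont set_take_drop)

text \<open>The right factors contribute the last letter and the left factors, with opposite sign,
  the first letter; each contribution collects to a \<open>chen\<close> sum of a shorter
  word.\<close>

lemma chen_diagonal_deriv:
  assumes w: "set w \<subseteq> A" "w \<noteq> []" and t: "t \<in> {0<..<1} - S"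
  shows "((\<lambda>z. chen w z z) has_vector_derivative f (last w) t * chen (butlast w) t t - f (hd w) t * chen (tl w) t t) (at t)"
proof -
  obtain v b where v: "w = v @ [b]" using w(2) rev_exhaust by blast
  obtain a u where u: "w = a # u" using w(2) by (cases w) auto
  have dl: "((\<lambda>z. left_iter f (take i w) z) has_vector_derivative (if i = 0 then 0 else - (f a t * left_iter f (take (i - 1) u) t))) (at t)" for i
  proof (cases i)
    case (Suc j)
    then show ?thesis using left_iter_deriv[of a "take j u" t] w(1) t set_take_drop[of u j] unfolding u by simp
  qed simp
  have dr: "((\<lambda>z. right_iter f (drop i w) z) has_vector_derivative (if i \<le> length v then f b t * right_iter f (drop i v) t else 0)) (at t)" for i
    using right_iter_sum_deriv[of v b t i] w(1) t unfolding v by simp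
  have "((\<lambda>z. chen w z z) has_vector_derivative
     (\<Sum>i\<le>length w. left_iter f (take i w) t * (if i \<le> length v then f b t * right_iter f (drop i v) t else 0)
        + (if i = 0 then 0 else - (f a t * left_iter f (take (i - 1) u) t)) * right_iter f (drop i w) t)) (at t)"
    unfolding chen_def by (intro has_vector_derivative_sum has_vector_derivative_mult dl dr)
  moreover have "(\<Sum>i\<le>length w. left_iter f (take i w) t * (if i \<le> length v then f b t * right_iter f (drop i v) t else 0)) = f b t * chen v t t"
    unfolding v by (simp add: chen_def sum_distrib_left mult_ac cong: sum.cong_simp)
  moreover have "(\<Sum>i\<le>length w. (if i = 0 then 0 else - (f a t * left_iter f (take (i - 1) u) t)) * right_iter f (drop i w) t) = - (f a t * chen u t t)"
    unfolding u by (simp add: chen_def sum.atMost_Suc_shift sum_distrib_left sum_negf mult.assoc del: sum.atMost_Suc)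
  ultimately have "((\<lambda>z. chen w z z) has_vector_derivative f b t * chen v t t - f a t * chen u t t) (at t)"
    by (simp add: sum.distrib)
  then show ?thesis using u v by (metis butlast_snoc last_snoc list.sel(1,3))
qed

text \<open>By induction on the length the derivative along the diagonal vanishes: it involves
  shorter words, and for a single letter its two terms cancel. At 1/2 every summand has a factor
  with a nonempty word, which is 0 there.\<close>

lemma chen_diagonal: "set w \<subseteq> A \<Longrightarrow> w \<noteq> [] \<Longrightarrow> z \<in> {0<..<1} \<Longrightarrow> chen w z z = 0"
proof (induction "length w" arbitrary: w z rule: less_induct)
  case less
  have half: "left_iter f u (1/2) = 0" "right_iter f u (1/2) = 0" if "u \<noteq> []" for u
  proof -
    show "left_iter f u (1/2) = 0" using that by (cases u) (auto simp: anti_def left_iter_Cons)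
    show "right_iter f u (1/2) = 0" using that by (cases u rule: rev_cases) (auto simp: anti_def right_iter_snoc)
  qed
  have "chen w (1/2) (1/2) = 0"
    unfolding chen_def
  proof (rule sum.neutral, rule ballI)
    fix i assume "i \<in> {..length w}"
    then have "take i w \<noteq> [] \<or> drop i w \<noteq> []" using less.prems(2) by (cases i) auto
    then show "left_iter f (take i w) (1/2) * right_iter f (drop i w) (1/2) = 0" using half by auto
  qed
  moreover have "chen w z z = chen w (1/2) (1/2)"
  proof (rule zero_derivative_imp_const[OF finite_S])
    show "continuous_on {0<..<1} (\<lambda>z. chen w z z)" by (rule chen_diagonal_cont) (rule less.prems)
    fix t assume t: "t \<in> {0<..<1} - S"
    have "f (last w) t * chen (butlast w) t t - f (hd w) t * chen (tl w) t t = 0"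
    proof (cases "tl w = []")
      case True
      then obtain a where "w = [a]" using less.prems(2) by (cases w) auto
      then show ?thesis by (simp add: chen_def)
    next
      case False
      then obtain a w' where w: "w = a # w'" "w' \<noteq> []" by (cases w) auto
      have "set (butlast w) \<subseteq> A" using less.prems(1) by (auto dest: in_set_butlastD)
      then have "chen (butlast w) t t = 0"
        using less.hyps[of "butlast w" t] w t by auto
      moreover have "chen (tl w) t t = 0"
        using less.hyps[of "tl w" t] less.prems(1) w t by auto
      ultimately show ?thesis by simp
    qed
    then show "((\<lambda>z. chen w z z) has_vector_derivative 0) (at t)"
      using chen_diagonal_deriv[OF less.prems(1,2) t] by simp
  qed (use less.prems in auto)
  ultimately show ?case by simp
qed

lemma iter_from:
  assumes "set (u @ [a]) \<subseteq> A" and z: "0 < z" "z < 1" and cu: "continuous_on {z..<1} (iter f z u)"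
  shows "continuous_on {z..<1} (iter f z (u @ [a]))" and "iter f z (u @ [a]) z = 0"
    and "\<And>t. t \<in> {z<..<1} - S \<Longrightarrow> (iter f z (u @ [a]) has_vector_derivative f a t * iter f z u t) (at t)"
proof -
  have a: "a \<in> A" using assms(1) by simp
  have z0: "0 \<le> z" using z by simp
  have int: "integrable lborel (\<lambda>s. indicator {z<..<t} s *\<^sub>R (f a s * iter f z u s))" if "z < t" "t < 1" for t
  proof -
    have "set_integrable lborel {z..t} (\<lambda>s. f a s * iter f z u s)"
      unfolding set_integrable_def
      by (intro form_times_integrable(1) a continuous_on_subset[OF cu]) (use that z in auto)
    then have "set_integrable lborel {z<..<t} (\<lambda>s. f a s * iter f z u s)"
      by (rule set_integrable_subset) auto
    then show ?thesis by (simp add: set_integrable_def)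
  qed
  \<comment> \<open>Continuity is known only from \<open>z\<close> on, but
    \<open>primitive_from\<close> asks for it on (0, 1) off \<open>S\<close>. Freezing the argument
    below \<open>z\<close> provides it and does not affect the integral, which starts at
    \<open>z\<close>.\<close>
  let ?g = "\<lambda>s. f a s * iter f z u (max s z)"
  have cc: "continuous_on {0<..<1} (\<lambda>s. iter f z u (max s z))"
    by (rule continuous_on_compose2[OF cu]) (use z in \<open>auto intro!: continuous_intros\<close>)
  have c: "continuous_on ({0<..<1} - S) ?g"
    by (intro continuous_on_mult f_cont a continuous_on_subset[OF cc]) auto
  have int': "integrable lborel (\<lambda>s. indicator {z<..<t} s *\<^sub>R ?g s)" if "z < t" "t < 1" for t
    using int[OF that] by (rule Bochner_Integration.integrable_cong[THEN iffD1, rotated -1]) (auto simp: indicator_def)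
  have e: "(\<lambda>t. LINT s|lborel. indicator {z<..<t} s *\<^sub>R ?g s) = iter f z (u @ [a])"
    unfolding iter_snoc fun_eq_iff by (intro allI Bochner_Integration.integral_cong) (auto simp: indicator_def)
  note P = primitive_from[OF int' c finite_S z0 z(2), unfolded e]
  show "continuous_on {z..<1} (iter f z (u @ [a]))" by (rule P(1))
  show "iter f z (u @ [a]) z = 0" by (simp add: iter_snoc)
  show "(iter f z (u @ [a]) has_vector_derivative f a t * iter f z u t) (at t)" if "t \<in> {z<..<1} - S" for t
    using P(3)[OF _ _ that] that by simp
qed

lemma iter_from_cont: "set u \<subseteq> A \<Longrightarrow> 0 < z \<Longrightarrow> z < 1 \<Longrightarrow> continuous_on {z..<1} (iter f z u)"
proof (induction u rule: rev_induct)
  case Nil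
  then show ?case by (simp add: iter_Nil[abs_def])
qed (use iter_from(1) in auto)

text \<open>Both sides have the same derivative in \<open>t\<close>, by induction on the word, and
  both vanish at \<open>t = z\<close> for a nonempty word; for \<open>chen\<close> this is
  \<open>chen_diagonal\<close>.\<close>

lemma iter_eq_chen:
  "set w \<subseteq> A \<Longrightarrow> 0 < z \<Longrightarrow> z \<le> t \<Longrightarrow> t < 1 \<Longrightarrow> iter f z w t = chen w z t"
proof (induction w arbitrary: t rule: rev_induct)
  case Nil
  then show ?case by (simp add: iter_Nil chen_def right_iter_Nil)
next
  case (snoc b w)
  have z: "0 < z" "z < 1" using snoc.prems by auto
  have w: "set w \<subseteq> A" using snoc.prems by simp
  note I = iter_from[OF snoc.prems(1) z iter_from_cont[OF w z]]
  have "((\<lambda>_. 0) has_integral (iter f z (w @ [b]) t - chen (w @ [b]) z t) - (iter f z (w @ [b]) z - chen (w @ [b]) z z)) {z..t}"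
  proof (rule fundamental_theorem_of_calculus_interior_strong[OF finite_S])
    show "continuous_on {z..t} (\<lambda>t. iter f z (w @ [b]) t - chen (w @ [b]) z t)"
      by (intro continuous_intros continuous_on_subset[OF I(1)] continuous_on_subset[OF chen_cont]) (use snoc.prems in auto)
    fix s assume s: "s \<in> {z<..<t} - S"
    have "((\<lambda>t. iter f z (w @ [b]) t - chen (w @ [b]) z t) has_vector_derivative f b s * iter f z w s - f b s * chen w z s) (at s)"
      by (intro has_vector_derivative_diff I(3) chen_deriv snoc.prems(1)) (use s snoc.prems in auto)
    then show "((\<lambda>t. iter f z (w @ [b]) t - chen (w @ [b]) z t) has_vector_derivative 0) (at s)"
      using snoc.IH[OF w z(1), of s] s snoc.prems by simp
  qed (use snoc.prems in simp)
  then have "(iter f z (w @ [b]) t - chen (w @ [b]) z t) - (iter f z (w @ [b]) z - chen (w @ [b]) z z) = 0"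
    by (rule has_integral_unique) simp
  then show ?case using I(2) chen_diagonal[OF snoc.prems(1), of z] z by simp
qed

end

section \<open>Expansion of the cut-off iterated integrals\<close>

locale path_forms_exp = path_forms +
  assumes exp_start: "\<And>a. a \<in> A \<Longrightarrow> \<exists>P. log_exp (\<lambda>z. of_real z * f a z) P"
    and exp_end: "\<And>a. a \<in> A \<Longrightarrow> \<exists>P. log_exp (\<lambda>z. of_real z * f a (1 - z)) P"
begin

lemma finite_avoid: "finite F \<Longrightarrow> \<exists>d>0. d \<le> 1/2 \<and> {0<..<d} \<inter> F = {}" for F :: "real set"
proof -
  assume F: "finite F"
  let ?M = "insert (1/2) (F \<inter> {0<..})"
  have "0 < Min ?M" using F by simp
  moreover have "Min ?M \<le> 1/2" using F by (intro Min_le) auto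
  moreover have "{0<..<Min ?M} \<inter> F = {}"
  proof -
    have "Min ?M \<le> x" if "x \<in> F" "0 < x" for x using F that by (intro Min_le) auto
    then show ?thesis by force
  qed
  ultimately show ?thesis by blast
qed

lemma left_iter_log_exp: "set u \<subseteq> A \<Longrightarrow> \<exists>P. log_exp (left_iter f u) P"
proof (induction u)
  case Nil
  then show ?case using log_exp_const[of 1] by (auto simp: left_iter.simps(1)[abs_def])
next
  case (Cons a u)
  obtain P Q where P: "log_exp (\<lambda>z. of_real z * f a z) P" and Q: "log_exp (left_iter f u) Q"
    using exp_start Cons by fastforce
  obtain d where d: "d > 0" "d \<le> 1/2" "{0<..<d} \<inter> S = {}" using finite_avoid[OF finite_S] by blast
  show ?case
  \<comment> \<open>\<open>log_exp_primitive\<close> integrates \<open>g z / z\<close>; so the form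
    enters as \<open>z * f a z\<close>, in which a simple pole has been cancelled. The factor -1 is
    there because \<open>z\<close> is the lower limit.\<close>
  proof (rule log_exp_primitive[OF log_exp_mult[OF log_exp_const[of "-1"] log_exp_mult[OF P Q]] d(1)])
    fix z assume z: "0 < z" "z < d"
    then have "z \<in> {0<..<1} - S" using d by auto
    from left_iter_deriv[OF Cons.prems this]
    show "(left_iter f (a # u) has_vector_derivative - 1 * (of_real z * f a z * left_iter f u z) / of_real z) (at z)"
      using z by simp
  qed
qed

lemma right_iter_log_exp: "set u \<subseteq> A \<Longrightarrow> \<exists>P. log_exp (\<lambda>z. right_iter f u (1 - z)) P"
proof (induction u rule: rev_induct)
  case Nil
  then show ?case using log_exp_const[of 1] by (auto simp: right_iter_Nil)
next
  case (snoc a u)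
  obtain P Q where P: "log_exp (\<lambda>z. of_real z * f a (1 - z)) P" and Q: "log_exp (\<lambda>z. right_iter f u (1 - z)) Q"
    using exp_end snoc by fastforce
  obtain d where d: "d > 0" "d \<le> 1/2" "{0<..<d} \<inter> (\<lambda>s. 1 - s) ` S = {}"
    using finite_avoid[of "(\<lambda>s. 1 - s) ` S"] finite_S by blast
  show ?case
  \<comment> \<open>Here the factor -1 is the derivative of \<open>1 - z\<close>.\<close>
  proof (rule log_exp_primitive[OF log_exp_mult[OF log_exp_const[of "-1"] log_exp_mult[OF P Q]] d(1)])
    fix z assume z: "0 < z" "z < d"
    have "1 - z \<notin> S"
    proof
      assume "1 - z \<in> S"
      then have "1 - (1 - z) \<in> (\<lambda>s. 1 - s) ` S" by (rule imageI)
      then have "z \<in> {0<..<d} \<inter> (\<lambda>s. 1 - s) ` S" using z by simp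
      then show False using d(3) by blast
    qed
    then have "1 - z \<in> {0<..<1} - S" using z d by auto
    from right_iter_deriv[OF snoc.prems this]
    have "(right_iter f (u @ [a]) has_vector_derivative f a (1 - z) * right_iter f u (1 - z)) (at (1 - z))" .
    moreover have "((\<lambda>z. 1 - z) has_vector_derivative - 1) (at z)"
      by (auto intro!: derivative_eq_intros)
    ultimately have "((right_iter f (u @ [a]) \<circ> (\<lambda>z. 1 - z)) has_vector_derivative (- 1) *\<^sub>R (f a (1 - z) * right_iter f u (1 - z))) (at z)"
      by (intro vector_diff_chain_at)
    then show "((\<lambda>z. right_iter f (u @ [a]) (1 - z)) has_vector_derivative - 1 * (of_real z * f a (1 - z) * right_iter f u (1 - z)) / of_real z) (at z)"
      using z by (simp add: o_def)
  qed
qed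

text \<open>No restriction on first and last letters is needed here. In
  \<open>chen w z (1 - z)\<close> each factor sees only one of the two moving ends, and each is an
  iterated primitive.\<close>

lemma iter_log_exp:
  assumes "set w \<subseteq> A"
  shows "\<exists>P. log_exp (\<lambda>z. iter f z w (1 - z)) P"
proof -
  have "\<exists>P. log_exp (\<lambda>z. \<Sum>i\<le>length w. left_iter f (take i w) z * right_iter f (drop i w) (1 - z)) P"
  proof (rule log_exp_sum)
    fix i
    obtain P Q where "log_exp (left_iter f (take i w)) P" "log_exp (\<lambda>z. right_iter f (drop i w) (1 - z)) Q"
      using left_iter_log_exp[OF set_take_drop(1)[OF assms]] right_iter_log_exp[OF set_take_drop(2)[OF assms]] by blast
    from log_exp_mult[OF this] show "\<exists>P. log_exp (\<lambda>z. left_iter f (take i w) z * right_iter f (drop i w) (1 - z)) P" by blast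
  qed
  then obtain P where P: "log_exp (\<lambda>z. chen w z (1 - z)) P" by (auto simp: chen_def)
  have "\<forall>\<^sub>F z in at_right 0. chen w z (1 - z) = iter f z w (1 - z)"
    using eventually_at_right_0[of "1/2"]
    by (auto elim!: eventually_mono simp: iter_eq_chen[OF assms])
  then have "log_exp (\<lambda>z. iter f z w (1 - z)) P" by (rule log_exp_cong[OF P])
  then show ?thesis by blast
qed

end

section \<open>The cut-off integral as an integral over a tree without branching\<close>

context path_forms
begin

text \<open>Extended by 0 to the whole space, so that all cuts, including the uncut case
  \<open>z = 0\<close>, live on one measure space. Comparing neighbours is the form in which the
  order appears as the domain of a tree.\<close>

definition cut_integrand :: "complex list \<Rightarrow> real \<Rightarrow> (nat \<Rightarrow> real) \<Rightarrow> complex" where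
  "cut_integrand w z x = (if (\<forall>i<length w. z < x i \<and> x i < 1 - z) \<and> (\<forall>i. Suc i < length w \<longrightarrow> x i < x (Suc i))
     then (\<Prod>i<length w. f (w ! i) (x i)) else 0)"

text \<open>A word is a chain with vertices \<open>0, ..., n\<close>, parent map \<open>Suc\<close>
  and root \<open>n\<close>. The first letter is the colour of the only leaf, and the bounded form
  of the last letter sits at the root. So \<open>tree_integral_by_recursion\<close> applies, with no
  logarithms in the kernels.\<close>

lemma cut_integrand_integral:
  assumes ua: "u @ [a] \<in> G" and u: "u \<noteq> []" and z: "0 \<le> z" "z < 1/2"
    and fa: "C \<ge> 0" "\<And>t. 0 < t \<Longrightarrow> t < 1 \<Longrightarrow> norm (f a t) \<le> C"
  shows "integrable (Pi\<^sub>M {..<length (u @ [a])} (\<lambda>_. lborel)) (cut_integrand (u @ [a]) z)"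
    and "(LINT x|Pi\<^sub>M {..<length (u @ [a])} (\<lambda>_. lborel). cut_integrand (u @ [a]) z x)
       = (LINT s|lborel. indicator {z<..<1 - z} s *\<^sub>R (f a s * iter f z u s))"
proof -
  define n where "n = length u"
  define w where "w = u @ [a]"
  have wA: "w ! i \<in> A" if "i \<le> n" for i
    using start_words_set[OF ua] that by (auto simp: w_def n_def nth_append dest!: nth_mem)
  have n0: "0 < n" using u by (simp add: n_def)
  have wn: "w ! n = a" "length w = Suc n" by (auto simp: w_def n_def)
  have w0: "w ! 0 \<noteq> p" using ua u by (cases u) (auto simp: w_def start_words_def)
  define V where "V = {..<Suc n}"
  define K where "K = (\<lambda>i t s. if z < s \<and> s < t then f (w ! i) s else 0)"
  define W where "W = (\<lambda>s. if z < s \<and> s < 1 - z then f a s else 0)"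
  define T where "T = (\<lambda>i. iter f z (take (Suc i) w))"
  have ch: "{c \<in> V - {n}. Suc c = i} = (if i = 0 then {} else {i - 1})" if "i \<le> n" for i
    using that by (auto simp: V_def)
  have prodT: "(\<Prod>c\<in>{c \<in> V - {n}. Suc c = i}. T c s) = iter f z (take i w) s" if "i \<le> n" for i s
    using ch[OF that] by (auto simp: T_def iter_Nil)
  \<comment> \<open>This bound does not depend on the cut, so \<open>z = 0\<close> is
    included.\<close>
  have Kn: "norm (K i t s) \<le> indicator {0<..<t} s * norm (f (w ! i) s)" for i t s
    using z by (auto simp: K_def indicator_def)
  \<comment> \<open>These kernels satisfy better bounds than required; the factor at least 1 brings
    them into the required form.\<close>
  have ratio: "1 \<le> (odds t / odds s) powr b" if "0 < s" "s < t" "t < 1" "0 < b" for s t b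
    using that odds_mono[of s t] odds_pos[of s] by (intro ge_one_powr_ge_zero) auto
  note TR = tree_integral_by_recursion[where V=V and r=n and par=Suc and rank="\<lambda>i. n - i" and K=K and W=W and T=T]
  have A1: "finite V" "n \<in> V" by (auto simp: V_def)
  have A2: "Suc v \<in> V \<and> n - Suc v < n - v" if "v \<in> V - {n}" for v using that by (auto simp: V_def)
  have A3: "(\<lambda>z. K v (fst z) (snd z)) \<in> borel_measurable (borel \<Otimes>\<^sub>M borel)" if "v \<in> V - {n}" for v
  proof -
    have [measurable]: "f (w ! v) \<in> borel_measurable borel" using that wA by (auto simp: V_def)
    show ?thesis unfolding K_def by measurable
  qed
  have A4: "W \<in> borel_measurable borel"
  proof -
    have [measurable]: "f a \<in> borel_measurable borel" using wA[of n] wn by auto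
    show ?thesis unfolding W_def by measurable
  qed
  have A5: "T v t = (LINT s|lborel. K v t s * (\<Prod>c\<in>{c \<in> V - {n}. Suc c = v}. T c s))" if "v \<in> V - {n}" for v t
  proof -
    have v: "v < n" using that by (auto simp: V_def)
    then have "take (Suc v) w = take v w @ [w ! v]" using wn by (intro take_Suc_conv_app_nth) simp
    then have "T v t = (LINT s|lborel. indicator {z<..<t} s *\<^sub>R (f (w ! v) s * iter f z (take v w) s))"
      unfolding T_def by (simp add: iter_snoc)
    also have "\<dots> = (LINT s|lborel. K v t s * iter f z (take v w) s)"
      by (intro Bochner_Integration.integral_cong) (auto simp: K_def indicator_def)
    finally show ?thesis using prodT[of v] v by simp
  qed
  have A6: "\<exists>c\<ge>0. \<forall>t s. 0 < t \<longrightarrow> t < 1 \<longrightarrow> s \<noteq> 0 \<longrightarrow>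
        norm (K v t s) \<le> c * (indicator {0<..<t} s * ((odds t / odds s) powr b * lam s))" if "v \<in> V - {n}" "0 < b" for v b
  proof -
    have "v \<le> n" using that by (auto simp: V_def)
    then obtain c where c: "c \<ge> 0" "\<And>t. 0 < t \<Longrightarrow> t < 1 \<Longrightarrow> norm (f (w ! v) t) \<le> c * lam t"
      using f_bound[OF wA[of v]] by blast
    show ?thesis
    proof (intro exI[of _ c] conjI c(1) allI impI)
      fix t s :: real assume ts: "0 < t" "t < 1"
      show "norm (K v t s) \<le> c * (indicator {0<..<t} s * ((odds t / odds s) powr b * lam s))"
      proof (cases "s \<in> {0<..<t}")
        case True
        have "norm (K v t s) \<le> c * lam s" using Kn[of v t s] c(2)[of s] True ts by auto
        also have "\<dots> \<le> c * ((odds t / odds s) powr b * lam s)"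
          using ratio[of s t b] True ts that lam_pos[of s] c(1) by (intro mult_left_mono) auto
        finally show ?thesis using True by simp
      qed (use Kn[of v t s] in auto)
    qed
  qed
  have A7: "\<exists>c\<ge>0. \<forall>t s. 0 < t \<longrightarrow> t < 1 \<longrightarrow> s \<noteq> 0 \<longrightarrow>
        norm (K v t s) \<le> c * (indicator {0<..<t} s * ((odds t / odds s) powr b * (1 / (1 - s))))"
    if "v \<in> V - {n}" "{c \<in> V - {n}. Suc c = v} = {}" "0 < b" for v b
  proof -
    have "v = 0" using ch[of v] that by (auto simp: V_def split: if_splits)
    then have "w ! v \<noteq> p" "w ! v \<in> A" using w0 wA by auto
    then obtain c where c: "c \<ge> 0" "\<And>t. 0 < t \<Longrightarrow> t < 1 \<Longrightarrow> norm (f (w ! v) t) \<le> c * (1 / (1 - t))"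
      using f_bound_start by blast
    show ?thesis
    proof (intro exI[of _ c] conjI c(1) allI impI)
      fix t s :: real assume ts: "0 < t" "t < 1"
      show "norm (K v t s) \<le> c * (indicator {0<..<t} s * ((odds t / odds s) powr b * (1 / (1 - s))))"
      proof (cases "s \<in> {0<..<t}")
        case True
        have "norm (K v t s) \<le> c * (1 / (1 - s))" using Kn[of v t s] c(2)[of s] True ts by auto
        also have "\<dots> \<le> c * ((odds t / odds s) powr b * (1 / (1 - s)))"
          using ratio[of s t b] True ts that c(1) mult_right_mono[of 1 "(odds t / odds s) powr b" "1 / (1 - s)"] by (intro mult_left_mono) auto
        finally show ?thesis using True by simp
      qed (use Kn[of v t s] in auto)
    qed
  qed
  have A8: "\<exists>c\<ge>0. \<forall>s. s \<noteq> 0 \<longrightarrow> s \<noteq> 1 \<longrightarrow> norm (W s) \<le> c * indicator {0<..<1} s"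
    using fa z by (intro exI[of _ C]) (auto simp: W_def indicator_def)
  have A9: "{c \<in> V - {n}. Suc c = n} \<noteq> {}" using ch[of n] n0 by simp
  have R1: "integrable (Pi\<^sub>M V (\<lambda>_. lborel)) (\<lambda>x. W (x n) * (\<Prod>v\<in>V - {n}. K v (x (Suc v)) (x v)))"
    by (rule TR(1)[OF A1 A2 A3 A4 A5 A6 A7 A8 A9])
  have R2: "(LINT x|Pi\<^sub>M V (\<lambda>_. lborel). W (x n) * (\<Prod>v\<in>V - {n}. K v (x (Suc v)) (x v)))
      = (LINT s|lborel. W s * (\<Prod>c\<in>{c \<in> V - {n}. Suc c = n}. T c s))"
    by (rule TR(2)[OF A1 A2 A3 A4 A5 A6 A7 A8 A9])
  have e: "W (x n) * (\<Prod>v\<in>V - {n}. K v (x (Suc v)) (x v)) = cut_integrand w z x" for x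
  proof -
    have V: "V - {n} = {..<n}" by (auto simp: V_def)
    show ?thesis
    proof (cases "(\<forall>i\<le>n. z < x i \<and> x i < 1 - z) \<and> (\<forall>i<n. x i < x (Suc i))")
      case True
      then have "(\<Prod>v\<in>{..<n}. K v (x (Suc v)) (x v)) = (\<Prod>v\<in>{..<n}. f (w ! v) (x v))"
        by (intro prod.cong) (auto simp: K_def)
      moreover have "W (x n) = f (w ! n) (x n)" using True wn by (auto simp: W_def)
      ultimately show ?thesis using True by (simp add: V cut_integrand_def wn mult.commute less_Suc_eq_le)
    next
      case False
      have "W (x n) * (\<Prod>v\<in>{..<n}. K v (x (Suc v)) (x v)) = 0"
      proof (rule ccontr)
        assume "W (x n) * (\<Prod>v\<in>{..<n}. K v (x (Suc v)) (x v)) \<noteq> 0"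
        then have 1: "z < x n" "x n < 1 - z" and 2: "\<And>v. v < n \<Longrightarrow> z < x v \<and> x v < x (Suc v)"
          by (auto simp: W_def K_def split: if_splits)
        have "x i \<le> x n" if "i \<le> n" for i
          using that by (induction rule: inc_induct) (use 2 in \<open>auto intro: less_imp_le order_trans\<close>)
        then have "\<forall>i\<le>n. x i < 1 - z" using 1 by (meson le_less_trans)
        then show False using False 1 2 by (metis le_neq_implies_less)
      qed
      then show ?thesis using False by (auto simp: V cut_integrand_def wn less_Suc_eq_le)
    qed
  qed
  have e2: "W s * (\<Prod>c\<in>{c \<in> V - {n}. Suc c = n}. T c s) = indicator {z<..<1 - z} s *\<^sub>R (f a s * iter f z u s)" for s
    using prodT[of n s] by (auto simp: W_def indicator_def w_def n_def)
  have VV: "V = {..<length w}" by (simp add: V_def wn)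
  show "integrable (Pi\<^sub>M {..<length (u @ [a])} (\<lambda>_. lborel)) (cut_integrand (u @ [a]) z)"
    using R1 unfolding e w_def[symmetric] unfolding VV .
  show "(LINT x|Pi\<^sub>M {..<length (u @ [a])} (\<lambda>_. lborel). cut_integrand (u @ [a]) z x)
       = (LINT s|lborel. indicator {z<..<1 - z} s *\<^sub>R (f a s * iter f z u s))"
    using R2 unfolding e e2 w_def[symmetric] unfolding VV .
qed

text \<open>A cut merely shrinks the domain, so the uncut integrand dominates, and it is integrable
  by the case \<open>z = 0\<close> of \<open>cut_integrand_integral\<close>.\<close>

lemma iter_cut_tendsto:
  assumes ua: "u @ [a] \<in> G" and u: "u \<noteq> []"
    and fa: "C \<ge> 0" "\<And>t. 0 < t \<Longrightarrow> t < 1 \<Longrightarrow> norm (f a t) \<le> C"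
  shows "((\<lambda>z. iter f z (u @ [a]) (1 - z)) \<longlongrightarrow> (LINT s|lborel. indicator {0<..<1} s *\<^sub>R (f a s * iter f 0 u s))) (at_right 0)"
proof -
  let ?M = "Pi\<^sub>M {..<length (u @ [a])} (\<lambda>_. lborel :: real measure)"
  let ?F = "cut_integrand (u @ [a])"
  have I: "integrable ?M (?F z)" if "0 \<le> z" "z < 1/2" for z
    by (rule cut_integrand_integral(1)[OF ua u that fa])
  have "((\<lambda>z. LINT x|?M. ?F z x) \<longlongrightarrow> (LINT x|?M. ?F 0 x)) (at_right 0)"
  proof (rule tendsto_at_right_sequentially[of 0 "1/2"])
    fix Z :: "nat \<Rightarrow> real" assume Z: "\<And>n. 0 < Z n" "\<And>n. Z n < 1/2" "Z \<longlonglongrightarrow> 0"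
    show "(\<lambda>n. LINT x|?M. ?F (Z n) x) \<longlonglongrightarrow> (LINT x|?M. ?F 0 x)"
    proof (rule integral_dominated_convergence[where w = "\<lambda>x. norm (?F 0 x)"])
      show "?F 0 \<in> borel_measurable ?M" using I[of 0] by auto
      show "?F (Z n) \<in> borel_measurable ?M" for n using I[of "Z n"] Z(1)[of n] Z(2)[of n] by auto
      show "integrable ?M (\<lambda>x. norm (?F 0 x))" using I[of 0] by auto
      show "AE x in ?M. norm (?F (Z n) x) \<le> norm (?F 0 x)" for n
      proof (rule AE_I2)
        fix x
        show "norm (?F (Z n) x) \<le> norm (?F 0 x)"
          using Z(1)[of n] unfolding cut_integrand_def by (auto 0 3 split: if_splits dest: order.strict_trans)
      qed
      show "AE x in ?M. (\<lambda>n. ?F (Z n) x) \<longlonglongrightarrow> ?F 0 x"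
      proof (rule AE_I2)
        fix x
        show "(\<lambda>n. ?F (Z n) x) \<longlonglongrightarrow> ?F 0 x"
        proof (rule tendsto_eventually)
          \<comment> \<open>For a fixed point only finitely many coordinates have to pass the cut,
            hence the integrand is eventually constant in \<open>n\<close>.\<close>
          have "\<forall>\<^sub>F n in sequentially. \<forall>i<length (u @ [a]). 0 < x i \<and> x i < 1 \<longrightarrow> Z n < x i \<and> x i < 1 - Z n"
          proof (subst eventually_ball_finite_distrib[of "{..<length (u @ [a])}", simplified Ball_def lessThan_iff], simp, intro allI impI)
            fix i
            show "\<forall>\<^sub>F n in sequentially. 0 < x i \<and> x i < 1 \<longrightarrow> Z n < x i \<and> x i < 1 - Z n"
            proof (cases "0 < x i \<and> x i < 1")
              case True
              have "\<forall>\<^sub>F n in sequentially. Z n < x i" "\<forall>\<^sub>F n in sequentially. Z n < 1 - x i"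
                using order_tendstoD(2)[OF Z(3)] True by auto
              then show ?thesis by eventually_elim auto
            next
              case False
              then show ?thesis by (intro always_eventually) blast
            qed
          qed
          then show "\<forall>\<^sub>F n in sequentially. ?F (Z n) x = ?F 0 x"
          proof eventually_elim
            case (elim n)
            have "(\<forall>i<length (u @ [a]). Z n < x i \<and> x i < 1 - Z n) \<longleftrightarrow> (\<forall>i<length (u @ [a]). 0 < x i \<and> x i < 1 - 0)"
              using elim Z(1)[of n] by (metis diff_zero less_trans diff_less_eq less_add_same_cancel1)
            then show ?case unfolding cut_integrand_def by presburger
          qed
        qed
      qed
    qed
  qed simp
  then have "((\<lambda>z. LINT x|?M. ?F z x) \<longlongrightarrow> (LINT s|lborel. indicator {0<..<1} s *\<^sub>R (f a s * iter f 0 u s))) (at_right 0)"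
    using cut_integrand_integral(2)[OF ua u _ _ fa, of 0] by simp
  then show ?thesis
  proof (rule Lim_transform_eventually)
    show "\<forall>\<^sub>F z in at_right 0. (LINT x|?M. ?F z x) = iter f z (u @ [a]) (1 - z)"
      by (rule eventually_mono[OF eventually_at_right_0[of "1/2"]], simp)
         (simp only: iter_snoc, rule cut_integrand_integral(2)[OF ua u _ _ fa], auto)
  qed
qed

end

text \<open>The expansion comes from \<open>iter_log_exp\<close> and the limit from
  \<open>iter_cut_tendsto\<close>; agreement of \<open>F\<close> with the cut integral near 0 is
  enough for both.\<close>

lemma (in path_forms_exp) constant_term_iter:
  assumes "u @ [a] \<in> G" "u \<noteq> []" and "C \<ge> 0" "\<And>t. 0 < t \<Longrightarrow> t < 1 \<Longrightarrow> norm (f a t) \<le> C"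
    and "\<And>z. 0 < z \<Longrightarrow> z < 1/2 \<Longrightarrow> F z = (LINT x|Pi\<^sub>M {..<length (u @ [a])} (\<lambda>_. lborel). cut_integrand (u @ [a]) z x)"
  shows "constant_term F = (LINT s|lborel. indicator {0<..<1} s *\<^sub>R (f a s * iter f 0 u s))"
proof -
  have ev: "\<forall>\<^sub>F z in at_right 0. iter f z (u @ [a]) (1 - z) = F z"
  proof (rule eventually_mono[OF eventually_at_right_0[of "1/2"]])
    fix z :: real assume z: "0 < z \<and> z < 1/2"
    then have "F z = (LINT s|lborel. indicator {z<..<1 - z} s *\<^sub>R (f a s * iter f z u s))"
      using cut_integrand_integral(2)[OF assms(1,2) _ _ assms(3,4), of z] assms(5)[of z] by simp
    then show "iter f z (u @ [a]) (1 - z) = F z" by (simp only: iter_snoc)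
  qed simp
  obtain P where "log_exp (\<lambda>z. iter f z (u @ [a]) (1 - z)) P"
    using iter_log_exp[OF start_words_set[OF assms(1)]] by blast
  then have "log_exp F P" using ev by (rule log_exp_cong)
  moreover have "(F \<longlongrightarrow> (LINT s|lborel. indicator {0<..<1} s *\<^sub>R (f a s * iter f 0 u s))) (at_right 0)"
    using iter_cut_tendsto[OF assms(1-4)] ev by (rule Lim_transform_eventually)
  ultimately show ?thesis by (rule constant_term_eq_limit)
qed

section \<open>The forms on a smooth path\<close>

lemma derivs_cont:
  fixes d :: "nat \<Rightarrow> real \<Rightarrow> complex"
  assumes d: "\<And>n t. t \<in> {a..b} \<Longrightarrow> (d n has_vector_derivative d (Suc n) t) (at t within {a..b})"
  shows "continuous_on {a..b} (d n)"
  unfolding continuous_on_eq_continuous_within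
  by (rule ballI) (rule has_vector_derivative_continuous, rule d)

text \<open>For all derivatives \<open>d m\<close> at once: the remainder of \<open>d m\<close> to
  order \<open>N + 1\<close> vanishes at 0 and has the remainder of \<open>d (Suc m)\<close> to
  order \<open>N\<close> as its derivative.\<close>

lemma taylor_bound:
  fixes d :: "nat \<Rightarrow> real \<Rightarrow> complex"
  assumes d: "\<And>n t. t \<in> {0..b} \<Longrightarrow> (d n has_vector_derivative d (Suc n) t) (at t within {0..b})"
  shows "\<exists>C\<ge>0. \<forall>t\<in>{0..b}. norm (d m t - (\<Sum>j<N. d (m + j) 0 / fact j * of_real t ^ j)) \<le> C * t ^ N"
proof (induction N arbitrary: m)
  case 0
  have "continuous_on {0..b} (d m)"
    by (rule derivs_cont[of _ _ d]) (rule d)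
  then have "bounded (d m ` {0..b})" by (intro compact_imp_bounded compact_continuous_image) auto
  then obtain B where "\<forall>x\<in>d m ` {0..b}. norm x \<le> B" unfolding bounded_iff by blast
  then show ?case by (intro exI[of _ "max B 0"]) (auto simp: le_max_iff_disj)
next
  case (Suc N)
  obtain C where C: "C \<ge> 0" "\<And>t. t \<in> {0..b} \<Longrightarrow> norm (d (Suc m) t - (\<Sum>j<N. d (Suc m + j) 0 / fact j * of_real t ^ j)) \<le> C * t ^ N"
    using Suc.IH[of "Suc m"] by blast
  let ?R = "\<lambda>t. d m t - (\<Sum>j<Suc N. d (m + j) 0 / fact j * of_real t ^ j)"
  let ?R' = "\<lambda>t. d (Suc m) t - (\<Sum>j<N. d (Suc m + j) 0 / fact j * of_real t ^ j)"
  have dR: "(?R has_vector_derivative ?R' t) (at t within {0..b})" if "t \<in> {0..b}" for t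
  proof -
    have "((\<lambda>t. d (m + j) 0 / fact j * of_real t ^ j) has_vector_derivative
        (if j = 0 then 0 else d (m + j) 0 / fact (j - 1) * of_real t ^ (j - 1))) (at t within {0..b})" for j
    proof -
      have "((\<lambda>t. of_real (t ^ j) :: complex) has_vector_derivative of_real (of_nat j * t ^ (j - 1))) (at t within {0..b})"
        by (intro has_vector_derivative_of_real) (auto simp: has_real_derivative_iff_has_vector_derivative[symmetric] intro!: derivative_eq_intros)
      then have "((\<lambda>t. d (m + j) 0 / fact j * of_real (t ^ j)) has_vector_derivative d (m + j) 0 / fact j * of_real (of_nat j * t ^ (j - 1))) (at t within {0..b})"
        by (rule has_vector_derivative_mult_right)
      then show ?thesis by (cases j) (auto simp: field_simps simp del: of_nat_Suc)
    qed
    then have "(?R has_vector_derivative d (Suc m) t - (\<Sum>j<Suc N. if j = 0 then 0 else d (m + j) 0 / fact (j - 1) * of_real t ^ (j - 1))) (at t within {0..b})"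
      by (intro has_vector_derivative_diff d that has_vector_derivative_sum)
    then show ?thesis by (simp add: sum.lessThan_Suc_shift del: sum.lessThan_Suc)
  qed
  have R0: "?R 0 = 0"
  proof -
    have "(\<Sum>j<Suc N. d (m + j) 0 / fact j * of_real 0 ^ j) = d m 0"
      by (simp add: sum.lessThan_Suc_shift del: sum.lessThan_Suc)
    then show ?thesis by simp
  qed
  have "norm (?R t) \<le> C * t ^ Suc N" if t: "t \<in> {0..b}" for t
  proof -
    have "norm (?R t - ?R 0) \<le> (C * t ^ N) * norm (t - 0)"
    proof (rule differentiable_bound[of "{0..t}" ?R "\<lambda>x h. h *\<^sub>R ?R' x"])
      fix x assume x: "x \<in> {0..t}"
      have "(?R has_vector_derivative ?R' x) (at x within {0..t})"
        by (rule has_vector_derivative_within_subset[OF dR]) (use x t in auto)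
      then show "(?R has_derivative (\<lambda>h. h *\<^sub>R ?R' x)) (at x within {0..t})"
        by (simp add: has_vector_derivative_def)
      have "norm (?R' x) \<le> C * x ^ N" using C(2)[of x] x t by auto
      also have "\<dots> \<le> C * t ^ N" using x C(1) by (intro mult_left_mono power_mono) auto
      finally show "onorm (\<lambda>h. h *\<^sub>R ?R' x) \<le> C * t ^ N"
        by (intro onorm_le) (simp add: mult.commute mult_left_mono)
    qed (use t in auto)
    then show ?thesis using R0 t by (simp add: mult_ac)
  qed
  with C(1) show ?case by blast
qed

lemma taylor_log_exp:
  fixes d :: "nat \<Rightarrow> real \<Rightarrow> complex"
  assumes d: "\<And>n t. t \<in> {0..b} \<Longrightarrow> (d n has_vector_derivative d (Suc n) t) (at t within {0..b})" and b: "0 < b"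
  shows "log_exp (d m) (\<lambda>j. [:d (m + j) 0 / fact j:])"
proof (rule log_expI)
  fix N
  obtain C where C: "C \<ge> 0" "\<And>t. t \<in> {0..b} \<Longrightarrow> norm (d m t - (\<Sum>j<Suc (Suc N). d (m + j) 0 / fact j * of_real t ^ j)) \<le> C * t ^ Suc (Suc N)"
    using taylor_bound[of b d m "Suc (Suc N)", OF d] by blast
  have "(\<lambda>z. d m z - log_partial (\<lambda>j. [:d (m + j) 0 / fact j:]) (Suc N) z) \<in> O[at_right 0](\<lambda>z. of_real z ^ Suc (Suc N))"
  proof (rule bigoI[where c=C], rule eventually_mono[OF eventually_at_right_0[OF b]])
    fix z assume z: "0 < z \<and> z < b"
    have "log_partial (\<lambda>j. [:d (m + j) 0 / fact j:]) (Suc N) z = (\<Sum>j<Suc (Suc N). d (m + j) 0 / fact j * of_real z ^ j)"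
      unfolding log_partial_def lessThan_Suc_atMost by simp
    then show "norm (d m z - log_partial (\<lambda>j. [:d (m + j) 0 / fact j:]) (Suc N) z) \<le> C * norm (of_real z ^ Suc (Suc N) :: complex)"
      using C(2)[of z] z by (simp add: norm_power norm_mult)
  qed
  then show "(\<lambda>z. d m z - log_partial (\<lambda>j. [:d (m + j) 0 / fact j:]) (Suc N) z) \<in> O[at_right 0](\<lambda>z. of_real z ^ N)"
    by (rule landau_o.big_trans) (rule power_bigo, simp)
qed

text \<open>Prepares the letter equal to the starting point, where the denominator of the form has a
  zero at 0 that has to be divided out.\<close>

lemma log_exp_divide_var:
  assumes h: "log_exp h (\<lambda>j. [:c j:])" and c0: "c 0 = 0"
  shows "log_exp (\<lambda>z. h z / of_real z) (\<lambda>j. [:c (Suc j):])"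
  unfolding log_exp_def
proof
  fix N
  have "(\<lambda>z. (h z - log_partial (\<lambda>j. [:c j:]) (Suc N) z) * inverse (of_real z)) \<in> O[at_right 0](\<lambda>z. of_real z ^ Suc N * inverse (of_real z))"
    by (rule landau_o.big.mult[OF h[unfolded log_exp_def, rule_format, of "Suc N"] landau_o.big_refl])
  also have "(\<lambda>z. of_real z ^ Suc N * inverse (of_real z) :: complex) \<in> O[at_right 0](\<lambda>z. of_real z ^ N)"
    by (rule bigoI[where c=1], rule eventually_mono[OF eventually_at_right_0[OF zero_less_one]]) (auto simp: norm_mult norm_power norm_inverse)
  finally have "(\<lambda>z. (h z - log_partial (\<lambda>j. [:c j:]) (Suc N) z) * inverse (of_real z)) \<in> O[at_right 0](\<lambda>z. of_real z ^ N)" .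
  then show "(\<lambda>z. h z / of_real z - log_partial (\<lambda>j. [:c (Suc j):]) N z) \<in> O[at_right 0](\<lambda>z. of_real z ^ N)"
  proof (rule bigo_ev_cong, intro eventually_mono[OF eventually_at_right_0[OF zero_less_one]])
    fix z :: real assume z: "0 < z \<and> z < 1"
    have "log_partial (\<lambda>j. [:c j:]) (Suc N) z = of_real z * log_partial (\<lambda>j. [:c (Suc j):]) N z"
      unfolding log_partial_def sum.atMost_Suc_shift by (simp add: c0 sum_distrib_left mult_ac)
    then show "(h z - log_partial (\<lambda>j. [:c j:]) (Suc N) z) * inverse (of_real z) = h z / of_real z - log_partial (\<lambda>j. [:c (Suc j):]) N z"
      using z by (simp add: field_simps)
  qed
qed

text \<open>If \<open>a\<close> is not the initial value, the denominator is an invertible series.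
  Otherwise its zero is simple, because \<open>d 1 0\<close> is nonzero, and the factor
  \<open>z\<close> cancels it.\<close>

lemma smooth_form_log_exp:
  assumes b: "0 < b"
    and d0: "\<And>t. t \<in> {0..b} \<Longrightarrow> d 0 t = g t"
    and d: "\<And>n t. t \<in> {0..b} \<Longrightarrow> (d n has_vector_derivative d (Suc n) t) (at t within {0..b})"
    and nz: "d 1 0 \<noteq> (0 :: complex)"
  shows "\<exists>P. log_exp (\<lambda>z. of_real z * (d 1 z / (g z - a))) P"
proof -
  have e: "log_exp (d m) (\<lambda>j. [:d (m + j) 0 / fact j:])" for m by (rule taylor_log_exp[of b d, OF d b])
  let ?h = "\<lambda>z. d 0 z + (- a)"
  let ?c = "\<lambda>j. d (0 + j) 0 / fact j + (if j = 0 then - a else 0)"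
  have "log_exp ?h (\<lambda>j. [:d (0 + j) 0 / fact j:] + (if j = 0 then [:- a:] else 0))"
    by (intro log_exp_add e log_exp_const)
  also have "(\<lambda>j. [:d (0 + j) 0 / fact j:] + (if j = 0 then [:- a:] else 0)) = (\<lambda>j. [:?c j:])"
    by (auto simp: fun_eq_iff)
  finally have h: "log_exp ?h (\<lambda>j. [:?c j:])" .
  have ev: "\<forall>\<^sub>F z in at_right 0. 0 < z \<and> z < b" by (rule eventually_at_right_0[OF b])
  show ?thesis
  proof (cases "a = d 0 0")
    case False
    then obtain B where B: "log_exp (\<lambda>z. inverse (?h z)) (\<lambda>j. [:B j:])"
      using log_exp_inverse[OF h] by auto
    have z: "log_exp (\<lambda>z. of_real z) (\<lambda>j. if j = 1 then [:1:] else 0)"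
      unfolding log_exp_def
    proof
      fix N
      show "(\<lambda>z. of_real z - log_partial (\<lambda>j. if j = 1 then [:1:] else 0) N z) \<in> O[at_right 0](\<lambda>z. of_real z ^ N)"
      proof (cases N)
        case 0
        then show ?thesis using power_bigo[of 0 1] by (simp add: log_partial_def)
      next
        case (Suc M)
        have "log_partial (\<lambda>j. if j = 1 then [:1:] else 0) N z = (\<Sum>j\<le>N. if j = 1 then of_real z else 0)" for z
          unfolding log_partial_def by (intro sum.cong) auto
        then have "log_partial (\<lambda>j. if j = 1 then [:1:] else 0) N z = of_real z" for z
          using Suc by simp
        then show ?thesis by simp
      qed
    qed
    have "\<exists>P. log_exp (\<lambda>z. of_real z * (d 1 z * inverse (?h z))) P"
      using log_exp_mult[OF z log_exp_mult[OF e[of 1] B]] by blast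
    then obtain P where "log_exp (\<lambda>z. of_real z * (d 1 z * inverse (?h z))) P" by blast
    then have "log_exp (\<lambda>z. of_real z * (d 1 z / (g z - a))) P"
      by (rule log_exp_cong, intro eventually_mono[OF ev]) (simp add: d0 divide_inverse)
    then show ?thesis by blast
  next
    case True
    have q: "log_exp (\<lambda>z. ?h z / of_real z) (\<lambda>j. [:?c (Suc j):])"
      by (rule log_exp_divide_var[OF h]) (simp add: True)
    obtain B where B: "log_exp (\<lambda>z. inverse (?h z / of_real z)) (\<lambda>j. [:B j:])"
      using log_exp_inverse[OF q] nz by auto
    obtain P where "log_exp (\<lambda>z. d 1 z * inverse (?h z / of_real z)) P"
      using log_exp_mult[OF e[of 1] B] by blast
    then have "log_exp (\<lambda>z. of_real z * (d 1 z / (g z - a))) P"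
      by (rule log_exp_cong, intro eventually_mono[OF ev]) (simp add: d0 divide_inverse)
    then show ?thesis by blast
  qed
qed

section \<open>Regularity of the path and growth of the forms at its ends\<close>

lemma positive_lower_bound:
  fixes h :: "real \<Rightarrow> real"
  assumes cont: "continuous_on {0<..<1} h" and pos: "\<And>t. 0 < t \<Longrightarrow> t < 1 \<Longrightarrow> 0 < h t"
    and c0: "c0 > 0" "\<forall>\<^sub>F t in at_right 0. c0 \<le> h t" and c1: "c1 > 0" "\<forall>\<^sub>F t in at_left 1. c1 \<le> h t"
  shows "\<exists>c>0. \<forall>t. 0 < t \<longrightarrow> t < 1 \<longrightarrow> c \<le> h t"
proof -
  obtain x where x: "x > 0" "\<And>t. 0 < t \<Longrightarrow> t < x \<Longrightarrow> c0 \<le> h t"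
    using c0(2) by (auto simp: eventually_at_right_field)
  obtain y where y: "y < 1" "\<And>t. y < t \<Longrightarrow> t < 1 \<Longrightarrow> c1 \<le> h t"
    using c1(2) by (auto simp: eventually_at_left_field)
  define x' y' where "x' = min x (1/2) / 2" and "y' = (max y (1/2) + 1) / 2"
  have xy: "0 < x'" "x' < x" "x' \<le> 1/2" "y < y'" "y' < 1" "1/2 \<le> y'" using x y by (auto simp: x'_def y'_def)
  have "\<exists>m\<in>{x'..y'}. \<forall>t\<in>{x'..y'}. h m \<le> h t"
    by (rule continuous_attains_inf) (use xy in \<open>auto intro!: continuous_on_subset[OF cont]\<close>)
  then obtain m where m: "m \<in> {x'..y'}" "\<And>t. t \<in> {x'..y'} \<Longrightarrow> h m \<le> h t" by blast
  show ?thesis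
  proof (intro exI[of _ "min (h m) (min c0 c1)"] conjI allI impI)
    show "0 < min (h m) (min c0 c1)" using pos[of m] m(1) xy c0 c1 by auto
    fix t :: real assume t: "0 < t" "t < 1"
    show "min (h m) (min c0 c1) \<le> h t"
      using m(2)[of t] x(2)[of t] y(2)[of t] t xy by (smt (verit) atLeastAtMost_iff)
  qed
qed

text \<open>\<open>t\<close> may itself be a break point; the two parts give the piece to its right
  and the piece to its left.\<close>

lemma finite_neighbours:
  fixes S :: "real set"
  assumes S: "finite S" "0 \<in> S" "1 \<in> S"
  shows "0 \<le> t \<Longrightarrow> t < 1 \<Longrightarrow> \<exists>a\<in>S. \<exists>b\<in>S. a \<le> t \<and> t < b \<and> {a<..<b} \<inter> S = {}"
    and "0 < t \<Longrightarrow> t \<le> 1 \<Longrightarrow> \<exists>a\<in>S. \<exists>b\<in>S. a < t \<and> t \<le> b \<and> {a<..<b} \<inter> S = {}"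
proof -
  assume t: "0 \<le> t" "t < 1"
  let ?A = "{s \<in> S. s \<le> t}" and ?B = "{s \<in> S. t < s}"
  have f: "finite ?A" "finite ?B" "?A \<noteq> {}" "?B \<noteq> {}" using S t by auto
  have "Max ?A \<in> ?A" "Min ?B \<in> ?B" using f by (auto intro: Max_in Min_in simp del: mem_Collect_eq)
  moreover have "{Max ?A<..<Min ?B} \<inter> S = {}"
  proof -
    have "s \<le> Max ?A \<or> Min ?B \<le> s" if "s \<in> S" for s
      using that f Max_ge[OF f(1), of s] Min_le[OF f(2), of s] by (cases "s \<le> t") auto
    then show ?thesis by force
  qed
  ultimately show "\<exists>a\<in>S. \<exists>b\<in>S. a \<le> t \<and> t < b \<and> {a<..<b} \<inter> S = {}" by blast
next
  assume t: "0 < t" "t \<le> 1"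
  let ?A = "{s \<in> S. s < t}" and ?B = "{s \<in> S. t \<le> s}"
  have f: "finite ?A" "finite ?B" "?A \<noteq> {}" "?B \<noteq> {}" using S t by auto
  have "Max ?A \<in> ?A" "Min ?B \<in> ?B" using f by (auto intro: Max_in Min_in simp del: mem_Collect_eq)
  moreover have "{Max ?A<..<Min ?B} \<inter> S = {}"
  proof -
    have "s \<le> Max ?A \<or> Min ?B \<le> s" if "s \<in> S" for s
      using that f Max_ge[OF f(1), of s] Min_le[OF f(2), of s] by (cases "s < t") auto
    then show ?thesis by force
  qed
  ultimately show "\<exists>a\<in>S. \<exists>b\<in>S. a < t \<and> t \<le> b \<and> {a<..<b} \<inter> S = {}" by blast
qed

text \<open>Set to 0 outside the open interval, so that it is a function on the whole real line
  whose values at the ends carry no junk.\<close>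

definition form :: "(real \<Rightarrow> complex) \<Rightarrow> complex \<Rightarrow> real \<Rightarrow> complex" where
  "form \<gamma> a t = (if 0 < t \<and> t < 1 then vector_derivative \<gamma> (at t) / (\<gamma> t - a) else 0)"

locale smooth_path =
  fixes \<gamma> :: "real \<Rightarrow> complex" and S :: "real set" and v w :: complex
  assumes S: "finite S" "0 \<in> S" "1 \<in> S" "S \<subseteq> {0..1}"
    and pieces: "\<And>a b. a \<in> S \<Longrightarrow> b \<in> S \<Longrightarrow> a < b \<Longrightarrow> {a<..<b} \<inter> S = {} \<Longrightarrow> smooth_on_Icc \<gamma> a b"
    and start: "((\<lambda>t. (\<gamma> t - \<gamma> 0) / of_real t) \<longlongrightarrow> v) (at_right 0)" "v \<noteq> 0"
    and finish: "((\<lambda>t. (\<gamma> t - \<gamma> 1) / of_real (t - 1)) \<longlongrightarrow> - w) (at_left 1)" "w \<noteq> 0"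
begin

lemma piece_cont:
  assumes "a \<in> S" "b \<in> S" "a < b" "{a<..<b} \<inter> S = {}"
  shows "continuous_on {a..b} \<gamma>"
proof -
  obtain d where d: "\<And>t. t \<in> {a..b} \<Longrightarrow> d 0 t = \<gamma> t"
    "\<And>n t. t \<in> {a..b} \<Longrightarrow> (d n has_vector_derivative d (Suc n) t) (at t within {a..b})" using pieces[OF assms] unfolding smooth_on_Icc_def by blast
  have "continuous_on {a..b} (d 0)"
    by (rule derivs_cont[of _ _ d]) (rule d(2))
  then show ?thesis by (rule continuous_on_eq) (rule d(1))
qed

lemma cont_right: "0 \<le> t \<Longrightarrow> t < 1 \<Longrightarrow> continuous (at_right t) \<gamma>"
proof -
  assume "0 \<le> t" "t < 1"
  then obtain a b where ab: "a \<in> S" "b \<in> S" "a \<le> t" "t < b" "{a<..<b} \<inter> S = {}"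
    using finite_neighbours(1)[OF S(1-3)] by metis
  then have "continuous_on {t..b} \<gamma>" by (intro continuous_on_subset[OF piece_cont[of a b]]) auto
  then have "continuous (at t within {t..b}) \<gamma>" using ab by (auto simp: continuous_on_eq_continuous_within)
  then show ?thesis using ab by (simp add: continuous_within at_within_Icc_at_right)
qed

lemma cont_left: "0 < t \<Longrightarrow> t \<le> 1 \<Longrightarrow> continuous (at_left t) \<gamma>"
proof -
  assume "0 < t" "t \<le> 1"
  then obtain a b where ab: "a \<in> S" "b \<in> S" "a < t" "t \<le> b" "{a<..<b} \<inter> S = {}"
    using finite_neighbours(2)[OF S(1-3)] by metis
  then have "continuous_on {a..t} \<gamma>" by (intro continuous_on_subset[OF piece_cont[of a b]]) auto
  then have "continuous (at t within {a..t}) \<gamma>" using ab by (auto simp: continuous_on_eq_continuous_within)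
  then show ?thesis using ab by (simp add: continuous_within at_within_Icc_at_left)
qed

lemma gamma_cont: "continuous_on {0<..<1} \<gamma>"
  by (rule continuous_at_imp_continuous_on) (auto simp: continuous_at_split intro: cont_left cont_right)

lemma gamma_tendsto: "(\<gamma> \<longlongrightarrow> \<gamma> 0) (at_right 0)" "(\<gamma> \<longlongrightarrow> \<gamma> 1) (at_left 1)"
  using cont_right[of 0] cont_left[of 1] by (auto simp: continuous_within)

abbreviation \<gamma>' :: "real \<Rightarrow> complex" where "\<gamma>' t \<equiv> vector_derivative \<gamma> (at t)"

lemma piece_deriv:
  assumes "a < t" "t < b" and d: "\<And>t. t \<in> {a..b} \<Longrightarrow> d 0 t = \<gamma> t"
    "\<And>n t. t \<in> {a..b} \<Longrightarrow> (d n has_vector_derivative d (Suc n) t) (at t within {a..b})"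
  shows "(\<gamma> has_vector_derivative d 1 t) (at t)" and "\<gamma>' t = d 1 t"
proof -
  have "(d 0 has_vector_derivative d 1 t) (at t)"
    using d(2)[of t 0] assms(1,2) by (simp add: at_within_Icc_at)
  then show *: "(\<gamma> has_vector_derivative d 1 t) (at t)"
    by (rule has_vector_derivative_transform_within_open[where S="{a<..<b}"]) (use assms d in auto)
  then show "\<gamma>' t = d 1 t" by (rule vector_derivative_at)
qed

lemma open_piece:
  assumes "t \<in> {0<..<1} - S"
  obtains a b d where "a \<in> S" "b \<in> S" "a < t" "t < b" "{a<..<b} \<inter> S = {}"
    "\<And>t. t \<in> {a..b} \<Longrightarrow> d 0 t = \<gamma> t"
    "\<And>n t. t \<in> {a..b} \<Longrightarrow> (d n has_vector_derivative d (Suc n) t) (at t within {a..b})"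
proof -
  obtain a b where ab: "a \<in> S" "b \<in> S" "a \<le> t" "t < b" "{a<..<b} \<inter> S = {}"
    using finite_neighbours(1)[OF S(1-3), of t] assms by auto
  then have "a < t" using assms by (cases "a = t") auto
  moreover obtain d where "\<And>t. t \<in> {a..b} \<Longrightarrow> d 0 t = \<gamma> t"
    "\<And>n t. t \<in> {a..b} \<Longrightarrow> (d n has_vector_derivative d (Suc n) t) (at t within {a..b})"
    using pieces[of a b] ab unfolding smooth_on_Icc_def by (metis le_less_trans)
  ultimately show thesis using that ab by blast
qed

lemma gamma_deriv: "t \<in> {0<..<1} - S \<Longrightarrow> (\<gamma> has_vector_derivative \<gamma>' t) (at t)"
proof -
  assume "t \<in> {0<..<1} - S"
  then obtain a b d where "a < t" "t < b" "\<And>t. t \<in> {a..b} \<Longrightarrow> d 0 t = \<gamma> t"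
    "\<And>n t. t \<in> {a..b} \<Longrightarrow> (d n has_vector_derivative d (Suc n) t) (at t within {a..b})"
    by (rule open_piece) blast
  from piece_deriv[of a t b d, OF this] show ?thesis by simp
qed

lemma deriv_cont: "continuous_on ({0<..<1} - S) \<gamma>'"
proof (rule continuous_at_imp_continuous_on, rule ballI)
  fix t assume "t \<in> {0<..<1} - S"
  then obtain a b d where ab: "a < t" "t < b" and d: "\<And>t. t \<in> {a..b} \<Longrightarrow> d 0 t = \<gamma> t"
    "\<And>n t. t \<in> {a..b} \<Longrightarrow> (d n has_vector_derivative d (Suc n) t) (at t within {a..b})"
    by (rule open_piece) blast
  have "(d 1 has_vector_derivative d (Suc 1) t) (at t)"
    using d(2)[of t 1] ab by (simp add: at_within_Icc_at)
  then have "isCont (d 1) t" by (rule has_vector_derivative_continuous)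
  moreover have "\<forall>\<^sub>F s in nhds t. d 1 s = \<gamma>' s"
  proof (rule eventually_mono[OF eventually_nhds_in_open[of "{a<..<b}" t]])
    show "d 1 s = \<gamma>' s" if "s \<in> {a<..<b}" for s using piece_deriv(2)[OF _ _ d] that by auto
  qed (use ab in auto)
  ultimately show "isCont \<gamma>' t" using isCont_cong[of "d 1" \<gamma>' t] by simp
qed

lemma deriv_bounded: "\<exists>M\<ge>0. \<forall>t. 0 < t \<longrightarrow> t < 1 \<longrightarrow> norm (\<gamma>' t) \<le> M"
proof -
  define I where "I = {(a, b). a \<in> S \<and> b \<in> S \<and> a < b \<and> {a<..<b} \<inter> S = {}}"
  have "I \<subseteq> S \<times> S" by (auto simp: I_def)
  then have fI: "finite I" using S(1) finite_subset by blast
  have 1: "bounded (\<gamma>' ` {a<..<b})" if abI: "(a, b) \<in> I" for a b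
  proof -
    obtain d where d: "\<And>t. t \<in> {a..b} \<Longrightarrow> d 0 t = \<gamma> t"
      "\<And>n t. t \<in> {a..b} \<Longrightarrow> (d n has_vector_derivative d (Suc n) t) (at t within {a..b})"
      using pieces[of a b] abI unfolding I_def smooth_on_Icc_def by blast
    have "continuous_on {a..b} (d 1)"
      by (rule derivs_cont[of _ _ d]) (rule d(2))
    then have "bounded (d 1 ` {a..b})" by (intro compact_imp_bounded compact_continuous_image) auto
    moreover have "\<gamma>' ` {a<..<b} \<subseteq> d 1 ` {a..b}" using piece_deriv(2)[OF _ _ d] by auto
    ultimately show ?thesis by (rule bounded_subset)
  qed
  \<comment> \<open>At a break point \<open>vector_derivative\<close> may be an arbitrary value, but
    there are only finitely many of them.\<close>
  have "bounded (\<gamma>' ` S \<union> (\<Union>(a, b)\<in>I. \<gamma>' ` {a<..<b}))"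
    using fI S(1) 1 by (intro bounded_Un[THEN iffD2] conjI finite_imp_bounded bounded_UN) auto
  moreover have "\<gamma>' ` {0<..<1} \<subseteq> \<gamma>' ` S \<union> (\<Union>(a, b)\<in>I. \<gamma>' ` {a<..<b})"
  proof
    fix y assume "y \<in> \<gamma>' ` {0<..<1}"
    then obtain t where t: "t \<in> {0<..<1}" "y = \<gamma>' t" by blast
    show "y \<in> \<gamma>' ` S \<union> (\<Union>(a, b)\<in>I. \<gamma>' ` {a<..<b})"
    proof (cases "t \<in> S")
      case False
      obtain a b where ab: "a \<in> S" "b \<in> S" "a \<le> t" "t < b" "{a<..<b} \<inter> S = {}"
        using finite_neighbours(1)[OF S(1-3), of t] t by auto
      then have "a < t" using False by (cases "a = t") auto
      with ab have "(a, b) \<in> I" "t \<in> {a<..<b}" by (auto simp: I_def)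
      then show ?thesis using t by blast
    qed (use t in auto)
  qed
  ultimately have "bounded (\<gamma>' ` {0<..<1})" by (rule bounded_subset)
  then obtain M where "\<forall>x\<in>\<gamma>' ` {0<..<1}. norm x \<le> M" unfolding bounded_iff by blast
  then show ?thesis by (intro exI[of _ "max M 0"]) (auto simp: le_max_iff_disj)
qed

text \<open>The end points of the path belong to this set as well, unless the open path returns to
  them.\<close>

definition letters_ok :: "complex set" where "letters_ok = - \<gamma> ` {0<..<1}"

lemma letters_ok_nz: "a \<in> letters_ok \<Longrightarrow> 0 < t \<Longrightarrow> t < 1 \<Longrightarrow> \<gamma> t - a \<noteq> 0"
  by (auto simp: letters_ok_def)

lemma form_cont:
  assumes "a \<in> letters_ok"
  shows "continuous_on ({0<..<1} - S) (form \<gamma> a)"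
proof (rule continuous_on_eq)
  show "continuous_on ({0<..<1} - S) (\<lambda>t. \<gamma>' t / (\<gamma> t - a))"
    by (intro continuous_intros deriv_cont continuous_on_subset[OF gamma_cont]) (use letters_ok_nz[OF assms] in auto)
qed (auto simp: form_def)

lemma form_measurable:
  assumes "a \<in> letters_ok"
  shows "form \<gamma> a \<in> borel_measurable borel"
proof -
  let ?U = "{0<..<1} - S"
  have U: "?U \<in> sets borel" using S(1) by (intro sets.Diff) (auto intro: borel_closed finite_imp_closed)
  have [measurable]: "(\<lambda>t. indicator ?U t *\<^sub>R form \<gamma> a t) \<in> borel_measurable borel"
    by (rule borel_measurable_continuous_on_indicator[OF U form_cont[OF assms]])
  have "(\<lambda>t. indicator ?U t *\<^sub>R form \<gamma> a t + (\<Sum>s\<in>S. indicator {s} t *\<^sub>R form \<gamma> a s)) \<in> borel_measurable borel"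
    by measurable
  also have "(\<lambda>t. indicator ?U t *\<^sub>R form \<gamma> a t + (\<Sum>s\<in>S. indicator {s} t *\<^sub>R form \<gamma> a s)) = form \<gamma> a"
  proof
    fix t
    have "(\<Sum>s\<in>S. indicator {s} t *\<^sub>R form \<gamma> a s) = (\<Sum>s\<in>S. if s = t then form \<gamma> a t else 0)"
      by (intro sum.cong) auto
    also have "\<dots> = (if t \<in> S then form \<gamma> a t else 0)" using S(1) by simp
    finally show "indicator ?U t *\<^sub>R form \<gamma> a t + (\<Sum>s\<in>S. indicator {s} t *\<^sub>R form \<gamma> a s) = form \<gamma> a t"
      by (auto simp: indicator_def form_def)
  qed
  finally show ?thesis .
qed

text \<open>For \<open>a\<close> equal to the starting point the linear lower bound is the
  nonvanishing of the tangent vector; for other \<open>a\<close> it follows from a constant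
  one.\<close>

lemma near_start:
  "\<exists>c>0. \<forall>\<^sub>F t in at_right 0. c * t \<le> norm (\<gamma> t - a)"
  "a \<noteq> \<gamma> 0 \<Longrightarrow> \<exists>c>0. \<forall>\<^sub>F t in at_right 0. c \<le> norm (\<gamma> t - a)"
proof -
  show 2: "\<exists>c>0. \<forall>\<^sub>F t in at_right 0. c \<le> norm (\<gamma> t - a)" if "a \<noteq> \<gamma> 0"
  proof (intro exI[of _ "norm (\<gamma> 0 - a) / 2"] conjI)
    have "((\<lambda>t. norm (\<gamma> t - a)) \<longlongrightarrow> norm (\<gamma> 0 - a)) (at_right 0)" by (intro tendsto_intros gamma_tendsto)
    from order_tendstoD(1)[OF this, of "norm (\<gamma> 0 - a) / 2"] that
    show "\<forall>\<^sub>F t in at_right 0. norm (\<gamma> 0 - a) / 2 \<le> norm (\<gamma> t - a)" by (auto elim: eventually_mono)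
  qed (use that in auto)
  show "\<exists>c>0. \<forall>\<^sub>F t in at_right 0. c * t \<le> norm (\<gamma> t - a)"
  proof (cases "a = \<gamma> 0")
    case True
    have "\<forall>\<^sub>F t in at_right 0. norm v / 2 < norm ((\<gamma> t - \<gamma> 0) / of_real t)"
      by (rule order_tendstoD(1)[OF tendsto_norm[OF start(1)]]) (use start(2) in auto)
    then have "\<forall>\<^sub>F t in at_right 0. norm v / 2 * t \<le> norm (\<gamma> t - a)"
      using eventually_at_right_0[OF zero_less_one]
      by eventually_elim (auto simp: norm_divide True field_simps)
    then show ?thesis using start(2) by (intro exI[of _ "norm v / 2"]) auto
  next
    case False
    then obtain c where c: "c > 0" "\<forall>\<^sub>F t in at_right 0. c \<le> norm (\<gamma> t - a)" using 2 by blast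
    have "\<forall>\<^sub>F t in at_right 0. c * t \<le> norm (\<gamma> t - a)"
      using c(2) eventually_at_right_0[OF zero_less_one]
    proof eventually_elim
      case (elim t)
      have "c * t \<le> c" using elim c(1) by (simp add: mult_left_le)
      then show ?case using elim by simp
    qed
    then show ?thesis using c(1) by blast
  qed
qed

lemma eventually_at_left_1: "\<forall>\<^sub>F t in at_left 1. 0 < t \<and> t < (1::real)"
  by (auto simp: eventually_at_left_field intro!: exI[of _ 0])

lemma near_end:
  "\<exists>c>0. \<forall>\<^sub>F t in at_left 1. c * (1 - t) \<le> norm (\<gamma> t - a)"
  "a \<noteq> \<gamma> 1 \<Longrightarrow> \<exists>c>0. \<forall>\<^sub>F t in at_left 1. c \<le> norm (\<gamma> t - a)"
proof -
  show 2: "\<exists>c>0. \<forall>\<^sub>F t in at_left 1. c \<le> norm (\<gamma> t - a)" if "a \<noteq> \<gamma> 1"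
  proof (intro exI[of _ "norm (\<gamma> 1 - a) / 2"] conjI)
    have "((\<lambda>t. norm (\<gamma> t - a)) \<longlongrightarrow> norm (\<gamma> 1 - a)) (at_left 1)" by (intro tendsto_intros gamma_tendsto)
    from order_tendstoD(1)[OF this, of "norm (\<gamma> 1 - a) / 2"] that
    show "\<forall>\<^sub>F t in at_left 1. norm (\<gamma> 1 - a) / 2 \<le> norm (\<gamma> t - a)" by (auto elim: eventually_mono)
  qed (use that in auto)
  show "\<exists>c>0. \<forall>\<^sub>F t in at_left 1. c * (1 - t) \<le> norm (\<gamma> t - a)"
  proof (cases "a = \<gamma> 1")
    case True
    have "\<forall>\<^sub>F t in at_left 1. norm w / 2 < norm ((\<gamma> t - \<gamma> 1) / of_real (t - 1))"
      by (rule order_tendstoD(1)[OF tendsto_norm[OF finish(1)]]) (use finish(2) in auto)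
    then have "\<forall>\<^sub>F t in at_left 1. norm w / 2 * (1 - t) \<le> norm (\<gamma> t - a)"
      using eventually_at_left_1
    proof eventually_elim
      case (elim t)
      have n: "norm (of_real (t - 1) :: complex) = 1 - t" using elim by (simp only: norm_of_real) simp
      have "norm w / 2 < norm (\<gamma> t - \<gamma> 1) / (1 - t)" using elim(1) unfolding norm_divide n .
      then show ?case using elim(2) by (simp add: True pos_less_divide_eq)
    qed
    then show ?thesis using finish(2) by (intro exI[of _ "norm w / 2"]) auto
  next
    case False
    then obtain c where c: "c > 0" "\<forall>\<^sub>F t in at_left 1. c \<le> norm (\<gamma> t - a)" using 2 by blast
    have "\<forall>\<^sub>F t in at_left 1. c * (1 - t) \<le> norm (\<gamma> t - a)"
      using c(2) eventually_at_left_1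
    proof eventually_elim
      case (elim t)
      have "c * (1 - t) \<le> c" using elim c(1) by (simp add: mult_left_le)
      then show ?case using elim by simp
    qed
    then show ?thesis using c(1) by blast
  qed
qed

text \<open>\<open>e\<close> is the allowed order of vanishing of \<open>\<gamma> t - a\<close> at
  the two ends: \<open>t * (1 - t)\<close> for all letters, \<open>1 - t\<close> for letters other
  than the starting point, and 1 for letters other than both end points.\<close>

lemma form_bound_gen:
  assumes a: "a \<in> letters_ok" and e: "continuous_on {0<..<1} e" "\<And>t. 0 < t \<Longrightarrow> t < 1 \<Longrightarrow> 0 < e t"
    and c0: "c0 > 0" "\<forall>\<^sub>F t in at_right 0. c0 * e t \<le> norm (\<gamma> t - a)"
    and c1: "c1 > 0" "\<forall>\<^sub>F t in at_left 1. c1 * e t \<le> norm (\<gamma> t - a)"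
  shows "\<exists>C\<ge>0. \<forall>t. 0 < t \<longrightarrow> t < 1 \<longrightarrow> norm (form \<gamma> a t) \<le> C * (1 / e t)"
proof -
  obtain M where M: "M \<ge> 0" "\<And>t. 0 < t \<Longrightarrow> t < 1 \<Longrightarrow> norm (\<gamma>' t) \<le> M" using deriv_bounded by blast
  have "\<exists>c>0. \<forall>t. 0 < t \<longrightarrow> t < 1 \<longrightarrow> c \<le> norm (\<gamma> t - a) / e t"
  proof (rule positive_lower_bound[OF _ _ c0(1) _ c1(1)])
    show "continuous_on {0<..<1} (\<lambda>t. norm (\<gamma> t - a) / e t)"
      by (intro continuous_intros gamma_cont e(1)) (use e(2) in force)
    show "0 < norm (\<gamma> t - a) / e t" if "0 < t" "t < 1" for t using letters_ok_nz[OF a that] e(2)[OF that] by simp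
    show "\<forall>\<^sub>F t in at_right 0. c0 \<le> norm (\<gamma> t - a) / e t"
      using c0(2) eventually_at_right_0[OF zero_less_one] by eventually_elim (auto simp: e(2) pos_le_divide_eq)
    show "\<forall>\<^sub>F t in at_left 1. c1 \<le> norm (\<gamma> t - a) / e t"
      using c1(2) eventually_at_left_1 by eventually_elim (auto simp: e(2) pos_le_divide_eq)
  qed
  then obtain c where c: "c > 0" "\<And>t. 0 < t \<Longrightarrow> t < 1 \<Longrightarrow> c \<le> norm (\<gamma> t - a) / e t" by blast
  show ?thesis
  proof (intro exI[of _ "M / c"] conjI allI impI)
    fix t :: real assume t: "0 < t" "t < 1"
    have ce: "c * e t \<le> norm (\<gamma> t - a)" using c(2)[OF t] e(2)[OF t] by (simp add: pos_le_divide_eq)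
    have "norm (form \<gamma> a t) = norm (\<gamma>' t) / norm (\<gamma> t - a)" using t by (simp add: form_def norm_divide)
    also have "\<dots> \<le> M / (c * e t)"
      using M(1) M(2)[OF t] ce c(1) e(2)[OF t] by (intro frac_le) auto
    finally show "norm (form \<gamma> a t) \<le> M / c * (1 / e t)" by simp
  qed (use M c in auto)
qed

lemma form_bound: "a \<in> letters_ok \<Longrightarrow> \<exists>C\<ge>0. \<forall>t. 0 < t \<longrightarrow> t < 1 \<longrightarrow> norm (form \<gamma> a t) \<le> C * lam t"
proof -
  assume a: "a \<in> letters_ok"
  obtain c0 where c0: "c0 > 0" "\<forall>\<^sub>F t in at_right 0. c0 * t \<le> norm (\<gamma> t - a)" using near_start(1) by blast
  obtain c1 where c1: "c1 > 0" "\<forall>\<^sub>F t in at_left 1. c1 * (1 - t) \<le> norm (\<gamma> t - a)" using near_end(1) by blast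
  have "\<exists>C\<ge>0. \<forall>t. 0 < t \<longrightarrow> t < 1 \<longrightarrow> norm (form \<gamma> a t) \<le> C * (1 / (t * (1 - t)))"
  proof (rule form_bound_gen[OF a _ _ c0(1) _ c1(1)])
    show "\<forall>\<^sub>F t in at_right 0. c0 * (t * (1 - t)) \<le> norm (\<gamma> t - a)"
      using c0(2) eventually_at_right_0[OF zero_less_one]
    proof eventually_elim
      case (elim t)
      have "c0 * (t * (1 - t)) \<le> c0 * t" using elim c0(1) by (intro mult_left_mono) (auto simp: mult_left_le)
      then show ?case using elim by linarith
    qed
    show "\<forall>\<^sub>F t in at_left 1. c1 * (t * (1 - t)) \<le> norm (\<gamma> t - a)"
      using c1(2) eventually_at_left_1
    proof eventually_elim
      case (elim t)
      have "c1 * (t * (1 - t)) \<le> c1 * (1 - t)" using elim c1(1) by (intro mult_left_mono) (auto simp: mult_left_le_one_le)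
      then show ?case using elim by linarith
    qed
  qed (auto intro!: continuous_intros)
  then show ?thesis by (simp add: lam_def)
qed

lemma form_bound_start: "a \<in> letters_ok \<Longrightarrow> a \<noteq> \<gamma> 0 \<Longrightarrow> \<exists>C\<ge>0. \<forall>t. 0 < t \<longrightarrow> t < 1 \<longrightarrow> norm (form \<gamma> a t) \<le> C * (1 / (1 - t))"
proof -
  assume a: "a \<in> letters_ok" "a \<noteq> \<gamma> 0"
  obtain c0 where c0: "c0 > 0" "\<forall>\<^sub>F t in at_right 0. c0 \<le> norm (\<gamma> t - a)" using near_start(2)[OF a(2)] by blast
  obtain c1 where c1: "c1 > 0" "\<forall>\<^sub>F t in at_left 1. c1 * (1 - t) \<le> norm (\<gamma> t - a)" using near_end(1) by blast
  show ?thesis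
  proof (rule form_bound_gen[OF a(1) _ _ c0(1) _ c1])
    show "\<forall>\<^sub>F t in at_right 0. c0 * (1 - t) \<le> norm (\<gamma> t - a)"
      using c0(2) eventually_at_right_0[OF zero_less_one]
    proof eventually_elim
      case (elim t)
      have "c0 * (1 - t) \<le> c0" using elim c0(1) by (simp add: mult_left_le)
      then show ?case using elim by linarith
    qed
  qed (auto intro!: continuous_intros)
qed

lemma form_bound_both: "a \<in> letters_ok \<Longrightarrow> a \<noteq> \<gamma> 0 \<Longrightarrow> a \<noteq> \<gamma> 1 \<Longrightarrow> \<exists>C\<ge>0. \<forall>t. 0 < t \<longrightarrow> t < 1 \<longrightarrow> norm (form \<gamma> a t) \<le> C"
proof -
  assume a: "a \<in> letters_ok" "a \<noteq> \<gamma> 0" "a \<noteq> \<gamma> 1"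
  obtain c0 where c0: "c0 > 0" "\<forall>\<^sub>F t in at_right 0. c0 \<le> norm (\<gamma> t - a)" using near_start(2)[OF a(2)] by blast
  obtain c1 where c1: "c1 > 0" "\<forall>\<^sub>F t in at_left 1. c1 \<le> norm (\<gamma> t - a)" using near_end(2)[OF a(3)] by blast
  have "\<exists>C\<ge>0. \<forall>t. 0 < t \<longrightarrow> t < 1 \<longrightarrow> norm (form \<gamma> a t) \<le> C * (1 / 1)"
    by (rule form_bound_gen[OF a(1) _ _ c0(1) _ c1(1)]) (use c0 c1 in auto)
  then show ?thesis by simp
qed

lemma form_log_exp_start: "\<exists>P. log_exp (\<lambda>z. of_real z * form \<gamma> a z) P"
proof -
  obtain a' b where ab: "a' \<in> S" "b \<in> S" "a' \<le> 0" "0 < b" "{a'<..<b} \<inter> S = {}"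
    using finite_neighbours(1)[OF S(1-3), of 0] by auto
  have "{0<..<b} \<subseteq> {a'<..<b}" using ab by auto
  then have b: "{0<..<b} \<inter> S = {}" "b \<le> 1" using ab S(4) by (blast, auto)
  obtain d where d: "\<And>t. t \<in> {0..b} \<Longrightarrow> d 0 t = \<gamma> t"
    "\<And>n t. t \<in> {0..b} \<Longrightarrow> (d n has_vector_derivative d (Suc n) t) (at t within {0..b})"
    using pieces[OF S(2) ab(2,4) b(1)] unfolding smooth_on_Icc_def by blast
  \<comment> \<open>The one-sided derivative of the first smooth piece is the prescribed tangent
    vector, hence nonzero as \<open>smooth_form_log_exp\<close> requires.\<close>
  have "d 1 0 = v"
  proof -
    have "((\<lambda>y. (1 / norm (y - 0)) *\<^sub>R (d 0 y - (d 0 0 + (y - 0) *\<^sub>R d (Suc 0) 0))) \<longlongrightarrow> 0) (at 0 within {0..b})"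
      using d(2)[of 0 0] ab(4) unfolding has_vector_derivative_def has_derivative_within by auto
    then have "((\<lambda>y. (1 / norm (y - 0)) *\<^sub>R (d 0 y - (d 0 0 + (y - 0) *\<^sub>R d (Suc 0) 0))) \<longlongrightarrow> 0) (at_right 0)"
      using ab(4) by (simp only: at_within_Icc_at_right)
    then have "((\<lambda>y. (\<gamma> y - \<gamma> 0) / of_real y - d 1 0) \<longlongrightarrow> 0) (at_right 0)"
    proof (rule Lim_transform_eventually, intro eventually_mono[OF eventually_at_right_0[OF ab(4)]])
      fix y assume y: "0 < y \<and> y < b"
      then have "d 0 y = \<gamma> y" "d 0 0 = \<gamma> 0" using d(1) by auto
      then show "(1 / norm (y - 0)) *\<^sub>R (d 0 y - (d 0 0 + (y - 0) *\<^sub>R d (Suc 0) 0)) = (\<gamma> y - \<gamma> 0) / of_real y - d 1 0"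
        using y by (simp add: scaleR_conv_of_real field_simps)
    qed
    then have "((\<lambda>y. (\<gamma> y - \<gamma> 0) / of_real y) \<longlongrightarrow> d 1 0) (at_right 0)" by (simp add: LIM_zero_iff)
    then show ?thesis using start(1) tendsto_unique trivial_limit_at_right_real by blast
  qed
  then obtain P where "log_exp (\<lambda>z. of_real z * (d 1 z / (\<gamma> z - a))) P"
    using smooth_form_log_exp[where d=d and g=\<gamma> and b=b and a=a] d ab(4) start(2) by auto
  then have "log_exp (\<lambda>z. of_real z * form \<gamma> a z) P"
    by (rule log_exp_cong, intro eventually_mono[OF eventually_at_right_0[OF ab(4)]])
       (use b piece_deriv(2)[OF _ _ d] in \<open>auto simp: form_def\<close>)
  then show ?thesis by blast
qed

end

section \<open>Reversal of the path\<close>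

lemma has_vector_derivative_reflect:
  assumes "(f has_vector_derivative f') (at (1 - t) within {1 - y..1 - x})"
  shows "((\<lambda>t. f (1 - t)) has_vector_derivative - f') (at t within {x..y})"
proof -
  have "((\<lambda>t. 1 - t) has_vector_derivative - 1) (at t within {x..y})"
    by (auto intro!: derivative_eq_intros)
  moreover have "(\<lambda>t. 1 - t) ` {x..y} = {1 - y..1 - x}" by (auto simp: image_iff intro!: bexI[of _ "1 - _"])
  ultimately have "((f \<circ> (\<lambda>t. 1 - t)) has_vector_derivative - 1 *\<^sub>R f') (at t within {x..y})"
    using assms by (intro vector_diff_chain_within) auto
  then show ?thesis by (simp add: o_def)
qed

lemma smooth_on_Icc_reflect:
  assumes "smooth_on_Icc g (1 - b) (1 - a)"
  shows "smooth_on_Icc (\<lambda>t. g (1 - t)) a b"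
proof -
  obtain d where d: "\<And>t. t \<in> {1 - b..1 - a} \<Longrightarrow> d 0 t = g t"
    "\<And>n t. t \<in> {1 - b..1 - a} \<Longrightarrow> (d n has_vector_derivative d (Suc n) t) (at t within {1 - b..1 - a})"
    using assms unfolding smooth_on_Icc_def by blast
  have "((\<lambda>t. (-1) ^ n * d n (1 - t)) has_vector_derivative (-1) ^ Suc n * d (Suc n) (1 - t)) (at t within {a..b})"
    if "t \<in> {a..b}" for n t
  proof -
    have "((\<lambda>t. (-1) ^ n * d n (1 - t)) has_vector_derivative (-1) ^ n * - d (Suc n) (1 - t)) (at t within {a..b})"
      by (intro has_vector_derivative_mult_right has_vector_derivative_reflect d(2)) (use that in auto)
    then show ?thesis by simp
  qed
  then show ?thesis unfolding smooth_on_Icc_def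
    using d(1) by (intro exI[of _ "\<lambda>n t. (-1) ^ n * d n (1 - t)"]) auto
qed

context smooth_path
begin

text \<open>Carries the expansion at the start over to the end. The sign in the condition at 1 makes
  \<open>w\<close> the initial tangent vector of the reversed path, so \<open>v\<close> and
  \<open>w\<close> simply change places.\<close>

lemma reflected: "smooth_path (\<lambda>t. \<gamma> (1 - t)) ((\<lambda>t. 1 - t) ` S) w v"
proof
  show "finite ((\<lambda>t. 1 - t) ` S)" "(\<lambda>t. 1 - t) ` S \<subseteq> {0..1}" using S by auto
  show "0 \<in> (\<lambda>t. 1 - t) ` S" "1 \<in> (\<lambda>t. 1 - t) ` S" using S by (auto simp: image_iff intro: bexI[of _ 0] bexI[of _ 1])
  show "w \<noteq> 0" "v \<noteq> 0" using start finish by auto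
  show "smooth_on_Icc (\<lambda>t. \<gamma> (1 - t)) a b"
    if "a \<in> (\<lambda>t. 1 - t) ` S" "b \<in> (\<lambda>t. 1 - t) ` S" "a < b" "{a<..<b} \<inter> (\<lambda>t. 1 - t) ` S = {}" for a b
  proof (rule smooth_on_Icc_reflect, rule pieces)
    show "1 - b \<in> S" "1 - a \<in> S" "1 - b < 1 - a" using that by auto
    show "{1 - b<..<1 - a} \<inter> S = {}"
    proof (rule ccontr)
      assume "{1 - b<..<1 - a} \<inter> S \<noteq> {}"
      then obtain s where "s \<in> S" "1 - b < s" "s < 1 - a" by auto
      then have "1 - s \<in> {a<..<b} \<inter> (\<lambda>t. 1 - t) ` S" by auto
      then show False using that(4) by blast
    qed
  qed
  have fl: "filterlim (\<lambda>t. 1 - t) (at_left 1) (at_right (0::real))" "filterlim (\<lambda>t. 1 - t) (at_right 0) (at_left (1::real))"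
    by (auto simp: filterlim_at eventually_at_filter intro!: tendsto_eq_intros)
  have "((\<lambda>t. (\<gamma> (1 - t) - \<gamma> 1) / of_real ((1 - t) - 1)) \<longlongrightarrow> - w) (at_right 0)"
    by (rule filterlim_compose[OF finish(1) fl(1)])
  from tendsto_minus[OF this] show "((\<lambda>t. (\<gamma> (1 - t) - \<gamma> (1 - 0)) / of_real t) \<longlongrightarrow> w) (at_right 0)" by simp
  have "((\<lambda>t. (\<gamma> (1 - t) - \<gamma> 0) / of_real (1 - t)) \<longlongrightarrow> v) (at_left 1)"
    by (rule filterlim_compose[OF start(1) fl(2)])
  from tendsto_minus[OF this] have "((\<lambda>t. - ((\<gamma> (1 - t) - \<gamma> 0) / of_real (1 - t))) \<longlongrightarrow> - v) (at_left 1)" .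
  moreover have "- ((\<gamma> (1 - t) - \<gamma> 0) / of_real (1 - t)) = (\<gamma> (1 - t) - \<gamma> (1 - 1)) / of_real (t - 1)" for t
    unfolding minus_divide_right by simp
  ultimately show "((\<lambda>t. (\<gamma> (1 - t) - \<gamma> (1 - 1)) / of_real (t - 1)) \<longlongrightarrow> - v) (at_left 1)" by simp
qed

lemma form_log_exp_end: "\<exists>P. log_exp (\<lambda>z. of_real z * form \<gamma> a (1 - z)) P"
proof -
  interpret R: smooth_path "\<lambda>t. \<gamma> (1 - t)" "(\<lambda>t. 1 - t) ` S" w v by (rule reflected)
  obtain P where P: "log_exp (\<lambda>z. of_real z * form (\<lambda>t. \<gamma> (1 - t)) a z) P" using R.form_log_exp_start by blast
  \<comment> \<open>The derivative of the reversed path carries the sign -1, which has to be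
    undone.\<close>
  have Q: "log_exp (\<lambda>z. - 1 * (of_real z * form (\<lambda>t. \<gamma> (1 - t)) a z)) (\<lambda>n. \<Sum>i\<le>n. (if i = 0 then [:- 1:] else 0) * P (n - i))"
    by (rule log_exp_mult[OF log_exp_const P])
  obtain e where e: "e > 0" "e \<le> 1/2" "{0<..<e} \<inter> (\<lambda>t. 1 - t) ` S = {}"
  proof -
    have "finite ((\<lambda>t. 1 - t) ` S)" using S(1) by simp
    from finite_set_avoid[OF this, of 0]
    obtain d where "d > 0" "\<forall>x\<in>(\<lambda>t. 1 - t) ` S. x \<noteq> 0 \<longrightarrow> d \<le> dist 0 x" by blast
    then show ?thesis by (intro that[of "min d (1/2)"]) (fastforce simp: dist_real_def)+
  qed
  have "log_exp (\<lambda>z. of_real z * form \<gamma> a (1 - z)) (\<lambda>n. \<Sum>i\<le>n. (if i = 0 then [:- 1:] else 0) * P (n - i))"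
  proof (rule log_exp_cong[OF Q], rule eventually_mono[OF eventually_at_right_0[OF e(1)]])
    fix z assume z: "0 < z \<and> z < e"
    have zS: "1 - z \<in> {0<..<1} - S"
    proof -
      have "1 - z \<notin> S"
      proof
        assume "1 - z \<in> S"
        then have "z \<in> {0<..<e} \<inter> (\<lambda>t. 1 - t) ` S" using z by (auto intro!: image_eqI[of _ _ "1 - z"])
        then show False using e(3) by blast
      qed
      then show ?thesis using z e by auto
    qed
    have "((\<gamma> \<circ> (\<lambda>t. 1 - t)) has_vector_derivative (- 1) *\<^sub>R \<gamma>' (1 - z)) (at z)"
      by (rule vector_diff_chain_at[where f="\<lambda>t. 1 - t" and g=\<gamma>, OF _ gamma_deriv[OF zS]])
         (auto intro!: derivative_eq_intros)
    then have "vector_derivative (\<lambda>t. \<gamma> (1 - t)) (at z) = - \<gamma>' (1 - z)"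
      by (simp add: o_def vector_derivative_at)
    then show "- 1 * (of_real z * form (\<lambda>t. \<gamma> (1 - t)) a z) = of_real z * form \<gamma> a (1 - z)"
      using z e by (simp add: form_def)
  qed
  then show ?thesis by blast
qed

lemma path_forms_exp: "path_forms_exp S letters_ok (\<gamma> 0) (form \<gamma>)"
proof
  fix a assume a: "a \<in> letters_ok"
  show "form \<gamma> a \<in> borel_measurable borel" by (rule form_measurable[OF a])
  show "continuous_on ({0<..<1} - S) (form \<gamma> a)" by (rule form_cont[OF a])
  show "\<exists>C\<ge>0. \<forall>t>0. t < 1 \<longrightarrow> norm (form \<gamma> a t) \<le> C * lam t" by (rule form_bound[OF a])
  show "\<exists>C\<ge>0. \<forall>t>0. t < 1 \<longrightarrow> norm (form \<gamma> a t) \<le> C * (1 / (1 - t))" if "a \<noteq> \<gamma> 0"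
    by (rule form_bound_start[OF a that])
  show "\<exists>P. log_exp (\<lambda>z. of_real z * form \<gamma> a z) P" by (rule form_log_exp_start)
  show "\<exists>P. log_exp (\<lambda>z. of_real z * form \<gamma> a (1 - z)) P" by (rule form_log_exp_end)
qed (rule S(1))

end

section \<open>Rooted trees\<close>

definition children :: "'v crtree \<Rightarrow> 'v \<Rightarrow> 'v set" where
  "children X v = {c \<in> verts X - {rt X}. parent X c = v}"

lemma walk_Cons: "walk X u (x # xs) v \<longleftrightarrow> x = u \<and> x \<in> verts X \<and>
    (if xs = [] then u = v else {u, hd xs} \<in> edges X \<and> walk X (hd xs) xs v)"
  by (cases xs) (auto simp: walk_def)

lemma walk_append:
  "walk X u xs v \<Longrightarrow> walk X v ys w \<Longrightarrow> walk X u (xs @ tl ys) w"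
  unfolding walk_def by (cases ys) (auto simp: successively_append_iff successively_Cons)

lemma walk_rev: "walk X u xs v \<Longrightarrow> walk X v (rev xs) u"
  unfolding walk_def by (auto simp: hd_rev last_rev insert_commute)

text \<open>When a new step leads back to a vertex of the list, the list is cut off at that
  vertex.\<close>

lemma rtranclp_distinct_path:
  assumes "rtranclp R x y"
  shows "\<exists>xs. xs \<noteq> [] \<and> distinct xs \<and> hd xs = x \<and> last xs = y \<and> successively R xs"
  using assms
proof (induction rule: rtranclp_induct)
  case base
  show ?case by (intro exI[of _ "[x]"]) simp
next
  case (step y z)
  then obtain xs where xs: "xs \<noteq> []" "distinct xs" "hd xs = x" "last xs = y" "successively R xs" by blast
  show ?case
  proof (cases "z \<in> set xs")
    case True
    then obtain as bs where "xs = as @ z # bs" by (meson split_list)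
    moreover from this have "successively R ((as @ [z]) @ bs)" using xs(5) by simp
    then have "successively R (as @ [z])" by (simp only: successively_append_iff)
    ultimately show ?thesis using xs
      by (intro exI[of _ "as @ [z]"]) (cases as; auto)
  next
    case False
    then show ?thesis using xs step(2)
      by (intro exI[of _ "xs @ [z]"]) (auto simp: successively_append_iff)
  qed
qed

locale tree =
  fixes X :: "'v crtree"
  assumes tree: "is_tree X"
begin

lemma fin_verts: "finite (verts X)" and root_vert: "rt X \<in> verts X"
  using tree by (simp_all add: is_tree_def)

lemma edge_verts: "d \<in> edges X \<Longrightarrow> d \<subseteq> verts X \<and> card d = 2"
  using tree by (simp add: is_tree_def)

lemma connected: "u \<in> verts X \<Longrightarrow> v \<in> verts X \<Longrightarrow> \<exists>xs. walk X u xs v"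
  using tree by (simp add: is_tree_def)

lemma acyclic: "simple_walk X u xs v \<Longrightarrow> length xs \<ge> 3 \<Longrightarrow> {v, u} \<notin> edges X"
  using tree unfolding is_tree_def by blast

lemma edge_neq: "{u, v} \<in> edges X \<Longrightarrow> u \<noteq> v"
  using edge_verts[of "{u, v}"] by (auto simp: card_insert_if)

lemma root_dist_walk:
  assumes "v \<in> verts X"
  shows "\<exists>xs. walk X v xs (rt X) \<and> length xs = Suc (root_dist X v)"
proof -
  obtain xs where xs: "walk X v xs (rt X)" using connected[OF assms root_vert] by blast
  then have "length xs = Suc (length xs - 1)" by (cases xs) (auto simp: walk_def)
  with xs have "\<exists>n xs. walk X v xs (rt X) \<and> length xs = Suc n" by blast
  then show ?thesis unfolding root_dist_def by (rule LeastI_ex)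
qed

lemma root_dist_le: "walk X v xs (rt X) \<Longrightarrow> length xs = Suc n \<Longrightarrow> root_dist X v \<le> n"
  unfolding root_dist_def by (rule Least_le) blast

lemma neighborsD: "u \<in> neighbors X v \<Longrightarrow> u \<in> verts X \<and> v \<in> verts X \<and> {u, v} \<in> edges X \<and> u \<noteq> v"
  using edge_verts[of "{u, v}"] edge_neq[of u v] by (auto simp: neighbors_def)

lemma root_dist_neighbor:
  assumes "u \<in> neighbors X v"
  shows "root_dist X u \<le> Suc (root_dist X v)"
proof -
  have uv: "u \<in> verts X" "v \<in> verts X" "{u, v} \<in> edges X" using neighborsD[OF assms] by auto
  obtain xs where xs: "walk X v xs (rt X)" "length xs = Suc (root_dist X v)" using root_dist_walk[OF uv(2)] by blast
  have "walk X u (u # xs) (rt X)" using xs uv by (auto simp: walk_Cons) (auto simp: walk_def)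
  then show ?thesis using xs by (intro root_dist_le) auto
qed

text \<open>The second vertex of a shortest walk to the root.\<close>

lemma ex_closer_neighbor:
  assumes "v \<in> verts X" "v \<noteq> rt X"
  shows "\<exists>u\<in>neighbors X v. Suc (root_dist X u) = root_dist X v"
proof -
  obtain xs where xs: "walk X v xs (rt X)" "length xs = Suc (root_dist X v)" using root_dist_walk[OF assms(1)] by blast
  obtain y ys where y: "xs = v # y # ys"
    using xs assms by (cases xs; cases "tl xs") (auto simp: walk_def)
  have w: "walk X y (y # ys) (rt X)" "{v, y} \<in> edges X" "y \<in> verts X" using xs(1) unfolding y by (auto simp: walk_def)
  have "root_dist X y \<le> length ys" by (rule root_dist_le[OF w(1)]) simp
  then have "Suc (root_dist X y) \<le> root_dist X v" using xs(2) y by simp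
  moreover have yn: "y \<in> neighbors X v" "v \<in> neighbors X y" using w assms by (auto simp: neighbors_def insert_commute)
  moreover have "root_dist X v \<le> Suc (root_dist X y)" by (rule root_dist_neighbor[OF yn(2)])
  ultimately show ?thesis by force
qed

lemma parent_props:
  assumes "v \<in> verts X" "v \<noteq> rt X"
  shows "parent X v \<in> neighbors X v" "Suc (root_dist X (parent X v)) = root_dist X v"
proof -
  obtain u where u: "u \<in> neighbors X v" "Suc (root_dist X u) = root_dist X v" using ex_closer_neighbor[OF assms] by blast
  have p: "parent X v \<in> neighbors X v \<and> root_dist X (parent X v) \<le> root_dist X u"
    using arg_min_nat_lemma[of "\<lambda>u. u \<in> neighbors X v" u "root_dist X"] u(1) unfolding parent_def by blast
  then show "parent X v \<in> neighbors X v" by blast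
  have "v \<in> neighbors X (parent X v)" using p neighborsD[of "parent X v" v] by (auto simp: neighbors_def insert_commute)
  then have "root_dist X v \<le> Suc (root_dist X (parent X v))" by (rule root_dist_neighbor)
  then show "Suc (root_dist X (parent X v)) = root_dist X v" using p u by simp
qed

lemma parent_vert: "v \<in> verts X \<Longrightarrow> v \<noteq> rt X \<Longrightarrow> parent X v \<in> verts X"
  using parent_props(1) neighborsD by blast

lemma parent_edge: "v \<in> verts X \<Longrightarrow> v \<noteq> rt X \<Longrightarrow> {v, parent X v} \<in> edges X"
  using parent_props(1)[of v] neighborsD[of "parent X v" v] by (simp add: insert_commute)

text \<open>If neither end of an edge were the parent of the other, the two ends would also be
  connected through the root without using the edge.\<close>

lemma edge_parent:
  assumes e: "{u, v} \<in> edges X"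
  shows "(u \<noteq> rt X \<and> parent X u = v) \<or> (v \<noteq> rt X \<and> parent X v = u)"
proof (rule ccontr)
  assume no: "\<not> ?thesis"
  have uv: "u \<in> verts X" "v \<in> verts X" "u \<noteq> v" using edge_verts[OF e] edge_neq[OF e] by auto
  define R where "R = (\<lambda>x y. {x, y} \<in> edges X \<and> {x, y} \<noteq> {u, v})"
  have sym: "R x y \<Longrightarrow> R y x" for x y by (simp add: R_def insert_commute)
  have reach: "rtranclp R w (rt X)" if "w \<in> verts X" for w
    using that
  proof (induction "root_dist X w" arbitrary: w rule: less_induct)
    case less
    show ?case
    proof (cases "w = rt X")
      case False
      have "{w, parent X w} \<noteq> {u, v}" using no False by (auto simp: doubleton_eq_iff)
      then have "R w (parent X w)" using parent_edge[OF less.prems False] by (simp add: R_def)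
      moreover have "rtranclp R (parent X w) (rt X)"
        using less.hyps parent_props(2)[OF less.prems False] parent_vert[OF less.prems False] by simp
      ultimately show ?thesis by (rule converse_rtranclp_into_rtranclp)
    qed simp
  qed
  have "symp R" by (rule sympI) (rule sym)
  then have "symp (rtranclp R)" by (rule symp_rtranclp)
  then have "rtranclp R (rt X) v" using reach[OF uv(2)] by (rule sympD)
  with reach[OF uv(1)] have "rtranclp R u v" by (rule rtranclp_trans)
  from rtranclp_distinct_path[OF this] obtain xs where
    xs: "xs \<noteq> []" "distinct xs" "hd xs = u" "last xs = v" "successively R xs" by blast
  obtain ys where ys: "xs = u # ys" using xs by (cases xs) auto
  have "ys \<noteq> []" using ys xs uv by auto
  then obtain y zs where y: "ys = y # zs" by (cases ys) auto
  \<comment> \<open>A path with two vertices would be the forbidden edge itself; with at least three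
    vertices it closes up to a cycle with that edge.\<close>
  have "zs \<noteq> []"
  proof
    assume "zs = []"
    then have "R u v" using xs ys y by auto
    then show False by (simp add: R_def)
  qed
  then have len: "length xs \<ge> 3" using ys y by (cases zs) auto
  have "set xs \<subseteq> verts X"
  proof
    fix z assume z: "z \<in> set xs"
    have "successively R (u # ys) \<Longrightarrow> z \<in> set ys \<Longrightarrow> z \<in> verts X" for u ys
      by (induction ys arbitrary: u) (use edge_verts in \<open>auto simp: R_def\<close>)
    then show "z \<in> verts X" using xs z ys uv by auto
  qed
  moreover have "successively (\<lambda>x y. {x, y} \<in> edges X) xs"
    by (rule successively_mono[OF xs(5)]) (auto simp: R_def)
  ultimately have "simple_walk X u xs v" using xs by (auto simp: simple_walk_def walk_def)
  then show False using acyclic len e by (metis insert_commute)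
qed

lemma parent_parent: "v \<in> verts X \<Longrightarrow> v \<noteq> rt X \<Longrightarrow> parent X v \<noteq> rt X \<Longrightarrow> parent X (parent X v) \<noteq> v"
  using parent_props(2)[of v] parent_props(2)[of "parent X v"] parent_vert[of v] by auto

lemma children_sub: "children X v \<subseteq> verts X" "finite (children X v)"
  using fin_verts by (auto simp: children_def)

lemma neighbors_eq:
  assumes "v \<in> verts X"
  shows "neighbors X v = children X v \<union> (if v = rt X then {} else {parent X v})"
proof (intro set_eqI iffI)
  fix u assume u: "u \<in> neighbors X v"
  then show "u \<in> children X v \<union> (if v = rt X then {} else {parent X v})"
    using edge_parent[of u v] neighborsD[OF u] by (auto simp: children_def)
next
  fix u assume "u \<in> children X v \<union> (if v = rt X then {} else {parent X v})"
  then consider "u \<in> children X v" | "v \<noteq> rt X" "u = parent X v" by (auto split: if_splits)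
  then show "u \<in> neighbors X v"
  proof cases
    case 1
    then have "{u, v} \<in> edges X" "u \<in> verts X" using parent_edge[of u] by (auto simp: children_def)
    then show ?thesis by (simp add: neighbors_def)
  qed (use parent_props[OF assms] in auto)
qed

lemma parent_notin_children: "v \<in> verts X \<Longrightarrow> v \<noteq> rt X \<Longrightarrow> parent X v \<notin> children X v"
  using parent_parent by (auto simp: children_def)

lemma vdegree_eq:
  assumes "v \<in> verts X"
  shows "vdegree X v = card (children X v) + (if v = rt X then 0 else 1)"
  using parent_notin_children[OF assms] children_sub(2)
  by (simp add: vdegree_def neighbors_eq[OF assms])

lemma other_neighbors_eq:
  assumes "v \<in> verts X" "v \<noteq> rt X"
  shows "neighbors X v - {parent X v} = children X v"
  using neighbors_eq[OF assms(1)] parent_notin_children[OF assms] assms(2) by auto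

text \<open>A walk without repetition that has once moved away from the root keeps moving away: the
  only step back leads to the vertex it came from.\<close>

lemma descend_not_root:
  "successively (\<lambda>x y. {x, y} \<in> edges X) (x # y # ys) \<Longrightarrow> distinct (x # y # ys) \<Longrightarrow>
    y \<noteq> rt X \<Longrightarrow> parent X y = x \<Longrightarrow> last (y # ys) \<noteq> rt X"
proof (induction ys arbitrary: x y)
  case (Cons z zs)
  have "{y, z} \<in> edges X" using Cons.prems by simp
  then have "(y \<noteq> rt X \<and> parent X y = z) \<or> (z \<noteq> rt X \<and> parent X z = y)" by (rule edge_parent)
  then have "z \<noteq> rt X \<and> parent X z = y" using Cons.prems by auto
  then show ?case using Cons.IH[of y z] Cons.prems by auto
qed simp

text \<open>By \<open>descend_not_root\<close> the first step must go to the parent. Hence simple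
  walks to the root are unique, and \<open>root_path\<close> is the chain of parents.\<close>

lemma simple_walk_root:
  assumes sw: "simple_walk X u xs (rt X)"
  shows "(u = rt X \<and> xs = [u]) \<or> (u \<noteq> rt X \<and> (\<exists>ys. xs = u # ys \<and> simple_walk X (parent X u) ys (rt X)))"
proof -
  obtain ys where ys: "xs = u # ys" using sw by (cases xs) (auto simp: simple_walk_def walk_def)
  show ?thesis
  proof (cases ys)
    case Nil
    then show ?thesis using sw ys by (auto simp: simple_walk_def walk_def)
  next
    case (Cons y zs)
    have s: "successively (\<lambda>x y. {x, y} \<in> edges X) (u # y # zs)" "distinct (u # y # zs)" "last (y # zs) = rt X"
      using sw ys Cons by (auto simp: simple_walk_def walk_def)
    have "u \<noteq> rt X" using s last_in_set[of "y # zs"] by auto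
    have "{u, y} \<in> edges X" using s by simp
    then have "(u \<noteq> rt X \<and> parent X u = y) \<or> (y \<noteq> rt X \<and> parent X y = u)" by (rule edge_parent)
    moreover have "\<not> (y \<noteq> rt X \<and> parent X y = u)" using descend_not_root[OF s(1,2)] s(3) by auto
    ultimately have "parent X u = y" by blast
    then show ?thesis using \<open>u \<noteq> rt X\<close> sw ys Cons by (auto simp: simple_walk_def walk_def)
  qed
qed

lemma simple_walk_exists:
  "v \<in> verts X \<Longrightarrow> \<exists>xs. simple_walk X v xs (rt X) \<and> (\<forall>x\<in>set xs. root_dist X x \<le> root_dist X v)"
proof (induction "root_dist X v" arbitrary: v rule: less_induct)
  case less
  show ?case
  proof (cases "v = rt X")
    case True
    then show ?thesis using less.prems by (intro exI[of _ "[v]"]) (auto simp: simple_walk_def walk_def)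
  next
    case False
    note p = parent_props(2)[OF less.prems False] parent_vert[OF less.prems False]
    then obtain xs where xs: "simple_walk X (parent X v) xs (rt X)" "\<forall>x\<in>set xs. root_dist X x \<le> root_dist X (parent X v)"
      using less.hyps[of "parent X v"] by auto
    have "v \<notin> set xs" using xs(2) p(1) by auto
    then have "simple_walk X v (v # xs) (rt X)"
      using xs(1) parent_edge[OF less.prems False] less.prems
      by (auto simp: simple_walk_def walk_Cons) (auto simp: walk_def)
    moreover have "\<forall>x\<in>set (v # xs). root_dist X x \<le> root_dist X v" using xs(2) p(1) by auto
    ultimately show ?thesis by blast
  qed
qed

lemma simple_walk_unique:
  "simple_walk X v xs (rt X) \<Longrightarrow> simple_walk X v ys (rt X) \<Longrightarrow> xs = ys"
proof (induction xs arbitrary: v ys)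
  case Nil
  then show ?case by (simp add: simple_walk_def walk_def)
next
  case (Cons x xs)
  show ?case
    using simple_walk_root[OF Cons.prems(1)] simple_walk_root[OF Cons.prems(2)] Cons.IH by auto
qed

lemma root_path_eq: "simple_walk X v xs (rt X) \<Longrightarrow> root_path X v = xs"
  unfolding root_path_def by (rule the_equality) (auto intro: simple_walk_unique)

lemma root_path_walk: "v \<in> verts X \<Longrightarrow> simple_walk X v (root_path X v) (rt X)"
proof -
  assume "v \<in> verts X"
  then obtain xs where "simple_walk X v xs (rt X)" using simple_walk_exists by blast
  then show ?thesis using root_path_eq by simp
qed

lemma root_path_root: "root_path X (rt X) = [rt X]"
  by (rule root_path_eq) (simp add: simple_walk_def walk_def root_vert)

lemma root_path_Cons: "v \<in> verts X \<Longrightarrow> v \<noteq> rt X \<Longrightarrow> root_path X v = v # root_path X (parent X v)"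
proof -
  assume v: "v \<in> verts X" "v \<noteq> rt X"
  then obtain ys where ys: "root_path X v = v # ys" "simple_walk X (parent X v) ys (rt X)"
    using simple_walk_root[OF root_path_walk[OF v(1)]] by auto
  then show ?thesis using root_path_eq[OF ys(2)] by simp
qed

lemma root_path_nonempty: "v \<in> verts X \<Longrightarrow> \<exists>ys. root_path X v = v # ys"
  using root_path_root root_path_Cons by (cases "v = rt X") auto

lemma root_path_set: "v \<in> verts X \<Longrightarrow> u \<in> set (root_path X v) \<Longrightarrow> u \<in> verts X \<and> root_dist X u \<le> root_dist X v"
  using simple_walk_exists[of v] root_path_eq[of v] by (auto simp: simple_walk_def walk_def)

lemma root_in_root_path: "v \<in> verts X \<Longrightarrow> rt X \<in> set (root_path X v)"
  using root_path_walk[of v] last_in_set by (force simp: simple_walk_def walk_def)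

lemma root_path_parent:
  "v \<in> verts X \<Longrightarrow> u \<in> set (root_path X v) \<Longrightarrow> u \<noteq> v \<Longrightarrow> \<exists>w\<in>set (root_path X v) - {rt X}. parent X w = u"
proof (induction "root_dist X v" arbitrary: v rule: less_induct)
  case less
  have nr: "v \<noteq> rt X" using less.prems root_path_root by auto
  note rp = root_path_Cons[OF less.prems(1) nr]
  show ?case
  proof (cases "u = parent X v")
    case True
    then show ?thesis using rp nr by auto
  next
    case False
    have "u \<in> set (root_path X (parent X v))" using rp less.prems by auto
    then have "\<exists>w\<in>set (root_path X (parent X v)) - {rt X}. parent X w = u"
      using less.hyps[of "parent X v"] parent_props(2)[OF less.prems(1) nr] parent_vert[OF less.prems(1) nr] False by auto
    then show ?thesis using rp by auto
  qed
qed

lemma through_iff: "u \<in> through X v \<longleftrightarrow> u \<in> verts X \<and> v \<in> set (root_path X u)"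
proof
  assume "u \<in> through X v"
  then obtain xs where "u \<in> verts X" "simple_walk X u xs (rt X)" "v \<in> set xs" by (auto simp: through_def)
  then show "u \<in> verts X \<and> v \<in> set (root_path X u)" using root_path_eq by simp
next
  assume "u \<in> verts X \<and> v \<in> set (root_path X u)"
  then show "u \<in> through X v" using root_path_walk by (auto simp: through_def)
qed

lemma through_self: "v \<in> verts X \<Longrightarrow> v \<in> through X v"
  using root_path_nonempty[of v] by (auto simp: through_iff)

lemma through_step: "u \<in> verts X \<Longrightarrow> u \<noteq> rt X \<Longrightarrow> u \<in> through X v \<longleftrightarrow> u = v \<or> parent X u \<in> through X v"
  using root_path_Cons[of u] parent_vert[of u] by (auto simp: through_iff)

lemma through_root: "rt X \<in> through X v \<longleftrightarrow> v = rt X"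
  using root_vert by (auto simp: through_iff root_path_root)

lemma through_dist: "u \<in> through X v \<Longrightarrow> root_dist X v \<le> root_dist X u"
  using root_path_set by (auto simp: through_iff)

end

section \<open>Branches planted on a new root\<close>

locale planted = tree +
  fixes v' v :: 'v and c :: complex
  assumes child: "v \<in> children X v'"
begin

lemma v: "v \<in> verts X" "v \<noteq> rt X" "parent X v = v'"
  using child by (auto simp: children_def)

lemma v': "v' \<in> verts X" "v' \<notin> through X v"
proof -
  show "v' \<in> verts X" using parent_vert[OF v(1,2)] unfolding v(3) .
  have "root_dist X v' < root_dist X v" using parent_props(2)[OF v(1,2)] unfolding v(3) by simp
  then show "v' \<notin> through X v" using through_dist[of v' v] by auto
qed

abbreviation "Y \<equiv> planted_subtree X v' c v"

lemma Y_simps: "verts Y = insert v' (through X v)" "rt Y = v'"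
  "edges Y = insert {v, v'} {d \<in> edges X. d \<subseteq> through X v}" "color Y = (color X)(v' := c)"
  by (auto simp: planted_subtree_def)

lemma through_verts: "u \<in> through X v \<Longrightarrow> u \<in> verts X \<and> u \<noteq> rt X \<and> u \<noteq> v'"
  using through_root[of v] v(2) v'(2) by (auto simp: through_iff)

lemma through_parent: "u \<in> through X v \<Longrightarrow> u \<noteq> v \<Longrightarrow> parent X u \<in> through X v"
  using through_step[of u v] through_verts[of u] by auto

lemma Y_parent_edge: "u \<in> through X v \<Longrightarrow> {u, parent X u} \<in> edges Y"
  using through_parent[of u] parent_edge[of u] through_verts[of u] v by (cases "u = v") (auto simp: Y_simps)

lemma Y_edges: "edges Y \<subseteq> edges X"
  using parent_edge[OF v(1,2)] v(3) by (auto simp: Y_simps)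

lemma Y_walk_root: "u \<in> verts Y \<Longrightarrow> \<exists>xs. walk Y u xs v'"
proof (induction "root_dist X u" arbitrary: u rule: less_induct)
  case less
  show ?case
  proof (cases "u = v'")
    case True
    then show ?thesis by (intro exI[of _ "[v']"]) (auto simp: walk_def Y_simps)
  next
    case False
    then have u: "u \<in> through X v" using less.prems by (simp add: Y_simps)
    have "parent X u \<in> verts Y" using through_parent[OF u] v(3) by (cases "u = v") (auto simp: Y_simps)
    then obtain xs where xs: "walk Y (parent X u) xs v'"
      using less.hyps[of "parent X u"] parent_props(2)[of u] through_verts[OF u] by auto
    then have "walk Y u (u # xs) v'"
      using Y_parent_edge[OF u] less.prems by (auto simp: walk_Cons) (auto simp: walk_def)
    then show ?thesis by blast
  qed
qed

lemma is_tree_Y: "is_tree Y"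
  unfolding is_tree_def
proof (intro conjI ballI)
  show "finite (verts Y)" using fin_verts by (auto simp: Y_simps through_def)
  show "rt Y \<in> verts Y" by (simp add: Y_simps)
  show "d \<subseteq> verts Y" "card d = 2" if "d \<in> edges Y" for d
    using that Y_edges edge_verts through_self[OF v(1)] by (auto simp: Y_simps)
  show "\<exists>xs. walk Y a xs b" if "a \<in> verts Y" "b \<in> verts Y" for a b
    using Y_walk_root[OF that(1)] Y_walk_root[OF that(2)] walk_append walk_rev by metis
  have sub: "verts Y \<subseteq> verts X" using through_verts v' by (auto simp: Y_simps)
  have "walk X a xs b" if "walk Y a xs b" for a xs b
    using that sub Y_edges unfolding walk_def by (auto elim!: successively_mono)
  then have "simple_walk X a xs b" if "simple_walk Y a xs b" for a xs b
    using that by (simp add: simple_walk_def)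
  \<comment> \<open>All edges of \<open>Y\<close>, including the one at the new root, are edges of
    \<open>X\<close>, so a cycle of \<open>Y\<close> would be a cycle of \<open>X\<close>.\<close>
  then show "\<not> (\<exists>u v xs. simple_walk Y u xs v \<and> length xs \<ge> 3 \<and> {v, u} \<in> edges Y)"
    using acyclic Y_edges by blast
qed

sublocale Y: tree Y
  by unfold_locales (rule is_tree_Y)

text \<open>By \<open>Y.edge_parent\<close> the edge from \<open>u\<close> to its old parent is a
  parent edge in \<open>Y\<close> in one of the two directions. The wrong one would make
  \<open>u\<close> the parent of its old parent in \<open>Y\<close>, against the induction
  hypothesis for the latter.\<close>

lemma parent_Y: "u \<in> through X v \<Longrightarrow> parent Y u = parent X u"
proof (induction "root_dist X u" arbitrary: u rule: less_induct)
  case less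
  have u: "u \<in> verts X" "u \<noteq> rt X" using through_verts[OF less.prems] by auto
  have e: "(u \<noteq> rt Y \<and> parent Y u = parent X u) \<or> (parent X u \<noteq> rt Y \<and> parent Y (parent X u) = u)"
    by (rule Y.edge_parent[OF Y_parent_edge[OF less.prems]])
  show ?case
  proof (cases "u = v")
    case True
    then show ?thesis using e v by (auto simp: Y_simps)
  next
    case False
    then have p: "parent X u \<in> through X v" by (rule through_parent[OF less.prems])
    have "parent Y (parent X u) = parent X (parent X u)"
      using less.hyps[OF _ p] parent_props(2)[OF u] by simp
    moreover have "parent X (parent X u) \<noteq> u" using parent_parent[OF u] through_verts[OF p] by auto
    ultimately show ?thesis using e by auto
  qed
qed

lemma children_Y: "u \<in> through X v \<Longrightarrow> children Y u = children X u"
  using through_verts parent_Y through_step by (auto simp: children_def Y_simps)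

lemma children_Y_root: "children Y v' = {v}"
proof -
  have "u = v" if "u \<in> through X v" "parent X u = v'" for u
    using through_parent[OF that(1)] that v'(2) by auto
  then show ?thesis
    using through_self[OF v(1)] parent_Y v(3) through_verts by (auto simp: children_def Y_simps)
qed

end

section \<open>The word as a recursion over all vertices\<close>

definition child_list :: "'v crtree \<Rightarrow> 'v \<Rightarrow> 'v list" where
  "child_list X v = (SOME vs. distinct vs \<and> set vs = children X v)"

lemma (in tree) child_list: "distinct (child_list X v)" "set (child_list X v) = children X v"
  using someI_ex[OF finite_distinct_list[OF children_sub(2)[of v], folded conj_commute[of "distinct _"]]]
  unfolding child_list_def by auto

text \<open>Both lists are chosen by the same \<open>SOME\<close> expression, so equal sets give
  equal lists and the shuffle factors come in the same order.\<close>

lemma (in tree) other_neighbors_child_list: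
  "v \<in> verts X \<Longrightarrow> v \<noteq> rt X \<Longrightarrow> other_neighbors X v = child_list X v"
  by (simp add: other_neighbors_def child_list_def other_neighbors_eq)

text \<open>The factor that a vertex and the edge to its parent contribute. At a branch vertex,
  whose colour is 0, it is the power \<open>letter 0 ^ k\<close> of the recursive definition, also
  for index 0.\<close>

definition edge_word :: "'v crtree \<Rightarrow> ('v set \<Rightarrow> nat) \<Rightarrow> 'v \<Rightarrow> ncpoly" where
  "edge_word X k v = (if k {v, parent X v} > 0 then letter (color X v) * letter 0 ^ (k {v, parent X v} - 1) else 1)"

text \<open>\<open>y v\<close> plays the role of the word, with its last letter removed, of the
  branch at \<open>v\<close> planted on a new root. The recursion is local at each vertex, as the
  integrals are, while \<open>tree_word\<close> jumps from one branching to the next.\<close>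

definition branch_words :: "'v crtree \<Rightarrow> ('v set \<Rightarrow> nat) \<Rightarrow> ('v \<Rightarrow> ncpoly) \<Rightarrow> bool" where
  "branch_words X k y \<longleftrightarrow> (\<forall>v\<in>verts X - {rt X}.
     y v = foldr (\<squnion>) (map y (child_list X v)) 1 * edge_word X k v)"

text \<open>The combinatorial part of harvestability, without the path and the colour of the root.
  It passes to planted branches whatever colour their new root has.\<close>

definition word_tree :: "'v crtree \<Rightarrow> ('v set \<Rightarrow> nat) \<Rightarrow> bool" where
  "word_tree X k \<longleftrightarrow> is_tree X \<and> card (children X (rt X)) = 1 \<and>
     (\<forall>v\<in>verts X - {rt X}. (k {v, parent X v} = 0 \<longrightarrow> card (children X v) \<ge> 2) \<and>
        (card (children X v) \<ge> 2 \<longrightarrow> color X v = 0))"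

text \<open>At a vertex with one child the shuffle has a single factor, so \<open>y\<close> only
  gains the edge word. Along an unbranched stretch these edge words make up the linear word; their
  indices are positive since index 0 demands two children.\<close>

lemma (in tree) chain_word:
  assumes wt: "word_tree X k" and y: "branch_words X k y" and c: "children X (rt X) = {c}"
  shows "v \<in> verts X \<Longrightarrow> v \<noteq> rt X \<Longrightarrow> (\<And>u. u \<in> set (root_path X (parent X v)) - {rt X} \<Longrightarrow> card (children X u) \<le> 1) \<Longrightarrow>
    y c * letter (color X (rt X)) = y v * linear_word (color X) k (root_path X (parent X v))"
proof (induction "root_dist X v" arbitrary: v rule: less_induct)
  case less
  note v = less.prems(1,2)
  show ?case
  proof (cases "parent X v = rt X")
    case True
    then have "v \<in> children X (rt X)" using v by (simp add: children_def)
    then show ?thesis using c True by (simp add: root_path_root)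
  next
    case False
    define p where "p = parent X v"
    have p: "p \<in> verts X" "p \<noteq> rt X" using parent_vert[OF v] False by (auto simp: p_def)
    have rp: "root_path X p = p # root_path X (parent X p)" by (rule root_path_Cons[OF p])
    have "card (children X p) \<le> 1" using less.prems(3)[of p] rp p(2) by (auto simp: p_def)
    moreover have "v \<in> children X p" using v by (simp add: children_def p_def)
    ultimately have chp: "children X p = {v}" using children_sub(2)[of p] by (metis card_le_Suc0_iff_eq One_nat_def is_singletonI' is_singleton_def empty_iff singletonD)
    then have "card (children X p) < 2" by simp
    then have kp: "k {p, parent X p} > 0" using wt p unfolding word_tree_def by fastforce
    have cl: "child_list X p = [v]"
    proof -
      have "length (child_list X p) = 1" using distinct_card[OF child_list(1)[of p]] child_list(2)[of p] chp by simp
      then obtain u where "child_list X p = [u]" by (auto simp: length_Suc_conv)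
      then show ?thesis using child_list(2)[of p] chp by auto
    qed
    have yp: "y p = y v * (letter (color X p) * letter 0 ^ (k {p, parent X p} - 1))"
      using y p cl kp by (simp add: branch_words_def shuffle_one edge_word_def)
    obtain zs where zs: "root_path X (parent X p) = parent X p # zs"
      using root_path_nonempty[OF parent_vert[OF p]] by blast
    have "y c * letter (color X (rt X)) = y p * linear_word (color X) k (root_path X (parent X p))"
    proof (rule less.hyps[OF _ p])
      show "root_dist X p < root_dist X v" using parent_props(2)[OF v] by (simp add: p_def)
      show "card (children X u) \<le> 1" if "u \<in> set (root_path X (parent X p)) - {rt X}" for u
        using less.prems(3)[of u] that rp by (auto simp: p_def)
    qed
    also have "\<dots> = y v * linear_word (color X) k (root_path X p)"
      unfolding rp zs yp by (simp add: mult.assoc)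
    finally show ?thesis by (simp add: p_def)
  qed
qed

text \<open>Induction on the number of vertices. Beyond the first branching the hypothesis applies
  to the planted branches, and up to the root \<open>chain_word\<close> takes over.\<close>

lemma tree_word_eq:
  "word_tree X k \<Longrightarrow> branch_words X k y \<Longrightarrow> children X (rt X) = {c} \<Longrightarrow> finite P \<Longrightarrow>
    tree_word P X k = y c * letter (color X (rt X))"
proof (induction "card (verts X)" arbitrary: X c rule: less_induct)
  case less
  interpret tree X using less.prems(1) by unfold_locales (simp add: word_tree_def)
  have c: "c \<in> verts X" "c \<noteq> rt X" using less.prems(3) children_sub(1)[of "rt X"] by (auto simp: children_def)
  have deg1: "vdegree X (rt X) = 1" using less.prems(3) by (simp add: vdegree_eq root_vert)
  have deg: "vdegree X v = card (children X v) + 1" if "v \<in> verts X" "v \<noteq> rt X" for v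
    using vdegree_eq[OF that(1)] that by simp
  show ?case
  proof (cases "has_branch X")
    case True
    define v' where "v' = first_branch X"
    have v': "v' \<in> verts X" "vdegree X v' > 2" using first_branch_props[OF True] by (auto simp: v'_def)
    have nr: "v' \<noteq> rt X" using v' deg1 by auto
    have min: "root_dist X v' \<le> root_dist X u" if "u \<in> verts X" "vdegree X u > 2" for u
      using arg_min_nat_le[of "\<lambda>v. v \<in> verts X \<and> vdegree X v > 2" u "root_dist X"] that
      unfolding v'_def first_branch_def by simp
    define c' where "c' = (SOME c. c \<notin> insert 0 P)"
    have "card (children X v') \<ge> 2" using v' deg[OF v'(1) nr] by simp
    then have col: "color X v' = 0" using less.prems(1) v' nr by (simp add: word_tree_def)
    \<comment> \<open>The auxiliary colour \<open>c'\<close> occurs in the word of the branch only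
      as its last letter, which \<open>remove_last\<close> strips off again.\<close>
    have sub: "remove_last (tree_word P (planted_subtree X v' c' v) k) = y v" if v: "v \<in> children X v'" for v
    proof -
      interpret planted X v' v c' using v by unfold_locales
      have Yr: "verts Y - {rt Y} = through X v" using v'(2) by (auto simp: Y_simps)
      have X_in: "u \<in> verts X - {rt X}" if "u \<in> through X v" for u using through_verts[OF that] by simp
      have cY: "color Y u = color X u" if "u \<in> through X v" for u using through_verts[OF that] by (simp add: Y_simps)
      have lt: "card (verts Y) < card (verts X)"
      proof (rule card_planted_subtree_less[OF tree deg1 True, folded v'_def])
        show "v \<in> set (other_neighbors X v')"
          using child child_list(2) other_neighbors_child_list[OF _ nr] \<open>v' \<in> verts X\<close> by simp
      qed
      have wt: "word_tree Y k"
        unfolding word_tree_def Yr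
      proof (intro conjI ballI impI)
        show "is_tree Y" by (rule is_tree_Y)
        show "card (children Y (rt Y)) = 1" using children_Y_root by (simp add: Y_simps)
        fix u assume u: "u \<in> through X v"
        show "2 \<le> card (children Y u)" if "k {u, parent Y u} = 0"
          using less.prems(1) X_in[OF u] that u by (simp add: word_tree_def children_Y parent_Y)
        show "color Y u = 0" if "2 \<le> card (children Y u)"
          using less.prems(1) X_in[OF u] that u by (simp add: word_tree_def children_Y cY)
      qed
      have bw: "branch_words Y k y"
        unfolding branch_words_def Yr
      proof
        fix u assume u: "u \<in> through X v"
        have "child_list Y u = child_list X u" using children_Y[OF u] by (simp add: child_list_def)
        moreover have "edge_word Y k u = edge_word X k u" using parent_Y[OF u] cY[OF u] by (simp add: edge_word_def)
        ultimately show "y u = foldr (\<squnion>) (map y (child_list Y u)) 1 * edge_word Y k u"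
          using less.prems(2) X_in[OF u] by (simp add: branch_words_def)
      qed
      have "children Y (rt Y) = {v}" using children_Y_root by (simp add: Y_simps)
      from less.hyps[OF lt wt bw this less.prems(4)] show ?thesis
        by (simp add: remove_last_times_letter)
    qed
    have on: "other_neighbors X v' = child_list X v'" by (rule other_neighbors_child_list[OF v'(1) nr])
    have e1: "map (\<lambda>v. remove_last (tree_word P (planted_subtree X v' c' v) k)) (other_neighbors X v') = map y (child_list X v')"
      unfolding on using sub child_list(2) by (intro map_cong) auto
    have "tree_word P X k = foldr (\<squnion>) (map y (child_list X v')) 1 * letter 0 ^ k {v', parent X v'} *
        linear_word (color X) k (root_path X (parent X v'))"
      using tree deg1 True unfolding tree_word.simps[of P X k] Let_def v'_def[symmetric] c'_def[symmetric] e1 by simp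
    also have "foldr (\<squnion>) (map y (child_list X v')) 1 * letter 0 ^ k {v', parent X v'} = y v'"
    proof -
      \<comment> \<open>The colour 0 of the branching supplies the missing letter for positive
        index; for index 0 both sides are 1.\<close>
      have "edge_word X k v' = letter 0 ^ k {v', parent X v'}"
        using col by (cases "k {v', parent X v'}") (auto simp: edge_word_def)
      then show ?thesis using less.prems(2) v' nr by (simp add: branch_words_def)
    qed
    also have "y v' * linear_word (color X) k (root_path X (parent X v')) = y c * letter (color X (rt X))"
    proof (rule chain_word[OF less.prems(1-3) v'(1) nr, symmetric])
      fix u assume u: "u \<in> set (root_path X (parent X v')) - {rt X}"
      have "u \<in> verts X" "root_dist X u < root_dist X v'"
        using root_path_set[OF parent_vert[OF v'(1) nr], of u] u parent_props(2)[OF v'(1) nr] by auto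
      then have "\<not> vdegree X u > 2" using min[of u] by auto
      then show "card (children X u) \<le> 1" using deg[of u] u \<open>u \<in> verts X\<close> by simp
    qed
    finally show ?thesis .
  next
    case False
    have card1: "card (children X u) \<le> 1" if "u \<in> verts X" for u
    proof (cases "u = rt X")
      case False
      then show ?thesis using \<open>\<not> has_branch X\<close> deg[OF that False] that by (auto simp: has_branch_def not_less)
    qed (use less.prems(3) in simp)
    \<comment> \<open>A vertex farthest from the root has no children; without branching it is the
      other end of the path.\<close>
    define v where "v = arg_max (root_dist X) (\<lambda>v. v \<in> verts X)"
    have bd: "\<forall>u. u \<in> verts X \<longrightarrow> root_dist X u \<le> Max (root_dist X ` verts X)"
      using fin_verts by auto
    have v: "v \<in> verts X" and vmax: "\<And>u. u \<in> verts X \<Longrightarrow> root_dist X u \<le> root_dist X v"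
      using arg_max_nat_lemma[of "\<lambda>v. v \<in> verts X" "rt X" "root_dist X" "Suc (Max (root_dist X ` verts X))"] root_vert bd
      unfolding v_def by (auto simp: less_Suc_eq_le)
    have leaf: "children X v = {}"
    proof (rule ccontr)
      assume "children X v \<noteq> {}"
      then obtain u where "u \<in> verts X" "u \<noteq> rt X" "parent X u = v" by (auto simp: children_def)
      then show False using parent_props(2)[of u] vmax[of u] by auto
    qed
    have nr: "v \<noteq> rt X" using leaf less.prems(3) by auto
    note rp = root_path_Cons[OF v nr]
    have chain: "card (children X u) \<le> 1" if "u \<in> set (root_path X (parent X v)) - {rt X}" for u
      using root_path_set[OF parent_vert[OF v nr], of u] that card1 by auto
    have "card (children X v) < 2" using leaf by simp
    then have kv: "k {v, parent X v} > 0" using less.prems(1) v nr unfolding word_tree_def by fastforce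
    have "child_list X v = []" using child_list(2)[of v] leaf by simp
    then have yv: "y v = letter (color X v) * letter 0 ^ (k {v, parent X v} - 1)"
      using less.prems(2) v nr kv by (simp add: branch_words_def edge_word_def)
    \<comment> \<open>Induction on the distance from the root: the parent of \<open>u\<close> lies
      on the path and is not its end \<open>v\<close>, so one of its children lies on the path as
      well, and \<open>u\<close> is its only child.\<close>
    have all: "u \<in> set (root_path X v)" if "u \<in> verts X" for u
      using that
    proof (induction "root_dist X u" arbitrary: u rule: less_induct)
      case (less u)
      show ?case
      proof (cases "u = rt X")
        case True
        then show ?thesis using root_in_root_path[OF v] by simp
      next
        case False
        let ?p = "parent X u"
        have p: "?p \<in> verts X" using parent_vert[OF less.prems False] .
        have "?p \<in> set (root_path X v)" using less.hyps[OF _ p] parent_props(2)[OF less.prems False] by simp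
        moreover have uc: "u \<in> children X ?p" using less.prems False by (simp add: children_def)
        then have "?p \<noteq> v" using leaf by auto
        ultimately obtain w where w: "w \<in> set (root_path X v)" "w \<noteq> rt X" "parent X w = ?p"
          using root_path_parent[OF v] by blast
        then have "w \<in> children X ?p" using root_path_set[OF v w(1)] by (simp add: children_def)
        then have "w = u" using uc card1[OF p] children_sub(2)[of ?p] by (metis card_le_Suc0_iff_eq One_nat_def)
        then show ?thesis using w by simp
      qed
    qed
    have lo: "linear_order X = root_path X v"
      unfolding linear_order_def
    proof (rule the_equality)
      obtain ys where ys: "root_path X v = v # ys" using root_path_nonempty[OF v] by blast
      show "set (root_path X v) = verts X \<and> simple_walk X (hd (root_path X v)) (root_path X v) (rt X)"
        using all root_path_set[OF v] root_path_walk[OF v] ys by auto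
      fix xs assume xs: "set xs = verts X \<and> simple_walk X (hd xs) xs (rt X)"
      then have "xs \<noteq> []" by (auto simp: simple_walk_def walk_def)
      then have h: "hd xs \<in> verts X" using xs hd_in_set[of xs] by simp
      have e: "root_path X (hd xs) = xs" using root_path_eq xs by blast
      have "v = hd xs"
      proof (rule ccontr)
        assume "v \<noteq> hd xs"
        then obtain w where "w \<in> set (root_path X (hd xs)) - {rt X}" "parent X w = v"
          using root_path_parent[OF h, of v] e xs v by auto
        then have "w \<in> children X v" using root_path_set[OF h, of w] by (simp add: children_def)
        then show False using leaf by simp
      qed
      then show "xs = root_path X v" using e by simp
    qed
    obtain zs where zs: "root_path X (parent X v) = parent X v # zs"
      using root_path_nonempty[OF parent_vert[OF v nr]] by blast
    have "tree_word P X k = linear_word (color X) k (v # root_path X (parent X v))"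
      using False unfolding tree_word.simps[of P X k] by (simp add: lo rp)
    also have "\<dots> = y v * linear_word (color X) k (root_path X (parent X v))"
      unfolding zs yv by (simp add: mult.assoc)
    also have "\<dots> = y c * letter (color X (rt X))"
      by (rule chain_word[OF less.prems(1-3) v nr chain, symmetric])
    finally show ?thesis .
  qed
qed

section \<open>The logarithm along the path\<close>

context smooth_path
begin

lemma path_log:
  assumes "0 \<in> letters_ok"
  shows "continuous_on {0<..<1} (path_log \<gamma>)" and "\<And>t. t \<in> {0<..<1} \<Longrightarrow> exp (path_log \<gamma> t) = \<gamma> t"
proof -
  have "\<exists>l. continuous_on {0<..<1} l \<and> (\<forall>t\<in>{0<..<1}. exp (l t) = \<gamma> t)"
  proof (rule continuous_logarithm_on_contractible[of "{0<..<1}" \<gamma>])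
    show "contractible {0<..<1::real}" by (intro convex_imp_contractible) simp
    show "\<gamma> z \<noteq> 0" if "z \<in> {0<..<1}" for z using letters_ok_nz[OF assms, of z] that by simp
    fix l assume "continuous_on {0<..<1} l" "\<And>x. x \<in> {0<..<1} \<Longrightarrow> \<gamma> x = exp (l x)"
    then show ?thesis by (intro exI[of _ l]) auto
  qed (rule gamma_cont)
  from someI_ex[OF this] have "continuous_on {0<..<1} (path_log \<gamma>) \<and> (\<forall>t\<in>{0<..<1}. exp (path_log \<gamma> t) = \<gamma> t)"
    unfolding path_log_def .
  then show "continuous_on {0<..<1} (path_log \<gamma>)" and "\<And>t. t \<in> {0<..<1} \<Longrightarrow> exp (path_log \<gamma> t) = \<gamma> t" by blast+
qed

text \<open>A continuous branch differs near \<open>t\<close> from its value at \<open>t\<close> by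
  the principal logarithm of \<open>\<gamma> s / \<gamma> t\<close>: the difference of values is
  smaller than pi there, so \<open>Ln\<close> inverts \<open>exp\<close>.\<close>

lemma path_log_deriv:
  assumes ok: "0 \<in> letters_ok" and t: "t \<in> {0<..<1} - S"
  shows "(path_log \<gamma> has_vector_derivative form \<gamma> 0 t) (at t)"
proof -
  let ?L = "path_log \<gamma>"
  have nz: "\<gamma> t \<noteq> 0" using letters_ok_nz[OF ok, of t] t by simp
  have cL: "isCont ?L t" using path_log(1)[OF ok] t by (auto simp: continuous_on_eq_continuous_at)
  have "((\<lambda>s. \<gamma> s / \<gamma> t) has_vector_derivative \<gamma>' t / \<gamma> t) (at t)"
    using has_vector_derivative_mult_right[OF gamma_deriv[OF t], of "inverse (\<gamma> t)"] by (simp add: field_simps)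
  moreover have "(Ln has_field_derivative inverse (\<gamma> t / \<gamma> t)) (at (\<gamma> t / \<gamma> t))"
    using nz by (intro has_field_derivative_Ln) simp
  ultimately have "((Ln \<circ> (\<lambda>s. \<gamma> s / \<gamma> t)) has_vector_derivative \<gamma>' t / \<gamma> t * inverse (\<gamma> t / \<gamma> t)) (at t)"
    by (rule field_vector_diff_chain_at)
  then have D: "((\<lambda>s. ?L t + Ln (\<gamma> s / \<gamma> t)) has_vector_derivative 0 + \<gamma>' t / \<gamma> t) (at t)"
    using nz by (intro has_vector_derivative_add has_vector_derivative_const) (simp add: o_def)
  obtain e where e: "e > 0" "\<And>s. dist s t < e \<Longrightarrow> s \<in> {0<..<1} \<and> dist (?L s) (?L t) < pi"
  proof -
    obtain e1 where e1: "e1 > 0" "\<And>s. dist s t < e1 \<Longrightarrow> dist (?L s) (?L t) < pi"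
      using cL pi_gt_zero unfolding continuous_at_eps_delta by blast
    show ?thesis
      using e1 t by (intro that[of "min e1 (min t (1 - t))"]) (auto simp: dist_real_def)
  qed
  have E: "?L t + Ln (\<gamma> s / \<gamma> t) = ?L s" if "s \<in> ball t e" for s
  proof -
    have s: "s \<in> {0<..<1}" "norm (?L s - ?L t) < pi" using e(2)[of s] that by (auto simp: dist_norm norm_minus_commute)
    have "\<bar>Im (?L s - ?L t)\<bar> < pi" using abs_Im_le_cmod[of "?L s - ?L t"] s(2) by linarith
    then have "Ln (exp (?L s - ?L t)) = ?L s - ?L t" by (intro Ln_exp) (auto simp: abs_less_iff)
    moreover have "exp (?L s - ?L t) = \<gamma> s / \<gamma> t" using path_log(2)[OF ok] s t by (simp add: exp_diff)
    ultimately show ?thesis by simp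
  qed
  have "(?L has_vector_derivative 0 + \<gamma>' t / \<gamma> t) (at t)"
    by (rule has_vector_derivative_transform_within_open[OF D open_ball _ E]) (use e(1) in auto)
  then show ?thesis using t by (simp add: form_def)
qed

text \<open>Integrates the bound of the form of the letter 0 by \<open>lam\<close>; provides the
  hypothesis of \<open>log_power_bound\<close>.\<close>

lemma path_log_bound:
  assumes ok: "0 \<in> letters_ok"
  shows "\<exists>C\<ge>0. \<forall>s t. 0 < s \<longrightarrow> s \<le> t \<longrightarrow> t < 1 \<longrightarrow> norm (path_log \<gamma> t - path_log \<gamma> s) \<le> C * (ln (odds t) - ln (odds s))"
proof -
  obtain C where C: "C \<ge> 0" "\<And>t. 0 < t \<Longrightarrow> t < 1 \<Longrightarrow> norm (form \<gamma> 0 t) \<le> C * lam t" using form_bound[OF ok] by blast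
  show ?thesis
  proof (intro exI[of _ C] conjI C(1) allI impI)
    fix s t :: real assume st: "0 < s" "s \<le> t" "t < 1"
    have 1: "(form \<gamma> 0 has_integral path_log \<gamma> t - path_log \<gamma> s) {s..t}"
      by (intro fundamental_theorem_of_calculus_interior_strong[OF S(1)] path_log_deriv ok continuous_on_subset[OF path_log(1)[OF ok]])
         (use st in auto)
    have "((\<lambda>t. ln (odds t)) has_real_derivative lam x) (at x)" if "x \<in> {s..t}" for x
    proof -
      have x: "0 < x" "x < 1" using that st by auto
      have "(odds has_real_derivative 1 / (1 - x)^2) (at x)"
        unfolding odds_def using x by (auto intro!: derivative_eq_intros simp: field_simps power2_eq_square)
      from DERIV_chain2[OF DERIV_ln[OF odds_pos[OF x]] this]
      have "((\<lambda>t. ln (odds t)) has_real_derivative inverse (odds x) * (1 / (1 - x)^2)) (at x)" .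
      moreover have "inverse (odds x) * (1 / (1 - x)^2) = lam x"
        using x by (simp add: odds_def lam_def power2_eq_square)
      ultimately show ?thesis by simp
    qed
    then have "(lam has_integral ln (odds t) - ln (odds s)) {s..t}"
      using st by (intro fundamental_theorem_of_calculus)
        (auto simp: has_real_derivative_iff_has_vector_derivative[symmetric] intro: has_field_derivative_at_within)
    then have 2: "((\<lambda>x. C * lam x) has_integral C * (ln (odds t) - ln (odds s))) {s..t}"
      by (rule has_integral_mult_right)
    have "norm (integral {s..t} (form \<gamma> 0)) \<le> integral {s..t} (\<lambda>x. C * lam x)"
      using 1 2 st C(2) by (intro integral_norm_bound_integral) (auto simp: integrable_on_def)
    then show "norm (path_log \<gamma> t - path_log \<gamma> s) \<le> C * (ln (odds t) - ln (odds s))"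
      by (simp only: integral_unique[OF 1] integral_unique[OF 2])
  qed
qed

end

section \<open>The tree integral\<close>

context tree
begin

lemma wf_children: "wf {(c, v). c \<in> children X v}"
proof (rule wf_subset[OF wf_measure[of "\<lambda>v. Max (root_dist X ` verts X) - root_dist X v"]])
  let ?N = "Max (root_dist X ` verts X)"
  show "{(c, v). c \<in> children X v} \<subseteq> Wellfounded.measure (\<lambda>v. ?N - root_dist X v)"
  proof
    fix z assume "z \<in> {(c, v). c \<in> children X v}"
    then obtain c v where z: "z = (c, v)" and c: "c \<in> verts X" "c \<noteq> rt X" "parent X c = v" by (auto simp: children_def)
    have "root_dist X v < root_dist X c" using parent_props(2)[OF c(1,2)] c(3) by simp
    moreover have "root_dist X c \<le> ?N" using c(1) fin_verts by simp
    ultimately show "z \<in> Wellfounded.measure (\<lambda>v. ?N - root_dist X v)"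
      unfolding z in_measure by linarith
  qed
qed

lemma ex_branch_words: "\<exists>y. branch_words X k y"
proof -
  let ?P = "\<lambda>(y :: _ \<Rightarrow> ncpoly) v r. r = foldr (\<squnion>) (map y (child_list X v)) 1 * edge_word X k v"
  have "\<exists>y. \<forall>v. ?P y v (y v)"
  proof (rule dependent_wf_choice[OF wf_children, of ?P])
    fix y y' :: "_ \<Rightarrow> ncpoly" and v r assume "\<And>z. (z, v) \<in> {(c, v). c \<in> children X v} \<Longrightarrow> y z = y' z"
    then have "map y (child_list X v) = map y' (child_list X v)" by (simp add: child_list(2))
    then show "?P y v r = ?P y' v r" by (simp only:)
  qed blast
  then show ?thesis unfolding branch_words_def by blast
qed

end

section \<open>Regularized integrals of convergent words\<close>

context path_forms
begin

lemma supp_foldr_shuffle_nonempty: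
  "xs \<noteq> [] \<Longrightarrow> (\<And>x. x \<in> set xs \<Longrightarrow> supp x \<subseteq> G - {[]}) \<Longrightarrow> supp (foldr (\<squnion>) xs 1) \<subseteq> G - {[]}"
proof (induction xs)
  case (Cons x xs)
  have z: "supp (foldr (\<squnion>) xs 1) \<subseteq> G"
    using J_foldr_shuffle(1)[of xs "1/2"] Cons.prems(2) by auto
  show ?case
  proof
    fix w assume "w \<in> supp (foldr (\<squnion>) (x # xs) 1)"
    then have "w \<in> supp (x \<squnion> foldr (\<squnion>) xs 1)" by simp
    from subsetD[OF supp_shuffle this]
    obtain u v where "u \<in> supp x" "v \<in> supp (foldr (\<squnion>) xs 1)" "w \<in> supp (shuffle_words u v)"
      by blast
    moreover from this have "u \<in> G - {[]}" "v \<in> G" using Cons.prems(2)[of x] z by auto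
    ultimately have "w \<in> G" "length w = length u + length v" "u \<noteq> []"
      using supp_shuffle_words[of u A p v] by auto
    then show "w \<in> G - {[]}" by auto
  qed
qed simp

lemma supp_letter_power:
  "supp z \<subseteq> G - {[]} \<Longrightarrow> (0 < j \<Longrightarrow> a \<in> A) \<Longrightarrow> supp (z * letter a ^ j) \<subseteq> G - {[]}"
proof (induction j)
  case (Suc j)
  then have "ok (z * letter a ^ j) a" by (cases j) (auto intro!: ok_nonempty)
  then show ?case using ok_supp_letter[of "z * letter a ^ j" a] by (simp only: power_Suc2 mult.assoc)
qed simp

lemma iter_times_form_integrable:
  assumes "u \<in> G" "u \<noteq> []" "a \<in> A" and C: "C \<ge> 0" "\<And>t. 0 < t \<Longrightarrow> t < 1 \<Longrightarrow> norm (f a t) \<le> C"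
  shows "integrable lborel (\<lambda>s. indicator {0<..<1} s *\<^sub>R (f a s * iter f 0 u s))"
proof (rule integrableI_bounded)
  obtain v b where u: "u = v @ [b]" using assms(2) rev_exhaust by blast
  obtain B where B: "B \<ge> 0" "\<And>s. 0 < s \<Longrightarrow> s < 1 \<Longrightarrow> norm (iter f 0 u s) \<le> B * odds s powr (1/2)"
    using iter_props(2)[of v b] assms(1) u by blast
  have [measurable]: "f a \<in> borel_measurable borel" "iter f 0 u \<in> borel_measurable borel"
    using assms(3) iter_measurable[OF start_words_set[OF assms(1)]] by auto
  show "(\<lambda>s. indicator {0<..<1} s *\<^sub>R (f a s * iter f 0 u s)) \<in> borel_measurable lborel" by measurable
  have "(\<integral>\<^sup>+ s. ennreal (norm (indicator {0<..<1} s *\<^sub>R (f a s * iter f 0 u s))) \<partial>lborel)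
      \<le> (\<integral>\<^sup>+ s. ennreal (C * B) * ennreal (indicator {0<..<1} s * odds s powr (1/2)) \<partial>lborel)"
  proof (rule nn_integral_mono)
    fix s :: real
    show "ennreal (norm (indicator {0<..<1} s *\<^sub>R (f a s * iter f 0 u s))) \<le> ennreal (C * B) * ennreal (indicator {0<..<1} s * odds s powr (1/2))"
    proof (cases "s \<in> {0<..<1}")
      case True
      then have "norm (f a s * iter f 0 u s) \<le> C * (B * odds s powr (1/2))"
        unfolding norm_mult using C B by (intro mult_mono) auto
      then have "ennreal (norm (f a s * iter f 0 u s)) \<le> ennreal (C * B * odds s powr (1/2))"
        by (intro ennreal_leI) (simp add: mult.assoc)
      then show ?thesis using True C B by (simp add: ennreal_mult')
    qed simp
  qed
  also have "\<dots> = ennreal (C * B) * (\<integral>\<^sup>+ s. ennreal (indicator {0<..<1} s * odds s powr (1/2)) \<partial>lborel)"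
    by (rule nn_integral_cmult) measurable
  also have "\<dots> < \<infinity>" using nn_integral_odds_half by (simp add: ennreal_mult_less_top)
  finally show "(\<integral>\<^sup>+ s. ennreal (norm (indicator {0<..<1} s *\<^sub>R (f a s * iter f 0 u s))) \<partial>lborel) < \<infinity>" .
qed

end

sublocale smooth_path \<subseteq> F: path_forms_exp S letters_ok "\<gamma> 0" "form \<gamma>"
  by (rule path_forms_exp)

context smooth_path
begin

text \<open>For \<open>z > 0\<close> the cut simplex stays inside the open interval, where
  \<open>form\<close> agrees with the integrand, and neighbouring inequalities imply those for all
  pairs.\<close>

lemma cut_iterated_integral_eq:
  assumes "0 < z"
  shows "cut_iterated_integral \<gamma> ws z = (LINT x|Pi\<^sub>M {..<length ws} (\<lambda>_. lborel). F.cut_integrand ws z x)"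
  unfolding cut_iterated_integral_def set_lebesgue_integral_def
proof (rule Bochner_Integration.integral_cong[OF refl])
  fix x :: "nat \<Rightarrow> real" assume "x \<in> space (Pi\<^sub>M {..<length ws} (\<lambda>_. lborel))"
  then have x: "x \<in> {..<length ws} \<rightarrow>\<^sub>E UNIV" by (simp add: space_PiM)
  let ?c = "(\<forall>i<length ws. z < x i \<and> x i < 1 - z) \<and> (\<forall>i. Suc i < length ws \<longrightarrow> x i < x (Suc i))"
  have mono: "x i < x j" if s: "\<forall>i. Suc i < length ws \<longrightarrow> x i < x (Suc i)" and "i < j" "j < length ws" for i j
    using that(2,3)
  proof (induction j)
    case (Suc j)
    then have "x j < x (Suc j)" using s by simp
    then show ?case using Suc by (cases "i = j") (auto intro: order.strict_trans)
  qed simp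
  have "x \<in> cut_simplex (length ws) z \<longleftrightarrow> ?c"
    using x mono unfolding cut_simplex_def by auto
  then show "indicator (cut_simplex (length ws) z) x *\<^sub>R (\<Prod>i<length ws. vector_derivative \<gamma> (at (x i)) / (\<gamma> (x i) - ws ! i)) = F.cut_integrand ws z x"
    using assms by (auto simp: F.cut_integrand_def form_def indicator_def intro!: prod.cong)
       (meson less_trans less_diff_eq less_add_same_cancel1 order.strict_trans2 diff_less_eq less_imp_le)+
qed

text \<open>The words neither start with \<open>\<gamma> 0\<close> nor end with an end point of the
  path; the form of the last letter is even bounded. So each constant term is an ordinary integral,
  and linearity combines them.\<close>

lemma reg_iterated_integral_times_letter:
  assumes y: "supp y \<subseteq> start_words letters_ok (\<gamma> 0) - {[]}" and a: "a \<in> letters_ok" "a \<noteq> \<gamma> 0" "a \<noteq> \<gamma> 1"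
  shows "reg_iterated_integral \<gamma> (y * letter a) = (LINT s|lborel. indicator {0<..<1} s *\<^sub>R (form \<gamma> a s * F.J y s))"
proof -
  obtain C where C: "C \<ge> 0" "\<And>t. 0 < t \<Longrightarrow> t < 1 \<Longrightarrow> norm (form \<gamma> a t) \<le> C" using form_bound_both[OF a] by blast
  let ?I = "\<lambda>u. LINT s|lborel. indicator {0<..<1} s *\<^sub>R (form \<gamma> a s * iter (form \<gamma>) 0 u s)"
  have ct: "constant_term (cut_iterated_integral \<gamma> (u @ [a])) = ?I u" if "u \<in> supp y" for u
  proof (rule F.constant_term_iter[OF _ _ C])
    show "u \<noteq> []" "u @ [a] \<in> start_words letters_ok (\<gamma> 0)" using y that a by (auto simp: start_words_snoc)
  qed (simp_all only: cut_iterated_integral_eq)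
  have "reg_iterated_integral \<gamma> (y * letter a) = lin (\<lambda>u. constant_term (cut_iterated_integral \<gamma> u)) (y * letter a)"
    by (simp add: reg_iterated_integral_def lin_def)
  also have "\<dots> = lin ?I y" unfolding lin_times_letter by (rule lin_cong) (rule ct)
  also have "\<dots> = (\<Sum>u\<in>Poly_Mapping.keys y. LINT s|lborel. of_rat (Poly_Mapping.lookup y u) *
      (indicator {0<..<1} s *\<^sub>R (form \<gamma> a s * iter (form \<gamma>) 0 (letters u) s)))"
    by (simp only: lin_def integral_mult_right_zero)
  also have "\<dots> = (LINT s|lborel. (\<Sum>u\<in>Poly_Mapping.keys y. of_rat (Poly_Mapping.lookup y u) *
      (indicator {0<..<1} s *\<^sub>R (form \<gamma> a s * iter (form \<gamma>) 0 (letters u) s))))"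
    by (rule Bochner_Integration.integral_sum[symmetric], intro integrable_mult_right impI F.iter_times_form_integrable[OF _ _ a(1) C])
       (use y in auto)
  also have "\<dots> = (LINT s|lborel. indicator {0<..<1} s *\<^sub>R (form \<gamma> a s * F.J y s))"
    by (intro Bochner_Integration.integral_cong) (auto simp: F.J_sum sum_distrib_left scaleR_conv_of_real mult_ac)
  finally show ?thesis .
qed

end

text \<open>The hypotheses of the theorem in terms of children instead of degrees.
  \<open>large_index\<close> keeps 0 off the open path as soon as an index produces a logarithm or a
  factor of index 0.\<close>

locale harvest = smooth_path \<gamma> S v\<^sub>0 v\<^sub>1 + tree X
  for \<gamma> :: "real \<Rightarrow> complex" and S v\<^sub>0 v\<^sub>1 and X :: "'v crtree" +
  fixes k :: "'v set \<Rightarrow> nat"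
  assumes colors: "v \<in> verts X \<Longrightarrow> color X v \<in> letters_ok"
    and root_color: "color X (rt X) \<noteq> \<gamma> 0" "color X (rt X) \<noteq> \<gamma> 1"
    and root_child: "card (children X (rt X)) = 1"
    and start_color: "v \<in> verts X - {rt X} \<Longrightarrow> children X v = {} \<Longrightarrow> color X v \<noteq> \<gamma> 0"
    and branch_color: "v \<in> verts X - {rt X} \<Longrightarrow> card (children X v) \<ge> 2 \<Longrightarrow> color X v = 0"
    and zero_index: "v \<in> verts X - {rt X} \<Longrightarrow> vindex X k v = 0 \<Longrightarrow> card (children X v) \<ge> 2 \<and> color X (parent X v) \<noteq> 0"
    and large_index: "v \<in> verts X \<Longrightarrow> vindex X k v \<noteq> 1 \<Longrightarrow> 0 \<in> letters_ok"
begin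

abbreviation "r \<equiv> rt X"
abbreviation "V \<equiv> verts X"
abbreviation "ind \<equiv> vindex X k"
abbreviation "Fr \<equiv> free_verts X k"

lemma ind_root: "ind r = 1"
  by (simp add: vindex_def)

lemma ind_nonroot: "v \<noteq> r \<Longrightarrow> ind v = k {v, parent X v}"
  by (simp add: vindex_def)

lemma Fr_iff: "v \<in> Fr \<longleftrightarrow> v \<in> V \<and> ind v > 0"
  by (simp add: free_verts_def)

lemma root_Fr: "r \<in> Fr"
  using root_vert ind_root by (simp add: Fr_iff)

lemma finite_Fr: "finite Fr"
  using fin_verts by (simp add: free_verts_def)

text \<open>A parent of index 0 would have colour 0, which \<open>zero_index\<close> forbids. So no
  two vertices of index 0 are adjacent, and contraction never has to climb more than one extra
  step.\<close>

lemma zero_color: "v \<in> V \<Longrightarrow> ind v = 0 \<Longrightarrow> v \<noteq> r \<and> color X v = 0 \<and> parent X v \<in> Fr"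
proof -
  assume v: "v \<in> V" "ind v = 0"
  then have nr: "v \<noteq> r" using ind_root by auto
  then have z: "card (children X v) \<ge> 2" "color X (parent X v) \<noteq> 0" using zero_index[of v] v by auto
  then have "color X v = 0" using branch_color[of v] v nr by auto
  moreover have "parent X v \<in> Fr"
  proof (cases "parent X v = r")
    case False
    have p: "parent X v \<in> V" using parent_vert[OF v(1) nr] .
    have "ind (parent X v) \<noteq> 0"
      using zero_index[of "parent X v"] branch_color[of "parent X v"] z(2) p False by auto
    then show ?thesis using p by (simp add: Fr_iff)
  qed (simp add: root_Fr)
  ultimately show ?thesis using nr by blast
qed

lemma word_tree: "word_tree X k"
  unfolding word_tree_def using tree root_child zero_index branch_color by (auto simp: ind_nonroot[symmetric])

text \<open>Vertices of index \<open>0\<close> are contracted: \<open>par\<close> and \<open>fch\<close> are the parent and the children after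
  contraction, and \<open>zch v\<close> consists of the vertices contracted into \<open>v\<close>.\<close>

definition par :: "'v \<Rightarrow> 'v" where
  "par v = (if parent X v \<in> Fr then parent X v else parent X (parent X v))"

definition fch :: "'v \<Rightarrow> 'v set" where
  "fch v = {c \<in> Fr - {r}. par c = v}"

definition zch :: "'v \<Rightarrow> 'v set" where
  "zch v = {c \<in> children X v. ind c = 0}"

lemma par_props:
  assumes "v \<in> Fr - {r}"
  shows "par v \<in> Fr" "root_dist X (par v) < root_dist X v"
proof -
  have v: "v \<in> V" "v \<noteq> r" using assms by (auto simp: Fr_iff)
  note p = parent_props(2)[OF v] parent_vert[OF v]
  have "par v \<in> Fr \<and> root_dist X (par v) < root_dist X v"
  proof (cases "parent X v \<in> Fr")
    case True
    then show ?thesis using p by (simp add: par_def)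
  next
    case False
    then have z: "ind (parent X v) = 0" using p(2) by (simp add: Fr_iff)
    note zc = zero_color[OF p(2) z]
    show ?thesis using zc False p parent_props(2)[OF p(2)] by (simp add: par_def)
  qed
  then show "par v \<in> Fr" "root_dist X (par v) < root_dist X v" by blast+
qed

lemma zero_child_free: "c \<in> V \<Longrightarrow> ind c = 0 \<Longrightarrow> d \<in> children X c \<Longrightarrow> d \<in> Fr - {r}"
  using zero_color[of c] zero_index[of d] zero_color[of d] by (auto simp: children_def Fr_iff)

lemma fch_eq:
  assumes v: "v \<in> Fr"
  shows "fch v = (children X v - zch v) \<union> (\<Union>c\<in>zch v. children X c)"
proof (intro set_eqI iffI)
  fix d assume d: "d \<in> fch v"
  then have dd: "d \<in> V" "d \<noteq> r" "ind d > 0" by (auto simp: fch_def Fr_iff)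
  show "d \<in> (children X v - zch v) \<union> (\<Union>c\<in>zch v. children X c)"
  proof (cases "parent X d \<in> Fr")
    case True
    then show ?thesis using d dd by (auto simp: fch_def par_def children_def zch_def)
  next
    case False
    then have z: "ind (parent X d) = 0" "parent X d \<in> V" using parent_vert[OF dd(1,2)] by (auto simp: Fr_iff)
    have "parent X (parent X d) = v" using d False by (auto simp: fch_def par_def)
    then have "parent X d \<in> zch v" using z zero_color[OF z(2,1)] by (auto simp: zch_def children_def)
    then show ?thesis using dd by (auto simp: children_def)
  qed
next
  fix d assume "d \<in> (children X v - zch v) \<union> (\<Union>c\<in>zch v. children X c)"
  then consider "d \<in> children X v" "ind d > 0" | c where "c \<in> zch v" "d \<in> children X c" by (auto simp: zch_def)
  then show "d \<in> fch v"
  proof cases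
    case 1
    then show ?thesis using v by (auto simp: fch_def children_def Fr_iff par_def)
  next
    case 2
    then have c: "c \<in> V" "ind c = 0" "parent X c = v" "c \<notin> Fr" by (auto simp: zch_def children_def Fr_iff)
    have "d \<in> Fr - {r}" "parent X d = c" using zero_child_free[OF c(1,2) 2(2)] 2 by (auto simp: children_def)
    then show ?thesis using c by (auto simp: fch_def par_def)
  qed
qed

text \<open>The value of a contracted vertex is the product over its children, so it may be
  exchanged for them in the product at its parent.\<close>

lemma prod_fch:
  fixes h :: "'v \<Rightarrow> complex"
  assumes v: "v \<in> Fr" and h: "\<And>c. c \<in> zch v \<Longrightarrow> h c = (\<Prod>d\<in>children X c. h d)"
  shows "(\<Prod>c\<in>fch v. h c) = (\<Prod>c\<in>children X v. h c)"
proof -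
  have fz: "finite (zch v)" using children_sub(2)[of v] by (auto simp: zch_def intro: finite_subset)
  have disj: "(children X v - zch v) \<inter> (\<Union>c\<in>zch v. children X c) = {}"
  proof -
    have "v \<noteq> c" if "c \<in> zch v" for c using that v by (auto simp: zch_def Fr_iff)
    then show ?thesis by (auto simp: children_def)
  qed
  have "(\<Prod>c\<in>fch v. h c) = (\<Prod>c\<in>children X v - zch v. h c) * (\<Prod>d\<in>(\<Union>c\<in>zch v. children X c). h d)"
    unfolding fch_eq[OF v] using fz children_sub(2) disj by (intro prod.union_disjoint) auto
  also have "(\<Prod>d\<in>(\<Union>c\<in>zch v. children X c). h d) = (\<Prod>c\<in>zch v. \<Prod>d\<in>children X c. h d)"
    using fz children_sub(2) by (intro prod.UNION_disjoint) (auto simp: children_def)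
  also have "\<dots> = (\<Prod>c\<in>zch v. h c)" using h by simp
  also have "(\<Prod>c\<in>children X v - zch v. h c) * (\<Prod>c\<in>zch v. h c) = (\<Prod>c\<in>children X v. h c)"
    using children_sub(2)[of v] by (subst prod.subset_diff[of "zch v" "children X v"]) (auto simp: zch_def)
  finally show ?thesis .
qed

text \<open>A leaf of the contracted tree is a leaf of \<open>X\<close>, because contracted vertices
  have children that survive. Hence the condition on leaf colours applies to it.\<close>

lemma fch_empty: "v \<in> Fr \<Longrightarrow> fch v = {} \<Longrightarrow> children X v = {}"
proof -
  assume v: "v \<in> Fr" "fch v = {}"
  show ?thesis
  proof (rule ccontr)
    assume "children X v \<noteq> {}"
    then obtain c where c: "c \<in> children X v" by blast
    then have cz: "c \<in> zch v" using v fch_eq[OF v(1)] by blast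
    then have "card (children X c) \<ge> 2" using c zero_index[of c] by (auto simp: zch_def children_def)
    then have "children X c \<noteq> {}" by auto
    then show False using v fch_eq[OF v(1)] cz by blast
  qed
qed

definition y :: "'v \<Rightarrow> ncpoly" where "y = (SOME y. branch_words X k y)"

lemma y_words: "branch_words X k y"
  unfolding y_def by (rule someI_ex[OF ex_branch_words])

definition x :: "'v \<Rightarrow> ncpoly" where "x v = foldr (\<squnion>) (map y (child_list X v)) 1"

lemma y_zero: "v \<in> V \<Longrightarrow> ind v = 0 \<Longrightarrow> y v = x v"
  using y_words zero_color[of v] by (simp add: branch_words_def edge_word_def x_def ind_nonroot[symmetric])

lemma y_pos: "v \<in> Fr - {r} \<Longrightarrow> y v = x v * letter (color X v) * letter 0 ^ (ind v - 1)"
  using y_words by (auto simp: branch_words_def edge_word_def x_def ind_nonroot[symmetric] Fr_iff mult.assoc)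

text \<open>Every word begins with the colour of a leaf, which is not \<open>\<gamma> 0\<close>;
  nonemptiness passes through a vertex of index 0 because it has children.\<close>

lemma supp_y: "v \<in> V - {r} \<Longrightarrow> supp (y v) \<subseteq> F.G - {[]}"
  and x_ok: "v \<in> V - {r} \<Longrightarrow> supp (x v) \<subseteq> F.G \<and> (children X v \<noteq> {} \<longrightarrow> supp (x v) \<subseteq> F.G - {[]}) \<and> F.ok (x v) (color X v)"
proof -
  have "supp (y v) \<subseteq> F.G - {[]} \<and> supp (x v) \<subseteq> F.G \<and> (children X v \<noteq> {} \<longrightarrow> supp (x v) \<subseteq> F.G - {[]}) \<and> F.ok (x v) (color X v)"
    if "v \<in> V - {r}" for v
    using wf_children that
  proof (induction v rule: wf_induct_rule)
    case (less v)
    have IH: "supp (y c) \<subseteq> F.G - {[]}" if "c \<in> children X v" for c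
      using less.IH[of c] that by (auto simp: children_def)
    have 1: "supp (x v) \<subseteq> F.G - {[]}" if "children X v \<noteq> {}"
      unfolding x_def using IH child_list(2)[of v] that
      by (intro F.supp_foldr_shuffle_nonempty) auto
    have xe: "x v = 1" if "children X v = {}" using child_list(2)[of v] that by (simp add: x_def)
    have 2: "F.ok (x v) (color X v)"
    proof (cases "children X v = {}")
      case True
      then have "color X v \<noteq> \<gamma> 0" "color X v \<in> letters_ok" using start_color colors less.prems by auto
      then show ?thesis using xe[OF True] by (simp add: F.ok_def letters_zero start_words_def)
    next
      case False
      then show ?thesis using 1 colors less.prems by (intro F.ok_nonempty) auto
    qed
    have "supp (y v) \<subseteq> F.G - {[]}"
    proof (cases "ind v = 0")
      case True
      then have "children X v \<noteq> {}" using zero_index[OF less.prems] by auto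
      then show ?thesis using 1 y_zero True less.prems by simp
    next
      case False
      then have "y v = x v * letter (color X v) * letter 0 ^ (ind v - 1)" using less.prems by (intro y_pos) (simp add: Fr_iff)
      moreover have "0 \<in> letters_ok" if "0 < ind v - 1" using large_index[of v] less.prems that by auto
      ultimately show ?thesis using F.supp_letter_power[OF F.ok_supp_letter[OF 2]] by simp
    qed
    then show ?case using 1 2 F.ok_supp by blast
  qed
  then show "v \<in> V - {r} \<Longrightarrow> supp (y v) \<subseteq> F.G - {[]}"
    and "v \<in> V - {r} \<Longrightarrow> supp (x v) \<subseteq> F.G \<and> (children X v \<noteq> {} \<longrightarrow> supp (x v) \<subseteq> F.G - {[]}) \<and> F.ok (x v) (color X v)"
    by blast+
qed

lemma J_x:
  assumes "0 < t" "t < 1"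
  shows "F.J (x v) t = (\<Prod>c\<in>children X v. F.J (y c) t)"
proof -
  have "F.J (x v) t = prod_list (map (\<lambda>z. F.J z t) (map y (child_list X v)))"
    unfolding x_def using supp_y child_list(2)[of v] assms
    by (intro F.J_foldr_shuffle(2)) (auto simp: children_def)
  also have "\<dots> = (\<Prod>c\<in>children X v. F.J (y c) t)"
    using prod.distinct_set_conv_list[OF child_list(1)[of v], of "\<lambda>c. F.J (y c) t"] child_list(2)[of v]
    by (simp add: o_def)
  finally show ?thesis .
qed

lemma J_fch:
  assumes "v \<in> Fr" "0 < t" "t < 1"
  shows "(\<Prod>c\<in>fch v. F.J (y c) t) = F.J (x v) t"
  unfolding J_x[OF assms(2,3)]
proof (rule prod_fch[OF assms(1)])
  fix c assume "c \<in> zch v"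
  then have "y c = x c" by (intro y_zero) (auto simp: zch_def children_def)
  then show "F.J (y c) t = (\<Prod>d\<in>children X c. F.J (y d) t)" using J_x[OF assms(2,3), of c] by simp
qed

text \<open>The tree domain is closed, but \<open>path_log\<close> and the forms have junk values at \<open>0\<close> and \<open>1\<close>.  The next
  three functions reproduce these values and are measurable all the same.\<close>

definition L :: "real \<Rightarrow> complex" where
  "L t = (if 0 \<in> letters_ok \<and> 0 \<le> t \<and> t \<le> 1 then path_log \<gamma> t else 0)"

definition dens :: "'v \<Rightarrow> real \<Rightarrow> complex" where
  "dens v s = (if 0 \<le> s \<and> s \<le> 1 then \<gamma>' s / (\<gamma> s - color X v) * (\<Prod>w\<in>zch v. \<gamma> s / (\<gamma> s - color X w)) else 0)"

definition K :: "'v \<Rightarrow> real \<Rightarrow> real \<Rightarrow> complex" where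
  "K v t s = (if 0 \<le> s \<and> s < t \<and> t \<le> 1 then (L t - L s) ^ (ind v - 1) / fact (ind v - 1) * dens v s else 0)"

lemma measurable_endpoints:
  fixes h g :: "real \<Rightarrow> complex"
  assumes [measurable]: "g \<in> borel_measurable borel"
    and "\<And>s. 0 < s \<Longrightarrow> s < 1 \<Longrightarrow> h s = g s" and "\<And>s. s < 0 \<or> 1 < s \<Longrightarrow> h s = 0"
  shows "h \<in> borel_measurable borel"
proof -
  have "h = (\<lambda>s. if 0 < s \<and> s < 1 then g s else if s = 0 then h 0 else if s = 1 then h 1 else 0)"
    using assms(2,3) by (auto simp: fun_eq_iff)
  also have "\<dots> \<in> borel_measurable borel" by measurable
  finally show ?thesis .
qed

text \<open>A contracted vertex has colour 0, so its factor is
  \<open>\<gamma> s / \<gamma> s = 1\<close> inside the interval. Only at the end points, where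
  \<open>\<gamma>\<close> may be 0, can it be something else.\<close>

lemma dens_eq: "v \<in> V \<Longrightarrow> 0 < s \<Longrightarrow> s < 1 \<Longrightarrow> dens v s = form \<gamma> (color X v) s"
proof -
  assume v: "v \<in> V" and s: "0 < s" "s < 1"
  have "(\<Prod>w\<in>zch v. \<gamma> s / (\<gamma> s - color X w)) = 1"
  proof (rule prod.neutral, rule ballI)
    fix w assume "w \<in> zch v"
    then have w: "w \<in> V" "ind w = 0" by (auto simp: zch_def children_def)
    then have "color X w = 0" "0 \<in> letters_ok" using zero_color[OF w] large_index[of w] by auto
    then show "\<gamma> s / (\<gamma> s - color X w) = 1" using letters_ok_nz[of 0 s] s by simp
  qed
  then show ?thesis using s by (simp add: dens_def form_def)
qed

lemma dens_measurable: "v \<in> V \<Longrightarrow> dens v \<in> borel_measurable borel"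
  using colors dens_eq by (intro measurable_endpoints[OF form_measurable[of "color X v"]]) (auto simp: dens_def)

lemma L_measurable[measurable]: "L \<in> borel_measurable borel"
proof (cases "0 \<in> letters_ok")
  case True
  have "(\<lambda>t. indicator {0<..<1} t *\<^sub>R path_log \<gamma> t) \<in> borel_measurable borel"
    by (intro borel_measurable_continuous_on_indicator path_log(1) True) auto
  then show ?thesis by (rule measurable_endpoints) (auto simp: L_def True)
next
  case False
  then have "L = (\<lambda>_. 0)" by (auto simp: L_def)
  then show ?thesis by simp
qed

lemma odds_ratio: "0 < s \<Longrightarrow> s < t \<Longrightarrow> t < 1 \<Longrightarrow> 0 < b \<Longrightarrow> 1 \<le> (odds t / odds s) powr b"
  using odds_mono[of s t] odds_pos[of s] by (intro ge_one_powr_ge_zero) auto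

lemma L_power_bound:
  assumes v: "v \<in> V" and b: "0 < b"
  shows "\<exists>c\<ge>0. \<forall>s t. 0 < s \<longrightarrow> s < t \<longrightarrow> t < 1 \<longrightarrow>
     norm ((L t - L s) ^ (ind v - 1) / fact (ind v - 1)) \<le> c * (odds t / odds s) powr b"
proof (cases "0 \<in> letters_ok")
  case True
  obtain C where "C \<ge> 0" "\<And>s t. 0 < s \<Longrightarrow> s \<le> t \<Longrightarrow> t < 1 \<Longrightarrow> norm (path_log \<gamma> t - path_log \<gamma> s) \<le> C * (ln (odds t) - ln (odds s))"
    using path_log_bound[OF True] by blast
  from log_power_bound[of "path_log \<gamma>" C, OF this(2) this(1) b, of "ind v - 1"]
  show ?thesis using True by (auto simp: L_def)
next
  case False
  then have "ind v = 1" using large_index[OF v] by blast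
  then show ?thesis using odds_ratio[OF _ _ _ b] by (intro exI[of _ 1]) auto
qed

lemma K_bound:
  assumes v: "v \<in> V" and b: "0 < b" and h: "h \<ge> 0" "\<And>s. 0 < s \<Longrightarrow> s < 1 \<Longrightarrow> norm (form \<gamma> (color X v) s) \<le> h * m s"
  shows "\<exists>c\<ge>0. \<forall>t s. 0 < t \<longrightarrow> t < 1 \<longrightarrow> s \<noteq> 0 \<longrightarrow>
        norm (K v t s) \<le> c * (indicator {0<..<t} s * ((odds t / odds s) powr b * m s))"
proof -
  obtain c where c: "c \<ge> 0" "\<And>s t. 0 < s \<Longrightarrow> s < t \<Longrightarrow> t < 1 \<Longrightarrow>
     norm ((L t - L s) ^ (ind v - 1) / fact (ind v - 1)) \<le> c * (odds t / odds s) powr b"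
    using L_power_bound[OF v b] by blast
  show ?thesis
  proof (intro exI[of _ "c * h"] conjI allI impI)
    fix t s :: real assume ts: "0 < t" "t < 1" "s \<noteq> 0"
    show "norm (K v t s) \<le> c * h * (indicator {0<..<t} s * ((odds t / odds s) powr b * m s))"
    proof (cases "0 < s \<and> s < t")
      case True
      have "norm (K v t s) = norm ((L t - L s) ^ (ind v - 1) / fact (ind v - 1)) * norm (form \<gamma> (color X v) s)"
        using True ts dens_eq[OF v, of s] by (simp add: K_def norm_mult norm_divide)
      also have "\<dots> \<le> (c * (odds t / odds s) powr b) * (h * m s)"
        using c h(2)[of s] True ts by (intro mult_mono) auto
      finally show ?thesis using True by (simp add: mult_ac)
    next
      case False
      then have "K v t s = 0" using ts by (auto simp: K_def)
      then show ?thesis using False by simp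
    qed
  qed (use c h in auto)
qed

text \<open>The recursion that \<open>tree_integral_by_recursion\<close> asks for.
  \<open>J_letter\<close> or \<open>J_letter_power\<close> handles the edge word, and
  \<open>J_fch\<close> turns the shuffle at \<open>v\<close> into the product over the contracted
  children.\<close>

lemma J_y:
  assumes v: "v \<in> Fr - {r}" and t: "0 < t" "t < 1"
  shows "F.J (y v) t = (LINT s|lborel. K v t s * (\<Prod>c\<in>fch v. F.J (y c) s))"
proof -
  have vV: "v \<in> V - {r}" "v \<in> Fr" using v by (auto simp: Fr_iff)
  have ok: "F.ok (x v) (color X v)" and ca: "color X v \<in> letters_ok" using x_ok[OF vV(1)] colors vV by auto
  let ?m = "ind v - 1"
  have "F.J (y v) t = (LINT s|lborel. indicator {0<..<t} s *\<^sub>R ((L t - L s) ^ ?m / fact ?m * (form \<gamma> (color X v) s * F.J (x v) s)))"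
  proof (cases "?m = 0")
    case True
    then show ?thesis unfolding y_pos[OF v] using F.J_letter[OF ok t] by simp
  next
    case False
    then have z: "0 \<in> letters_ok" using large_index[of v] vV by auto
    obtain C where C: "C \<ge> 0" "\<And>s t. 0 < s \<Longrightarrow> s \<le> t \<Longrightarrow> t < 1 \<Longrightarrow> norm (path_log \<gamma> t - path_log \<gamma> s) \<le> C * (ln (odds t) - ln (odds s))"
      using path_log_bound[OF z] by blast
    have "F.J (y v) t = (LINT s|lborel. indicator {0<..<t} s *\<^sub>R ((path_log \<gamma> t - path_log \<gamma> s) ^ ?m / fact ?m * (form \<gamma> (color X v) s * F.J (x v) s)))"
      unfolding y_pos[OF v] by (rule F.J_letter_power[OF ok ca z path_log(1)[OF z] path_log_deriv[OF z] C(2) C(1) t])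
    also have "\<dots> = (LINT s|lborel. indicator {0<..<t} s *\<^sub>R ((L t - L s) ^ ?m / fact ?m * (form \<gamma> (color X v) s * F.J (x v) s)))"
      using t z by (intro Bochner_Integration.integral_cong) (auto simp: L_def indicator_def)
    finally show ?thesis .
  qed
  \<comment> \<open>The kernel \<open>K\<close> admits \<open>s = 0\<close> with its junk value,
    unlike the integral over the open interval; the difference is a null set.\<close>
  also have "\<dots> = (LINT s|lborel. (if s = 0 then 0 else K v t s * (\<Prod>c\<in>fch v. F.J (y c) s)))"
  proof (rule Bochner_Integration.integral_cong[OF refl])
    fix s
    show "indicator {0<..<t} s *\<^sub>R ((L t - L s) ^ ?m / fact ?m * (form \<gamma> (color X v) s * F.J (x v) s)) =
      (if s = 0 then 0 else K v t s * (\<Prod>c\<in>fch v. F.J (y c) s))"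
    proof (cases "0 < s \<and> s < t")
      case True
      then show ?thesis using t dens_eq[of v s] J_fch[OF vV(2), of s] vV by (simp add: K_def)
    qed (use t in \<open>auto simp: K_def\<close>)
  qed
  also have "\<dots> = (LINT s|lborel. K v t s * (\<Prod>c\<in>fch v. F.J (y c) s))"
  proof (rule integral_cong_AE)
    have Km: "(\<lambda>s. K v t s) \<in> borel_measurable borel"
    proof -
      have [measurable]: "dens v \<in> borel_measurable borel" using dens_measurable vV by auto
      show ?thesis unfolding K_def by measurable
    qed
    have [measurable]: "(\<lambda>s. K v t s * (\<Prod>c\<in>fch v. F.J (y c) s)) \<in> borel_measurable borel"
      using supp_y by (intro borel_measurable_times Km borel_measurable_prod F.J_measurable) (auto simp: fch_def Fr_iff)
    show "(\<lambda>s. if s = 0 then 0 else K v t s * (\<Prod>c\<in>fch v. F.J (y c) s)) \<in> borel_measurable lborel"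
      "(\<lambda>s. K v t s * (\<Prod>c\<in>fch v. F.J (y c) s)) \<in> borel_measurable lborel" by measurable
    show "AE s in lborel. (if s = 0 then 0 else K v t s * (\<Prod>c\<in>fch v. F.J (y c) s)) = K v t s * (\<Prod>c\<in>fch v. F.J (y c) s)"
      using AE_not_01 by eventually_elim auto
  qed
  finally show ?thesis .
qed

end

section \<open>The integral over the contracted tree\<close>

lemma integral_cong_except_01:
  fixes f g :: "real \<Rightarrow> complex"
  assumes [measurable]: "f \<in> borel_measurable borel" and e: "\<And>s. s \<noteq> 0 \<Longrightarrow> s \<noteq> 1 \<Longrightarrow> g s = f s"
  shows "(LINT s|lborel. g s) = (LINT s|lborel. f s)"
proof (rule integral_cong_AE)
  have "g = (\<lambda>s. if s = 0 then g 0 else if s = 1 then g 1 else f s)" using e by (auto simp: fun_eq_iff)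
  also have "\<dots> \<in> borel_measurable borel" by measurable
  finally show "g \<in> borel_measurable lborel" by simp
  show "AE s in lborel. g s = f s" using AE_not_01 by eventually_elim (auto simp: e)
qed simp

context harvest
begin

lemma integral_over_free_vertices:
  assumes c: "children X r = {c}"
  shows "(LINT x|Pi\<^sub>M Fr (\<lambda>_. lborel). dens r (x r) * (\<Prod>v\<in>Fr - {r}. K v (x (par v)) (x v)))
     = (LINT s|lborel. indicator {0<..<1} s *\<^sub>R (form \<gamma> (color X r) s * F.J (y c) s))"
proof -
  \<comment> \<open>The recursion has to hold for every real \<open>t\<close>, while
    \<open>J_y\<close> gives it inside (0, 1) only. Elsewhere \<open>T\<close> is defined by the
    recursion; these values do not feed back, as the kernels vanish for almost all \<open>s\<close>
    outside (0, 1).\<close>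
  define T where "T = (\<lambda>v t. if 0 < t \<and> t < 1 then F.J (y v) t else (LINT s|lborel. K v t s * (\<Prod>c\<in>fch v. F.J (y c) s)))"
  have T01: "T v t = F.J (y v) t" if "0 < t" "t < 1" for v t using that by (simp add: T_def)
  have dm: "dens v \<in> borel_measurable borel" if "v \<in> Fr" for v using dens_measurable that by (simp add: Fr_iff)
  have Km: "(\<lambda>z. K v (fst z) (snd z)) \<in> borel_measurable (borel \<Otimes>\<^sub>M borel)" if "v \<in> Fr" for v
  proof -
    have [measurable]: "dens v \<in> borel_measurable borel" by (rule dm[OF that])
    show ?thesis unfolding K_def by measurable
  qed
  have Km1: "(\<lambda>s. K v t s) \<in> borel_measurable borel" if "v \<in> Fr" for v t
  proof -
    have [measurable]: "dens v \<in> borel_measurable borel" by (rule dm[OF that])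
    show ?thesis unfolding K_def by measurable
  qed
  have Jm: "(\<lambda>s. \<Prod>c\<in>fch v. F.J (y c) s) \<in> borel_measurable borel" for v
    using supp_y by (intro borel_measurable_prod F.J_measurable) (auto simp: fch_def Fr_iff)
  have Teq: "T v t = (LINT s|lborel. K v t s * (\<Prod>c\<in>fch v. T c s))" if v: "v \<in> Fr - {r}" for v t
  proof -
    have "T v t = (LINT s|lborel. K v t s * (\<Prod>c\<in>fch v. F.J (y c) s))"
      using J_y[OF v, of t] by (simp add: T_def)
    also have "\<dots> = (LINT s|lborel. K v t s * (\<Prod>c\<in>fch v. T c s))"
    proof (rule integral_cong_except_01[symmetric])
      show "(\<lambda>s. K v t s * (\<Prod>c\<in>fch v. F.J (y c) s)) \<in> borel_measurable borel"
        using Km1 Jm v by (intro borel_measurable_times) auto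
      fix s :: real assume s: "s \<noteq> 0" "s \<noteq> 1"
      show "K v t s * (\<Prod>c\<in>fch v. T c s) = K v t s * (\<Prod>c\<in>fch v. F.J (y c) s)"
      proof (cases "0 < s \<and> s < 1")
        case True
        then show ?thesis by (simp add: T01)
      next
        case False
        then have "K v t s = 0" using s by (auto simp: K_def)
        then show ?thesis by simp
      qed
    qed
    finally show ?thesis .
  qed
  have P: "par v \<in> Fr \<and> root_dist X (par v) < root_dist X v" if "v \<in> Fr - {r}" for v
    using par_props[OF that] by blast
  have B1: "\<exists>c\<ge>0. \<forall>t s. 0 < t \<longrightarrow> t < 1 \<longrightarrow> s \<noteq> 0 \<longrightarrow>
        norm (K v t s) \<le> c * (indicator {0<..<t} s * ((odds t / odds s) powr b * lam s))" if v: "v \<in> Fr - {r}" and b: "0 < b" for v b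
  proof -
    have vV: "v \<in> V" using v by (auto simp: Fr_iff)
    obtain h where "h \<ge> 0" "\<And>t. 0 < t \<Longrightarrow> t < 1 \<Longrightarrow> norm (form \<gamma> (color X v) t) \<le> h * lam t"
      using form_bound[OF colors[OF vV]] by blast
    from K_bound[OF vV b this] show ?thesis .
  qed
  have B2: "\<exists>c\<ge>0. \<forall>t s. 0 < t \<longrightarrow> t < 1 \<longrightarrow> s \<noteq> 0 \<longrightarrow>
        norm (K v t s) \<le> c * (indicator {0<..<t} s * ((odds t / odds s) powr b * (1 / (1 - s))))"
    if v: "v \<in> Fr - {r}" and e: "{c \<in> Fr - {r}. par c = v} = {}" and b: "0 < b" for v b
  proof -
    have vV: "v \<in> V - {r}" "v \<in> Fr" using v by (auto simp: Fr_iff)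
    have "children X v = {}" using fch_empty[OF vV(2)] e by (simp add: fch_def)
    then have "color X v \<noteq> \<gamma> 0" by (rule start_color[OF vV(1)])
    then obtain h where "h \<ge> 0" "\<And>t. 0 < t \<Longrightarrow> t < 1 \<Longrightarrow> norm (form \<gamma> (color X v) t) \<le> h * (1 / (1 - t))"
      using form_bound_start[of "color X v"] colors vV by blast
    from K_bound[OF _ b this] vV(1) show ?thesis by simp
  qed
  have B3: "\<exists>c\<ge>0. \<forall>s. s \<noteq> 0 \<longrightarrow> s \<noteq> 1 \<longrightarrow> norm (dens r s) \<le> c * indicator {0<..<1} s"
  proof -
    obtain C where C: "C \<ge> 0" "\<And>t. 0 < t \<Longrightarrow> t < 1 \<Longrightarrow> norm (form \<gamma> (color X r) t) \<le> C"
      using form_bound_both[OF colors[OF root_vert] root_color] by blast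
    show ?thesis
    proof (intro exI[of _ C] conjI C(1) allI impI)
      fix s :: real assume s: "s \<noteq> 0" "s \<noteq> 1"
      show "norm (dens r s) \<le> C * indicator {0<..<1} s"
      proof (cases "0 < s \<and> s < 1")
        case True
        then show ?thesis using C(2)[of s] dens_eq[OF root_vert, of s] by simp
      next
        case False
        then have "dens r s = 0" using s by (auto simp: dens_def)
        then show ?thesis using C(1) by simp
      qed
    qed
  qed
  have B4: "{c \<in> Fr - {r}. par c = r} \<noteq> {}"
  proof
    assume "{c \<in> Fr - {r}. par c = r} = {}"
    then have "children X r = {}" using fch_empty[OF root_Fr] by (simp add: fch_def)
    then show False using c by simp
  qed
  have "(LINT x|Pi\<^sub>M Fr (\<lambda>_. lborel). dens r (x r) * (\<Prod>v\<in>Fr - {r}. K v (x (par v)) (x v)))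
      = (LINT s|lborel. dens r s * (\<Prod>c\<in>{c \<in> Fr - {r}. par c = r}. T c s))"
    by (rule tree_integral_by_recursion(2)[where rank="root_dist X" and T=T,
          OF finite_Fr root_Fr P Km dm[OF root_Fr] Teq[unfolded fch_def] B1 B2 B3 B4]) auto
  also have "\<dots> = (LINT s|lborel. indicator {0<..<1} s *\<^sub>R (form \<gamma> (color X r) s * F.J (y c) s))"
  proof (rule integral_cong_except_01)
    have cV: "c \<in> V - {r}" using c by (auto simp: children_def)
    have [measurable]: "form \<gamma> (color X r) \<in> borel_measurable borel" "F.J (y c) \<in> borel_measurable borel"
      using form_measurable[OF colors[OF root_vert]] F.J_measurable[of "y c"] supp_y[OF cV] by auto
    show "(\<lambda>s. indicator {0<..<1} s *\<^sub>R (form \<gamma> (color X r) s * F.J (y c) s)) \<in> borel_measurable borel" by measurable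
    fix s :: real assume s: "s \<noteq> 0" "s \<noteq> 1"
    show "dens r s * (\<Prod>c\<in>{c \<in> Fr - {r}. par c = r}. T c s) = indicator {0<..<1} s *\<^sub>R (form \<gamma> (color X r) s * F.J (y c) s)"
    proof (cases "0 < s \<and> s < 1")
      case True
      then have "(\<Prod>c\<in>{c \<in> Fr - {r}. par c = r}. T c s) = F.J (y c) s"
        using J_fch[OF root_Fr, of s] J_x[of s r] c by (simp add: T01 fch_def)
      then show ?thesis using True dens_eq[OF root_vert, of s] by simp
    next
      case False
      then have "dens r s = 0" using s by (auto simp: dens_def)
      then show ?thesis using False by simp
    qed
  qed
  finally show ?thesis .
qed

section \<open>Parametrization of the tree domain by its free coordinates\<close>

definition in_dom :: "('v \<Rightarrow> real) \<Rightarrow> bool" where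
  "in_dom s \<longleftrightarrow> (\<forall>v\<in>Fr. 0 \<le> s v \<and> s v \<le> 1) \<and> (\<forall>v\<in>Fr - {r}. s v < s (par v))"

text \<open>The inverse of \<open>proj_free\<close> on the tree domain. One step to the parent
  suffices, since the parent of a vertex of index 0 is free.\<close>

definition lift :: "('v \<Rightarrow> real) \<Rightarrow> 'v \<Rightarrow> real" where
  "lift s = restrict (\<lambda>v. if v \<in> Fr then s v else s (parent X v)) V"

lemma nonfree: "v \<in> V \<Longrightarrow> v \<notin> Fr \<Longrightarrow> ind v = 0 \<and> v \<noteq> r \<and> parent X v \<in> Fr"
  using zero_color[of v] by (simp add: Fr_iff)

lemma tree_domain_lift:
  assumes t: "t \<in> tree_domain X k"
  shows "lift (proj_free X k t) = t" and "in_dom (proj_free X k t)"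
proof -
  have t1: "t \<in> V \<rightarrow>\<^sub>E {0..1}" and t2: "\<And>v. v \<in> V \<Longrightarrow> v \<noteq> r \<Longrightarrow> (if ind v > 0 then t v < t (parent X v) else t v = t (parent X v))"
    using t unfolding tree_domain_def by auto
  show "lift (proj_free X k t) = t"
  proof
    fix v
    consider "v \<in> Fr" | "v \<in> V" "v \<notin> Fr" | "v \<notin> V" by blast
    then show "lift (proj_free X k t) v = t v"
    proof cases
      case 1
      then show ?thesis by (simp add: lift_def proj_free_def Fr_iff)
    next
      case 2
      then show ?thesis using nonfree[of v] t2[of v] by (simp add: lift_def proj_free_def)
    next
      case 3
      then show ?thesis by (simp add: lift_def PiE_arb[OF t1])
    qed
  qed
  show "in_dom (proj_free X k t)"
    unfolding in_dom_def
  proof (intro conjI ballI)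
    fix v assume "v \<in> Fr"
    then show "0 \<le> proj_free X k t v" "proj_free X k t v \<le> 1" using t1 by (auto simp: proj_free_def Fr_iff)
  next
    fix v assume v: "v \<in> Fr - {r}"
    then have vV: "v \<in> V" "v \<noteq> r" "ind v > 0" by (auto simp: Fr_iff)
    have lt: "t v < t (parent X v)" using t2[OF vV(1,2)] vV(3) by simp
    have "t (parent X v) = t (par v)"
    proof (cases "parent X v \<in> Fr")
      case False
      have p: "parent X v \<in> V" by (rule parent_vert[OF vV(1,2)])
      show ?thesis using nonfree[OF p False] t2[OF p] False by (simp add: par_def)
    qed (simp add: par_def)
    then show "proj_free X k t v < proj_free X k t (par v)"
      using lt v par_props(1)[OF v] by (simp add: proj_free_def)
  qed
qed

lemma lift_tree_domain:
  assumes s: "s \<in> Fr \<rightarrow>\<^sub>E UNIV" "in_dom s"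
  shows "lift s \<in> tree_domain X k" and "proj_free X k (lift s) = s"
proof -
  have d: "\<And>v. v \<in> Fr \<Longrightarrow> 0 \<le> s v \<and> s v \<le> 1" "\<And>v. v \<in> Fr - {r} \<Longrightarrow> s v < s (par v)"
    using s(2) by (auto simp: in_dom_def)
  show "proj_free X k (lift s) = s"
  proof
    fix v
    show "proj_free X k (lift s) v = s v"
      using PiE_arb[OF s(1), of v] by (cases "v \<in> Fr") (auto simp: proj_free_def lift_def Fr_iff)
  qed
  show "lift s \<in> tree_domain X k"
    unfolding tree_domain_def
  proof (intro CollectI conjI ballI)
    show "lift s \<in> V \<rightarrow>\<^sub>E {0..1}"
    proof (rule PiE_I)
      fix v assume v: "v \<in> V"
      show "lift s v \<in> {0..1}"
      proof (cases "v \<in> Fr")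
        case True
        then show ?thesis using d(1)[OF True] v by (simp add: lift_def)
      next
        case False
        then show ?thesis using d(1)[of "parent X v"] nonfree[OF v False] v by (simp add: lift_def)
      qed
    qed (simp add: lift_def)
    fix v assume v: "v \<in> V - {r}"
    have p: "parent X v \<in> V" using parent_vert v by auto
    show "if 0 < ind v then lift s v < lift s (parent X v) else lift s v = lift s (parent X v)"
    proof (cases "0 < ind v")
      case True
      then have vF: "v \<in> Fr - {r}" using v by (simp add: Fr_iff)
      have "lift s (parent X v) = s (par v)" using p by (simp add: lift_def par_def)
      moreover have "lift s v = s v" using vF v by (simp add: lift_def)
      ultimately show ?thesis using d(2)[OF vF] True by simp
    next
      case False
      then have "v \<notin> Fr" by (simp add: Fr_iff)
      then show ?thesis using False nonfree[of v] v p by (simp add: lift_def)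
    qed
  qed
qed

text \<open>A pointwise identity without exceptional null sets: \<open>L\<close>,
  \<open>dens\<close> and \<open>K\<close> copy the end point values, and their case distinctions
  vanish exactly where the indicator does.\<close>

lemma tree_integrand:
  assumes s: "s \<in> Fr \<rightarrow>\<^sub>E UNIV"
  shows "indicator (proj_free X k ` tree_domain X k) s *\<^sub>R
      (\<Prod>v\<in>V. tree_factor \<gamma> X k (the_inv_into (tree_domain X k) (proj_free X k) s) v)
    = dens r (s r) * (\<Prod>v\<in>Fr - {r}. K v (s (par v)) (s v))"
proof (cases "in_dom s")
  case True
  let ?t = "lift s"
  have inj: "inj_on (proj_free X k) (tree_domain X k)"
    by (rule inj_on_inverseI[where g = lift]) (rule tree_domain_lift(1))
  note lt = lift_tree_domain[OF s True]
  have inv: "the_inv_into (tree_domain X k) (proj_free X k) s = ?t"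
    by (rule the_inv_into_f_eq[OF inj lt(2,1)])
  have mem: "s \<in> proj_free X k ` tree_domain X k" using lt by (metis imageI)
  have d: "\<And>v. v \<in> Fr \<Longrightarrow> 0 \<le> s v \<and> s v \<le> 1" "\<And>v. v \<in> Fr - {r} \<Longrightarrow> s v < s (par v)"
    using True by (auto simp: in_dom_def)
  have tF: "?t v = s v" if "v \<in> Fr" for v using that by (simp add: lift_def Fr_iff)
  define q where "q = (\<lambda>v. if v = r then 1 else (L (s (par v)) - L (s v)) ^ (ind v - 1) / fact (ind v - 1))"
  define z where "z = (\<lambda>v. \<Prod>w\<in>zch v. \<gamma> (s v) / (\<gamma> (s v) - color X w))"
  have fac: "tree_factor \<gamma> X k ?t v = q v * (\<gamma>' (s v) / (\<gamma> (s v) - color X v))" if v: "v \<in> Fr" for v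
  proof (cases "v = r")
    case True
    then show ?thesis using tF[OF root_Fr] by (simp add: tree_factor_def ind_root q_def)
  next
    case False
    then have vF: "v \<in> Fr - {r}" and vV: "v \<in> V" "ind v > 0" using v by (auto simp: Fr_iff)
    have tp: "?t (parent X v) = s (par v)" using parent_vert[OF vV(1) False] by (simp add: lift_def par_def)
    \<comment> \<open>For index 1 the exponent is 0, so it does not matter that
      \<open>path_log\<close> is arbitrary when the path passes through 0. For larger index
      \<open>L\<close> equals \<open>path_log\<close> on the closed interval.\<close>
    have "(path_log \<gamma> (s (par v)) - path_log \<gamma> (s v)) ^ (ind v - 1) = (L (s (par v)) - L (s v)) ^ (ind v - 1)"
    proof (cases "ind v = 1")
      case False
      then have "0 \<in> letters_ok" using large_index[OF vV(1)] by blast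
      then show ?thesis using d(1)[OF v] d(1)[OF par_props(1)[OF vF]] by (simp add: L_def)
    qed simp
    then show ?thesis using vV False tF[OF v] tp by (simp add: tree_factor_def q_def)
  qed
  have zfac: "tree_factor \<gamma> X k ?t w = \<gamma> (s (parent X w)) / (\<gamma> (s (parent X w)) - color X w)" if "w \<in> V - Fr" for w
    using that nonfree[of w] by (simp add: tree_factor_def lift_def)
  \<comment> \<open>The factors of the contracted vertices are grouped by their free parent, whose
    coordinate they share; they are the product in \<open>dens\<close>.\<close>
  have VF: "V - Fr = (\<Union>v\<in>Fr. zch v)"
    using nonfree by (auto simp: zch_def children_def Fr_iff)
  have "(\<Prod>w\<in>V - Fr. tree_factor \<gamma> X k ?t w) = (\<Prod>w\<in>V - Fr. \<gamma> (s (parent X w)) / (\<gamma> (s (parent X w)) - color X w))"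
    by (intro prod.cong refl zfac)
  also have "\<dots> = (\<Prod>v\<in>Fr. \<Prod>w\<in>zch v. \<gamma> (s (parent X w)) / (\<gamma> (s (parent X w)) - color X w))"
    unfolding VF
    by (intro prod.UNION_disjoint finite_Fr ballI finite_subset[OF _ children_sub(2)]) (auto simp: zch_def children_def)
  also have "\<dots> = (\<Prod>v\<in>Fr. z v)"
    by (intro prod.cong refl) (auto simp: z_def zch_def children_def)
  finally have zprod: "(\<Prod>w\<in>V - Fr. tree_factor \<gamma> X k ?t w) = (\<Prod>v\<in>Fr. z v)" .
  have "(\<Prod>v\<in>V. tree_factor \<gamma> X k ?t v) = (\<Prod>v\<in>V - Fr. tree_factor \<gamma> X k ?t v) * (\<Prod>v\<in>Fr. tree_factor \<gamma> X k ?t v)"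
    by (rule prod.subset_diff) (auto simp: Fr_iff fin_verts)
  also have "\<dots> = (\<Prod>v\<in>Fr. q v * dens v (s v))"
    unfolding zprod prod.distrib[symmetric]
  proof (intro prod.cong refl)
    fix v assume v: "v \<in> Fr"
    show "z v * tree_factor \<gamma> X k ?t v = q v * dens v (s v)"
      unfolding fac[OF v] using d(1)[OF v] by (simp add: dens_def z_def)
  qed
  also have "\<dots> = q r * dens r (s r) * (\<Prod>v\<in>Fr - {r}. q v * dens v (s v))"
    by (rule prod.remove[OF finite_Fr root_Fr])
  also have "(\<Prod>v\<in>Fr - {r}. q v * dens v (s v)) = (\<Prod>v\<in>Fr - {r}. K v (s (par v)) (s v))"
  proof (intro prod.cong refl)
    fix v assume v: "v \<in> Fr - {r}"
    then show "q v * dens v (s v) = K v (s (par v)) (s v)"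
      using d(1)[of v] d(1)[OF par_props(1)[OF v]] d(2)[OF v] by (simp add: K_def q_def)
  qed
  finally show ?thesis using mem by (simp add: inv q_def)
next
  case False
  have "s \<notin> proj_free X k ` tree_domain X k" using False tree_domain_lift(2) by blast
  moreover have "dens r (s r) * (\<Prod>v\<in>Fr - {r}. K v (s (par v)) (s v)) = 0"
  proof (rule ccontr)
    assume nz: "dens r (s r) * (\<Prod>v\<in>Fr - {r}. K v (s (par v)) (s v)) \<noteq> 0"
    then have "dens r (s r) \<noteq> 0" and K0: "\<And>v. v \<in> Fr - {r} \<Longrightarrow> K v (s (par v)) (s v) \<noteq> 0"
      using finite_Fr by auto
    then have "0 \<le> s r \<and> s r \<le> 1" by (auto simp: dens_def split: if_splits)
    moreover have "0 \<le> s v \<and> s v < s (par v) \<and> s (par v) \<le> 1" if "v \<in> Fr - {r}" for v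
      using K0[OF that] by (auto simp: K_def split: if_splits)
    ultimately have "in_dom s" unfolding in_dom_def by (metis DiffI less_imp_le order_trans singletonD)
    then show False using False by simp
  qed
  ultimately show ?thesis by simp
qed

lemma tree_integral_eq:
  assumes "finite P"
  shows "tree_integral \<gamma> X k = reg_iterated_integral \<gamma> (tree_word P X k)"
proof -
  obtain c where c: "children X r = {c}" using root_child card_1_singletonE by blast
  have cV: "c \<in> V - {r}" using c by (auto simp: children_def)
  have "tree_integral \<gamma> X k = (LINT x|Pi\<^sub>M Fr (\<lambda>_. lborel). dens r (x r) * (\<Prod>v\<in>Fr - {r}. K v (x (par v)) (x v)))"
    unfolding tree_integral_def set_lebesgue_integral_def
    by (intro Bochner_Integration.integral_cong refl tree_integrand) (simp add: space_PiM)
  also have "\<dots> = (LINT s|lborel. indicator {0<..<1} s *\<^sub>R (form \<gamma> (color X r) s * F.J (y c) s))"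
    by (rule integral_over_free_vertices[OF c])
  also have "\<dots> = reg_iterated_integral \<gamma> (y c * letter (color X r))"
    by (rule reg_iterated_integral_times_letter[OF supp_y[OF cV] colors[OF root_vert] root_color, symmetric])
  also have "y c * letter (color X r) = tree_word P X k"
    by (rule tree_word_eq[OF word_tree y_words c assms, symmetric])
  finally show ?thesis .
qed

end

text \<open>\<open>forms_defined\<close>: 0 may be a colour without lying in \<open>D\<close>, so
  the path could run through 0; then neither the letter 0 nor the logarithm along the path makes
  sense. \<open>word_defined\<close>: a leaf of index 0 would call for the power -1 of the letter 0
  in its word.\<close>

theorem theorem3p16:
  fixes D :: "complex set"
    and p q :: tangential_point
    and \<gamma> :: "real \<Rightarrow> complex"
    and X :: "'v crtree"
    and k :: "'v set \<Rightarrow> nat"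
  assumes "finite D"
    and "tangential_base_point p" and "tangential_base_point q"
    and "tangential_path p q (- D) \<gamma>"
    and "colored_rooted_tree D X"
    and "harvestable \<gamma> X k"
    and forms_defined: "0 \<in> \<gamma> ` {0<..<1} \<longrightarrow> (\<forall>v\<in>verts X. color X v \<noteq> 0 \<and> vindex X k v = 1)"
    and word_defined: "\<forall>v\<in>verts X. vdegree X v = 1 \<longrightarrow> vindex X k v > 0"
  shows "tree_integral \<gamma> X k = reg_iterated_integral \<gamma> (tree_word {\<gamma> 0, \<gamma> 1} X k)"
proof -
  have path: "piecewise_smooth \<gamma>" "\<gamma> 0 = fst p" "\<gamma> 1 = fst q"
    "((\<lambda>t. (\<gamma> t - fst p) / of_real t) \<longlongrightarrow> snd p) (at_right 0)"
    "((\<lambda>t. (\<gamma> t - fst q) / of_real (t - 1)) \<longlongrightarrow> - snd q) (at_left 1)"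
    "\<gamma> ` {0<..<1} \<subseteq> - D"
    using assms(4) by (auto simp: tangential_path_def)
  obtain S where S: "finite S" "{0, 1} \<subseteq> S" "S \<subseteq> {0..1}"
    and pieces: "\<forall>a\<in>S. \<forall>b\<in>S. a < b \<and> {a<..<b} \<inter> S = {} \<longrightarrow> smooth_on_Icc \<gamma> a b"
    using path(1) unfolding piecewise_smooth_def by (elim exE conjE)
  interpret P: smooth_path \<gamma> S "snd p" "snd q"
  proof
    show "finite S" "0 \<in> S" "1 \<in> S" "S \<subseteq> {0..1}" using S by auto
    show "smooth_on_Icc \<gamma> a b" if "a \<in> S" "b \<in> S" "a < b" "{a<..<b} \<inter> S = {}" for a b
      using pieces that by blast
    show "((\<lambda>t. (\<gamma> t - \<gamma> 0) / of_real t) \<longlongrightarrow> snd p) (at_right 0)" unfolding path(2) by (rule path(4))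
    show "((\<lambda>t. (\<gamma> t - \<gamma> 1) / of_real (t - 1)) \<longlongrightarrow> - snd q) (at_left 1)" unfolding path(3) by (rule path(5))
    show "snd p \<noteq> 0" "snd q \<noteq> 0" using assms(2,3) by (simp_all add: tangential_base_point_def)
  qed
  interpret T: tree X
    using assms(5) by unfold_locales (simp add: colored_rooted_tree_def)
  have adm: "\<And>v. v \<in> verts X \<Longrightarrow> color X v = \<gamma> 0 \<Longrightarrow> vdegree X v > 1" "color X (rt X) \<noteq> \<gamma> 0" "color X (rt X) \<noteq> \<gamma> 1"
    and deg: "vdegree X (rt X) = 1" "\<And>v. v \<in> verts X \<Longrightarrow> color X v \<noteq> 0 \<Longrightarrow> vdegree X v \<le> 2"
      "\<And>v. v \<in> verts X \<Longrightarrow> color X v = 0 \<Longrightarrow> vdegree X v \<noteq> 2"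
    and zero: "\<And>v. v \<in> verts X \<Longrightarrow> vindex X k v = 0 \<Longrightarrow> color X v = 0 \<and> color X (parent X v) \<noteq> 0"
    using assms(6) by (auto simp: harvestable_def admissible_def)
  have vd: "vdegree X v = card (children X v) + 1" if "v \<in> verts X - {rt X}" for v
    using T.vdegree_eq[of v] that by simp
  \<comment> \<open>The path avoids \<open>D\<close>, but the colour 0 need not belong to
    \<open>D\<close>; it is \<open>forms_defined\<close> that keeps the path away from 0 when this
    matters.\<close>
  have zero_ok: "0 \<in> P.letters_ok" if "v \<in> verts X" "color X v = 0 \<or> vindex X k v \<noteq> 1" for v
    using forms_defined that by (auto simp: P.letters_ok_def)
  interpret H: harvest \<gamma> S "snd p" "snd q" X k
  proof
    show "color X v \<in> P.letters_ok" if "v \<in> verts X" for v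
    proof (cases "color X v = 0")
      case True
      then show ?thesis using zero_ok[OF that] by simp
    next
      case False
      then have "color X v \<in> D" using assms(5) that by (auto simp: colored_rooted_tree_def)
      then show ?thesis using path(6) by (auto simp: P.letters_ok_def)
    qed
    show "card (children X (rt X)) = 1" using deg(1) T.vdegree_eq[OF T.root_vert] by simp
    show "color X v \<noteq> \<gamma> 0" if "v \<in> verts X - {rt X}" "children X v = {}" for v
      using adm(1)[of v] vd[OF that(1)] that by auto
    show "color X v = 0" if "v \<in> verts X - {rt X}" "2 \<le> card (children X v)" for v
      using deg(2)[of v] vd[OF that(1)] that by force
    show "2 \<le> card (children X v) \<and> color X (parent X v) \<noteq> 0" if "v \<in> verts X - {rt X}" "vindex X k v = 0" for v
    proof -
      have z: "color X v = 0" "color X (parent X v) \<noteq> 0" using zero[of v] that by auto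
      \<comment> \<open>The degree is neither 1, by \<open>word_defined\<close>, nor 2, since the
        colour is 0; so there are at least two children besides the parent.\<close>
      have "vdegree X v \<noteq> 1" using word_defined that by auto
      moreover have "vdegree X v \<noteq> 2" using deg(3)[of v] z that by auto
      ultimately show ?thesis using vd[OF that(1)] z by simp
    qed
    show "0 \<in> P.letters_ok" if "v \<in> verts X" "vindex X k v \<noteq> 1" for v using zero_ok that by blast
  qed (use adm in auto)
  show ?thesis by (rule H.tree_integral_eq) simp
qed

end
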